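(* For every $\varepsilon>0$ there exists $k_0\in\mathbb{R}$ such that for every $k\in[k_0,+\infty)$ there is a $C^2$-neighborhood $\mathcal{U}\subset\mathrm{Diff}^2(\mathbb{T}^2)$ of the standard map $f_k$ such that for every $g\in\mathcal{U}$, if $\mu_g$ is a measure of maximal entropy for $g$, then: 1. $\dim_H(\mu_g)>2-\varepsilon$; 2. the support of $\mu_g$ is $\frac{8}{k^{1/3}}$-dense in $\mathbb{T}^2$.
   Context: For $k\in\mathbb{R}$, the standard map on $\mathbb{T}^2=\mathbb{R}^2/\mathbb{Z}^2$ is $f_k(x,y)=(2x-y+k\sin(2\pi x),\,x)$ (mod $\mathbb{Z}^2$). For a diffeomorphism $g$, an invariant probability measure $\mu$ is a measure of maximal entropy if $h_\mu(g)=h_{\mathrm{top}}(g)$. The Hausdorff dimension of a probability measure $\mu$ is $\dim_H(\mu)=\inf\{\dim_H(X):\mu(X)=1\}$, where $\dim_H(X)$ is the Hausdorff dimension of the set $X$. A set $A$ is $r$-dense in $\mathbb{T}^2$ if every point of $\mathbb{T}^2$ is within distance $r$ of $A$. *)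

theory Defs
  imports "HOL-Probability.Probability"
begin

section \<open>The torus\<close>

definition int_lattice :: "(real \<times> real) set" where
  "int_lattice = \<int> \<times> \<int>"

lemma int_lattice_0 [simp]: "0 \<in> int_lattice"
  by (simp add: int_lattice_def zero_prod_def)

lemma int_lattice_add: "u \<in> int_lattice \<Longrightarrow> v \<in> int_lattice \<Longrightarrow> u + v \<in> int_lattice"
  by (auto simp: int_lattice_def)

lemma int_lattice_uminus: "u \<in> int_lattice \<Longrightarrow> - u \<in> int_lattice"
  by (auto simp: int_lattice_def)

lemma closed_int_lattice: "closed int_lattice"
  by (simp add: int_lattice_def closed_Times)

quotient_type torus = "real \<times> real" / "\<lambda>p q. p - q \<in> int_lattice"
  morphisms rep_torus to_torus
proof (rule equivpI)
  show "reflp (\<lambda>p q. p - q \<in> int_lattice)"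
    by (simp add: reflp_def)
  show "symp (\<lambda>p q. p - q \<in> int_lattice)"
    by (metis (no_types, lifting) sympI int_lattice_uminus minus_diff_eq)
  show "transp (\<lambda>p q. p - q \<in> int_lattice)"
  proof (rule transpI)
    fix x y z assume "x - y \<in> int_lattice" "y - z \<in> int_lattice"
    then show "x - z \<in> int_lattice"
      using int_lattice_add by fastforce
  qed
qed

lemma to_torus_eq_iff: "to_torus p = to_torus q \<longleftrightarrow> p - q \<in> int_lattice"
  by (rule torus.abs_eq_iff)

lemma to_torus_surj: "\<exists>p. to_torus p = a"
  by (metis Quotient3_abs_rep Quotient3_torus)

definition fibre :: "torus \<Rightarrow> (real \<times> real) set" where
  "fibre a = {p. to_torus p = a}"

lemma fibre_nonempty [simp]: "fibre a \<noteq> {}"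
  using to_torus_surj by (auto simp: fibre_def)

lemma closed_fibre: "closed (fibre a)"
proof -
  obtain p where p: "to_torus p = a"
    using to_torus_surj by blast
  have "fibre a = (\<lambda>q. q - p) -` int_lattice"
    using p by (simp add: fibre_def vimage_def to_torus_eq_iff[symmetric])
  then show ?thesis
    by (simp add: closed_vimage[OF closed_int_lattice] continuous_intros)
qed

lemma setdist_fibre:
  assumes "p \<in> fibre a"
  shows "setdist (fibre a) (fibre b) = setdist {p} (fibre b)"
proof (rule antisym)
  show "setdist (fibre a) (fibre b) \<le> setdist {p} (fibre b)"
    using assms by (intro setdist_subset_left) auto
  show "setdist {p} (fibre b) \<le> setdist (fibre a) (fibre b)"
  proof (rule le_setdistI)
    fix p' q assume p': "p' \<in> fibre a" and q: "q \<in> fibre b"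
    have "p - p' \<in> int_lattice"
      using assms p' by (simp add: fibre_def to_torus_eq_iff[symmetric])
    then have "q + (p - p') \<in> fibre b"
      using q by (auto simp: fibre_def to_torus_eq_iff)
    then have "setdist {p} (fibre b) \<le> dist p (q + (p - p'))"
      by (intro setdist_le_dist) auto
    also have "\<dots> = dist p' q"
      by (simp add: dist_norm norm_minus_commute algebra_simps)
    finally show "setdist {p} (fibre b) \<le> dist p' q" .
  qed auto
qed

text \<open>The metric is the quotient (flat) metric, so that the metric topology is the quotient
  topology.\<close>

instantiation torus :: metric_space
begin

definition dist_torus :: "torus \<Rightarrow> torus \<Rightarrow> real" where
  "dist_torus a b = setdist (fibre a) (fibre b)"

definition uniformity_torus :: "(torus \<times> torus) filter" where
  "uniformity_torus = (INF e\<in>{0<..}. principal {(x, y). dist x y < e})"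

definition open_torus :: "torus set \<Rightarrow> bool" where
  "open_torus U \<longleftrightarrow> (\<forall>x\<in>U. eventually (\<lambda>(x', y). x' = x \<longrightarrow> y \<in> U) uniformity)"

instance
proof
  show "uniformity = (INF e\<in>{0<..}. principal {(x, y). dist x y < (e::real)} :: (torus \<times> torus) filter)"
    by (rule uniformity_torus_def)
  show "open U \<longleftrightarrow> (\<forall>x\<in>U. \<forall>\<^sub>F (x', y) in uniformity. x' = x \<longrightarrow> y \<in> U)" for U :: "torus set"
    by (rule open_torus_def)
  show "dist a b = 0 \<longleftrightarrow> a = b" for a b :: torus
  proof -
    obtain p where p: "p \<in> fibre a"
      using fibre_nonempty by blast
    have "dist a b = 0 \<longleftrightarrow> p \<in> closure (fibre b)"
      by (simp add: dist_torus_def setdist_fibre[OF p] setdist_eq_0_sing_1)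
    also have "\<dots> \<longleftrightarrow> a = b"
      using p closed_fibre[of b] by (auto simp: closure_closed) (auto simp: fibre_def)
    finally show ?thesis .
  qed
  show "dist a b \<le> dist a c + dist b c" for a b c :: torus
  proof -
    obtain p where p: "p \<in> fibre c"
      using fibre_nonempty by blast
    have "setdist (fibre a) (fibre b) \<le> setdist (fibre a) {p} + setdist {p} (fibre b)"
      by (rule setdist_triangle)
    then show ?thesis
      using setdist_fibre[OF p] by (simp add: dist_torus_def setdist_sym)
  qed
qed

end

lemma dist_to_torus_le: "dist (to_torus p) (to_torus q) \<le> dist p q"
  unfolding dist_torus_def by (intro setdist_le_dist) (auto simp: fibre_def)

lemma continuous_on_to_torus: "continuous_on A to_torus"
  unfolding continuous_on_iff using dist_to_torus_le le_less_trans by blast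

lemma compact_UNIV_torus: "compact (UNIV :: torus set)"
proof -
  have "a \<in> to_torus ` ({0..1} \<times> {0..1})" for a
  proof -
    obtain p where p: "to_torus p = a"
      using to_torus_surj by blast
    have "to_torus (frac (fst p), frac (snd p)) = to_torus p"
      by (simp add: to_torus_eq_iff int_lattice_def frac_def minus_prod_def)
    moreover have "(frac (fst p), frac (snd p)) \<in> {0..1} \<times> {0..1}"
      using less_imp_le[OF frac_lt_1] by (auto simp: frac_ge_0)
    ultimately show ?thesis
      using p by (metis image_eqI)
  qed
  then have "UNIV = to_torus ` ({0..1} \<times> {0..1})"
    by blast
  then show ?thesis
    by (metis compact_continuous_image continuous_on_to_torus compact_Times compact_Icc)
qed


section \<open>The group of \<open>C\<^sup>2\<close> diffeomorphisms and its topology\<close>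

text \<open>\<open>G\<close> is a lift of \<open>g\<close> to the universal cover, with first and second derivative \<open>G'\<close> and
  \<open>G''\<close>, the latter being continuous. (Continuity of \<open>G\<close> and \<open>G'\<close> follows from
  differentiability.)\<close>

definition C2_lift ::
  "(torus \<Rightarrow> torus) \<Rightarrow> (real \<times> real \<Rightarrow> real \<times> real) \<Rightarrow>
   (real \<times> real \<Rightarrow> (real \<times> real) \<Rightarrow>\<^sub>L (real \<times> real)) \<Rightarrow>
   (real \<times> real \<Rightarrow> (real \<times> real) \<Rightarrow>\<^sub>L ((real \<times> real) \<Rightarrow>\<^sub>L (real \<times> real))) \<Rightarrow> bool"
where
  "C2_lift g G G' G'' \<longleftrightarrow>
     (\<forall>p. to_torus (G p) = g (to_torus p)) \<and>
     (\<forall>p. (G has_derivative blinfun_apply (G' p)) (at p)) \<and>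
     (\<forall>p. (G' has_derivative blinfun_apply (G'' p)) (at p)) \<and>
     continuous_on UNIV G''"

definition C2_map :: "(torus \<Rightarrow> torus) \<Rightarrow> bool" where
  "C2_map g \<longleftrightarrow> (\<exists>G G' G''. C2_lift g G G' G'')"

definition Diff2 :: "(torus \<Rightarrow> torus) set" where
  "Diff2 = {g. bij g \<and> C2_map g \<and> C2_map (inv g)}"

definition C2_ball :: "(torus \<Rightarrow> torus) \<Rightarrow> real \<Rightarrow> (torus \<Rightarrow> torus) set" where
  "C2_ball f r = {g \<in> Diff2. \<exists>F F' F'' G G' G''.
     C2_lift f F F' F'' \<and> C2_lift g G G' G'' \<and>
     (\<forall>p. norm (G p - F p) < r \<and> norm (G' p - F' p) < r \<and> norm (G'' p - F'' p) < r)}"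

definition C2_topology :: "(torus \<Rightarrow> torus) topology" where
  "C2_topology = topology (\<lambda>U. U \<subseteq> Diff2 \<and> (\<forall>f\<in>U. \<exists>r>0. C2_ball f r \<subseteq> U))"

lemma C2_ball_mono: "r \<le> s \<Longrightarrow> C2_ball f r \<subseteq> C2_ball f s"
  unfolding C2_ball_def by (force intro: less_le_trans)

lemma openin_C2_topology:
  "openin C2_topology U \<longleftrightarrow> U \<subseteq> Diff2 \<and> (\<forall>f\<in>U. \<exists>r>0. C2_ball f r \<subseteq> U)"
proof -
  have "istopology (\<lambda>U. U \<subseteq> Diff2 \<and> (\<forall>f\<in>U. \<exists>r>0. C2_ball f r \<subseteq> U))"
    unfolding istopology_def
  proof (intro conjI allI impI; (elim conjE)?)
    fix S T
    assume S: "\<forall>f\<in>S. \<exists>r>0. C2_ball f r \<subseteq> S" and T: "\<forall>f\<in>T. \<exists>r>0. C2_ball f r \<subseteq> T"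
    show "\<forall>f\<in>S \<inter> T. \<exists>r>0. C2_ball f r \<subseteq> S \<inter> T"
    proof
      fix f assume "f \<in> S \<inter> T"
      then obtain r s where "r > 0" "C2_ball f r \<subseteq> S" "s > 0" "C2_ball f s \<subseteq> T"
        using S T by blast
      then show "\<exists>r>0. C2_ball f r \<subseteq> S \<inter> T"
        using C2_ball_mono[of "min r s" r f] C2_ball_mono[of "min r s" s f]
        by (intro exI[of _ "min r s"]) auto
    qed
  next
    fix \<K> :: "(torus \<Rightarrow> torus) set set"
    assume *: "\<forall>K\<in>\<K>. K \<subseteq> Diff2 \<and> (\<forall>f\<in>K. \<exists>r>0. C2_ball f r \<subseteq> K)"
    then show "\<forall>f\<in>\<Union>\<K>. \<exists>r>0. C2_ball f r \<subseteq> \<Union>\<K>"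
      by (meson UnionE Union_upper subset_trans)
  qed auto
  then show ?thesis
    by (simp add: C2_topology_def topology_inverse')
qed

lemma topspace_C2_topology: "topspace C2_topology = Diff2"
proof
  show "topspace C2_topology \<subseteq> Diff2"
    using openin_C2_topology openin_topspace by blast
  have "openin C2_topology Diff2"
    unfolding openin_C2_topology C2_ball_def by (auto intro: exI[of _ 1])
  then show "Diff2 \<subseteq> topspace C2_topology"
    by (rule openin_subset)
qed


section \<open>The standard map\<close>

definition standard_lift :: "real \<Rightarrow> real \<times> real \<Rightarrow> real \<times> real" where
  "standard_lift k = (\<lambda>(x, y). (2 * x - y + k * sin (2 * pi * x), x))"

lemma sin_2pi_cong:
  assumes "x - y \<in> \<int>"
  shows "sin (2 * pi * x) = sin (2 * pi * y)"
proof -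
  obtain n where "x - y = of_int n"
    using assms by (rule Ints_cases)
  then have "2 * pi * x = 2 * pi * y + 2 * pi * of_int n"
    by (metis add_diff_cancel_left' diff_add_cancel distrib_left add.commute)
  then show ?thesis
    using sin.plus_of_int[of "2 * pi * y" n] by (simp add: mult_ac)
qed

lift_definition standard_map :: "real \<Rightarrow> torus \<Rightarrow> torus" is standard_lift
proof -
  fix k :: real and p q :: "real \<times> real"
  assume pq: "p - q \<in> int_lattice"
  obtain x y x' y' where [simp]: "p = (x, y)" "q = (x', y')"
    by (metis surj_pair)
  have xy: "x - x' \<in> \<int>" "y - y' \<in> \<int>"
    using pq by (simp_all add: int_lattice_def)
  have "2 * x - y - (2 * x' - y') = 2 * (x - x') - (y - y')"
    by simp
  also have "\<dots> \<in> \<int>"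
    by (intro Ints_diff[OF Ints_mult[OF Ints_numeral xy(1)] xy(2)])
  finally show "standard_lift k p - standard_lift k q \<in> int_lattice"
    using xy sin_2pi_cong[OF xy(1)] by (simp add: standard_lift_def int_lattice_def)
qed

lemma C2_map_linear_plus_sin:
  fixes A :: "real \<times> real \<Rightarrow> real \<times> real" and l :: "real \<times> real \<Rightarrow> real"
    and e :: "real \<times> real"
  assumes A: "bounded_linear A" and l: "bounded_linear l"
    and lift: "\<And>p. to_torus (A p + sin (2 * pi * l p) *\<^sub>R e) = g (to_torus p)"
  shows "C2_map g"
proof -
  define B where "B = Blinfun (\<lambda>h. l h *\<^sub>R e)"
  define C where "C = Blinfun (\<lambda>h. l h *\<^sub>R B)"
  define G where "G p = A p + sin (2 * pi * l p) *\<^sub>R e" for p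
  define G' where "G' p = Blinfun A + (2 * pi * cos (2 * pi * l p)) *\<^sub>R B" for p
  define G'' where "G'' p = (- (2 * pi)\<^sup>2 * sin (2 * pi * l p)) *\<^sub>R C" for p
  have B: "blinfun_apply B h = l h *\<^sub>R e" for h
    unfolding B_def by (subst bounded_linear_Blinfun_apply)
      (auto intro: bounded_linear_scaleR_const[OF l])
  have C: "blinfun_apply C h = l h *\<^sub>R B" for h
    unfolding C_def by (subst bounded_linear_Blinfun_apply)
      (auto intro: bounded_linear_scaleR_const[OF l])
  note [derivative_intros] = bounded_linear.has_derivative[OF l] bounded_linear.has_derivative[OF A]
  have "(G has_derivative blinfun_apply (G' p)) (at p)" for p
    unfolding G_def
    by (rule derivative_eq_intros refl)+
      (simp add: G'_def B fun_eq_iff blinfun.add_left blinfun.scaleR_left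
        bounded_linear_Blinfun_apply[OF A] mult_ac)
  moreover have "(G' has_derivative blinfun_apply (G'' p)) (at p)" for p
    unfolding G'_def
    by (rule derivative_eq_intros refl)+
      (simp add: G''_def C fun_eq_iff blinfun.scaleR_left blinfun.minus_left power2_eq_square mult_ac)
  moreover have "continuous_on UNIV G''"
    unfolding G''_def by (intro continuous_intros linear_continuous_on l)
  moreover have "\<forall>p. to_torus (G p) = g (to_torus p)"
    using lift by (simp add: G_def)
  ultimately show ?thesis
    unfolding C2_map_def C2_lift_def by blast
qed

definition standard_lift_inv :: "real \<Rightarrow> real \<times> real \<Rightarrow> real \<times> real" where
  "standard_lift_inv k = (\<lambda>(u, v). (v, 2 * v - u + k * sin (2 * pi * v)))"

lemma standard_lift_inv: "standard_lift k (standard_lift_inv k p) = p"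
    "standard_lift_inv k (standard_lift k p) = p"
  by (auto simp: standard_lift_def standard_lift_inv_def split: prod.splits)

lemma standard_map_to_torus: "standard_map k (to_torus p) = to_torus (standard_lift k p)"
  by (rule standard_map.abs_eq)

lemma standard_map_in_Diff2: "standard_map k \<in> Diff2"
proof -
  have inj: "inj (standard_map k)"
  proof (rule injI)
    fix a b assume eq: "standard_map k a = standard_map k b"
    obtain x y where a: "a = to_torus (x, y)"
      using to_torus_surj by (metis surj_pair)
    obtain x' y' where b: "b = to_torus (x', y')"
      using to_torus_surj by (metis surj_pair)
    have 1: "x - x' \<in> \<int>"
      and 2: "(2 * x - y + k * sin (2 * pi * x)) - (2 * x' - y' + k * sin (2 * pi * x')) \<in> \<int>"
      using eq by (simp_all add: a b standard_map_to_torus standard_lift_def to_torus_eq_iff int_lattice_def)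
    have "y - y' = 2 * (x - x') -
        ((2 * x - y + k * sin (2 * pi * x)) - (2 * x' - y' + k * sin (2 * pi * x')))"
      using sin_2pi_cong[OF 1] by simp
    also have "\<dots> \<in> \<int>"
      by (intro Ints_diff[OF Ints_mult[OF Ints_numeral 1] 2])
    finally show "a = b"
      using 1 by (simp add: a b to_torus_eq_iff int_lattice_def)
  qed
  have right: "standard_map k (to_torus (standard_lift_inv k p)) = to_torus p" for p
    by (simp add: standard_map_to_torus standard_lift_inv)
  have "surj (standard_map k)"
    unfolding surj_def using right to_torus_surj by (metis (no_types))
  with inj have "bij (standard_map k)"
    by (simp add: bij_def)
  moreover have "C2_map (standard_map k)"
  proof (rule C2_map_linear_plus_sin)
    show "bounded_linear (\<lambda>p::real \<times> real. (2 * fst p - snd p, fst p))"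
      by (intro bounded_linear_intros)
    show "bounded_linear (fst :: real \<times> real \<Rightarrow> real)"
      by (rule bounded_linear_fst)
    show "to_torus ((2 * fst p - snd p, fst p) + sin (2 * pi * fst p) *\<^sub>R (k, 0)) =
        standard_map k (to_torus p)" for p
      by (simp add: standard_map_to_torus standard_lift_def case_prod_unfold mult_ac)
  qed
  moreover have "C2_map (inv (standard_map k))"
  proof (rule C2_map_linear_plus_sin)
    show "bounded_linear (\<lambda>p::real \<times> real. (snd p, 2 * snd p - fst p))"
      by (intro bounded_linear_intros)
    show "bounded_linear (snd :: real \<times> real \<Rightarrow> real)"
      by (rule bounded_linear_snd)
    show "to_torus ((snd p, 2 * snd p - fst p) + sin (2 * pi * snd p) *\<^sub>R (0, k)) =
        inv (standard_map k) (to_torus p)" for p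
      using inv_f_eq[OF inj right, of p]
      by (simp add: standard_lift_inv_def case_prod_unfold mult_ac)
  qed
  ultimately show ?thesis
    by (simp add: Diff2_def)
qed


section \<open>Entropy\<close>

definition invariant_prob :: "('a::topological_space \<Rightarrow> 'a) \<Rightarrow> 'a measure \<Rightarrow> bool" where
  "invariant_prob g \<mu> \<longleftrightarrow>
     prob_space \<mu> \<and> sets \<mu> = sets borel \<and> g \<in> borel \<rightarrow>\<^sub>M borel \<and> distr \<mu> borel g = \<mu>"

definition partition_entropy :: "'a measure \<Rightarrow> 'a set set \<Rightarrow> real" where
  "partition_entropy \<mu> P = - (\<Sum>A\<in>P. measure \<mu> A * ln (measure \<mu> A))"

text \<open>The partition \<open>\<Or>\<^sub>i\<^sub><\<^sub>n g\<^sup>-\<^sup>iP\<close>.\<close>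

definition dynamical_refinement :: "'a measure \<Rightarrow> ('a \<Rightarrow> 'a) \<Rightarrow> 'a set set \<Rightarrow> nat \<Rightarrow> 'a set set" where
  "dynamical_refinement \<mu> g P n =
     common_refinement ((\<lambda>i. (\<lambda>A. (g ^^ i) -` A \<inter> space \<mu>) ` P) ` {..<n})"

text \<open>By subadditivity, the upper limit below is a limit if \<open>\<mu>\<close> is \<open>g\<close>-invariant.\<close>

definition metric_entropy_wrt :: "'a measure \<Rightarrow> ('a \<Rightarrow> 'a) \<Rightarrow> 'a set set \<Rightarrow> ereal" where
  "metric_entropy_wrt \<mu> g P =
     limsup (\<lambda>n. ereal (partition_entropy \<mu> (dynamical_refinement \<mu> g P n) / real n))"

definition metric_entropy :: "'a measure \<Rightarrow> ('a \<Rightarrow> 'a) \<Rightarrow> ereal" where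
  "metric_entropy \<mu> g =
     (SUP P\<in>{P. finite P \<and> P \<subseteq> sets \<mu> \<and> partition_on (space \<mu>) P}. metric_entropy_wrt \<mu> g P)"

definition bowen_separated :: "('a::metric_space \<Rightarrow> 'a) \<Rightarrow> nat \<Rightarrow> real \<Rightarrow> 'a set \<Rightarrow> bool" where
  "bowen_separated g n e E \<longleftrightarrow>
     (\<forall>x\<in>E. \<forall>y\<in>E. x \<noteq> y \<longrightarrow> (\<exists>i<n. e < dist ((g ^^ i) x) ((g ^^ i) y)))"

text \<open>Bowen's definition, for a continuous map of a compact space.\<close>

definition topological_entropy :: "('a::metric_space \<Rightarrow> 'a) \<Rightarrow> ereal" where
  "topological_entropy g =
     (SUP e\<in>{0<..}. limsup (\<lambda>n.
        SUP E\<in>{E. finite E \<and> bowen_separated g n e E}. ereal (ln (real (card E)) / real n)))"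

definition maximal_entropy_measure :: "('a::metric_space \<Rightarrow> 'a) \<Rightarrow> 'a measure \<Rightarrow> bool" where
  "maximal_entropy_measure g \<mu> \<longleftrightarrow>
     invariant_prob g \<mu> \<and> metric_entropy \<mu> g = topological_entropy g"


section \<open>Hausdorff dimension\<close>

text \<open>The summand \<open>diam(U)\<^sup>s\<close>, where \<open>diam(U)\<^sup>0 = 1\<close> for nonempty \<open>U\<close>; note that
  \<open>0 powr 0 = 0\<close>.\<close>

definition hausdorff_weight :: "real \<Rightarrow> 'a::metric_space set \<Rightarrow> ennreal" where
  "hausdorff_weight s U =
     (if U = {} then 0 else if s = 0 then 1 else ennreal (diameter U powr s))"

text \<open>Boundedness is required since the diameter of an unbounded set is unspecified.\<close>

definition hausdorff_premeasure :: "real \<Rightarrow> real \<Rightarrow> 'a::metric_space set \<Rightarrow> ennreal" where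
  "hausdorff_premeasure s d X =
     (INF U\<in>{U :: nat \<Rightarrow> 'a set. X \<subseteq> (\<Union>i. U i) \<and> (\<forall>i. bounded (U i) \<and> diameter (U i) \<le> d)}.
        \<Sum>i. hausdorff_weight s (U i))"

definition hausdorff_measure :: "real \<Rightarrow> 'a::metric_space set \<Rightarrow> ennreal" where
  "hausdorff_measure s X = (SUP d\<in>{0<..}. hausdorff_premeasure s d X)"

definition hausdorff_dim :: "'a::metric_space set \<Rightarrow> ereal" where
  "hausdorff_dim X = (INF s\<in>{s. 0 \<le> s \<and> hausdorff_measure s X = 0}. ereal s)"

definition measure_hausdorff_dim :: "'a::metric_space measure \<Rightarrow> ereal" where
  "measure_hausdorff_dim \<mu> = (INF X\<in>{X \<in> sets \<mu>. emeasure \<mu> X = 1}. hausdorff_dim X)"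


section \<open>Support and density\<close>

definition measure_support :: "'a::topological_space measure \<Rightarrow> 'a set" where
  "measure_support \<mu> = {x. \<forall>U. open U \<and> x \<in> U \<longrightarrow> emeasure \<mu> U > 0}"

definition r_dense :: "real \<Rightarrow> 'a::metric_space set \<Rightarrow> bool" where
  "r_dense r A \<longleftrightarrow> (\<forall>x. \<exists>a\<in>A. dist x a \<le> r)"

end

theory Submission
  imports Defs
begin

text \<open>
  Both statements follow from counting orbits, using that the entropy $h$ is at least $\ln k$ while
  $g$ expands by at most $L = 7k$. If a set of positive measure for a measure of maximal entropy is covered by sets
  whose points stay \<open>\<delta>\<close>-close for time $T$, then at least $e^{T(h-\kappa)}$ sets are needed.

  \<^item> A set of full measure and small dimension has a cover by sets $U_i$ whose diameters are so small
    that an orbit visiting $U_i$ is known for a time proportional to $\ln(1/\mathrm{diam}\,U_i)$. A typical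
    orbit visits such sets all the time, which describes it with fewer than $e^{T(h-\kappa)}$ symbols.
  \<^item> By the same counting, typical points have a vector expanded by $(L e^{-C})^n$ in time $n$, so by Pliss'
    lemma most times are hyperbolic. At a hyperbolic time the orbit can be interrupted by a detour of length $4$
    through any given point: $g$ maps a small square across the whole torus. If a ball has measure zero, typical
    orbits avoid it, and detours through its centre at arbitrary sets of times give more separated orbits than
    the entropy allows.
\<close>

section \<open>Entropy and covers by Bowen-small sets\<close>

text \<open>The driving fact is that \<open>ln L - ln k = ln 7\<close> does not grow with
  \<open>k\<close>: the entropy is within a constant of the largest conceivable value, so typical
  orbits waste only a bounded factor of expansion per step. This bound does the work of Lyapunov
  exponents. Pliss' lemma turns it into a small density of bad times with a threshold of
  \<open>exp 80000\<close> per step, a constant that a large \<open>k\<close> still dominates.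

  In the dimension estimate, \<open>g\<close> and its inverse have the same Lipschitz constant
  \<open>L\<close>, so a visit to a set of diameter \<open>d\<close> fixes about
  \<open>ln (1 / d) / ln L\<close> steps both of the future and of the past. This gives the bound
  \<open>2 * ln k / ln L\<close>, which tends to 2.

  The obstacle to density is the neighbourhood of the lines \<open>cos (2 * pi * x) = 0\<close>,
  where there is no horizontal expansion. A segment of length \<open>l\<close> is stretched there
  only to a length of order \<open>k * l ^ 2\<close>, so detours need \<open>l\<close> well above
  \<open>k powr (- 1 / 2)\<close>, while the claimed density needs \<open>l\<close> below
  \<open>k powr (- 1 / 3)\<close>. The choice is \<open>l = k powr (- 2 / 5)\<close>. Orbits are
  found by following paths across squares with the intermediate value theorem, which asks for no
  control of slopes.\<close>

definition bowen_small :: "('a::metric_space \<Rightarrow> 'a) \<Rightarrow> nat \<Rightarrow> real \<Rightarrow> 'a set \<Rightarrow> bool" where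
 "bowen_small g T \<delta> A \<longleftrightarrow> (\<forall>x\<in>A. \<forall>y\<in>A. \<forall>i<T. dist ((g ^^ i) x) ((g ^^ i) y) < \<delta>)"

text \<open>A separated set of greatest cardinality is spanning, since any point that it misses
  could be added. \<open>e \<ge> 0\<close> ensures that the added point is new.\<close>

lemma exists_maximal_bowen_separated:
 fixes g :: "'a::metric_space \<Rightarrow> 'a"
 assumes N: "\<And>E. finite E \<Longrightarrow> bowen_separated g T e E \<Longrightarrow> card E \<le> N" and e: "e \<ge> 0"
 shows "\<exists>E\<subseteq>Y. finite E \<and> bowen_separated g T e E \<and>
      (\<forall>y\<in>Y. \<exists>x\<in>E. \<forall>i<T. dist ((g ^^ i) x) ((g ^^ i) y) \<le> e)"
proof -
 define S where "S = {E. E \<subseteq> Y \<and> finite E \<and> bowen_separated g T e E}"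
 have ne: "{} \<in> S"
  by (simp add: S_def bowen_separated_def)
 have bd: "\<forall>E. E \<in> S \<longrightarrow> card E < Suc N"
  using N unfolding S_def by (auto simp: less_Suc_eq_le)
 obtain E where E: "E \<in> S" and max: "\<forall>E'. E' \<in> S \<longrightarrow> card E' \<le> card E"
  using ex_has_greatest_nat[of "\<lambda>E. E \<in> S" "{}" card "Suc N"] ne bd by blast
 have "\<exists>x\<in>E. \<forall>i<T. dist ((g ^^ i) x) ((g ^^ i) y) \<le> e" if "y \<in> Y" for y
 proof (rule ccontr)
  assume neg: "\<not> ?thesis"
  have y: "y \<notin> E"
   using neg e by auto
  have "bowen_separated g T e (insert y E)"
   using E neg unfolding S_def bowen_separated_def
   by (auto simp: not_le dist_commute)
  then have "insert y E \<in> S"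
   using E that by (auto simp: S_def)
  then have "card (insert y E) \<le> card E"
   using max by blast
  then show False
   using y E by (simp add: S_def)
 qed
 then show ?thesis
  using E by (auto simp: S_def)
qed

text \<open>Gibbs' inequality: \<open>q\<close> is a sub-probability on the cells,
  \<open>- ln (q A)\<close> the length of a code word, and entropy never exceeds the mean length of
  a code. The bound \<open>F\<close> depends on points rather than cells, so that its integral can
  later be computed by invariance.\<close>

lemma partition_entropy_le_integral:
 fixes M :: "'a measure" and q :: "'a set \<Rightarrow> real"
 assumes "prob_space M" and fin: "finite R" and sets: "R \<subseteq> sets M" and part: "partition_on (space M) R"
  and q: "\<And>A. A \<in> R \<Longrightarrow> q A > 0" and q1: "(\<Sum>A\<in>R. q A) \<le> 1"
  and F: "integrable M F" and le: "\<And>A x. A \<in> R \<Longrightarrow> x \<in> A \<Longrightarrow> - ln (q A) \<le> F x"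
 shows "partition_entropy M R \<le> integral\<^sup>L M F"
proof -
 interpret prob_space M by fact
 have disj: "disjoint_family_on (\<lambda>A. A) R"
  using part unfolding partition_on_def disjoint_def disjoint_family_on_def by auto
 have un: "(\<Union>A\<in>R. A) = space M"
  using part by (auto simp: partition_on_def)
 have p1: "(\<Sum>A\<in>R. measure M A) = 1"
  using finite_measure_finite_Union[OF fin, of "\<lambda>A. A"] sets disj un prob_space by auto
 \<comment> \<open>This is \<open>ln t \<le> t - 1\<close> at \<open>t = q A / measure M A\<close>;
   the corrections \<open>q A - measure M A\<close> sum to at most 0.\<close>
 have "- (measure M A * ln (measure M A)) \<le> measure M A * (- ln (q A)) + (q A - measure M A)"
  if A: "A \<in> R" for A
 proof (cases "measure M A = 0")
  case True
  then show ?thesis using q[OF A] by simp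
 next
  case False
  then have p: "measure M A > 0"
   using measure_nonneg[of M A] by linarith
  have "ln (q A / measure M A) \<le> q A / measure M A - 1"
   using p q[OF A] by (intro ln_le_minus_one) auto
  then have "measure M A * (ln (q A) - ln (measure M A)) \<le> measure M A * (q A / measure M A - 1)"
   using p q[OF A] by (intro mult_left_mono) (auto simp: ln_div)
  also have "\<dots> = q A - measure M A"
   using p by (simp add: field_simps)
  finally show ?thesis by (simp add: algebra_simps)
 qed
 then have "partition_entropy M R \<le> (\<Sum>A\<in>R. measure M A * (- ln (q A)) + (q A - measure M A))"
  unfolding partition_entropy_def by (simp add: sum_negf[symmetric] sum_mono)
 also have "\<dots> \<le> (\<Sum>A\<in>R. measure M A * (- ln (q A)))"
  using q1 p1 by (simp add: sum.distrib sum_subtractf sum_negf)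
 also have "\<dots> \<le> (\<Sum>A\<in>R. LINT x:A|M. F x)"
 proof (rule sum_mono)
  fix A assume A: "A \<in> R"
  have AM: "A \<in> sets M" using A sets by auto
  have "measure M A * (- ln (q A)) = (LINT x:A|M. - ln (q A))"
   using AM by (simp add: set_lebesgue_integral_def)
  also have "\<dots> \<le> (LINT x:A|M. F x)"
   using le[OF A] AM integrable_mult_indicator[OF AM F]
   by (intro set_integral_mono)
     (auto simp: set_integrable_def emeasure_eq_measure intro!: integrable_mult_left)
  finally show "measure M A * (- ln (q A)) \<le> (LINT x:A|M. F x)" .
 qed
 also have "\<dots> = (LINT x:(\<Union>A\<in>R. A)|M. F x)"
 proof -
  have "(LINT x:(\<Union>A\<in>R. A)|M. F x) = (\<Sum>A\<in>R. LINT x:A|M. F x)"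
   using fin disj sets integrable_mult_indicator[OF _ F]
   by (intro set_integral_finite_Union) (auto simp: set_integrable_def id_def)
  then show ?thesis by simp
 qed
 also have "\<dots> = integral\<^sup>L M F"
  unfolding un using F by (simp add: set_integral_space)
 finally show ?thesis .
qed

section \<open>Itineraries with respect to a partition\<close>

definition cell_of :: "'a set set \<Rightarrow> 'a \<Rightarrow> 'a set" where
 "cell_of P x = (THE A. A \<in> P \<and> x \<in> A)"

lemma cell_of:
 assumes "partition_on UNIV P"
 shows "cell_of P x \<in> P" "x \<in> cell_of P x" "A \<in> P \<Longrightarrow> x \<in> A \<Longrightarrow> cell_of P x = A"
proof -
 have *: "\<exists>!A. A \<in> P \<and> x \<in> A"
  using assms unfolding partition_on_def disjoint_def by blast
 show "cell_of P x \<in> P" "x \<in> cell_of P x"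
  using theI'[OF *] by (auto simp: cell_of_def)
 show "A \<in> P \<Longrightarrow> x \<in> A \<Longrightarrow> cell_of P x = A"
  unfolding cell_of_def using * by (auto intro!: the1_equality)
qed

text \<open>Atoms of the join are itinerary classes. The choice function behind
  \<open>common_refinement\<close> is indexed by the pulled-back partitions and not by the times;
  times with equal partitions share a cell, so the itinerary is read off from a point
  \<open>x\<close> of the atom.\<close>

lemma in_dynamical_refinement_iff:
 assumes part: "partition_on UNIV P" and sp: "space M = UNIV"
  and R: "R \<in> dynamical_refinement M g P T" and x: "x \<in> R"
 shows "y \<in> R \<longleftrightarrow> (\<forall>i<T. cell_of P ((g ^^ i) x) = cell_of P ((g ^^ i) y))"
proof -
 let ?Q = "\<lambda>i. (\<lambda>A. (g ^^ i) -` A \<inter> space M) ` P"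
 obtain f where f: "f \<in> (\<Pi> Q\<in>?Q ` {..<T}. Q)" and R_eq: "R = \<Inter> (f ` ?Q ` {..<T})"
  using R unfolding dynamical_refinement_def common_refinement by auto
 have cell: "f (?Q i) = (g ^^ i) -` cell_of P ((g ^^ i) z)" if "i < T" "z \<in> R" for i z
 proof -
  have "f (?Q i) \<in> ?Q i"
   using f that by auto
  then obtain A where A: "A \<in> P" "f (?Q i) = (g ^^ i) -` A"
   using sp by auto
  then have "(g ^^ i) z \<in> A"
   using that R_eq by auto
  then show ?thesis
   using A cell_of(3)[OF part A(1)] by auto
 qed
 show ?thesis
 proof
  assume y: "y \<in> R"
  show "\<forall>i<T. cell_of P ((g ^^ i) x) = cell_of P ((g ^^ i) y)"
  proof (intro allI impI)
   fix i assume i: "i < T"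
   have "(g ^^ i) x \<in> cell_of P ((g ^^ i) y)"
    using cell[OF i x] cell[OF i y] cell_of(2)[OF part, of "(g ^^ i) x"] by auto
   then show "cell_of P ((g ^^ i) x) = cell_of P ((g ^^ i) y)"
    using cell_of[OF part] by metis
  qed
 next
  assume *: "\<forall>i<T. cell_of P ((g ^^ i) x) = cell_of P ((g ^^ i) y)"
  have "y \<in> f (?Q i)" if "i < T" for i
   using cell[OF that x] * that cell_of(2)[OF part, of "(g ^^ i) y"] by auto
  then show "y \<in> R"
   unfolding R_eq by auto
 qed
qed

lemma partition_on_dynamical_refinement:
 assumes part: "partition_on UNIV P" and sp: "space M = UNIV"
 shows "partition_on UNIV (dynamical_refinement M g P T)"
proof (rule partition_onI)
 show "\<Union> (dynamical_refinement M g P T) = UNIV"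
 proof -
  have "\<Union> ((\<lambda>A. (g ^^ i) -` A \<inter> space M) ` P) = UNIV" for i
   using cell_of(1,2)[OF part] sp by auto
  then show ?thesis
   unfolding dynamical_refinement_def Union_common_refinement by auto
 qed
 show "disjnt A B" if "A \<in> dynamical_refinement M g P T" "B \<in> dynamical_refinement M g P T" "A \<noteq> B" for A B
  using in_dynamical_refinement_iff[OF part sp that(1)] in_dynamical_refinement_iff[OF part sp that(2)] that(3)
  by (fastforce simp: disjnt_def)
 show "{} \<notin> dynamical_refinement M g P T"
  by (simp add: dynamical_refinement_def common_refinement_def)
qed

lemma finite_dynamical_refinement:
 assumes "finite P"
 shows "finite (dynamical_refinement M g P T)"
proof -
 have "finite (\<Pi>\<^sub>E Q\<in>(\<lambda>i. (\<lambda>A. (g ^^ i) -` A \<inter> space M) ` P) ` {..<T}. Q)"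
  using assms by (intro finite_PiE) auto
 then show ?thesis
  unfolding dynamical_refinement_def common_refinement_def by auto
qed

lemma measurable_funpow:
 fixes g :: "'a::topological_space \<Rightarrow> 'a"
 assumes "g \<in> borel \<rightarrow>\<^sub>M borel"
 shows "g ^^ i \<in> borel \<rightarrow>\<^sub>M borel"
proof (induction i)
 case 0
 show ?case by (simp add: id_def)
next
 case (Suc i)
 have "g \<circ> g ^^ i \<in> borel \<rightarrow>\<^sub>M borel"
  by (rule measurable_comp[OF Suc assms])
 then show ?case by (simp add: comp_def)
qed

lemma sets_dynamical_refinement:
 assumes g: "g \<in> borel \<rightarrow>\<^sub>M borel" and M: "sets M = sets borel" and P: "P \<subseteq> sets M" "finite P" and T: "T > 0"
 shows "dynamical_refinement M g P T \<subseteq> sets M"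
proof
 fix R assume R: "R \<in> dynamical_refinement M g P T"
 let ?Q = "\<lambda>i. (\<lambda>A. (g ^^ i) -` A \<inter> space M) ` P"
 have sp: "space M = UNIV"
  using sets_eq_imp_space_eq[OF M] by simp
 obtain f where f: "f \<in> (\<Pi> Q\<in>?Q ` {..<T}. Q)" and R_eq: "R = \<Inter> (f ` ?Q ` {..<T})"
  using R unfolding dynamical_refinement_def common_refinement by auto
 have "f (?Q i) \<in> sets M" if "i < T" for i
 proof -
  have "f (?Q i) \<in> ?Q i" using f that by auto
  then obtain A where "A \<in> P" "f (?Q i) = (g ^^ i) -` A" using sp by auto
  then show ?thesis
   using measurable_sets[OF measurable_funpow[OF g], of A i] P M by auto
 qed
 then show "R \<in> sets M"
  unfolding R_eq using T by (intro sets.finite_INT) (auto simp: image_comp)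
qed

text \<open>The weights \<open>q\<close> below code a point by the element of the cover containing it, and
 then its itinerary by the at most one compact piece that the image of this element can meet;
 visits to the complement of the compact pieces are coded at full cost.\<close>

lemma partition_entropy_le_covers:
 fixes g :: "'a::metric_space \<Rightarrow> 'a" and P :: "'a set set"
 assumes inv: "invariant_prob g M"
  and P: "finite P" "P \<subseteq> sets M" "partition_on UNIV P"
  and \<eta>: "0 < \<eta>" "\<eta> < 1"
  and K: "\<And>A. A \<in> P \<Longrightarrow> K A \<subseteq> A" "\<And>A. A \<in> P \<Longrightarrow> K A \<in> sets M"
  and bad: "measure M (- (\<Union>A\<in>P. K A)) \<le> \<eta>0"
  and sep: "\<And>A B x y. A \<in> P \<Longrightarrow> B \<in> P \<Longrightarrow> A \<noteq> B \<Longrightarrow> x \<in> K A \<Longrightarrow> y \<in> K B \<Longrightarrow> \<delta> \<le> dist x y"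
  and Y: "Y \<in> sets M" "Y \<subseteq> \<Union>\<A>" "-Y \<subseteq> \<Union>\<B>"
  and fin: "finite \<A>" "finite \<B>" "\<A> \<noteq> {}" "\<B> \<noteq> {}"
  and small: "\<And>A. A \<in> \<A> \<union> \<B> \<Longrightarrow> bowen_small g T \<delta> A"
  and T: "T > 0"
 shows "partition_entropy M (dynamical_refinement M g P T) \<le>
   ln 2 + measure M Y * ln (card \<A>) + (1 - measure M Y) * ln (card \<B>)
    + T * (- ln (1 - \<eta>) + \<eta>0 * ln (card P / \<eta>))"
proof -
 interpret prob_space M
  using inv by (simp add: invariant_prob_def)
 have sM: "sets M = sets borel" and g: "g \<in> borel \<rightarrow>\<^sub>M borel" and distr: "distr M borel g = M"
  using inv by (auto simp: invariant_prob_def)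
 have sp: "space M = UNIV"
  using sets_eq_imp_space_eq[OF sM] by simp
 have P0: "card P > 0"
  using P(1,3) unfolding partition_on_def by (auto simp: card_gt_0_iff)
 define Kb where "Kb = - (\<Union>A\<in>P. K A)"
 have Kb: "Kb \<in> sets M"
  unfolding Kb_def using K(2) P(1) sp by (auto simp: Compl_eq_Diff_UNIV sp[symmetric])
 \<comment> \<open>For a Bowen-small \<open>V\<close> the images of its points at time
   \<open>i\<close> are closer than \<open>\<delta>\<close>, so by \<open>sep\<close> they meet at
   most one compact piece. \<open>star i V\<close> is the cell of that piece, and arbitrary if none
   is met.\<close>
 define star where "star i V = (SOME A. A \<in> P \<and> (\<exists>x\<in>V. (g ^^ i) x \<in> K A))" for i and V :: "'a set"
 \<comment> \<open>A mixture of the prediction with the uniform distribution: a right prediction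
   costs at most \<open>- ln (1 - \<eta>)\<close>, and any symbol at most
   \<open>ln (card P / \<eta>)\<close>.\<close>
 define w where "w i V A = (if A = star i V then 1 - \<eta> else 0) + \<eta> / card P" for i and V :: "'a set" and A :: "'a set"
 define W where "W V f = (\<Prod>i<T. w i V (f i))" for V and f :: "nat \<Rightarrow> 'a set"
 \<comment> \<open>Half of the mass goes to the predictions of each cover, which costs
   \<open>ln 2\<close>; naming a set then costs \<open>ln (card \<A>)\<close> for points of
   \<open>Y\<close> and \<open>ln (card \<B>)\<close> for the others.\<close>
 define Q where "Q f = 1 / (2 * card \<A>) * (\<Sum>V\<in>\<A>. W V f) + 1 / (2 * card \<B>) * (\<Sum>V\<in>\<B>. W V f)" for f
 have w_pos: "w i V A > 0" for i V A
  using \<eta> P0 by (auto simp: w_def intro!: add_nonneg_pos)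
 have W_pos: "W V f > 0" for V f
  unfolding W_def by (intro prod_pos) (auto simp: w_pos)
 have cA: "card \<A> > 0" "card \<B> > 0"
  using fin by (auto simp: card_gt_0_iff)
 have w_sum: "(\<Sum>A\<in>P. w i V A) \<le> 1" for i V
 proof -
  have "(\<Sum>A\<in>P. w i V A) = (\<Sum>A\<in>P. if A = star i V then 1 - \<eta> else 0) + \<eta>"
   using P0 by (simp add: w_def sum.distrib)
  also have "\<dots> \<le> 1"
   using P(1) \<eta> by (simp add: sum.delta)
  finally show ?thesis .
 qed
 have W_sum: "(\<Sum>f\<in>PiE {..<T} (\<lambda>_. P). W V f) \<le> 1" for V
 proof -
  have "(\<Sum>f\<in>PiE {..<T} (\<lambda>_. P). W V f) = (\<Prod>i<T. \<Sum>A\<in>P. w i V A)"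
   unfolding W_def using P(1) by (subst prod_sum_PiE) auto
  also have "\<dots> \<le> 1"
   by (intro prod_le_1) (auto intro!: sum_nonneg less_imp_le[OF w_pos] w_sum)
  finally show ?thesis .
 qed
 have avg: "1 / (2 * card \<C>) * (\<Sum>f\<in>PiE {..<T} (\<lambda>_. P). \<Sum>V\<in>\<C>. W V f) \<le> 1 / 2"
  if "card \<C> > 0" for \<C> :: "'a set set"
 proof -
  have "(\<Sum>f\<in>PiE {..<T} (\<lambda>_. P). \<Sum>V\<in>\<C>. W V f) = (\<Sum>V\<in>\<C>. \<Sum>f\<in>PiE {..<T} (\<lambda>_. P). W V f)"
   by (rule sum.swap)
  also have "\<dots> \<le> card \<C>"
   using sum_mono[OF W_sum, of "\<lambda>x. x" \<C>] by simp
  finally show ?thesis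
   using that by (simp add: field_simps)
 qed
 have Q_sum: "(\<Sum>f\<in>PiE {..<T} (\<lambda>_. P). Q f) \<le> 1"
  unfolding Q_def sum.distrib sum_distrib_left[symmetric]
  using avg[OF cA(1)] avg[OF cA(2)] by linarith
 have Q_pos: "Q f > 0" for f
  unfolding Q_def using cA W_pos fin by (intro add_pos_pos mult_pos_pos sum_pos) auto
 let ?R = "dynamical_refinement M g P T"
 have partR: "partition_on UNIV ?R"
  by (rule partition_on_dynamical_refinement[OF P(3) sp])
 define pt where "pt R = (SOME x. x \<in> R)" for R :: "'a set"
 have pt: "pt R \<in> R" if "R \<in> ?R" for R
  using that partR unfolding pt_def partition_on_def by (metis someI_ex ex_in_conv)
 define wd where "wd x = (\<lambda>i\<in>{..<T}. cell_of P ((g ^^ i) x))" for x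
 have wd_same: "wd x = wd y" if "R \<in> ?R" "x \<in> R" "y \<in> R" for R x y
  using in_dynamical_refinement_iff[OF P(3) sp that(1,2), of y] that(3)
  by (auto simp: wd_def restrict_def fun_eq_iff)
 have inj: "inj_on (\<lambda>R. wd (pt R)) ?R"
 proof (rule inj_onI)
  fix R R' assume R: "R \<in> ?R" "R' \<in> ?R" and eq: "wd (pt R) = wd (pt R')"
  have "\<forall>i<T. cell_of P ((g ^^ i) (pt R)) = cell_of P ((g ^^ i) (pt R'))"
  proof (intro allI impI)
   fix i assume "i < T"
   then show "cell_of P ((g ^^ i) (pt R)) = cell_of P ((g ^^ i) (pt R'))"
    using fun_cong[OF eq, of i] by (simp add: wd_def)
  qed
  then have "pt R' \<in> R"
   using in_dynamical_refinement_iff[OF P(3) sp R(1) pt[OF R(1)]] by auto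
  then show "R = R'"
   using R pt[OF R(2)] partR unfolding partition_on_def disjoint_def by auto
 qed
 define q where "q R = Q (wd (pt R))" for R
 have q_sum: "(\<Sum>R\<in>?R. q R) \<le> 1"
 proof -
  have "(\<Sum>R\<in>?R. q R) = (\<Sum>f\<in>(\<lambda>R. wd (pt R)) ` ?R. Q f)"
   unfolding q_def by (simp add: sum.reindex[OF inj])
  also have "\<dots> \<le> (\<Sum>f\<in>PiE {..<T} (\<lambda>_. P). Q f)"
   using P(1) Q_pos cell_of(1)[OF P(3)]
   by (intro sum_mono2 finite_PiE) (auto simp: wd_def less_imp_le)
  finally show ?thesis using Q_sum by simp
 qed
 \<comment> \<open>The code length of a point. Each summand of the last term integrates to
   \<open>measure M Kb * ln (card P / \<eta>)\<close> whatever \<open>i\<close> is, by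
   invariance.\<close>
 define F where "F x = ln 2 + (indicat_real Y x * ln (card \<A>) + indicat_real (-Y) x * ln (card \<B>))
   + T * (- ln (1 - \<eta>)) + (\<Sum>i<T. indicat_real Kb ((g ^^ i) x) * ln (card P / \<eta>))" for x
 have ind: "indicat_real Kb ((g ^^ i) x) = indicat_real ((g ^^ i) -` Kb) x" for i x
  by (simp add: indicator_def)
 have pre: "(g ^^ i) -` A \<in> sets M" if "A \<in> sets M" for A i
  using measurable_sets[OF measurable_funpow[OF g], of A i] that sM by auto
 have meas_pre: "measure M ((g ^^ i) -` A) = measure M A" if A: "A \<in> sets M" for A i
 proof (induction i)
  case (Suc i)
  have "measure M ((g ^^ Suc i) -` A) = measure M (g -` ((g ^^ i) -` A) \<inter> space M)"
   by (simp add: sp vimage_comp funpow_Suc_right del: funpow.simps)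
  also have "\<dots> = measure (distr M borel g) ((g ^^ i) -` A)"
  proof -
   have "g \<in> M \<rightarrow>\<^sub>M borel"
    using g measurable_cong_sets[OF sM refl] by blast
   then show ?thesis
    using pre[OF A, of i] sM by (simp add: measure_distr)
  qed
  finally show ?case using Suc distr by (simp add: comp_def)
 qed simp
 have intF: "integrable M F"
  unfolding F_def ind using Y(1) Kb pre sp
  by (intro Bochner_Integration.integrable_add Bochner_Integration.integrable_sum
    integrable_mult_left integrable_real_indicator integrable_const)
   (auto simp: emeasure_eq_measure Compl_eq_Diff_UNIV sp[symmetric])
 have covY: "- ln (Q (wd x)) \<le> ln 2 + ln (card \<C>) + T * (- ln (1 - \<eta>))
   + (\<Sum>i<T. indicat_real Kb ((g ^^ i) x) * ln (card P / \<eta>))"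
  if \<C>: "\<C> = \<A> \<or> \<C> = \<B>" and V: "V \<in> \<C>" "x \<in> V" for x V \<C>
 proof -
  have c: "card \<C> > 0" and fC: "finite \<C>"
   using cA fin \<C> by auto
  have wi: "- ln (w i V (cell_of P ((g ^^ i) x))) \<le>
    - ln (1 - \<eta>) + indicat_real Kb ((g ^^ i) x) * ln (card P / \<eta>)" if i: "i < T" for i
  proof (cases "(g ^^ i) x \<in> Kb")
   case True
   have "\<eta> / card P \<le> w i V (cell_of P ((g ^^ i) x))"
    using \<eta> by (simp add: w_def)
   then have "ln (\<eta> / card P) \<le> ln (w i V (cell_of P ((g ^^ i) x)))"
    using \<eta> P0 w_pos by (subst ln_le_cancel_iff) auto
   moreover have "ln (\<eta> / card P) = - ln (card P / \<eta>)"
    using \<eta> P0 by (simp add: ln_div)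
   moreover have "ln (1 - \<eta>) \<le> 0"
    using \<eta> by simp
   ultimately show ?thesis using True by simp
  next
   case False
   then obtain A where A: "A \<in> P" "(g ^^ i) x \<in> K A"
    by (auto simp: Kb_def)
   have "star i V \<in> P \<and> (\<exists>y\<in>V. (g ^^ i) y \<in> K (star i V))"
    unfolding star_def by (rule someI[of _ A]) (use A V in auto)
   then obtain y where y: "star i V \<in> P" "y \<in> V" "(g ^^ i) y \<in> K (star i V)"
    by blast
   have "dist ((g ^^ i) x) ((g ^^ i) y) < \<delta>"
    using small[of V] \<C> V y i by (auto simp: bowen_small_def)
   then have "star i V = A"
    using sep[OF A(1) y(1) _ A(2) y(3)] by force
   then have "cell_of P ((g ^^ i) x) = star i V"
    using cell_of(3)[OF P(3) A(1)] K(1)[OF A(1)] A(2) by auto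
   then have "1 - \<eta> \<le> w i V (cell_of P ((g ^^ i) x))"
    using \<eta> by (simp add: w_def)
   then have "ln (1 - \<eta>) \<le> ln (w i V (cell_of P ((g ^^ i) x)))"
    using \<eta> w_pos by (subst ln_le_cancel_iff) auto
   then show ?thesis using False by simp
  qed
  have "W V (wd x) / (2 * card \<C>) \<le> 1 / (2 * card \<C>) * (\<Sum>V\<in>\<C>. W V (wd x))"
  proof -
   have "W V (wd x) \<le> (\<Sum>V\<in>\<C>. W V (wd x))"
    using fC V W_pos by (intro member_le_sum) (auto simp: less_imp_le)
   then show ?thesis by (simp add: divide_right_mono)
  qed
  also have "\<dots> \<le> Q (wd x)"
  proof -
   have "0 \<le> 1 / (2 * card \<D>) * (\<Sum>V\<in>\<D>. W V (wd x))" for \<D> :: "'a set set"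
    by (intro mult_nonneg_nonneg sum_nonneg less_imp_le[OF W_pos]) auto
   from this[of \<A>] this[of \<B>] show ?thesis
    using \<C> unfolding Q_def by auto
  qed
  finally have le: "W V (wd x) / (2 * card \<C>) \<le> Q (wd x)" .
  have "ln (W V (wd x) / (2 * card \<C>)) \<le> ln (Q (wd x))"
   using le W_pos c Q_pos by (subst ln_le_cancel_iff) auto
  moreover have "ln (W V (wd x) / (2 * card \<C>)) = ln (W V (wd x)) - (ln 2 + ln (card \<C>))"
   using W_pos[of V "wd x"] c by (simp add: ln_div ln_mult)
  moreover have "ln (W V (wd x)) = (\<Sum>i<T. ln (w i V (cell_of P ((g ^^ i) x))))"
   unfolding W_def using w_pos
   by (subst ln_prod) (auto simp: wd_def intro!: sum.cong less_imp_neq[symmetric])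
  moreover have "(\<Sum>i<T. - ln (w i V (cell_of P ((g ^^ i) x)))) \<le>
    (\<Sum>i<T. - ln (1 - \<eta>) + indicat_real Kb ((g ^^ i) x) * ln (card P / \<eta>))"
   using wi by (intro sum_mono) auto
  moreover have "(\<Sum>i<T. - ln (1 - \<eta>) + indicat_real Kb ((g ^^ i) x) * ln (card P / \<eta>)) =
    T * (- ln (1 - \<eta>)) + (\<Sum>i<T. indicat_real Kb ((g ^^ i) x) * ln (card P / \<eta>))"
   by (simp only: sum.distrib) simp
  ultimately show ?thesis
   unfolding sum_negf by linarith
 qed
 have le: "- ln (q R) \<le> F x" if R: "R \<in> ?R" and x: "x \<in> R" for R x
 proof -
  have wx: "wd (pt R) = wd x"
   using wd_same[OF R pt[OF R] x] .
  show ?thesis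
  proof (cases "x \<in> Y")
   case True
   then obtain V where "V \<in> \<A>" "x \<in> V" using Y by auto
   then show ?thesis
    using covY[of \<A> V x] True by (simp add: q_def wx F_def)
  next
   case False
   then obtain V where "V \<in> \<B>" "x \<in> V" using Y by auto
   then show ?thesis
    using covY[of \<B> V x] False by (simp add: q_def wx F_def)
  qed
 qed
 have "partition_entropy M ?R \<le> integral\<^sup>L M F"
  by (rule partition_entropy_le_integral[OF prob_space_axioms finite_dynamical_refinement[OF P(1)]
     sets_dynamical_refinement[OF g sM P(2,1) T] _ _ q_sum intF le])
    (use partR sp Q_pos in \<open>auto simp: q_def\<close>)
 also have "integral\<^sup>L M F = ln 2 + (measure M Y * ln (card \<A>) + measure M (-Y) * ln (card \<B>))
   + T * (- ln (1 - \<eta>)) + (\<Sum>i<T. measure M Kb * ln (card P / \<eta>))"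
 proof -
  have [simp]: "integrable M (indicat_real A)" if "A \<in> sets M" for A
   using that by (intro integrable_real_indicator) (auto simp: emeasure_eq_measure)
  have Yc: "-Y \<in> sets M"
   using Y(1) sp by (auto simp: Compl_eq_Diff_UNIV sp[symmetric])
  define c where "c = ln (card P / \<eta>)"
  have [simp]: "integrable M (\<lambda>x. indicat_real A x * b)" if "A \<in> sets M" for A b
   using that by (intro integrable_mult_left) auto
  have int: "(\<integral>x. indicat_real A x * b \<partial>M) = measure M A * b" if "A \<in> sets M" for A b
   using that sp by simp
  have sum: "(\<integral>x. (\<Sum>i<T. indicat_real ((g ^^ i) -` Kb) x * c) \<partial>M) = (\<Sum>i<T. measure M Kb * c)"
   using pre[OF Kb] meas_pre[OF Kb] by (subst Bochner_Integration.integral_sum) (auto simp: int)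
  have isum: "integrable M (\<lambda>x. \<Sum>i<T. indicat_real ((g ^^ i) -` Kb) x * c)"
   using pre[OF Kb] by (intro Bochner_Integration.integrable_sum) auto
  show ?thesis
   unfolding F_def ind c_def[symmetric] using Y(1) Yc isum
   by (subst Bochner_Integration.integral_add Bochner_Integration.integral_add[OF _ isum],
     (intro Bochner_Integration.integrable_add integrable_const, simp_all)[2])+
     (simp_all only: sum int, simp add: prob_space[unfolded sp] sp)
 qed
 also have "measure M (-Y) = 1 - measure M Y"
  using prob_compl[OF Y(1)] by (simp add: sp Compl_eq_Diff_UNIV)
 also have "(\<Sum>i<T. measure M Kb * ln (card P / \<eta>)) \<le> T * (\<eta>0 * ln (card P / \<eta>))"
 proof -
  have "ln (card P / \<eta>) \<ge> 0"
   using P0 \<eta> by (intro ln_ge_zero) (auto simp: field_simps)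
  then have "measure M Kb * ln (card P / \<eta>) \<le> \<eta>0 * ln (card P / \<eta>)"
   using bad by (intro mult_right_mono) (auto simp: Kb_def)
  then show ?thesis
   by (simp add: mult_left_mono)
 qed
 finally show ?thesis
  by (simp add: algebra_simps)
qed

section \<open>Entropy at finite times\<close>

lemma eventually_card_separated_le:
 fixes h \<kappa> e :: real and g :: "'a::metric_space \<Rightarrow> 'a"
 assumes h: "topological_entropy g = ereal h" and \<kappa>: "\<kappa> > 0" and e: "e > 0"
 shows "\<forall>\<^sub>F T in sequentially. \<forall>E. finite E \<longrightarrow> bowen_separated g T e E \<longrightarrow> card E \<le> exp (T * (h + \<kappa>))"
proof -
 let ?s = "\<lambda>n. SUP E\<in>{E. finite E \<and> bowen_separated g n e E}. ereal (ln (real (card E)) / real n)"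
 have "limsup ?s \<le> topological_entropy g"
  unfolding topological_entropy_def using e by (intro SUP_upper) auto
 also have "\<dots> < ereal (h + \<kappa>)"
  using h \<kappa> by simp
 finally have "\<forall>\<^sub>F T in sequentially. ?s T < ereal (h + \<kappa>)"
  by (rule Limsup_lessD)
 with eventually_gt_at_top[of 0] show ?thesis
 proof eventually_elim
  case (elim T)
  show ?case
  proof (intro allI impI)
   fix E assume E: "finite E" "bowen_separated g T e E"
   have "ereal (ln (real (card E)) / real T) \<le> ?s T"
    using E by (intro SUP_upper) auto
   also have "\<dots> < ereal (h + \<kappa>)"
    by (rule elim(2))
   finally have "ln (real (card E)) \<le> T * (h + \<kappa>)"
    using elim(1) by (simp add: field_simps)
   then have "exp (ln (real (card E))) \<le> exp (T * (h + \<kappa>))"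
    by simp
   then show "card E \<le> exp (T * (h + \<kappa>))"
    by (cases "card E = 0") auto
  qed
 qed
qed

text \<open>Metric entropy being an upper limit, its lower bound holds at infinitely many times
  only, whereas upper bounds by topological entropy hold at all large times. Hence
  \<open>\<exists>\<^sub>F\<close> here and in everything deduced from it.\<close>

lemma frequently_partition_entropy_gt:
 fixes h \<kappa> :: real
 assumes "metric_entropy M g = ereal h" "\<kappa> > 0"
 obtains P where "finite P" "P \<subseteq> sets M" "partition_on (space M) P"
  "\<exists>\<^sub>F T in sequentially. T * (h - \<kappa>) < partition_entropy M (dynamical_refinement M g P T)"
proof -
 have "ereal (h - \<kappa>) < metric_entropy M g"
  using assms by simp
 then obtain P where P: "finite P" "P \<subseteq> sets M" "partition_on (space M) P"
  and lt: "ereal (h - \<kappa>) < metric_entropy_wrt M g P"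
  unfolding metric_entropy_def less_SUP_iff by auto
 let ?H = "\<lambda>T. partition_entropy M (dynamical_refinement M g P T)"
 have "\<exists>\<^sub>F T in sequentially. T * (h - \<kappa>) < ?H T"
 proof (rule ccontr)
  assume "\<not> ?thesis"
  then have "\<forall>\<^sub>F T in sequentially. ?H T \<le> T * (h - \<kappa>)"
   by (simp add: frequently_def not_less)
  with eventually_gt_at_top[of 0]
  have "\<forall>\<^sub>F T in sequentially. ereal (?H T / real T) \<le> ereal (h - \<kappa>)"
   by eventually_elim (simp add: field_simps)
  then have "metric_entropy_wrt M g P \<le> ereal (h - \<kappa>)"
   unfolding metric_entropy_wrt_def by (rule Limsup_bounded)
  with lt show False by simp
 qed
 with P that show thesis by blast
qed

lemma compact_inner_approximation:
 fixes M :: "'a::{second_countable_topology, complete_space} measure"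
 assumes "prob_space M" and M: "sets M = sets borel" and A: "A \<in> sets M" and e: "e > 0"
 obtains K where "compact K" "K \<subseteq> A" "measure M (A - K) \<le> e"
proof -
 interpret prob_space M by fact
 have "emeasure M A = (SUP K \<in> {K. K \<subseteq> A \<and> compact K}. emeasure M K)"
  using A M by (intro inner_regular) (auto simp: emeasure_eq_measure)
 moreover have "emeasure M A < emeasure M A + ennreal e"
  using e by (simp add: emeasure_eq_measure ennreal_plus[symmetric] ennreal_less_iff del: ennreal_plus)
 ultimately have "\<not> (\<forall>K\<in>{K. K \<subseteq> A \<and> compact K}. emeasure M K + ennreal e \<le> emeasure M A)"
 proof (intro notI)
  assume *: "\<forall>K\<in>{K. K \<subseteq> A \<and> compact K}. emeasure M K + ennreal e \<le> emeasure M A"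
  have "measure M K \<le> measure M A - e" if "K \<subseteq> A" "compact K" for K
  proof -
   have "ennreal (measure M K + e) \<le> ennreal (measure M A)"
    using *[rule_format, of K] that e by (simp add: emeasure_eq_measure)
   then show ?thesis by (simp add: ennreal_le_iff)
  qed
  then have "(SUP K \<in> {K. K \<subseteq> A \<and> compact K}. emeasure M K) \<le> ennreal (measure M A - e)"
   by (intro SUP_least) (auto simp: emeasure_eq_measure intro!: ennreal_leI)
  with \<open>emeasure M A = _\<close> have "ennreal (measure M A) \<le> ennreal (measure M A - e)"
   by (simp add: emeasure_eq_measure)
  moreover have "measure M A - e \<ge> 0"
   using *[rule_format, of "{}"] e by (simp add: emeasure_eq_measure)
  ultimately show False using e by (simp add: ennreal_le_iff)
 qed
 then obtain K where K: "K \<subseteq> A" "compact K" "emeasure M A < emeasure M K + ennreal e"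
  by (auto simp: not_le)
 have KM: "K \<in> sets M"
  using K M by (simp add: compact_imp_closed borel_closed)
 have "ennreal (measure M A) < ennreal (measure M K + e)"
  using K(3) e by (simp add: emeasure_eq_measure)
 then have "measure M A < measure M K + e"
  by (simp only: ennreal_less_iff measure_nonneg)
 moreover have "measure M (A - K) = measure M A - measure M K"
  using K KM A by (intro finite_measure_Diff) auto
 ultimately show thesis
  using that[of K] K by auto
qed

lemma finite_compact_family_separated:
 fixes K :: "'b \<Rightarrow> 'a::metric_space set"
 assumes "finite P" and K: "\<And>A. A \<in> P \<Longrightarrow> compact (K A)"
  and disj: "\<And>A B. A \<in> P \<Longrightarrow> B \<in> P \<Longrightarrow> A \<noteq> B \<Longrightarrow> K A \<inter> K B = {}"
 shows "\<exists>\<delta>>0. \<forall>A\<in>P. \<forall>B\<in>P. A \<noteq> B \<longrightarrow> (\<forall>x\<in>K A. \<forall>y\<in>K B. \<delta> \<le> dist x y)"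
proof -
 have "\<exists>d>0. \<forall>x\<in>K A. \<forall>y\<in>K B. d \<le> dist x y" if AB: "A \<in> P" "B \<in> P" "A \<noteq> B" for A B
 proof (cases "K A = {} \<or> K B = {}")
  case True
  then show ?thesis by (auto intro: exI[of _ 1])
 next
  case False
  have "continuous_on (K A) (\<lambda>x. infdist x (K B))"
   by (intro continuous_intros)
  then obtain x0 where x0: "x0 \<in> K A" "\<forall>x\<in>K A. infdist x0 (K B) \<le> infdist x (K B)"
   using continuous_attains_inf[OF K[OF AB(1)]] False by metis
  have "x0 \<notin> K B"
   using x0(1) disj[OF AB] by auto
  then have "infdist x0 (K B) > 0"
   using in_closed_iff_infdist_zero[OF compact_imp_closed[OF K[OF AB(2)]], of x0] False
    infdist_nonneg[of x0 "K B"] by linarith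
  moreover have "infdist x0 (K B) \<le> dist x y" if "x \<in> K A" "y \<in> K B" for x y
   using x0(2) that infdist_le[OF that(2), of x] by force
  ultimately show ?thesis by blast
 qed
 then obtain d where d: "\<And>A B. A \<in> P \<Longrightarrow> B \<in> P \<Longrightarrow> A \<noteq> B \<Longrightarrow> d A B > 0 \<and> (\<forall>x\<in>K A. \<forall>y\<in>K B. d A B \<le> dist x y)"
  by metis
 define D where "D = insert 1 ((\<lambda>(A, B). d A B) ` {(A, B). A \<in> P \<and> B \<in> P \<and> A \<noteq> B})"
 have fin: "finite D"
 proof -
  have "{(A, B). A \<in> P \<and> B \<in> P \<and> A \<noteq> B} \<subseteq> P \<times> P" by auto
  then show ?thesis
   unfolding D_def using assms(1) finite_subset by fastforce
 qed
 show ?thesis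
 proof (intro exI[of _ "Min D"] conjI ballI impI)
  have "Min D \<in> D"
   using fin by (intro Min_in) (auto simp: D_def)
  then show "Min D > 0"
   using d by (auto simp: D_def)
  fix A B x y assume AB: "A \<in> P" "B \<in> P" "A \<noteq> B" and xy: "x \<in> K A" "y \<in> K B"
  then have "Min D \<le> d A B"
   using fin by (intro Min_le) (auto simp: D_def)
  then show "Min D \<le> dist x y"
   using d[OF AB] xy by force
 qed
qed

text \<open>Points outside \<open>Y\<close> are coded by a maximal separated set, at no more than
  the topological entropy. Since the average over all points must reach \<open>h\<close>, a cover of
  \<open>Y\<close> that is too small leaves a deficit of entropy on a set of measure at least
  \<open>c\<close>.\<close>

proposition maximal_entropy_cover_lower_bound:
 fixes h \<kappa> c :: real and g :: "'a::{second_countable_topology, complete_space} \<Rightarrow> 'a"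
 assumes mme: "maximal_entropy_measure g M" and h: "topological_entropy g = ereal h"
  and \<kappa>: "\<kappa> > 0" and c: "c > 0"
 obtains \<delta> where "\<delta> > 0"
  "\<exists>\<^sub>F T in sequentially. \<forall>Y \<A>. Y \<in> sets M \<longrightarrow> c \<le> measure M Y \<longrightarrow> finite \<A> \<longrightarrow> Y \<subseteq> \<Union>\<A> \<longrightarrow>
    (\<forall>A\<in>\<A>. bowen_small g T \<delta> A) \<longrightarrow> exp (T * (h - \<kappa>)) \<le> card \<A>"
proof -
 have inv: "invariant_prob g M" and hM: "metric_entropy M g = ereal h"
  using mme h by (auto simp: maximal_entropy_measure_def)
 interpret prob_space M
  using inv by (simp add: invariant_prob_def)
 have sM: "sets M = sets borel"
  using inv by (auto simp: invariant_prob_def)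
 have sp: "space M = UNIV"
  using sets_eq_imp_space_eq[OF sM] by simp
 \<comment> \<open>Four errors of size \<open>T * \<kappa>1\<close> arise: in the lower bound of the
   entropy, in the cover of the complement of \<open>Y\<close>, in the coding, and for
   \<open>ln 2\<close>. They are divided by the measure of \<open>Y\<close>, which is at least
   \<open>c\<close>.\<close>
 define \<kappa>1 where "\<kappa>1 = c * \<kappa> / 4"
 have \<kappa>1: "\<kappa>1 > 0"
  using c \<kappa> by (simp add: \<kappa>1_def)
 obtain P where P: "finite P" "P \<subseteq> sets M" "partition_on UNIV P"
  and freq: "\<exists>\<^sub>F T in sequentially. T * (h - \<kappa>1) < partition_entropy M (dynamical_refinement M g P T)"
  using frequently_partition_entropy_gt[OF hM \<kappa>1] sp by metis
 have P0: "card P > 0"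
  using P(1,3) unfolding partition_on_def by (auto simp: card_gt_0_iff)
 define \<eta> where "\<eta> = 1 - exp (- (\<kappa>1 / 2))"
 have \<eta>: "0 < \<eta>" "\<eta> < 1" "- ln (1 - \<eta>) = \<kappa>1 / 2"
  using \<kappa>1 by (auto simp: \<eta>_def)
 define l where "l = ln (card P / \<eta>)"
 have l: "l \<ge> 0"
  unfolding l_def using P0 \<eta> by (intro ln_ge_zero) (auto simp: field_simps)
 \<comment> \<open>A visit outside the compact pieces costs \<open>l\<close>; with frequency
   \<open>\<eta>0\<close> such visits cost \<open>\<kappa>1 / 2\<close>, and
   \<open>- ln (1 - \<eta>)\<close> is the other half.\<close>
 define \<eta>0 where "\<eta>0 = \<kappa>1 / (2 * (l + 1))"
 have \<eta>0: "\<eta>0 > 0" "\<eta>0 * l \<le> \<kappa>1 / 2"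
  using \<kappa>1 l by (auto simp: \<eta>0_def field_simps)
 have "\<exists>K. compact K \<and> K \<subseteq> A \<and> measure M (A - K) \<le> \<eta>0 / card P" if "A \<in> P" for A
  using compact_inner_approximation[OF prob_space_axioms sM, of A "\<eta>0 / card P"] that P \<eta>0 P0
  by (metis divide_pos_pos of_nat_0_less_iff subsetD)
 then obtain K where K: "\<And>A. A \<in> P \<Longrightarrow> compact (K A)" "\<And>A. A \<in> P \<Longrightarrow> K A \<subseteq> A"
  "\<And>A. A \<in> P \<Longrightarrow> measure M (A - K A) \<le> \<eta>0 / card P"
  by metis
 have KM: "K A \<in> sets M" if "A \<in> P" for A
  using K(1)[OF that] sM by (simp add: compact_imp_closed borel_closed)
 have disj: "K A \<inter> K B = {}" if "A \<in> P" "B \<in> P" "A \<noteq> B" for A B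
  using K(2)[OF that(1)] K(2)[OF that(2)] P(3) that unfolding partition_on_def disjoint_def by blast
 obtain \<delta> where \<delta>: "\<delta> > 0"
  and sep: "\<And>A B x y. A \<in> P \<Longrightarrow> B \<in> P \<Longrightarrow> A \<noteq> B \<Longrightarrow> x \<in> K A \<Longrightarrow> y \<in> K B \<Longrightarrow> \<delta> \<le> dist x y"
  using finite_compact_family_separated[of P K, OF P(1) K(1) disj] by metis
 have bad: "measure M (- (\<Union>A\<in>P. K A)) \<le> \<eta>0"
 proof -
  have "- (\<Union>A\<in>P. K A) \<subseteq> (\<Union>A\<in>P. A - K A)"
   using P(3) unfolding partition_on_def by blast
  then have "measure M (- (\<Union>A\<in>P. K A)) \<le> measure M (\<Union>A\<in>P. A - K A)"
   using P KM by (intro finite_measure_mono sets.finite_UN) auto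
  also have "\<dots> \<le> (\<Sum>A\<in>P. measure M (A - K A))"
   using P KM by (intro finite_measure_subadditive_finite) auto
  also have "\<dots> \<le> (\<Sum>A\<in>P. \<eta>0 / card P)"
   by (intro sum_mono K(3))
  finally show ?thesis using P0 by simp
 qed
 have ev: "\<forall>\<^sub>F T in sequentially. \<forall>E. finite E \<longrightarrow> bowen_separated g T (\<delta> / 3) E \<longrightarrow> card E \<le> exp (T * (h + \<kappa>1))"
  using \<delta> by (intro eventually_card_separated_le[OF h \<kappa>1]) auto
 obtain T0 :: nat where T0: "ln 2 / \<kappa>1 \<le> T0" "max 0 (- h / \<kappa>1) \<le> T0"
  using real_arch_simple[of "max (ln 2 / \<kappa>1) (max 0 (- h / \<kappa>1))"] by auto
 have h0: "h \<ge> 0 \<or> True" by simp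
 show thesis
 proof (rule that[OF \<delta>], rule frequently_mp[OF _ freq])
  show "\<forall>\<^sub>F T in sequentially. T * (h - \<kappa>1) < partition_entropy M (dynamical_refinement M g P T) \<longrightarrow>
    (\<forall>Y \<A>. Y \<in> sets M \<longrightarrow> c \<le> measure M Y \<longrightarrow> finite \<A> \<longrightarrow> Y \<subseteq> \<Union>\<A> \<longrightarrow>
     (\<forall>A\<in>\<A>. bowen_small g T \<delta> A) \<longrightarrow> exp (T * (h - \<kappa>)) \<le> card \<A>)"
   using ev eventually_ge_at_top[of "Suc T0"]
  proof (eventually_elim, intro allI impI)
   fix T Y \<A>
   assume sepT: "\<forall>E. finite E \<longrightarrow> bowen_separated g T (\<delta> / 3) E \<longrightarrow> card E \<le> exp (T * (h + \<kappa>1))"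
    and T: "Suc T0 \<le> T"
    and ent: "T * (h - \<kappa>1) < partition_entropy M (dynamical_refinement M g P T)"
    and Y: "Y \<in> sets M" "c \<le> measure M Y" and \<A>: "finite \<A>" "Y \<subseteq> \<Union>\<A>"
    and small: "\<forall>A\<in>\<A>. bowen_small g T \<delta> A"
   have bnd: "card E \<le> nat \<lfloor>exp (T * (h + \<kappa>1))\<rfloor>" if "finite E" "bowen_separated g T (\<delta> / 3) E" for E
    using sepT that by (simp add: le_nat_floor)
   obtain E where E: "E \<subseteq> -Y" "finite E" "bowen_separated g T (\<delta> / 3) E"
    "\<forall>y\<in>-Y. \<exists>x\<in>E. \<forall>i<T. dist ((g ^^ i) x) ((g ^^ i) y) \<le> \<delta> / 3"
    using exists_maximal_bowen_separated[of g T "\<delta> / 3" _ "-Y", OF bnd] \<delta> by auto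
   \<comment> \<open>If \<open>Y\<close> is everything, \<open>E\<close> is empty; the cover by the
     empty set then supplies the nonempty family that the coding asks for.\<close>
   define \<B> where "\<B> = (if E = {} then {{}} else (\<lambda>x. {y. \<forall>i<T. dist ((g ^^ i) x) ((g ^^ i) y) \<le> \<delta> / 3}) ` E)"
   have \<B>: "finite \<B>" "\<B> \<noteq> {}" "-Y \<subseteq> \<Union>\<B>"
    using E by (auto simp: \<B>_def)
   have small\<B>: "bowen_small g T \<delta> B" if "B \<in> \<B>" for B
   proof -
    have "dist ((g ^^ i) y) ((g ^^ i) z) < \<delta>"
     if "dist ((g ^^ i) x) ((g ^^ i) y) \<le> \<delta> / 3" "dist ((g ^^ i) x) ((g ^^ i) z) \<le> \<delta> / 3" for x y z i
     using dist_triangle3[of "(g ^^ i) y" "(g ^^ i) z" "(g ^^ i) x"] that \<delta> by linarith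
    then show ?thesis
     using that unfolding \<B>_def bowen_small_def by (auto split: if_splits)
   qed
   have "c \<le> 1"
    using Y(2) prob_le_1[of Y] by linarith
   have Y0: "Y \<noteq> {}"
    using Y(2) c by auto
   then have \<A>0: "\<A> \<noteq> {}"
    using \<A> by auto
   have ln\<B>: "ln (card \<B>) \<le> max 0 (T * (h + \<kappa>1))"
   proof (cases "E = {}")
    case False
    then have "real (card \<B>) \<le> card E"
     using E(2) by (simp add: \<B>_def card_image_le)
    also have "\<dots> \<le> exp (T * (h + \<kappa>1))"
     using sepT E by blast
    finally have "ln (card \<B>) \<le> ln (exp (T * (h + \<kappa>1)))"
     using \<B> by (subst ln_le_cancel_iff) (auto simp: card_gt_0_iff)
    then show ?thesis by simp
   qed (simp add: \<B>_def)
   \<comment> \<open>A singleton is separated, so the bound on separated sets already forces this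
     sign.\<close>
   have pos: "T * (h + \<kappa>1) \<ge> 0"
   proof -
    have "card {undefined :: 'a} \<le> exp (T * (h + \<kappa>1))"
     by (rule sepT[rule_format]) (auto simp: bowen_separated_def)
    then show ?thesis by simp
   qed
   have "T * (h - \<kappa>1) < ln 2 + measure M Y * ln (card \<A>) + (1 - measure M Y) * ln (card \<B>)
     + T * (- ln (1 - \<eta>) + \<eta>0 * ln (card P / \<eta>))"
   proof (rule less_le_trans[OF ent])
    show "partition_entropy M (dynamical_refinement M g P T) \<le>
     ln 2 + measure M Y * ln (card \<A>) + (1 - measure M Y) * ln (card \<B>)
     + T * (- ln (1 - \<eta>) + \<eta>0 * ln (card P / \<eta>))"
     by (rule partition_entropy_le_covers[OF inv P \<eta>(1,2) K(2) KM bad sep Y(1) \<A>(2) \<B>(3) \<A>(1) \<B>(1) \<A>0 \<B>(2)])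
       (use small small\<B> T in auto)
   qed
   also have "\<dots> \<le> ln 2 + measure M Y * ln (card \<A>) + (1 - measure M Y) * (T * (h + \<kappa>1)) + T * \<kappa>1"
   proof -
    have "(1 - measure M Y) * ln (card \<B>) \<le> (1 - measure M Y) * (T * (h + \<kappa>1))"
     using ln\<B> pos by (intro mult_left_mono) auto
    moreover have "- ln (1 - \<eta>) + \<eta>0 * ln (card P / \<eta>) \<le> \<kappa>1"
     using \<eta>(3) \<eta>0(2) by (simp add: l_def)
    then have "T * (- ln (1 - \<eta>) + \<eta>0 * ln (card P / \<eta>)) \<le> T * \<kappa>1"
     by (intro mult_left_mono) auto
    ultimately show ?thesis by linarith
   qed
   finally have 1: "measure M Y * (T * h) - measure M Y * ln (card \<A>) < ln 2 + 3 * (T * \<kappa>1) - measure M Y * (T * \<kappa>1)"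
    by (simp add: algebra_simps)
   have "ln 2 \<le> T * \<kappa>1"
   proof -
    have "ln 2 / \<kappa>1 \<le> T" using T0(1) T by linarith
    then show ?thesis using \<kappa>1 by (simp add: field_simps)
   qed
   moreover have "measure M Y * (T * \<kappa>1) \<ge> 0"
    using \<kappa>1 by simp
   ultimately have 2: "measure M Y * (T * h - ln (card \<A>)) \<le> 4 * (T * \<kappa>1)"
    using 1 by (simp add: algebra_simps)
   have "T * h - ln (card \<A>) \<le> T * \<kappa>"
   proof (rule ccontr)
    assume "\<not> ?thesis"
    then have 3: "T * h - ln (card \<A>) > T * \<kappa>" by simp
    have "c * (T * \<kappa>) < c * (T * h - ln (card \<A>))"
     using 3 c by simp
    also have "\<dots> \<le> measure M Y * (T * h - ln (card \<A>))"
    proof -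
     have "0 \<le> T * \<kappa>" using \<kappa> by simp
     with 3 have "0 \<le> T * h - ln (card \<A>)" by linarith
     with Y(2) show ?thesis by (intro mult_right_mono)
    qed
    also have "\<dots> \<le> 4 * (T * \<kappa>1)" by (rule 2)
    finally show False
     by (simp add: \<kappa>1_def)
   qed
   then have "exp (T * (h - \<kappa>)) \<le> exp (ln (card \<A>))"
    by (simp add: algebra_simps)
   then show "exp (T * (h - \<kappa>)) \<le> card \<A>"
    using \<A> \<A>0 by (simp add: card_gt_0_iff)
  qed
 qed
qed

section \<open>Geometry of the torus\<close>

text \<open>A fibre is closed in the plane, so its distance to a point is attained.\<close>

lemma exists_nearest_lift:
 obtains q where "to_torus q = b" "dist p q = dist (to_torus p) b"
proof -
 obtain q where q: "q \<in> fibre b" "infdist p (fibre b) = dist p q"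
  using infdist_attains_inf[OF closed_fibre fibre_nonempty] by blast
 have "dist (to_torus p) b = setdist {p} (fibre b)"
  unfolding dist_torus_def by (rule setdist_fibre) (simp add: fibre_def)
 also have "\<dots> = dist p q"
  using q(2) by (simp add: infdist_eq_setdist)
 finally show thesis
  using that[of q] q(1) by (simp add: fibre_def)
qed

lemma open_to_torus_image:
 assumes "open U" shows "open (to_torus ` U)"
 unfolding open_dist
proof
 fix a assume "a \<in> to_torus ` U"
 then obtain p where p: "p \<in> U" "a = to_torus p" by auto
 then obtain e where e: "e > 0" "ball p e \<subseteq> U"
  using assms openE by blast
 have "b \<in> to_torus ` U" if "dist b a < e" for b
 proof -
  obtain q where "to_torus q = b" "dist p q = dist (to_torus p) b"
   by (rule exists_nearest_lift)
  then show ?thesis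
   using that p e by (auto simp: dist_commute intro!: image_eqI[of _ _ q])
 qed
 then show "\<exists>e>0. \<forall>b. dist b a < e \<longrightarrow> b \<in> to_torus ` U"
  using e by blast
qed

text \<open>Completeness and a countable base are the setting of inner regularity by compact sets,
  on which \<open>compact_inner_approximation\<close> rests.\<close>

instance torus :: complete_space
proof
 fix X :: "nat \<Rightarrow> torus" assume "Cauchy X"
 then show "convergent X"
  using compact_UNIV_torus unfolding compact_eq_totally_bounded complete_def convergent_def by auto
qed

instance torus :: second_countable_topology
proof
 obtain B :: "(real \<times> real) set set" where B: "countable B" "topological_basis B"
  using ex_countable_basis by blast
 have "topological_basis ((`) to_torus ` B)"
 proof (rule topological_basisI)
  show "open b" if "b \<in> (`) to_torus ` B" for b
   using that open_to_torus_image topological_basis_open[OF B(2)] by auto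
  fix U a assume U: "open (U :: torus set)" "a \<in> U"
  obtain p where p: "to_torus p = a"
   using to_torus_surj by blast
  have "open (to_torus -` U)"
   using continuous_on_to_torus[of UNIV] U(1) by (simp add: continuous_on_open_vimage)
  then obtain b where "b \<in> B" "p \<in> b" "b \<subseteq> to_torus -` U"
   using topological_basisE[OF B(2), of "to_torus -` U" p] p U by auto
  then show "\<exists>b\<in>(`) to_torus ` B. a \<in> b \<and> b \<subseteq> U"
   using p by (intro bexI[of _ "to_torus ` b"]) auto
 qed
 then show "\<exists>B::torus set set. countable B \<and> open = generate_topology B"
  using B(1) topological_basis_imp_subbasis by blast
qed

section \<open>Elementary estimates in the plane\<close>

lemma int_lattice_norm_less_1:
 assumes "v \<in> int_lattice" "norm v < 1" shows "v = 0"
proof -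
 obtain a b where v: "v = (a, b)" "a \<in> \<int>" "b \<in> \<int>"
  using assms(1) by (cases v) (auto simp: int_lattice_def)
 have "\<bar>a\<bar> < 1" "\<bar>b\<bar> < 1"
  using assms(2) norm_fst_le[of a b] norm_snd_le[of b a] by (auto simp: v(1))
 then show ?thesis
  using v Ints_nonzero_abs_less1 by (metis zero_prod_def)
qed

lemma to_torus_diff_lattice: "v \<in> int_lattice \<Longrightarrow> to_torus (p - v) = to_torus p"
 by (simp add: to_torus_eq_iff int_lattice_uminus)

lemma norm_Pair_le_add: "norm (a, b) \<le> norm a + norm (b :: real)" for a :: real
 using norm_triangle_ineq[of "(a, 0)" "(0, b)"] by simp

lemma abs_fst_le_norm: "\<bar>fst v\<bar> \<le> norm v" and abs_snd_le_norm: "\<bar>snd v\<bar> \<le> norm v" for v :: "real \<times> real"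
 using norm_fst_le[of "fst v" "snd v"] norm_snd_le[of "snd v" "fst v"] by simp_all

lemma norm_le_abs_add: "norm v \<le> \<bar>fst v\<bar> + \<bar>snd v\<bar>" for v :: "real \<times> real"
 using norm_Pair_le_add[of "fst v" "snd v"] by simp

lemma abs_sin_diff_le: "\<bar>sin x - sin y\<bar> \<le> \<bar>x - y\<bar>" for x y :: real
proof -
 have "norm (sin x - sin y) \<le> 1 * norm (x - y)"
  by (rule field_differentiable_bound[of UNIV sin cos]) (auto intro!: derivative_eq_intros)
 then show ?thesis by simp
qed

lemma abs_cos_diff_le: "\<bar>cos x - cos y\<bar> \<le> \<bar>x - y\<bar>" for x y :: real
proof -
 have "norm (cos x - cos y) \<le> 1 * norm (x - y)"
  by (rule field_differentiable_bound[of UNIV cos "\<lambda>x. - sin x"])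
    (auto intro!: derivative_eq_intros)
 then show ?thesis by simp
qed

lemma abs_sin_remainder_le: "\<bar>sin (a + b) - sin a - b * cos a\<bar> \<le> b\<^sup>2" for a b :: real
proof -
 define f where "f x = sin x - x * cos a" for x
 have "norm (f (a + b) - f a) \<le> \<bar>b\<bar> * norm (a + b - a)"
 proof (rule field_differentiable_bound[of "closed_segment a (a + b)" f "\<lambda>x. cos x - cos a"])
  fix x assume x: "x \<in> closed_segment a (a + b)"
  show "(f has_field_derivative cos x - cos a) (at x within closed_segment a (a + b))"
   unfolding f_def by (auto intro!: derivative_eq_intros)
  have "\<bar>x - a\<bar> \<le> \<bar>b\<bar>"
   using segment_bound(1)[OF x] by simp
  then show "norm (cos x - cos a) \<le> \<bar>b\<bar>"
   using abs_cos_diff_le[of x a] by simp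
 qed auto
 then show ?thesis
  by (simp add: f_def power2_eq_square algebra_simps)
qed

text \<open>The determinant with columns \<open>u\<close> and \<open>v\<close>, that is, their
  signed area.\<close>

definition wedge :: "real \<times> real \<Rightarrow> real \<times> real \<Rightarrow> real" where
 "wedge u v = fst u * snd v - snd u * fst v"

lemma abs_wedge_le: "\<bar>wedge u v\<bar> \<le> norm u * norm v"
proof -
 have "(wedge u v)\<^sup>2 + (inner u v)\<^sup>2 = (norm u)\<^sup>2 * (norm v)\<^sup>2"
  unfolding power2_norm_eq_inner
  by (simp add: wedge_def inner_prod_def power2_eq_square algebra_simps)
 then have "(wedge u v)\<^sup>2 \<le> (norm u * norm v)\<^sup>2"
  by (simp add: power_mult_distrib) (metis le_add_same_cancel1 zero_le_power2)
 then show ?thesis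
  by (metis abs_ge_zero abs_le_square_iff abs_of_nonneg mult_nonneg_nonneg norm_ge_zero)
qed

lemma wedge_add_right: "wedge u (v + w) = wedge u v + wedge u w"
 and wedge_diff_right: "wedge u (v - w) = wedge u v - wedge u w"
 and wedge_scaleR_right: "wedge u (c *\<^sub>R v) = c * wedge u v"
 and wedge_scaleR_left: "wedge (c *\<^sub>R u) v = c * wedge u v"
 by (simp_all add: wedge_def algebra_simps)

text \<open>\<open>(- snd \<rho>, fst \<rho>)\<close> spans the kernel of
  \<open>inner \<rho>\<close>, and its wedge with \<open>v\<close> is again \<open>Q\<close>. So
  \<open>\<rho>\<close> reads off the coordinate along \<open>v\<close>, and \<open>wedge v\<close>
  the other one, with the same denominator.\<close>

lemma decompose_vector:
 assumes "inner \<rho> v = Q" "Q \<noteq> 0"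
 shows "\<xi> = (inner \<rho> \<xi> / Q) *\<^sub>R v + (wedge v \<xi> / Q) *\<^sub>R (- snd \<rho>, fst \<rho>)"
proof -
 have "Q *\<^sub>R \<xi> = inner \<rho> \<xi> *\<^sub>R v + wedge v \<xi> *\<^sub>R (- snd \<rho>, fst \<rho>)"
  unfolding assms(1)[symmetric]
  by (simp add: wedge_def inner_prod_def prod_eq_iff algebra_simps)
 then have "(1 / Q) *\<^sub>R (Q *\<^sub>R \<xi>) = (1 / Q) *\<^sub>R (inner \<rho> \<xi> *\<^sub>R v + wedge v \<xi> *\<^sub>R (- snd \<rho>, fst \<rho>))"
  by simp
 then show ?thesis
  using assms(2) by (simp add: scaleR_add_right)
qed

section \<open>Maps close to the standard map\<close>

text \<open>\<open>E\<close> is the perturbation; its second derivative appears only as a Lipschitz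
  constant of \<open>E'\<close>. The size \<open>1 / k ^ 4\<close> keeps \<open>r * L ^ 3\<close>
  below \<open>1 / 2\<close>, the strongest amplification of the perturbation, met in
  \<open>box_remainder\<close>.\<close>

locale near_standard =
 fixes k r :: real and g :: "torus \<Rightarrow> torus" and G E :: "real \<times> real \<Rightarrow> real \<times> real"
  and E' :: "real \<times> real \<Rightarrow> (real \<times> real) \<Rightarrow>\<^sub>L (real \<times> real)"
 assumes k: "k \<ge> 1000" and r: "0 \<le> r" "r \<le> 1 / k ^ 4"
  and bij_g: "bij g"
  and lift: "to_torus (G p) = g (to_torus p)"
  and G_eq: "G p = standard_lift k p + E p"
  and E_le: "norm (E p) \<le> r"
  and E_deriv: "(E has_derivative blinfun_apply (E' p)) (at p)"
  and E'_le: "norm (E' p) \<le> r"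
  and E'_lipschitz: "norm (E' p - E' q) \<le> r * norm (p - q)"
begin

section \<open>The derivative, its transpose and its determinant\<close>

definition L :: real where "L = 7 * k"

definition D :: "real \<times> real \<Rightarrow> real \<times> real \<Rightarrow> real \<times> real" where
 "D p \<xi> = ((2 + 2 * pi * k * cos (2 * pi * fst p)) * fst \<xi> - snd \<xi> + fst (E' p \<xi>), fst \<xi> + snd (E' p \<xi>))"

text \<open>The transpose of \<open>D p\<close>, given by pairing with the images of the two basis
  vectors; see \<open>inner_Dt\<close>.\<close>

definition Dt :: "real \<times> real \<Rightarrow> real \<times> real \<Rightarrow> real \<times> real" where
 "Dt p \<rho> = (inner \<rho> (D p (1, 0)), inner \<rho> (D p (0, 1)))"

lemma r_small: "r \<le> 1 / 1000" "r * k \<le> 1 / 1000" "r * k ^ 2 \<le> 1 / 1000" "r * k ^ 3 \<le> 1 / 1000"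
proof -
 have k1: "1 \<le> k ^ n" for n :: nat
  using k by (simp add: one_le_power)
 have 3: "r * k ^ 3 \<le> 1 / 1000"
 proof -
  have "r * k ^ 3 \<le> 1 / k ^ 4 * k ^ 3"
   using r k by (intro mult_right_mono) auto
  also have "\<dots> = 1 / k"
   using k by (simp add: field_simps eval_nat_numeral)
  also have "\<dots> \<le> 1 / 1000"
   using k by (intro divide_left_mono) auto
  finally show ?thesis .
 qed
 have mono: "r * k ^ n \<le> r * k ^ 3" if "n \<le> 3" for n
  using r k that by (intro mult_left_mono power_increasing) auto
 show "r \<le> 1 / 1000" "r * k \<le> 1 / 1000" "r * k ^ 2 \<le> 1 / 1000" "r * k ^ 3 \<le> 1 / 1000"
  using mono[of 0] mono[of 1] mono[of 2] 3 by simp_all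
qed

lemma pi_bounds: "pi < 3.15" "pi > 3"
 using pi_less_4 pi_approx by auto

lemma E'_apply: "norm (E' p \<xi>) \<le> r * norm \<xi>"
 using norm_blinfun[of "E' p" \<xi>] E'_le[of p] by (meson mult_right_mono norm_ge_zero order_trans)

lemma E'_apply_components: "\<bar>fst (E' p \<xi>)\<bar> \<le> r * norm \<xi>" "\<bar>snd (E' p \<xi>)\<bar> \<le> r * norm \<xi>"
 using E'_apply[of p \<xi>] norm_fst_le[of "fst (E' p \<xi>)" "snd (E' p \<xi>)"] norm_snd_le[of "snd (E' p \<xi>)" "fst (E' p \<xi>)"]
 by auto

lemma D_add: "D p (u + v) = D p u + D p v"
 and D_diff: "D p (u - v) = D p u - D p v"
 and D_scaleR: "D p (c *\<^sub>R u) = c *\<^sub>R D p u"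
 by (simp_all add: D_def blinfun.add_right blinfun.diff_right blinfun.scaleR_right algebra_simps)

lemma D_snd_le: "\<bar>snd (D p \<xi>)\<bar> \<le> \<bar>fst \<xi>\<bar> + r * norm \<xi>"
 using E'_apply_components[of p \<xi>] by (simp add: D_def)

text \<open>The second row of the derivative carries no factor \<open>k\<close>. Hence a vector that
  was just stretched strongly is nearly horizontal; \<open>Dt_snd_le2\<close> is the counterpart for
  covectors.\<close>

lemma D_snd_le2: "\<bar>snd (D p \<xi>)\<bar> \<le> 2 * norm \<xi>"
proof -
 have "\<bar>fst \<xi>\<bar> \<le> norm \<xi>"
  using norm_fst_le[of "fst \<xi>" "snd \<xi>"] by simp
 moreover have "r * norm \<xi> \<le> 1 * norm \<xi>"
  using r_small by (intro mult_right_mono) auto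
 ultimately show ?thesis
  using D_snd_le[of p \<xi>] by linarith
qed

lemma norm_D_le: "norm (D p \<xi>) \<le> L * norm \<xi>"
proof -
 have f: "\<bar>fst \<xi>\<bar> \<le> norm \<xi>" "\<bar>snd \<xi>\<bar> \<le> norm \<xi>"
  using norm_fst_le[of "fst \<xi>" "snd \<xi>"] norm_snd_le[of "snd \<xi>" "fst \<xi>"] by simp_all
 have "\<bar>2 + 2 * pi * k * cos (2 * pi * fst p)\<bar> \<le> 2 + 2 * pi * k * 1"
  using k by (intro order_trans[OF abs_triangle_ineq] add_mono) (auto simp: abs_mult intro!: mult_mono)
 \<comment> \<open>\<open>2 * pi < 6.3\<close>; the remaining \<open>0.7 * k\<close> in
   \<open>L\<close> absorbs all terms without a factor \<open>k\<close>.\<close>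
 also have "\<dots> \<le> 2 + 6.3 * k"
  using pi_bounds k by simp
 finally have "\<bar>(2 + 2 * pi * k * cos (2 * pi * fst p)) * fst \<xi>\<bar> \<le> (2 + 6.3 * k) * norm \<xi>"
  unfolding abs_mult using f k by (intro mult_mono) auto
 moreover have "r * norm \<xi> \<le> 1 * norm \<xi>"
  using r_small by (intro mult_right_mono) auto
 ultimately have "\<bar>fst (D p \<xi>)\<bar> \<le> (2 + 6.3 * k) * norm \<xi> + norm \<xi> + norm \<xi>"
  using E'_apply_components(1)[of p \<xi>] f unfolding D_def fst_conv by linarith
 then have "norm (D p \<xi>) \<le> (6.3 * k + 6) * norm \<xi>"
  using norm_Pair_le_add[of "fst (D p \<xi>)" "snd (D p \<xi>)"] D_snd_le2[of p \<xi>] by (simp add: algebra_simps)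
 also have "\<dots> \<le> L * norm \<xi>"
  unfolding L_def using k by (intro mult_right_mono) auto
 finally show ?thesis .
qed

lemma inner_Dt: "inner (Dt p \<rho>) \<xi> = inner \<rho> (D p \<xi>)"
proof -
 have "\<xi> = fst \<xi> *\<^sub>R (1, 0) + snd \<xi> *\<^sub>R (0, 1)"
  by (simp add: prod_eq_iff)
 then have "D p \<xi> = fst \<xi> *\<^sub>R D p (1, 0) + snd \<xi> *\<^sub>R D p (0, 1)"
  by (metis D_add D_scaleR)
 then show ?thesis
  by (simp add: Dt_def inner_prod_def inner_add_right algebra_simps)
qed

lemma norm_Dt_le: "norm (Dt p \<rho>) \<le> L * norm \<rho>"
proof (cases "norm (Dt p \<rho>) = 0")
 case True
 then show ?thesis using k by (simp add: L_def)
next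
 case False
 have "norm (Dt p \<rho>) * norm (Dt p \<rho>) = inner \<rho> (D p (Dt p \<rho>))"
  by (simp add: inner_Dt[symmetric] dot_square_norm power2_eq_square)
 also have "\<dots> \<le> norm \<rho> * norm (D p (Dt p \<rho>))"
  by (rule norm_cauchy_schwarz)
 also have "\<dots> \<le> norm \<rho> * (L * norm (Dt p \<rho>))"
  by (intro mult_left_mono norm_D_le) auto
 finally show ?thesis
  using False by (simp add: mult_ac)
qed

lemma Dt_snd_le2: "\<bar>snd (Dt p \<rho>)\<bar> \<le> 2 * norm \<rho>"
proof -
 have "norm (D p (0, 1)) \<le> 2"
 proof -
  have "\<bar>fst (D p (0, 1))\<bar> \<le> 1 + r" "\<bar>snd (D p (0, 1))\<bar> \<le> r"
   using E'_apply_components[of p "(0, 1)"] by (auto simp: D_def)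
  then show ?thesis
   using norm_Pair_le_add[of "fst (D p (0, 1))" "snd (D p (0, 1))"] r_small by simp
 qed
 then have "norm \<rho> * norm (D p (0, 1)) \<le> norm \<rho> * 2"
  by (intro mult_left_mono) auto
 then show ?thesis
  using Cauchy_Schwarz_ineq2[of \<rho> "D p (0, 1)"] by (simp add: Dt_def)
qed

definition det :: "real \<times> real \<Rightarrow> real" where
 "det p = wedge (D p (1, 0)) (D p (0, 1))"

lemma wedge_D: "wedge (D p u) (D p v) = det p * wedge u v"
proof -
 have *: "D p \<xi> = fst \<xi> *\<^sub>R D p (1, 0) + snd \<xi> *\<^sub>R D p (0, 1)" for \<xi>
 proof -
  have "\<xi> = fst \<xi> *\<^sub>R (1, 0) + snd \<xi> *\<^sub>R (0, 1)"
   by (simp add: prod_eq_iff)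
  then show ?thesis by (metis D_add D_scaleR)
 qed
 show ?thesis
  unfolding det_def *[of u] *[of v] by (simp add: wedge_def algebra_simps)
qed

text \<open>The standard map preserves area, so the determinant is 1 up to the perturbation. The
  crude bound 2 costs a factor \<open>2 ^ n\<close> over \<open>n\<close> steps, which is negligible
  against powers of \<open>k\<close>.\<close>

lemma abs_det_le: "\<bar>det p\<bar> \<le> 2"
proof -
 have 1: "\<bar>snd (D p (0, 1))\<bar> \<le> r" "\<bar>fst (D p (0, 1))\<bar> \<le> 1 + r"
  "\<bar>snd (D p (1, 0))\<bar> \<le> 1 + r"
  using E'_apply_components[of p "(0, 1)"] E'_apply_components[of p "(1, 0)"] by (auto simp: D_def)
 have 2: "\<bar>fst (D p (1, 0))\<bar> \<le> L"
  using norm_D_le[of p "(1, 0)"] norm_fst_le[of "fst (D p (1, 0))" "snd (D p (1, 0))"] by simp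
 have "\<bar>det p\<bar> \<le> \<bar>fst (D p (1, 0)) * snd (D p (0, 1))\<bar> + \<bar>snd (D p (1, 0)) * fst (D p (0, 1))\<bar>"
  unfolding det_def wedge_def by (rule abs_triangle_ineq4)
 also have "\<dots> \<le> L * r + (1 + r) * (1 + r)"
  unfolding abs_mult using 1 2 r k by (intro add_mono mult_mono) (auto simp: L_def)
 also have "\<dots> \<le> 2"
 proof -
  have "L * r \<le> 7 / 1000"
   using r_small(2) by (simp add: L_def mult.commute)
  moreover have "(1 + r) * (1 + r) \<le> 1.001 * 1.001"
   using r r_small by (intro mult_mono) auto
  ultimately show ?thesis by simp
 qed
 finally show ?thesis .
qed

section \<open>Second-order remainders of the lift\<close>

lemma norm_E_diff_le: "norm (E p - E q) \<le> r * norm (p - q)"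
proof -
 have "norm (E p - E q) \<le> r * norm (p - q)"
  by (rule differentiable_bound[of UNIV E "\<lambda>x. blinfun_apply (E' x)"])
    (use E_deriv E'_le in \<open>auto simp: norm_blinfun.rep_eq[symmetric]\<close>)
 then show ?thesis .
qed

lemma norm_E_remainder_le: "norm (E (p + \<xi>) - E p - E' p \<xi>) \<le> r * (norm \<xi>)\<^sup>2"
proof -
 define f where "f x = E x - E' p (x - p)" for x
 have f: "(f has_derivative (\<lambda>h. E' x h - E' p h)) (at x)" for x
  unfolding f_def by (auto intro!: derivative_eq_intros E_deriv)
 have "norm (f (p + \<xi>) - f p) \<le> (r * norm \<xi>) * norm ((p + \<xi>) - p)"
 proof (rule differentiable_bound[of "closed_segment p (p + \<xi>)" f "\<lambda>x. blinfun_apply (E' x - E' p)"])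
  fix x assume x: "x \<in> closed_segment p (p + \<xi>)"
  show "(f has_derivative blinfun_apply (E' x - E' p)) (at x within closed_segment p (p + \<xi>))"
   using has_derivative_at_withinI[OF f[of x]] by (simp add: blinfun.diff_left[abs_def])
  have "norm (x - p) \<le> norm \<xi>"
   using segment_bound(1)[OF x] by simp
  then have "r * norm (x - p) \<le> r * norm \<xi>"
   using r by (intro mult_left_mono)
  then show "onorm (blinfun_apply (E' x - E' p)) \<le> r * norm \<xi>"
   using E'_lipschitz[of x p] by (simp add: norm_blinfun.rep_eq[symmetric])
 qed auto
 then show ?thesis
  by (simp add: f_def power2_eq_square algebra_simps blinfun.zero_right)
qed

definition N :: "real \<times> real \<Rightarrow> real \<times> real \<Rightarrow> real \<times> real" where
 "N p \<xi> = G (p + \<xi>) - G p - D p \<xi>"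

lemma G_add: "G (p + \<xi>) = G p + D p \<xi> + N p \<xi>"
 by (simp add: N_def)

lemma N_eq: "N p \<xi> = (k * (sin (2 * pi * fst p + 2 * pi * fst \<xi>) - sin (2 * pi * fst p) - 2 * pi * fst \<xi> * cos (2 * pi * fst p)), 0)
  + (E (p + \<xi>) - E p - E' p \<xi>)"
 by (simp add: N_def G_eq D_def standard_lift_def case_prod_unfold prod_eq_iff algebra_simps)

text \<open>The strong nonlinearity \<open>k * sin\<close> depends on the abscissa alone and acts on
  the first component alone; all the rest is perturbation. The shadowing estimates live on this
  asymmetry.\<close>

lemma fst_N_le: "\<bar>fst (N p \<xi>)\<bar> \<le> 40 * k * (fst \<xi>)\<^sup>2 + r * (norm \<xi>)\<^sup>2"
 and snd_N_le: "\<bar>snd (N p \<xi>)\<bar> \<le> r * (norm \<xi>)\<^sup>2"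
proof -
 let ?R = "E (p + \<xi>) - E p - E' p \<xi>"
 have R: "\<bar>fst ?R\<bar> \<le> r * (norm \<xi>)\<^sup>2" "\<bar>snd ?R\<bar> \<le> r * (norm \<xi>)\<^sup>2"
  using norm_E_remainder_le[of p \<xi>] abs_fst_le_norm[of ?R] abs_snd_le_norm[of ?R]
  by linarith+
 let ?s = "sin (2 * pi * fst p + 2 * pi * fst \<xi>) - sin (2 * pi * fst p) - 2 * pi * fst \<xi> * cos (2 * pi * fst p)"
 have "\<bar>k * ?s\<bar> \<le> k * (2 * pi * fst \<xi>)\<^sup>2"
  using abs_sin_remainder_le[of "2 * pi * fst p" "2 * pi * fst \<xi>"] k by (simp add: abs_mult)
 also have "\<dots> \<le> k * (40 * (fst \<xi>)\<^sup>2)"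
 proof -
  have "pi * pi \<le> 3.15 * 3.15"
   using pi_bounds by (intro mult_mono) auto
  then have "4 * (pi * pi) * (fst \<xi>)\<^sup>2 \<le> 40 * (fst \<xi>)\<^sup>2"
   by (intro mult_right_mono) auto
  then show ?thesis
   using k by (intro mult_left_mono) (auto simp: power2_eq_square algebra_simps)
 qed
 finally have s: "\<bar>k * ?s\<bar> \<le> 40 * k * (fst \<xi>)\<^sup>2" by simp
 have "fst (N p \<xi>) = k * ?s + fst ?R" "snd (N p \<xi>) = snd ?R"
  unfolding N_eq by simp_all
 then show "\<bar>fst (N p \<xi>)\<bar> \<le> 40 * k * (fst \<xi>)\<^sup>2 + r * (norm \<xi>)\<^sup>2" "\<bar>snd (N p \<xi>)\<bar> \<le> r * (norm \<xi>)\<^sup>2"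
  using s R by linarith+
qed

lemma norm_N_le: "norm (N p \<xi>) \<le> 50 * k * (norm \<xi>)\<^sup>2"
proof -
 have "(fst \<xi>)\<^sup>2 \<le> (norm \<xi>)\<^sup>2"
  using norm_fst_le[of "fst \<xi>" "snd \<xi>"] by (metis abs_le_square_iff abs_norm_cancel prod.collapse real_norm_def)
 then have "40 * k * (fst \<xi>)\<^sup>2 \<le> 40 * k * (norm \<xi>)\<^sup>2"
  using k by (intro mult_left_mono) auto
 moreover have "r * (norm \<xi>)\<^sup>2 \<le> k * (norm \<xi>)\<^sup>2"
  using r_small k by (intro mult_right_mono) auto
 ultimately have "norm (N p \<xi>) \<le> 42 * k * (norm \<xi>)\<^sup>2"
  using norm_Pair_le_add[of "fst (N p \<xi>)" "snd (N p \<xi>)"] fst_N_le[of p \<xi>] snd_N_le[of p \<xi>]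
  by simp
 also have "\<dots> \<le> 50 * k * (norm \<xi>)\<^sup>2"
  using k by (intro mult_right_mono) auto
 finally show ?thesis .
qed

lemma L_ge: "L \<ge> 7000"
 using k by (simp add: L_def)

lemma standard_lift_diff:
 fixes p q
 defines "F \<equiv> standard_lift k p - standard_lift k q"
 shows "\<bar>fst F\<bar> \<le> 2 * \<bar>fst (p - q)\<bar> + \<bar>snd (p - q)\<bar> + 6.3 * k * \<bar>fst (p - q)\<bar>"
  "\<bar>snd (p - q)\<bar> \<le> 2 * \<bar>fst (p - q)\<bar> + \<bar>fst F\<bar> + 6.3 * k * \<bar>fst (p - q)\<bar>"
  "snd F = fst (p - q)"
proof -
 define x where "x = fst (p - q)"
 define y where "y = snd (p - q)"
 define s where "s = k * (sin (2 * pi * fst p) - sin (2 * pi * fst q))"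
 have "\<bar>s\<bar> \<le> k * (2 * pi * \<bar>x\<bar>)"
  using abs_sin_diff_le[of "2 * pi * fst p" "2 * pi * fst q"] k
  by (simp add: abs_mult right_diff_distrib[symmetric] s_def x_def)
 also have "\<dots> \<le> k * (6.3 * \<bar>x\<bar>)"
  using pi_bounds k by (intro mult_left_mono mult_right_mono) auto
 finally have s: "\<bar>s\<bar> \<le> 6.3 * k * \<bar>x\<bar>" by simp
 have F: "fst F = 2 * x - y + s"
  by (simp add: F_def x_def y_def s_def standard_lift_def case_prod_unfold algebra_simps)
 show "snd F = fst (p - q)"
  by (simp add: F_def standard_lift_def case_prod_unfold)
 show "\<bar>fst F\<bar> \<le> 2 * \<bar>fst (p - q)\<bar> + \<bar>snd (p - q)\<bar> + 6.3 * k * \<bar>fst (p - q)\<bar>"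
  "\<bar>snd (p - q)\<bar> \<le> 2 * \<bar>fst (p - q)\<bar> + \<bar>fst F\<bar> + 6.3 * k * \<bar>fst (p - q)\<bar>"
  unfolding F x_def[symmetric] y_def[symmetric] using s by linarith+
qed

lemma norm_G_diff_le: "norm (G p - G q) \<le> L * norm (p - q)"
proof -
 let ?F = "standard_lift k p - standard_lift k q"
 define n where "n = norm (p - q)"
 have n: "\<bar>fst (p - q)\<bar> \<le> n" "\<bar>snd (p - q)\<bar> \<le> n" "0 \<le> n"
  unfolding n_def by (rule abs_fst_le_norm abs_snd_le_norm norm_ge_zero)+
 have 1: "6.3 * k * \<bar>fst (p - q)\<bar> \<le> 6.3 * k * n"
  using n k by (intro mult_left_mono) auto
 have F: "norm ?F \<le> 4 * n + 6.3 * k * n"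
  using standard_lift_diff(1,3)[of p q] norm_le_abs_add[of ?F] n 1 by linarith
 have 2: "r * n \<le> 1 * n"
  using r_small n by (intro mult_right_mono) auto
 have 3: "norm (G p - G q) \<le> norm ?F + norm (E p - E q)"
  unfolding G_eq by (metis add_diff_add norm_triangle_ineq)
 have 4: "5 * n \<le> 0.7 * k * n"
  using k n by (intro mult_right_mono) auto
 have "norm (G p - G q) \<le> 7 * k * n"
  using F 2 3 4 norm_E_diff_le[of p q] unfolding n_def[symmetric] by linarith
 then show ?thesis
  by (simp add: L_def n_def)
qed

text \<open>The inverse of the standard map has the same shape with exchanged coordinates:
  \<open>snd\<close> of the image is the old abscissa, from which the old ordinate is recovered with
  a factor of about \<open>6.3 * k\<close>.\<close>

lemma norm_diff_le_G: "norm (p - q) \<le> L * norm (G p - G q)"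
proof -
 let ?F = "standard_lift k p - standard_lift k q"
 define n where "n = norm (p - q)"
 define m where "m = norm ?F"
 define a where "a = norm (G p - G q)"
 have m: "\<bar>fst ?F\<bar> \<le> m" "\<bar>fst (p - q)\<bar> \<le> m" "0 \<le> m"
  using abs_fst_le_norm[of ?F] abs_snd_le_norm[of ?F] standard_lift_diff(3)[of p q]
  by (simp_all add: m_def)
 have 1: "6.3 * k * \<bar>fst (p - q)\<bar> \<le> 6.3 * k * m"
  using m k by (intro mult_left_mono) auto
 have 2: "n \<le> 4 * m + 6.3 * k * m"
  using standard_lift_diff(2)[of p q] norm_le_abs_add[of "p - q"] m 1 unfolding n_def by linarith
 have n0: "0 \<le> n" by (simp add: n_def)
 have 3: "m \<le> a + r * n"
 proof -
  have "?F = (G p - G q) - (E p - E q)" by (simp add: G_eq)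
  then have "m \<le> a + norm (E p - E q)"
   unfolding m_def a_def by (metis norm_triangle_ineq4)
  then show ?thesis
   using norm_E_diff_le[of p q] by (simp add: n_def)
 qed
 have 4: "6.5 * k * m \<le> 6.5 * k * (a + r * n)"
  using 3 k by (intro mult_left_mono) auto
 have 5: "4 * m \<le> 0.2 * k * m"
  using k m by (intro mult_right_mono) auto
 have 6: "r * k * n \<le> 1 / 1000 * n"
  using r_small(2) n0 by (intro mult_right_mono)
 have "n \<le> 6.5 * (k * a) + 6.5 * (r * k * n)"
  using 2 4 5 by (simp add: algebra_simps)
 then have "99 / 100 * n \<le> 6.5 * (k * a)"
  using 6 n0 by linarith
 moreover have "0 \<le> k * a"
  using k by (simp add: a_def)
 ultimately have "n \<le> 7 * (k * a)"
  by linarith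
 then show ?thesis
  by (simp add: L_def n_def a_def)
qed

text \<open>\<open>E (p + v) - E p\<close> is a lattice vector, because both lifts descend to the
  torus, and it is shorter than 1, because \<open>E\<close> is small. In other words,
  \<open>g\<close> acts on the fundamental group as the standard map does.\<close>

lemma E_periodic: "v \<in> int_lattice \<Longrightarrow> E (p + v) = E p"
proof -
 assume v: "v \<in> int_lattice"
 have tv: "to_torus (p + v) = to_torus p"
  using v by (simp add: to_torus_eq_iff)
 have "to_torus (G (p + v)) = to_torus (G p)"
  by (simp add: lift tv)
 moreover have "to_torus (standard_lift k (p + v)) = to_torus (standard_lift k p)"
  by (simp add: standard_map_to_torus[symmetric] tv)
 ultimately have "(G (p + v) - G p) - (standard_lift k (p + v) - standard_lift k p) \<in> int_lattice"
  unfolding to_torus_eq_iff by (metis diff_conv_add_uminus int_lattice_add int_lattice_uminus)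
 moreover have "(G (p + v) - G p) - (standard_lift k (p + v) - standard_lift k p) = E (p + v) - E p"
  by (simp add: G_eq)
 moreover have "norm (E (p + v) - E p) < 1"
  using norm_triangle_ineq4[of "E (p + v)" "E p"] E_le[of p] E_le[of "p + v"] r_small by linarith
 ultimately show ?thesis
  using int_lattice_norm_less_1 by (metis eq_iff_diff_eq_0)
qed

lemma E'_periodic:
 assumes v: "v \<in> int_lattice" shows "E' (p + v) = E' p"
proof -
 have "((\<lambda>x. E (x + v)) has_derivative E' (p + v)) (at p)"
 proof -
  have "((\<lambda>x. x + v) has_derivative (\<lambda>h. h)) (at p)"
   by (auto intro!: derivative_eq_intros)
  from has_derivative_compose[OF this E_deriv[of "p + v"]] show ?thesis .
 qed
 moreover have "(\<lambda>x. E (x + v)) = E"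
  using E_periodic[OF v] by auto
 ultimately show ?thesis
  using has_derivative_unique[OF E_deriv[of p]] by (auto intro: blinfun_eqI)
qed

lemma cos_2pi_periodic: "v \<in> int_lattice \<Longrightarrow> cos (2 * pi * fst (p + v)) = cos (2 * pi * fst p)"
proof -
 assume "v \<in> int_lattice"
 then obtain n where n: "fst v = of_int n"
  by (auto simp: int_lattice_def elim: Ints_cases)
 have "cos (2 * pi * fst p + 2 * pi * of_int n) = cos (2 * pi * fst p)"
  using cos.plus_of_int[of "2 * pi * fst p" n] by (simp add: mult_ac)
 then show ?thesis
  by (simp add: n algebra_simps)
qed

lemma D_periodic: "v \<in> int_lattice \<Longrightarrow> D (p + v) = D p"
 using cos_2pi_periodic[of v p] E'_periodic[of v p] by (auto simp: D_def)

lemma norm_Pair2_0: "norm (a, 0 :: real) = \<bar>a :: real\<bar>"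
 by (simp add: norm_Pair)

lemma norm_D_diff_le: "norm (D p \<xi> - D q \<xi>) \<le> 50 * k * norm (p - q) * norm \<xi>"
proof -
 have f: "\<bar>fst \<xi>\<bar> \<le> norm \<xi>" "\<bar>fst p - fst q\<bar> \<le> norm (p - q)"
  using abs_fst_le_norm[of \<xi>] abs_fst_le_norm[of "p - q"] by simp_all
 define c where "c = cos (2 * pi * fst p) - cos (2 * pi * fst q)"
 have "\<bar>c\<bar> \<le> 2 * pi * \<bar>fst p - fst q\<bar>"
  using abs_cos_diff_le[of "2 * pi * fst p" "2 * pi * fst q"]
  by (simp add: c_def abs_mult right_diff_distrib[symmetric])
 also have "\<dots> \<le> 6.3 * norm (p - q)"
  using pi_bounds f by (intro mult_mono) auto
 finally have c: "\<bar>c\<bar> \<le> 6.3 * norm (p - q)" .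
 have eq: "D p \<xi> - D q \<xi> = (2 * pi * k * c * fst \<xi>, 0) + (E' p - E' q) \<xi>"
  by (simp add: D_def c_def prod_eq_iff blinfun.diff_left algebra_simps)
 have "\<bar>2 * pi * k * c * fst \<xi>\<bar> \<le> 6.3 * k * (6.3 * norm (p - q)) * norm \<xi>"
  unfolding abs_mult using pi_bounds k c f by (intro mult_mono) auto
 moreover have "norm ((E' p - E' q) \<xi>) \<le> r * norm (p - q) * norm \<xi>"
  using norm_blinfun[of "E' p - E' q" \<xi>] E'_lipschitz[of p q] by (meson mult_right_mono norm_ge_zero order_trans)
 moreover have "r * norm (p - q) * norm \<xi> \<le> k * norm (p - q) * norm \<xi>"
  using r_small k by (intro mult_right_mono) auto
 ultimately have "norm (D p \<xi> - D q \<xi>) \<le> 6.3 * k * (6.3 * norm (p - q)) * norm \<xi> + k * norm (p - q) * norm \<xi>"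
  using norm_triangle_ineq[of "(2 * pi * k * c * fst \<xi>, 0)" "(E' p - E' q) \<xi>"] unfolding eq norm_Pair2_0 by linarith
 also have "\<dots> = 40.69 * (k * norm (p - q) * norm \<xi>)"
  by (simp add: algebra_simps)
 also have "\<dots> \<le> 50 * (k * norm (p - q) * norm \<xi>)"
  using k by (intro mult_right_mono) auto
 finally show ?thesis by (simp add: mult_ac)
qed

text \<open>On the lattice the lift acts by the integer matrix with rows \<open>(2, - 1)\<close> and
  \<open>(1, 0)\<close>, of determinant 1; \<open>w\<close> is the preimage of \<open>v\<close>
  under this matrix.\<close>

lemma standard_lift_surj_lattice:
 assumes "v \<in> int_lattice"
 obtains w where "w \<in> int_lattice" "\<And>q. standard_lift k (q + w) = standard_lift k q + v"
proof -
 obtain a b where ab: "v = (a, b)" "a \<in> \<int>" "b \<in> \<int>"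
  using assms by (cases v) (auto simp: int_lattice_def)
 have w: "(b, 2 * b - a) \<in> int_lattice"
  using ab by (auto simp: int_lattice_def)
 have "standard_lift k (q + (b, 2 * b - a)) = standard_lift k q + v" for q
 proof -
  have "sin (2 * pi * (fst q + b)) = sin (2 * pi * fst q)"
   using ab(3) by (intro sin_2pi_cong) simp
  then show ?thesis
   by (simp add: standard_lift_def case_prod_unfold ab(1) prod_eq_iff)
 qed
 with w show thesis using that by blast
qed

section \<open>Lipschitz bounds on the torus\<close>

lemma dist_g_le: "dist (g a) (g b) \<le> L * dist a b"
proof -
 obtain p where p: "to_torus p = a" using to_torus_surj by blast
 obtain q where q: "to_torus q = b" "dist p q = dist (to_torus p) b" by (rule exists_nearest_lift)
 have "dist (g a) (g b) \<le> dist (G p) (G q)"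
  using dist_to_torus_le[of "G p" "G q"] p q by (simp add: lift)
 also have "\<dots> \<le> L * dist p q"
  using norm_G_diff_le by (simp add: dist_norm)
 finally show ?thesis using p q by simp
qed

lemma exists_lift_preimage:
 assumes "to_torus q' = g b"
 obtains q where "to_torus q = b" "G q = q'"
proof -
 obtain q0 where q0: "to_torus q0 = b" using to_torus_surj by blast
 have "q' - G q0 \<in> int_lattice"
  using assms q0 by (simp add: to_torus_eq_iff[symmetric] lift)
 then obtain w where w: "w \<in> int_lattice" "\<And>q. standard_lift k (q + w) = standard_lift k q + (q' - G q0)"
  using standard_lift_surj_lattice by blast
 have "G (q0 + w) = q'"
  using w(2)[of q0] E_periodic[OF w(1), of q0] by (simp add: G_eq)
 moreover have "to_torus (q0 + w) = b"
  using q0 w(1) to_torus_eq_iff[of "q0 + w" q0] by simp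
 ultimately show thesis using that by blast
qed

lemma dist_le_g: "dist a b \<le> L * dist (g a) (g b)"
proof -
 obtain p where p: "to_torus p = a" using to_torus_surj by blast
 obtain q' where q': "to_torus q' = g b" "dist (G p) q' = dist (to_torus (G p)) (g b)" by (rule exists_nearest_lift)
 obtain q where q: "to_torus q = b" "G q = q'"
  using exists_lift_preimage[OF q'(1)] .
 have "dist a b \<le> dist p q"
  using dist_to_torus_le[of p q] p q by simp
 also have "\<dots> \<le> L * dist (G p) (G q)"
  using norm_diff_le_G by (simp add: dist_norm)
 finally show ?thesis using p q q' by (simp add: lift)
qed

lemma dist_funpow_le: "dist ((g ^^ n) a) ((g ^^ n) b) \<le> L ^ n * dist a b"
proof (induction n)
 case (Suc n)
 have "dist ((g ^^ Suc n) a) ((g ^^ Suc n) b) \<le> L * dist ((g ^^ n) a) ((g ^^ n) b)"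
  using dist_g_le by simp
 also have "\<dots> \<le> L * (L ^ n * dist a b)"
  using Suc L_ge by (intro mult_left_mono) auto
 finally show ?case by (simp add: mult_ac)
qed simp

lemma dist_le_funpow: "dist a b \<le> L ^ n * dist ((g ^^ n) a) ((g ^^ n) b)"
proof (induction n)
 case (Suc n)
 have "L ^ n * dist ((g ^^ n) a) ((g ^^ n) b) \<le> L ^ n * (L * dist ((g ^^ Suc n) a) ((g ^^ Suc n) b))"
  using dist_le_g L_ge by (intro mult_left_mono) auto
 then show ?case
  using Suc by (simp add: mult_ac)
qed simp

lemma continuous_on_G: "continuous_on A G"
proof (rule lipschitz_on_continuous_on)
 show "L-lipschitz_on A G"
  using L_ge by (intro lipschitz_onI) (auto simp: dist_norm norm_G_diff_le)
qed

lemma to_torus_funpow: "to_torus ((G ^^ n) p) = (g ^^ n) (to_torus p)"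
 by (induction n) (simp_all add: lift)

end

section \<open>Crossing paths\<close>

text \<open>\<open>b\<close> is the first time at or above level \<open>B\<close>, and
  \<open>a\<close> the last time before \<open>b\<close> at or below level \<open>A\<close>; in
  between the path can leave the strip on neither side.\<close>

lemma path_cut_le:
 fixes \<phi> :: "real \<Rightarrow> real"
 assumes c: "continuous_on {lo..hi} \<phi>" and le: "lo \<le> hi" and A: "\<phi> lo \<le> A" and B: "B \<le> \<phi> hi" and AB: "A \<le> B"
 shows "\<exists>a b. lo \<le> a \<and> a \<le> b \<and> b \<le> hi \<and> \<phi> a = A \<and> \<phi> b = B \<and> (\<forall>u\<in>{a..b}. A \<le> \<phi> u \<and> \<phi> u \<le> B)"
proof -
 have closedB: "compact {u \<in> {lo..hi}. B \<le> \<phi> u}"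
 proof -
  have "closed ({lo..hi} \<inter> \<phi> -` {B..})"
   by (rule continuous_closed_preimage[OF c]) auto
  then have "compact ({lo..hi} \<inter> ({lo..hi} \<inter> \<phi> -` {B..}))"
   by (intro compact_Int_closed) auto
  moreover have "{lo..hi} \<inter> ({lo..hi} \<inter> \<phi> -` {B..}) = {u \<in> {lo..hi}. B \<le> \<phi> u}" by auto
  ultimately show ?thesis by simp
 qed
 have "hi \<in> {u \<in> {lo..hi}. B \<le> \<phi> u}"
  using le B by auto
 then obtain b where b: "b \<in> {lo..hi}" "B \<le> \<phi> b" and bmin: "\<And>u. u \<in> {lo..hi} \<Longrightarrow> B \<le> \<phi> u \<Longrightarrow> b \<le> u"
  using compact_attains_inf[OF closedB] by blast
 have cb: "continuous_on {lo..b} \<phi>"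
  using c b by (auto intro: continuous_on_subset)
 have "\<phi> b = B"
 proof -
  obtain u where "lo \<le> u" "u \<le> b" "\<phi> u = B"
   using IVT'[of \<phi> lo B b] A AB b cb by auto
  then show ?thesis
   using bmin[of u] b by auto
 qed
 have bB: "\<phi> u \<le> B" if "u \<in> {lo..b}" for u
  using bmin[of u] that b \<open>\<phi> b = B\<close> by force
 have closedA: "compact {u \<in> {lo..b}. \<phi> u \<le> A}"
 proof -
  have "closed ({lo..b} \<inter> \<phi> -` {..A})"
   by (rule continuous_closed_preimage[OF cb]) auto
  then have "compact ({lo..b} \<inter> ({lo..b} \<inter> \<phi> -` {..A}))"
   by (intro compact_Int_closed) auto
  moreover have "{lo..b} \<inter> ({lo..b} \<inter> \<phi> -` {..A}) = {u \<in> {lo..b}. \<phi> u \<le> A}" by auto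
  ultimately show ?thesis by simp
 qed
 have "lo \<in> {u \<in> {lo..b}. \<phi> u \<le> A}"
  using b A by auto
 then obtain a where a: "a \<in> {lo..b}" "\<phi> a \<le> A" and amax: "\<And>u. u \<in> {lo..b} \<Longrightarrow> \<phi> u \<le> A \<Longrightarrow> u \<le> a"
  using compact_attains_sup[OF closedA] by blast
 have "\<phi> a = A"
 proof -
  have "continuous_on {a..b} \<phi>"
   using cb a by (auto intro: continuous_on_subset)
  then obtain u where "a \<le> u" "u \<le> b" "\<phi> u = A"
   using IVT'[of \<phi> a A b] a AB \<open>\<phi> b = B\<close> by auto
  then show ?thesis
   using amax[of u] a by auto
 qed
 moreover have "A \<le> \<phi> u" if "u \<in> {a..b}" for u
  using amax[of u] that a \<open>\<phi> a = A\<close> by force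
 ultimately show ?thesis
  using a b \<open>\<phi> b = B\<close> bB by (intro exI[of _ a] exI[of _ b]) auto
qed

text \<open>Paths are parametrised by segments \<open>closed_segment lo hi\<close> with \<open>lo\<close>, \<open>hi\<close> in arbitrary order,
 so that reversing the orientation of a path needs no reparametrisation.\<close>

lemma path_cut:
 fixes \<phi> :: "real \<Rightarrow> real"
 assumes c: "continuous_on (closed_segment lo hi) \<phi>" and A: "\<phi> lo \<le> A" and B: "B \<le> \<phi> hi" and AB: "A \<le> B"
 obtains a b where "closed_segment a b \<subseteq> closed_segment lo hi" "\<phi> a = A" "\<phi> b = B"
  "\<And>u. u \<in> closed_segment a b \<Longrightarrow> A \<le> \<phi> u \<and> \<phi> u \<le> B"
proof (cases "lo \<le> hi")
 case True
 then have "continuous_on {lo..hi} \<phi>"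
  using c by (simp add: closed_segment_eq_real_ivl)
 from path_cut_le[OF this True A B AB] obtain a b where
  "lo \<le> a" "a \<le> b" "b \<le> hi" "\<phi> a = A" "\<phi> b = B" "\<forall>u\<in>{a..b}. A \<le> \<phi> u \<and> \<phi> u \<le> B" by blast
 then show thesis
  using True by (intro that[of a b]) (auto simp: closed_segment_eq_real_ivl)
next
 case False
 define \<psi> where "\<psi> u = \<phi> (- u)" for u
 have "continuous_on {- lo..- hi} \<psi>"
  unfolding \<psi>_def using False
  by (intro continuous_on_compose2[OF c] continuous_intros) (auto simp: closed_segment_eq_real_ivl)
 from path_cut_le[OF this, of A B] obtain a b where
  "-lo \<le> a" "a \<le> b" "b \<le> -hi" "\<psi> a = A" "\<psi> b = B" and ab: "\<forall>u\<in>{a..b}. A \<le> \<psi> u \<and> \<psi> u \<le> B"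
  using False A B AB by (auto simp: \<psi>_def)
 moreover have "A \<le> \<phi> u \<and> \<phi> u \<le> B" if "u \<in> closed_segment (-a) (-b)" for u
  using ab[rule_format, of "-u"] that \<open>a \<le> b\<close> by (auto simp: \<psi>_def closed_segment_eq_real_ivl split: if_splits)
 ultimately show thesis
  using False by (intro that[of "-a" "-b"]) (auto simp: closed_segment_eq_real_ivl \<psi>_def)
qed

lemma path_cut_symmetric:
 fixes \<phi> :: "real \<Rightarrow> real"
 assumes "continuous_on (closed_segment lo hi) \<phi>" "\<phi> lo \<le> - P" "P \<le> \<phi> hi" "0 \<le> P"
 shows "\<exists>a b. closed_segment a b \<subseteq> closed_segment lo hi \<and> \<phi> a = - P \<and> \<phi> b = P \<and>
  (\<forall>u\<in>closed_segment a b. \<bar>\<phi> u\<bar> \<le> P)"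
proof -
 have le: "- P \<le> P" using assms(4) by simp
 obtain a b where "closed_segment a b \<subseteq> closed_segment lo hi" "\<phi> a = - P" "\<phi> b = P"
  and ab: "\<And>u. u \<in> closed_segment a b \<Longrightarrow> - P \<le> \<phi> u \<and> \<phi> u \<le> P"
  using path_cut[OF assms(1-3) le] by metis
 moreover have "\<bar>\<phi> u\<bar> \<le> P" if "u \<in> closed_segment a b" for u
  using ab[OF that] by linarith
 ultimately show ?thesis by blast
qed

text \<open>\<open>l\<close> is the side of the squares that paths cross, and \<open>\<tau>\<close>
  the factor by which the expansion per step may fall short of \<open>L\<close>. The condition
  \<open>l_large\<close> makes horizontal segments of length \<open>l / 2\<close> wrap around the
  torus even at critical points; the upper bounds on \<open>l\<close> keep the nonlinear terms below
  the size of the square.\<close>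

locale shadowing = near_standard +
 fixes l \<tau> :: real
 assumes l: "0 < l" and \<tau>: "1 \<le> \<tau>" and l_small: "1000000 * \<tau> * l \<le> 1" and L_large: "1000000 * \<tau>\<^sup>2 \<le> L"
  and l_large: "1000 \<le> k * l\<^sup>2"
begin

text \<open>\<open>\<mu> / 2 = \<tau> / L\<close> is the inverse of the guaranteed expansion. The
  factor 2 is slack that pays for the doubling permitted by \<open>abs_det_le\<close>.\<close>

definition \<mu> :: real where "\<mu> = 2 * \<tau> / L"

lemma L_pos: "L > 0"
 using L_ge by simp

lemma mu: "0 < \<mu>" "\<mu> \<le> 1 / 100000" "2 * (L * \<mu>\<^sup>2) \<le> 1" "k * \<mu> = 2 * \<tau> / 7"
proof -
 show "0 < \<mu>" using L_pos \<tau> by (simp add: \<mu>_def)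
 have "\<tau> * 1 \<le> \<tau> * \<tau>"
  using \<tau> by (intro mult_left_mono) auto
 then show "\<mu> \<le> 1 / 100000"
  using L_large L_pos \<tau> by (simp add: \<mu>_def divide_le_eq power2_eq_square) (use mult_left_mono[of 1 \<tau> \<tau>] in linarith)
 have "2 * (L * \<mu>\<^sup>2) = 8 * \<tau>\<^sup>2 / L"
  using L_pos by (simp add: \<mu>_def power2_eq_square field_simps)
 also have "\<dots> \<le> 1"
  using L_large L_pos zero_le_power2[of \<tau>] by (simp add: divide_le_eq)
 finally show "2 * (L * \<mu>\<^sup>2) \<le> 1" .
 show "k * \<mu> = 2 * \<tau> / 7"
  using k by (simp add: \<mu>_def L_def)
qed

text \<open>Two guaranteed contractions beat one maximal expansion, which is what lets quadratic
  errors be absorbed.\<close>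

lemma L_mu2_power: "L ^ n * \<mu> ^ (2 * n) \<le> (1 / 2) ^ n"
proof -
 have "L ^ n * \<mu> ^ (2 * n) = (L * \<mu>\<^sup>2) ^ n"
  by (simp add: power_mult_distrib power_mult)
 also have "\<dots> \<le> (1 / 2) ^ n"
  using mu L_pos by (intro power_mono) auto
 finally show ?thesis .
qed

lemma L_mu2_power_le_1: "L ^ n * \<mu> ^ (2 * n) \<le> 1"
 using L_mu2_power[of n] power_le_one[of "1/2 :: real" n] by simp

lemma l_le: "l \<le> 1 / 1000000"
proof -
 have "1 * l \<le> \<tau> * l"
  using \<tau> l by (intro mult_right_mono) auto
 then show ?thesis using l_small by simp
qed

lemma tau_l: "\<tau> * l \<le> 1 / 1000000"
 using l_small by simp

text \<open>The square has centre \<open>c\<close> and side \<open>l\<close>, and the path joins its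
  left side to its right side. Nothing is required of the slope of the path: the argument uses
  connectedness only.\<close>

definition crosses :: "(real \<Rightarrow> real \<times> real) \<Rightarrow> real \<Rightarrow> real \<Rightarrow> real \<times> real \<Rightarrow> bool" where
 "crosses \<sigma> lo hi c \<longleftrightarrow> continuous_on (closed_segment lo hi) \<sigma> \<and>
   fst (\<sigma> lo) = fst c - l / 2 \<and> fst (\<sigma> hi) = fst c + l / 2 \<and>
   (\<forall>u\<in>closed_segment lo hi. \<bar>fst (\<sigma> u) - fst c\<bar> \<le> l / 2 \<and> \<bar>snd (\<sigma> u) - snd c\<bar> \<le> l / 2)"

lemma crossesI_cut_oriented:
 assumes \<sigma>: "continuous_on (closed_segment lo hi) \<sigma>"
  and ends: "fst (\<sigma> lo) \<le> fst c - l / 2" "fst c + l / 2 \<le> fst (\<sigma> hi)"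
  and y: "\<And>u. u \<in> closed_segment lo hi \<Longrightarrow> \<bar>snd (\<sigma> u) - snd c\<bar> \<le> l / 2"
 shows "\<exists>a b. closed_segment a b \<subseteq> closed_segment lo hi \<and> crosses \<sigma> a b c"
proof -
 have "continuous_on (closed_segment lo hi) (\<lambda>u. fst (\<sigma> u))"
  by (intro continuous_intros \<sigma>)
 from path_cut[OF this ends] l obtain a b where ab: "closed_segment a b \<subseteq> closed_segment lo hi"
  "fst (\<sigma> a) = fst c - l / 2" "fst (\<sigma> b) = fst c + l / 2"
  "\<And>u. u \<in> closed_segment a b \<Longrightarrow> fst c - l / 2 \<le> fst (\<sigma> u) \<and> fst (\<sigma> u) \<le> fst c + l / 2"
  by (auto simp del: le_divide_eq_numeral divide_le_eq_numeral)
 have x: "\<bar>fst (\<sigma> u) - fst c\<bar> \<le> l / 2" if "u \<in> closed_segment a b" for u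
  using ab(4)[OF that] unfolding abs_le_iff by linarith
 have "crosses \<sigma> a b c"
  unfolding crosses_def using ab(1-3) x y \<sigma> by (auto intro: continuous_on_subset)
 then show ?thesis using ab(1) by blast
qed

lemma crossesI_cut:
 assumes \<sigma>: "continuous_on (closed_segment lo hi) \<sigma>"
  and ends: "fst (\<sigma> lo) \<le> fst c - l / 2 \<and> fst c + l / 2 \<le> fst (\<sigma> hi) \<or>
        fst (\<sigma> hi) \<le> fst c - l / 2 \<and> fst c + l / 2 \<le> fst (\<sigma> lo)"
  and y: "\<And>u. u \<in> closed_segment lo hi \<Longrightarrow> \<bar>snd (\<sigma> u) - snd c\<bar> \<le> l / 2"
 obtains a b where "closed_segment a b \<subseteq> closed_segment lo hi" "crosses \<sigma> a b c"
 using ends crossesI_cut_oriented[of lo hi \<sigma> c] crossesI_cut_oriented[of hi lo \<sigma> c] \<sigma> y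
 by (metis closed_segment_commute)

section \<open>Shadowing a hyperbolic orbit segment\<close>

text \<open>A segment \<open>X 0, \<dots>, X m\<close> of a lifted orbit, with a vector \<open>v\<close> pushed forward and a covector \<open>\<rho>\<close>
 pulled back by the derivative. The growth conditions say that \<open>v\<close> has been expanded almost maximally
 before time \<open>m\<close>, and that \<open>\<rho>\<close> will be after time \<open>0\<close>.\<close>

definition word :: "nat \<Rightarrow> (nat \<Rightarrow> real \<times> real) \<Rightarrow> (nat \<Rightarrow> real \<times> real) \<Rightarrow> (nat \<Rightarrow> real \<times> real) \<Rightarrow> real \<Rightarrow> bool" where
 "word m X v \<rho> Q \<longleftrightarrow> m > 0 \<and>
   (\<forall>i<m. X (Suc i) = G (X i) \<and> v (Suc i) = D (X i) (v i) \<and> \<rho> i = Dt (X i) (\<rho> (Suc i))) \<and>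
   (\<forall>i\<le>m. inner (\<rho> i) (v i) = Q) \<and> norm (v 0) = 1 \<and> norm (\<rho> m) = 1 \<and>
   (\<forall>i\<le>m. norm (v i) \<le> 2 * Q * (\<mu> / 2) ^ (m - i) \<and> norm (\<rho> i) \<le> 2 * Q * (\<mu> / 2) ^ i) \<and>
   \<bar>snd (v 0)\<bar> \<le> \<mu> \<and> \<bar>snd (v m)\<bar> \<le> \<mu> * norm (v m) \<and>
   \<bar>snd (\<rho> 0)\<bar> \<le> \<mu> * norm (\<rho> 0) \<and> \<bar>snd (\<rho> m)\<bar> \<le> \<mu>"

context
 fixes m X v \<rho> Q
 assumes w: "word m X v \<rho> Q"
begin

lemma word_simps:
 "m > 0" "i < m \<Longrightarrow> X (Suc i) = G (X i)" "i < m \<Longrightarrow> v (Suc i) = D (X i) (v i)" "i < m \<Longrightarrow> \<rho> i = Dt (X i) (\<rho> (Suc i))"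
 "i \<le> m \<Longrightarrow> inner (\<rho> i) (v i) = Q" "norm (v 0) = 1" "norm (\<rho> m) = 1"
 "i \<le> m \<Longrightarrow> norm (v i) \<le> 2 * Q * (\<mu> / 2) ^ (m - i)" "i \<le> m \<Longrightarrow> norm (\<rho> i) \<le> 2 * Q * (\<mu> / 2) ^ i"
 "\<bar>snd (v 0)\<bar> \<le> \<mu>" "\<bar>snd (v m)\<bar> \<le> \<mu> * norm (v m)" "\<bar>snd (\<rho> 0)\<bar> \<le> \<mu> * norm (\<rho> 0)" "\<bar>snd (\<rho> m)\<bar> \<le> \<mu>"
 using w unfolding word_def by auto

lemma word_v_le: "i \<le> m \<Longrightarrow> norm (v i) \<le> L ^ i"
proof (induction i)
 case (Suc i)
 then have "norm (v (Suc i)) \<le> L * norm (v i)"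
  using norm_D_le word_simps(3) by simp
 also have "\<dots> \<le> L * L ^ i"
  using Suc L_pos by (intro mult_left_mono) auto
 finally show ?case by simp
qed (simp add: word_simps)

lemma word_rho_le: "i \<le> m \<Longrightarrow> norm (\<rho> (m - i)) \<le> L ^ i"
proof (induction i)
 case (Suc i)
 then have "\<rho> (m - Suc i) = Dt (X (m - Suc i)) (\<rho> (m - i))"
  using word_simps(4)[of "m - Suc i"] by (simp add: Suc_diff_Suc)
 then have "norm (\<rho> (m - Suc i)) \<le> L * norm (\<rho> (m - i))"
  using norm_Dt_le by simp
 also have "\<dots> \<le> L * L ^ i"
  using Suc L_pos by (intro mult_left_mono) auto
 finally show ?case by simp
qed (simp add: word_simps)

lemma word_rho_le': "i \<le> m \<Longrightarrow> norm (\<rho> i) \<le> L ^ (m - i)"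
 using word_rho_le[of "m - i"] by simp

text \<open>At \<open>i = m\<close> the covector has norm 1, so its growth condition reads
  \<open>1 \<le> 2 * Q * (\<mu> / 2) ^ m\<close>. Thus \<open>Q\<close> is exponentially large in
  \<open>m\<close>.\<close>

lemma word_Q: "Q \<ge> 10000" "2 ^ Suc m \<le> 4 * \<mu> * Q"
proof -
 have Qm: "1 \<le> 2 * Q * (\<mu> / 2) ^ m"
  using word_simps(9)[of m] word_simps(7) by simp
 have "(\<mu> / 2) ^ m \<le> (\<mu> / 2) ^ 1"
  using mu word_simps(1) by (intro power_decreasing) auto
 have Q0: "Q > 0"
 proof (rule ccontr)
  assume "\<not> Q > 0"
  then have "2 * Q * (\<mu> / 2) ^ m \<le> 0"
   using mu by (simp add: mult_nonpos_nonneg)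
  with Qm show False by simp
 qed
 have "2 * Q * (\<mu> / 2) ^ m \<le> 2 * Q * (\<mu> / 2)"
  using Q0 \<open>(\<mu> / 2) ^ m \<le> (\<mu> / 2) ^ 1\<close> by (intro mult_left_mono) auto
 then have "1 \<le> Q * \<mu>" using Qm by simp
 moreover have "Q * \<mu> \<le> Q * (1 / 100000)"
  using mu Q0 by (intro mult_left_mono) auto
 ultimately show "Q \<ge> 10000" by simp
 have "2 ^ m \<le> 2 * Q * \<mu> ^ m"
  using Qm by (simp add: power_divide field_simps)
 also have "\<dots> \<le> 2 * Q * \<mu> ^ 1"
  using mu word_simps(1) Q0 by (intro mult_left_mono power_decreasing) auto
 finally show "2 ^ Suc m \<le> 4 * \<mu> * Q"
  by (simp add: mult_ac)
qed

text \<open>Half-width of the box at time \<open>i\<close> in the coordinate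
  \<open>inner (\<rho> i)\<close>. It decreases, so that the image of a path across one box still
  reaches beyond the next; the decrement pays for the remainder, through
  \<open>(1 / 2) ^ (m - i)\<close> near the end and through \<open>Q * \<mu> ^ (3 * i + 2)\<close>
  near the start.\<close>

definition P :: "nat \<Rightarrow> real" where
 "P i = l * (2 - (1 / 2) ^ (m - i) + Q * \<mu> ^ (3 * i + 2))"

text \<open>Half-width in the coordinate \<open>wedge (v i)\<close>. It more than doubles in each
  step, to leave room for the determinant and the remainder; this is harmless, as \<open>Q\<close>
  exceeds \<open>2 ^ m\<close> by far.\<close>

definition S :: "nat \<Rightarrow> real" where
 "S i = l * (2 ^ Suc i - 1 + Q * \<mu> ^ (3 * (m - i) + 2))"

lemma S_nonneg: "S i \<ge> 0"
proof -
 have "(1 :: real) \<le> 2 ^ Suc i"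
  by (rule one_le_power) simp
 then show ?thesis
  unfolding S_def using l mu word_Q by (intro mult_nonneg_nonneg add_nonneg_nonneg) auto
qed

lemma P_v_le:
 assumes i: "i \<le> m"
 shows "P i * norm (v i) / Q \<le> l * (4 * \<mu> ^ (m - i) + \<mu> ^ (i + 2))"
proof -
 have Q0: "Q > 0" using word_Q by simp
 have "P i * norm (v i) \<le> l * (2 + Q * \<mu> ^ (3 * i + 2)) * norm (v i)"
  unfolding P_def using l by (intro mult_right_mono mult_left_mono) auto
 also have "\<dots> = l * (2 * norm (v i) + Q * (\<mu> ^ (3 * i + 2) * norm (v i)))"
  by (simp add: algebra_simps)
 also have "\<dots> \<le> l * (4 * Q * \<mu> ^ (m - i) + Q * \<mu> ^ (i + 2))"
 proof -
  have "2 * norm (v i) \<le> 4 * Q * (\<mu> / 2) ^ (m - i)"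
   using word_simps(8)[OF i] by simp
  also have "\<dots> \<le> 4 * Q * \<mu> ^ (m - i)"
   using mu Q0 by (intro mult_left_mono power_mono) auto
  finally have 1: "2 * norm (v i) \<le> 4 * Q * \<mu> ^ (m - i)" .
  have "\<mu> ^ (3 * i + 2) * norm (v i) \<le> \<mu> ^ (3 * i + 2) * L ^ i"
   using word_v_le[OF i] mu by (intro mult_left_mono) auto
  also have "\<dots> = \<mu> ^ (i + 2) * (L ^ i * \<mu> ^ (2 * i))"
   by (simp add: power_add[symmetric] mult_ac)
  also have "\<dots> \<le> \<mu> ^ (i + 2) * 1"
   using mu L_mu2_power_le_1 by (intro mult_left_mono) auto
  finally have "Q * (\<mu> ^ (3 * i + 2) * norm (v i)) \<le> Q * \<mu> ^ (i + 2)"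
   using Q0 by simp
  with 1 show ?thesis using l by (intro mult_left_mono) auto
 qed
 finally show ?thesis
  using Q0 by (simp add: field_simps)
qed

lemma S_rho_le:
 assumes i: "i \<le> m"
 shows "S i * norm (\<rho> i) / Q \<le> l * (4 * \<mu> ^ i + \<mu> ^ (m - i))"
proof -
 have Q0: "Q > 0" using word_Q by simp
 have "S i * norm (\<rho> i) \<le> l * (2 ^ Suc i + Q * \<mu> ^ (3 * (m - i) + 2)) * norm (\<rho> i)"
  unfolding S_def using l by (intro mult_right_mono mult_left_mono) auto
 also have "\<dots> = l * (2 ^ Suc i * norm (\<rho> i) + Q * (\<mu> ^ (3 * (m - i) + 2) * norm (\<rho> i)))"
  by (simp add: algebra_simps)
 also have "\<dots> \<le> l * (4 * Q * \<mu> ^ i + Q * \<mu> ^ (m - i))"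
 proof -
  have "2 ^ Suc i * norm (\<rho> i) \<le> 2 ^ Suc i * (2 * Q * (\<mu> / 2) ^ i)"
   using word_simps(9)[OF i] by (intro mult_left_mono) auto
  also have "\<dots> = 4 * Q * \<mu> ^ i"
   by (simp add: power_divide)
  finally have 1: "2 ^ Suc i * norm (\<rho> i) \<le> 4 * Q * \<mu> ^ i" .
  have "\<mu> ^ (3 * (m - i) + 2) * norm (\<rho> i) \<le> \<mu> ^ (3 * (m - i)) * L ^ (m - i)"
   using word_rho_le'[OF i] mu by (intro mult_mono power_decreasing) auto
  also have "\<dots> = \<mu> ^ (m - i) * (L ^ (m - i) * \<mu> ^ (2 * (m - i)))"
   by (simp add: power_add[symmetric] mult_ac)
  also have "\<dots> \<le> \<mu> ^ (m - i) * 1"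
   using mu L_mu2_power_le_1 by (intro mult_left_mono) auto
  finally have "Q * (\<mu> ^ (3 * (m - i) + 2) * norm (\<rho> i)) \<le> Q * \<mu> ^ (m - i)"
   using Q0 by simp
  show ?thesis
   by (rule mult_left_mono[OF add_mono[OF 1 \<open>Q * (\<mu> ^ (3 * (m - i) + 2) * norm (\<rho> i)) \<le> Q * \<mu> ^ (m - i)\<close>] less_imp_le[OF l]])
 qed
 finally show ?thesis
  using Q0 by (simp add: field_simps)
qed

definition in_box :: "nat \<Rightarrow> real \<times> real \<Rightarrow> bool" where
 "in_box i \<xi> \<longleftrightarrow> \<bar>inner (\<rho> i) \<xi>\<bar> \<le> P i \<and> \<bar>wedge (v i) \<xi>\<bar> \<le> S i"

lemma in_box_decompose:
 assumes i: "i \<le> m" and b: "in_box i \<xi>"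
 shows "norm \<xi> \<le> P i * norm (v i) / Q + S i * norm (\<rho> i) / Q"
  "\<bar>fst \<xi>\<bar> \<le> P i * norm (v i) / Q + S i * \<bar>snd (\<rho> i)\<bar> / Q"
proof -
 have Q0: "Q > 0" using word_Q by simp
 define a where "a = inner (\<rho> i) \<xi> / Q"
 define b where "b = wedge (v i) \<xi> / Q"
 have a: "\<bar>a\<bar> \<le> P i / Q" and b: "\<bar>b\<bar> \<le> S i / Q"
  using b Q0 by (auto simp: a_def b_def in_box_def abs_divide intro!: divide_right_mono)
 have dec: "\<xi> = a *\<^sub>R v i + b *\<^sub>R (- snd (\<rho> i), fst (\<rho> i))"
  unfolding a_def b_def using word_simps(5)[OF i] Q0 by (intro decompose_vector) auto
 have J: "norm (- snd (\<rho> i), fst (\<rho> i)) = norm (\<rho> i)"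
  by (cases "\<rho> i") (simp add: norm_Pair add.commute)
 have "norm \<xi> \<le> \<bar>a\<bar> * norm (v i) + \<bar>b\<bar> * norm (\<rho> i)"
  using norm_triangle_ineq[of "a *\<^sub>R v i" "b *\<^sub>R (- snd (\<rho> i), fst (\<rho> i))"]
  by (subst dec) (simp only: norm_scaleR J)
 also have "\<dots> \<le> P i / Q * norm (v i) + S i / Q * norm (\<rho> i)"
  using a b by (intro add_mono mult_right_mono) auto
 finally show "norm \<xi> \<le> P i * norm (v i) / Q + S i * norm (\<rho> i) / Q" by simp
 have "fst \<xi> = a * fst (v i) - b * snd (\<rho> i)"
  using arg_cong[OF dec, of fst] by simp
 then have "\<bar>fst \<xi>\<bar> \<le> \<bar>a\<bar> * \<bar>fst (v i)\<bar> + \<bar>b\<bar> * \<bar>snd (\<rho> i)\<bar>"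
  by (metis abs_mult abs_triangle_ineq4)
 also have "\<dots> \<le> P i / Q * norm (v i) + S i / Q * \<bar>snd (\<rho> i)\<bar>"
  using a b abs_fst_le_norm[of "v i"] by (intro add_mono mult_mono mult_right_mono) auto
 finally show "\<bar>fst \<xi>\<bar> \<le> P i * norm (v i) / Q + S i * \<bar>snd (\<rho> i)\<bar> / Q" by simp
qed

text \<open>The shadowing estimate: points that stay in the boxes are exponentially close to the
  orbit away from both ends of the word.\<close>

lemma in_box_norm_le:
 assumes i: "i \<le> m" and b: "in_box i \<xi>"
 shows "norm \<xi> \<le> 5 * l * (\<mu> ^ (m - i) + \<mu> ^ i)"
proof -
 have "\<mu> ^ (i + 2) \<le> \<mu> ^ i"
  using mu by (intro power_decreasing) auto
 then have "l * (4 * \<mu> ^ (m - i) + \<mu> ^ (i + 2)) \<le> l * (4 * \<mu> ^ (m - i) + \<mu> ^ i)"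
  using l by (intro mult_left_mono) auto
 then show ?thesis
  using in_box_decompose(1)[OF i b] P_v_le[OF i] S_rho_le[OF i] by (simp add: algebra_simps)
qed

text \<open>The second term has one more factor \<open>\<mu>\<close> than in
  \<open>in_box_norm_le\<close>: the contracted direction is nearly vertical, since
  \<open>snd (\<rho> i)\<close> is at most \<open>2 * norm (\<rho> (Suc i))\<close>. The strong
  nonlinearity sees only the abscissa and so profits from this factor.\<close>

lemma in_box_fst_le:
 assumes i: "i < m" and b: "in_box i \<xi>"
 shows "\<bar>fst \<xi>\<bar> \<le> 5 * l * (\<mu> ^ (m - i) + \<mu> ^ Suc i)"
proof -
 have Q0: "Q > 0" using word_Q by simp
 have i': "i \<le> m" "Suc i \<le> m" using i by auto
 have mi: "m - i = Suc (m - Suc i)" using i by simp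
 have "S i * \<bar>snd (\<rho> i)\<bar> \<le> S i * (2 * norm (\<rho> (Suc i)))"
  using Dt_snd_le2[of "X i" "\<rho> (Suc i)"] word_simps(4)[OF i]
  by (intro mult_left_mono S_nonneg) auto
 also have "\<dots> \<le> l * (2 ^ Suc i + Q * \<mu> ^ (3 * (m - i) + 2)) * (2 * norm (\<rho> (Suc i)))"
  unfolding S_def using l by (intro mult_right_mono mult_left_mono) auto
 also have "\<dots> = l * (2 * 2 ^ Suc i * norm (\<rho> (Suc i)) + 2 * Q * (\<mu> ^ (3 * (m - i) + 2) * norm (\<rho> (Suc i))))"
  by (simp add: algebra_simps)
 also have "\<dots> \<le> l * (4 * Q * \<mu> ^ Suc i + Q * \<mu> ^ (m - i))"
 proof -
  have "2 * 2 ^ Suc i * norm (\<rho> (Suc i)) \<le> 2 * 2 ^ Suc i * (2 * Q * (\<mu> / 2) ^ Suc i)"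
   using word_simps(9)[OF i'(2)] by (intro mult_left_mono) auto
  also have "\<dots> = 4 * Q * \<mu> ^ Suc i"
   by (simp add: power_divide)
  finally have 1: "2 * 2 ^ Suc i * norm (\<rho> (Suc i)) \<le> 4 * Q * \<mu> ^ Suc i" .
  have "\<mu> ^ (3 * (m - i) + 2) * norm (\<rho> (Suc i)) \<le> \<mu> ^ (3 * (m - Suc i) + 1 + (m - i) - (m - Suc i)) * L ^ (m - Suc i)"
   using word_rho_le'[OF i'(2)] mu by (intro mult_mono power_decreasing) (auto simp: mi)
  also have "\<dots> = \<mu> * (\<mu> ^ (m - i) * (L ^ (m - Suc i) * \<mu> ^ (2 * (m - Suc i))))"
   by (simp add: power_add[symmetric] mult_ac mi power_Suc[symmetric] del: power_Suc)
  also have "\<dots> \<le> \<mu> * (\<mu> ^ (m - i) * 1)"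
   using mu L_mu2_power_le_1 by (intro mult_left_mono) auto
  also have "\<dots> \<le> (1 / 2) * \<mu> ^ (m - i)"
   using mu by simp
  finally have "2 * Q * (\<mu> ^ (3 * (m - i) + 2) * norm (\<rho> (Suc i))) \<le> 2 * Q * ((1 / 2) * \<mu> ^ (m - i))"
   using Q0 by (intro mult_left_mono) auto
  with 1 show ?thesis using l by (intro mult_left_mono) auto
 qed
 finally have "S i * \<bar>snd (\<rho> i)\<bar> / Q \<le> l * (4 * \<mu> ^ Suc i + \<mu> ^ (m - i))"
  using Q0 by (simp add: field_simps)
 moreover have "l * (4 * \<mu> ^ (m - i) + \<mu> ^ (i + 2)) \<le> l * (4 * \<mu> ^ (m - i) + \<mu> ^ Suc i)"
  using l mu by (intro mult_left_mono add_left_mono power_decreasing) auto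
 ultimately show ?thesis
  using in_box_decompose(2)[OF i'(1) b] P_v_le[OF i'(1)] by (simp add: algebra_simps)
qed

text \<open>The second bound carries a factor \<open>L\<close> because \<open>box_step\<close>
  multiplies this component by \<open>fst (v (Suc i))\<close>, which may be as large as
  \<open>L * norm (v i)\<close>. The term is then of order \<open>r * L ^ 3\<close>.\<close>

lemma box_remainder:
 assumes i: "i < m" and b: "in_box i \<xi>"
 defines "y \<equiv> \<mu> ^ (m - i) + \<mu> ^ Suc i"
 shows "\<bar>fst (N (X i) \<xi>)\<bar> \<le> 1100 * k * l\<^sup>2 * y\<^sup>2" "L * \<bar>snd (N (X i) \<xi>)\<bar> \<le> 10 * k * l\<^sup>2 * y\<^sup>2"
  "y\<^sup>2 \<le> 2 * \<mu> ^ (2 * (m - i)) + 2 * \<mu> ^ (2 * Suc i)"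
proof -
 have y0: "y \<ge> 0" using mu by (simp add: y_def)
 have Lmu: "1 \<le> L * \<mu>"
  using \<tau> L_pos by (simp add: \<mu>_def)
 have f: "\<bar>fst \<xi>\<bar> \<le> 5 * l * y"
  using in_box_fst_le[OF i b] by (simp add: y_def)
 have n: "norm \<xi> \<le> 5 * l * (L * y)"
 proof -
  have "norm \<xi> \<le> 5 * l * (\<mu> ^ (m - i) + \<mu> ^ i)"
   using in_box_norm_le[OF _ b] i by simp
  also have "\<dots> \<le> 5 * l * (L * y)"
  proof -
   have "\<mu> ^ i * 1 \<le> \<mu> ^ i * (L * \<mu>)"
    using Lmu mu by (intro mult_left_mono) auto
   moreover have "1 * \<mu> ^ (m - i) \<le> L * \<mu> ^ (m - i)"
    using mu L_ge by (intro mult_right_mono) auto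
   ultimately show ?thesis
    using l by (intro mult_left_mono) (auto simp: y_def algebra_simps)
  qed
  finally show ?thesis .
 qed
 have f2: "(fst \<xi>)\<^sup>2 \<le> 25 * l\<^sup>2 * y\<^sup>2"
  using power_mono[OF f, of 2] by (simp add: power2_eq_square mult_ac)
 have n2: "(norm \<xi>)\<^sup>2 \<le> 25 * l\<^sup>2 * (L\<^sup>2 * y\<^sup>2)"
  using power_mono[OF n, of 2] by (simp add: power2_eq_square mult_ac)
 have rL2: "r * L\<^sup>2 \<le> 1" and rL3: "r * L ^ 3 \<le> 1 / 2"
  using r_small by (simp_all add: L_def power_mult_distrib)
 define w where "w = l\<^sup>2 * y\<^sup>2"
 have w0: "w \<ge> 0" by (simp add: w_def)
 have "r * (norm \<xi>)\<^sup>2 \<le> r * (25 * l\<^sup>2 * (L\<^sup>2 * y\<^sup>2))"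
  using n2 r by (intro mult_left_mono) auto
 then have rn: "r * (norm \<xi>)\<^sup>2 \<le> 25 * (r * L\<^sup>2) * w"
  by (simp add: w_def mult_ac)
 also have "\<dots> \<le> 25 * 1 * w"
  using rL2 w0 by (intro mult_right_mono mult_left_mono) auto
 finally have rn1: "r * (norm \<xi>)\<^sup>2 \<le> 25 * w" by simp
 have "40 * k * (fst \<xi>)\<^sup>2 \<le> 40 * k * (25 * l\<^sup>2 * y\<^sup>2)"
  using f2 k by (intro mult_left_mono) auto
 then have "\<bar>fst (N (X i) \<xi>)\<bar> \<le> 1000 * (k * w) + 25 * w"
  using fst_N_le[of "X i" \<xi>] rn1 by (simp add: w_def mult_ac)
 moreover have "25 * w \<le> 100 * (k * w)"
  using k w0 mult_right_mono[of 1 k w] by simp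
 ultimately show "\<bar>fst (N (X i) \<xi>)\<bar> \<le> 1100 * k * l\<^sup>2 * y\<^sup>2"
  by (simp add: w_def mult_ac)
 have "L * \<bar>snd (N (X i) \<xi>)\<bar> \<le> L * (25 * (r * L\<^sup>2) * w)"
  using snd_N_le[of "X i" \<xi>] rn L_pos by (intro mult_left_mono) auto
 also have "\<dots> = 25 * (r * L ^ 3) * w"
  by (simp add: eval_nat_numeral mult_ac)
 also have "\<dots> \<le> 25 * (1 / 2) * w"
  using rL3 w0 by (intro mult_right_mono mult_left_mono) auto
 also have "\<dots> \<le> 10 * k * w"
  using k w0 by (intro mult_right_mono) auto
 finally show "L * \<bar>snd (N (X i) \<xi>)\<bar> \<le> 10 * k * l\<^sup>2 * y\<^sup>2"
  by (simp add: w_def mult_ac)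
 have "0 \<le> (\<mu> ^ (m - i) - \<mu> ^ Suc i)\<^sup>2" by simp
 then show "y\<^sup>2 \<le> 2 * \<mu> ^ (2 * (m - i)) + 2 * \<mu> ^ (2 * Suc i)"
  unfolding y_def power_even_eq by (simp add: power2_eq_square algebra_simps)
qed

text \<open>Each summand of the squared bound \<open>y\<^sup>2\<close> is paired with the bound on
  the covector that suits it: \<open>L ^ (m - Suc i)\<close> with
  \<open>\<mu> ^ (2 * (m - i))\<close>, and \<open>2 * Q * \<mu> ^ Suc i\<close> with
  \<open>\<mu> ^ (2 * Suc i)\<close>. For the vector the pairing is the mirror image.\<close>

lemma box_step:
 assumes i: "i < m" and b: "in_box i \<xi>"
 shows "\<bar>inner (\<rho> (Suc i)) (N (X i) \<xi>)\<bar> \<le> P i - P (Suc i)"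
  "\<bar>wedge (v (Suc i)) (N (X i) \<xi>)\<bar> \<le> S (Suc i) - 2 * S i"
proof -
 have Q0: "Q > 0" using word_Q by simp
 define y where "y = \<mu> ^ (m - i) + \<mu> ^ Suc i"
 note rem = box_remainder[OF i b, folded y_def]
 have k0: "k > 0" using k by simp
 define c where "c = k * l\<^sup>2"
 have c0: "c \<ge> 0" using k0 by (simp add: c_def)
 have mi: "m - i = Suc (m - Suc i)" using i by simp
 \<comment> \<open>The constant \<open>c\<close> is absorbed in one of two ways: into a factor
   \<open>L\<close>, because \<open>l\<close> is small, or by a factor \<open>\<mu>\<close>, because
   \<open>\<tau> * l\<close> is small.\<close>
 have cL: "2400 * c \<le> l * L"
 proof -
  have "2400 * k * l * l \<le> 2400 * k * l * (1 / 1000000)"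
   using l_le k0 l by (intro mult_left_mono) auto
  also have "\<dots> \<le> l * (7 * k)" using k0 l by simp
  finally show ?thesis by (simp add: c_def L_def power2_eq_square mult_ac)
 qed
 have c\<mu>: "20000 * (c * \<mu>) \<le> l"
 proof -
  have "20000 * (c * \<mu>) = 20000 * (2 * \<tau> / 7) * l * l"
   using mu(4) by (simp add: c_def power2_eq_square mult_ac)
  also have "\<dots> = (40000 / 7 * (\<tau> * l)) * l"
   by simp
  also have "\<dots> \<le> 1 * l"
   using tau_l l by (intro mult_right_mono) auto
  finally show ?thesis by simp
 qed
 have "\<bar>snd (N (X i) \<xi>)\<bar> \<le> 10 * c * y\<^sup>2"
 proof -
  have "1 * \<bar>snd (N (X i) \<xi>)\<bar> \<le> L * \<bar>snd (N (X i) \<xi>)\<bar>"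
   using L_ge by (intro mult_right_mono) auto
  then show ?thesis using rem(2) by (simp add: c_def mult_ac)
 qed
 moreover have "\<bar>fst (N (X i) \<xi>)\<bar> \<le> 1100 * (c * y\<^sup>2)"
  using rem(1) by (simp add: c_def mult_ac)
 moreover have "0 \<le> c * y\<^sup>2"
  using c0 by simp
 ultimately have N: "norm (N (X i) \<xi>) \<le> 1200 * c * y\<^sup>2"
  using norm_le_abs_add[of "N (X i) \<xi>"] by linarith
 have y2: "1200 * c * y\<^sup>2 \<le> 2400 * c * \<mu> ^ (2 * (m - i)) + 2400 * c * \<mu> ^ (2 * Suc i)"
  using mult_left_mono[OF rem(3), of "1200 * c"] c0 by (simp add: algebra_simps)
 have "\<bar>inner (\<rho> (Suc i)) (N (X i) \<xi>)\<bar> \<le> norm (\<rho> (Suc i)) * (2400 * c * \<mu> ^ (2 * (m - i)) + 2400 * c * \<mu> ^ (2 * Suc i))"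
  by (rule order_trans[OF Cauchy_Schwarz_ineq2], intro mult_left_mono order_trans[OF N y2]) auto
 also have "\<dots> = 2400 * c * (norm (\<rho> (Suc i)) * \<mu> ^ (2 * (m - i))) + 2400 * c * (norm (\<rho> (Suc i)) * \<mu> ^ (2 * Suc i))"
  by (simp add: algebra_simps)
 also have "\<dots> \<le> l * (1 / 2) ^ (m - i) + (1 / 2) * l * Q * \<mu> ^ (3 * i + 2)"
 proof (rule add_mono)
  have "2400 * c * (norm (\<rho> (Suc i)) * \<mu> ^ (2 * (m - i))) \<le> 2400 * c * (L ^ (m - Suc i) * \<mu> ^ (2 * (m - i)))"
   using word_rho_le'[of "Suc i"] i mu c0 by (intro mult_left_mono mult_right_mono) auto
  also have "\<dots> \<le> l * L * (L ^ (m - Suc i) * \<mu> ^ (2 * (m - i)))"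
   using cL mu L_pos by (intro mult_right_mono) auto
  also have "\<dots> = l * (L ^ (m - i) * \<mu> ^ (2 * (m - i)))"
   by (simp add: mi)
  also have "\<dots> \<le> l * (1 / 2) ^ (m - i)"
   using L_mu2_power l by (intro mult_left_mono) auto
  finally show "2400 * c * (norm (\<rho> (Suc i)) * \<mu> ^ (2 * (m - i))) \<le> l * (1 / 2) ^ (m - i)" .
  have "norm (\<rho> (Suc i)) \<le> 2 * Q * (\<mu> / 2) ^ Suc i"
   using word_simps(9)[of "Suc i"] i by simp
  also have "\<dots> \<le> 2 * Q * \<mu> ^ Suc i"
   using mu Q0 by (intro mult_left_mono power_mono) auto
  finally have "2400 * c * (norm (\<rho> (Suc i)) * \<mu> ^ (2 * Suc i)) \<le> 2400 * c * (2 * Q * \<mu> ^ Suc i * \<mu> ^ (2 * Suc i))"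
   using mu c0 by (intro mult_left_mono mult_right_mono) auto
  also have "\<dots> = (4800 * (c * \<mu>)) * (Q * \<mu> ^ (3 * i + 2))"
  proof -
   have "\<mu> ^ Suc i * \<mu> ^ (2 * Suc i) = \<mu> * \<mu> ^ (3 * i + 2)"
    unfolding power_add[symmetric] power_Suc[symmetric] by (rule arg_cong[of _ _ "power \<mu>"]) simp
   then show ?thesis by (simp add: mult_ac)
  qed
  also have "\<dots> \<le> ((1 / 2) * l) * (Q * \<mu> ^ (3 * i + 2))"
   using c\<mu> c0 Q0 mu l by (intro mult_right_mono) auto
  finally show "2400 * c * (norm (\<rho> (Suc i)) * \<mu> ^ (2 * Suc i)) \<le> (1 / 2) * l * Q * \<mu> ^ (3 * i + 2)"
   by (simp add: mult_ac)
 qed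
 also have "\<dots> \<le> P i - P (Suc i)"
 proof -
  have "\<mu> ^ (3 * Suc i + 2) \<le> (1 / 2) * \<mu> ^ (3 * i + 2)"
  proof -
   have "\<mu> ^ (3 * Suc i + 2) = \<mu> ^ 3 * \<mu> ^ (3 * i + 2)"
    by (simp add: power_add eval_nat_numeral mult_ac)
   moreover have "\<mu> ^ 3 \<le> \<mu> ^ 1"
    using mu by (intro power_decreasing) auto
   ultimately show ?thesis
    using mu by (intro order_trans[OF _ mult_right_mono[of "\<mu> ^ 3" "1 / 2"]]) auto
  qed
  then have "l * Q * \<mu> ^ (3 * Suc i + 2) \<le> l * Q * ((1 / 2) * \<mu> ^ (3 * i + 2))"
   using l Q0 by (intro mult_left_mono) auto
  then show ?thesis
   unfolding P_def mi by (simp add: algebra_simps)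
 qed
 finally show "\<bar>inner (\<rho> (Suc i)) (N (X i) \<xi>)\<bar> \<le> P i - P (Suc i)" .
 have v: "norm (v (Suc i)) \<le> L * norm (v i)" "\<bar>snd (v (Suc i))\<bar> \<le> 2 * norm (v i)"
  using norm_D_le D_snd_le2 word_simps(3)[OF i] by simp_all
 have "\<bar>wedge (v (Suc i)) (N (X i) \<xi>)\<bar> \<le> \<bar>fst (v (Suc i))\<bar> * \<bar>snd (N (X i) \<xi>)\<bar> + \<bar>snd (v (Suc i))\<bar> * \<bar>fst (N (X i) \<xi>)\<bar>"
  unfolding wedge_def by (metis abs_mult abs_triangle_ineq4)
 also have "\<dots> \<le> (L * norm (v i)) * \<bar>snd (N (X i) \<xi>)\<bar> + (2 * norm (v i)) * (1100 * k * l\<^sup>2 * y\<^sup>2)"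
  using v rem(1) abs_fst_le_norm[of "v (Suc i)"] by (intro add_mono mult_mono) auto
 also have "\<dots> = norm (v i) * (L * \<bar>snd (N (X i) \<xi>)\<bar> + 2 * (1100 * k * l\<^sup>2 * y\<^sup>2))"
  by (simp add: algebra_simps)
 also have "\<dots> \<le> norm (v i) * (10 * k * l\<^sup>2 * y\<^sup>2 + 2 * (1100 * k * l\<^sup>2 * y\<^sup>2))"
  using rem(2) by (intro mult_left_mono add_right_mono) auto
 also have "\<dots> = norm (v i) * (2210 * c * y\<^sup>2)"
  by (simp add: c_def)
 also have "\<dots> \<le> norm (v i) * (2210 * c * (2 * \<mu> ^ (2 * (m - i)) + 2 * \<mu> ^ (2 * Suc i)))"
  using rem(3) c0 by (intro mult_left_mono) auto
 also have "\<dots> = 4420 * c * (norm (v i) * \<mu> ^ (2 * Suc i)) + 4420 * c * (norm (v i) * \<mu> ^ (2 * (m - i)))"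
  by (simp add: algebra_simps)
 also have "\<dots> \<le> l + l * Q * ((1 / 2) * \<mu> ^ (3 * (m - Suc i) + 2))"
 proof (rule add_mono)
  have "4420 * c * (norm (v i) * \<mu> ^ (2 * Suc i)) \<le> 4420 * c * (L ^ i * \<mu> ^ (2 * Suc i))"
   using word_v_le[of i] i mu c0 by (intro mult_left_mono mult_right_mono) auto
  also have "\<dots> = (4420 * (c * \<mu>)) * (\<mu> * (L ^ i * \<mu> ^ (2 * i)))"
   by (simp add: mult_ac)
  also have "\<dots> \<le> l * (1 * 1)"
   using c\<mu> c0 mu L_mu2_power_le_1[of i] l L_pos by (intro mult_mono) auto
  finally show "4420 * c * (norm (v i) * \<mu> ^ (2 * Suc i)) \<le> l" by simp
  have "norm (v i) \<le> 2 * Q * (\<mu> / 2) ^ (m - i)"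
   using word_simps(8)[of i] i by simp
  also have "\<dots> \<le> 2 * Q * \<mu> ^ (m - i)"
   using mu Q0 by (intro mult_left_mono power_mono) auto
  finally have "4420 * c * (norm (v i) * \<mu> ^ (2 * (m - i))) \<le> 4420 * c * (2 * Q * \<mu> ^ (m - i) * \<mu> ^ (2 * (m - i)))"
   using mu c0 by (intro mult_left_mono mult_right_mono) auto
  also have "\<dots> = (8840 * (c * \<mu>)) * (Q * \<mu> ^ (3 * (m - Suc i) + 2))"
  proof -
   have "\<mu> ^ (m - i) * \<mu> ^ (2 * (m - i)) = \<mu> * \<mu> ^ (3 * (m - Suc i) + 2)"
    unfolding mi power_add[symmetric] power_Suc[symmetric] by (rule arg_cong[of _ _ "power \<mu>"]) simp
   then show ?thesis by (simp add: mult_ac)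
  qed
  also have "\<dots> \<le> ((1 / 2) * l) * (Q * \<mu> ^ (3 * (m - Suc i) + 2))"
   using c\<mu> c0 Q0 mu l by (intro mult_right_mono) auto
  finally show "4420 * c * (norm (v i) * \<mu> ^ (2 * (m - i))) \<le> l * Q * ((1 / 2) * \<mu> ^ (3 * (m - Suc i) + 2))"
   by (simp add: mult_ac)
 qed
 also have "\<dots> \<le> S (Suc i) - 2 * S i"
 proof -
  have "2 * \<mu> ^ (3 * (m - i) + 2) \<le> (1 / 2) * \<mu> ^ (3 * (m - Suc i) + 2)"
  proof -
   have "\<mu> ^ (3 * (m - i) + 2) = \<mu> ^ 3 * \<mu> ^ (3 * (m - Suc i) + 2)"
    unfolding mi power_add[symmetric] by (rule arg_cong[of _ _ "power \<mu>"]) simp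
   moreover have "\<mu> ^ 3 \<le> \<mu> ^ 1"
    using mu by (intro power_decreasing) auto
   ultimately show ?thesis
    using mu by (intro order_trans[OF _ mult_right_mono[of "2 * \<mu> ^ 3" "1 / 2"]]) auto
  qed
  then have "l * Q * (2 * \<mu> ^ (3 * (m - i) + 2)) \<le> l * Q * ((1 / 2) * \<mu> ^ (3 * (m - Suc i) + 2))"
   using l Q0 by (intro mult_left_mono) auto
  then show ?thesis
   unfolding S_def by (simp add: algebra_simps)
 qed
 finally show "\<bar>wedge (v (Suc i)) (N (X i) \<xi>)\<bar> \<le> S (Suc i) - 2 * S i" .
qed

text \<open>By adjointness \<open>inner (\<rho> (Suc i))\<close> of the image equals
  \<open>inner (\<rho> i)\<close> of the point up to the remainder. So the image of a path across
  one box spans the slightly narrower next one and can be cut to it.\<close>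

lemma word_chain:
 fixes lo hi :: real
 assumes \<sigma>: "continuous_on (closed_segment lo hi) \<sigma>"
  and ends: "inner (\<rho> 0) (\<sigma> lo - X 0) \<le> - P 0" "P 0 \<le> inner (\<rho> 0) (\<sigma> hi - X 0)"
  and w0: "\<And>u. u \<in> closed_segment lo hi \<Longrightarrow> \<bar>wedge (v 0) (\<sigma> u - X 0)\<bar> \<le> S 0"
  and i: "i \<le> m"
 shows "\<exists>a b. closed_segment a b \<subseteq> closed_segment lo hi \<and>
   inner (\<rho> i) ((G ^^ i) (\<sigma> a) - X i) = - P i \<and> inner (\<rho> i) ((G ^^ i) (\<sigma> b) - X i) = P i \<and>
   (\<forall>u\<in>closed_segment a b. \<forall>j\<le>i. in_box j ((G ^^ j) (\<sigma> u) - X j))"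
 using i
proof (induction i)
 have P0: "P i \<ge> 0" for i
 proof -
  have "(1 / 2 :: real) ^ (m - i) \<le> 1" by (rule power_le_one) auto
  then show ?thesis
   unfolding P_def using l mu word_Q by (intro mult_nonneg_nonneg add_nonneg_nonneg) auto
 qed
 case 0
 have "continuous_on (closed_segment lo hi) (\<lambda>u. inner (\<rho> 0) (\<sigma> u - X 0))"
  by (intro continuous_intros \<sigma>)
 from path_cut_symmetric[of lo hi "\<lambda>u. inner (\<rho> 0) (\<sigma> u - X 0)" "P 0", OF this ends P0]
 obtain a b where ab: "closed_segment a b \<subseteq> closed_segment lo hi"
  "inner (\<rho> 0) (\<sigma> a - X 0) = - P 0" "inner (\<rho> 0) (\<sigma> b - X 0) = P 0"
  "\<And>u. u \<in> closed_segment a b \<Longrightarrow> \<bar>inner (\<rho> 0) (\<sigma> u - X 0)\<bar> \<le> P 0"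
  by blast
 moreover have "in_box 0 (\<sigma> u - X 0)" if "u \<in> closed_segment a b" for u
  using ab(4)[OF that] w0[of u] that ab(1) unfolding in_box_def by blast
 ultimately show ?case
  by (intro exI[of _ a] exI[of _ b]) auto
next
 have P0: "P i \<ge> 0" for i
 proof -
  have "(1 / 2 :: real) ^ (m - i) \<le> 1" by (rule power_le_one) auto
  then show ?thesis
   unfolding P_def using l mu word_Q by (intro mult_nonneg_nonneg add_nonneg_nonneg) auto
 qed
 case (Suc i)
 then have i: "i < m" by simp
 obtain a b where ab: "closed_segment a b \<subseteq> closed_segment lo hi"
   "inner (\<rho> i) ((G ^^ i) (\<sigma> a) - X i) = - P i" "inner (\<rho> i) ((G ^^ i) (\<sigma> b) - X i) = P i"
   and box: "\<And>u j. u \<in> closed_segment a b \<Longrightarrow> j \<le> i \<Longrightarrow> in_box j ((G ^^ j) (\<sigma> u) - X j)"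
  using Suc by auto
 define \<xi> where "\<xi> j u = (G ^^ j) (\<sigma> u) - X j" for j u
 have step: "\<xi> (Suc i) u = D (X i) (\<xi> i u) + N (X i) (\<xi> i u)" for u
  using G_add[of "X i" "\<xi> i u"] word_simps(2)[OF i] by (simp add: \<xi>_def)
 have cont: "continuous_on (closed_segment a b) (\<lambda>u. (G ^^ j) (\<sigma> u))" for j
 proof (induction j)
  case 0
  then show ?case using \<sigma> ab(1) by (auto intro: continuous_on_subset)
 next
  case (Suc j)
  then show ?case
   by (auto intro: continuous_on_compose2[OF continuous_on_G[of UNIV]])
 qed
 have in1: "inner (\<rho> (Suc i)) (\<xi> (Suc i) u) = inner (\<rho> i) (\<xi> i u) + inner (\<rho> (Suc i)) (N (X i) (\<xi> i u))" for u
  unfolding step word_simps(4)[OF i] inner_Dt inner_add_right ..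
 have wd: "wedge (v (Suc i)) (\<xi> (Suc i) u) = det (X i) * wedge (v i) (\<xi> i u) + wedge (v (Suc i)) (N (X i) (\<xi> i u))" for u
  unfolding step wedge_add_right word_simps(3)[OF i] wedge_D ..
 have stp: "\<bar>inner (\<rho> (Suc i)) (N (X i) (\<xi> i u))\<bar> \<le> P i - P (Suc i)"
  "\<bar>wedge (v (Suc i)) (N (X i) (\<xi> i u))\<bar> \<le> S (Suc i) - 2 * S i" if "u \<in> closed_segment a b" for u
  using box_step[OF i box[OF that order_refl]] by (simp_all add: \<xi>_def)
 have cont': "continuous_on (closed_segment a b) (\<lambda>u. inner (\<rho> (Suc i)) (\<xi> (Suc i) u))"
  unfolding \<xi>_def by (intro continuous_intros cont)
 have e1: "inner (\<rho> (Suc i)) (\<xi> (Suc i) a) \<le> - P (Suc i)"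
  using stp(1)[of a] ab(2) in1[of a] by (simp add: \<xi>_def[symmetric])
 have e2: "P (Suc i) \<le> inner (\<rho> (Suc i)) (\<xi> (Suc i) b)"
  using stp(1)[of b] ab(3) in1[of b] by (simp add: \<xi>_def[symmetric])
 from path_cut_symmetric[of a b "\<lambda>u. inner (\<rho> (Suc i)) (\<xi> (Suc i) u)" "P (Suc i)", OF cont' e1 e2 P0]
 obtain a' b' where ab': "closed_segment a' b' \<subseteq> closed_segment a b"
  "inner (\<rho> (Suc i)) (\<xi> (Suc i) a') = - P (Suc i)" "inner (\<rho> (Suc i)) (\<xi> (Suc i) b') = P (Suc i)"
  and in2: "\<And>u. u \<in> closed_segment a' b' \<Longrightarrow> \<bar>inner (\<rho> (Suc i)) (\<xi> (Suc i) u)\<bar> \<le> P (Suc i)"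
  by blast
 have "in_box (Suc i) (\<xi> (Suc i) u)" if u: "u \<in> closed_segment a' b'" for u
 proof -
  have u': "u \<in> closed_segment a b" using u ab' by auto
  have "\<bar>wedge (v (Suc i)) (\<xi> (Suc i) u)\<bar> \<le> \<bar>det (X i)\<bar> * \<bar>wedge (v i) (\<xi> i u)\<bar> + \<bar>wedge (v (Suc i)) (N (X i) (\<xi> i u))\<bar>"
   unfolding wd by (metis abs_mult abs_triangle_ineq)
  also have "\<dots> \<le> 2 * S i + (S (Suc i) - 2 * S i)"
   using abs_det_le stp(2)[OF u'] box[OF u' order_refl]
   by (intro add_mono mult_mono) (auto simp: in_box_def \<xi>_def)
  finally show ?thesis
   using in2[OF u] unfolding in_box_def by simp
 qed
 then have "\<forall>u\<in>closed_segment a' b'. \<forall>j\<le>Suc i. in_box j ((G ^^ j) (\<sigma> u) - X j)"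
  using box ab'(1) by (auto simp: le_Suc_eq \<xi>_def simp del: funpow.simps)
 then show ?case
  using ab' ab(1) unfolding \<xi>_def by (intro exI[of _ a'] exI[of _ b']) auto
qed

text \<open>A passage from the square to the first box and from the last box to the square. Both
  work because \<open>\<rho> 0\<close>, \<open>\<rho> m\<close> and \<open>v m\<close> are nearly
  horizontal.\<close>

lemma word_crossing:
 assumes cr: "crosses \<sigma> lo hi (X 0)"
 obtains a b where "closed_segment a b \<subseteq> closed_segment lo hi" "crosses (\<lambda>u. (G ^^ m) (\<sigma> u)) a b (X m)"
  "\<And>u j. u \<in> closed_segment a b \<Longrightarrow> j \<le> m \<Longrightarrow> norm ((G ^^ j) (\<sigma> u) - X j) \<le> 5 * l * (\<mu> ^ (m - j) + \<mu> ^ j)"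
proof -
 have Q0: "Q \<ge> 10000" by (rule word_Q)
 have m0: "m > 0" by (rule word_simps)
 have \<sigma>: "continuous_on (closed_segment lo hi) \<sigma>"
  and ex: "fst (\<sigma> lo - X 0) = - l / 2" "fst (\<sigma> hi - X 0) = l / 2"
  and bd: "\<And>u. u \<in> closed_segment lo hi \<Longrightarrow> \<bar>fst (\<sigma> u - X 0)\<bar> \<le> l / 2 \<and> \<bar>snd (\<sigma> u - X 0)\<bar> \<le> l / 2"
  using cr by (auto simp: crosses_def)
 have w0: "\<bar>wedge (v 0) (\<sigma> u - X 0)\<bar> \<le> S 0" if "u \<in> closed_segment lo hi" for u
 proof -
  have "\<bar>wedge (v 0) (\<sigma> u - X 0)\<bar> \<le> \<bar>fst (v 0)\<bar> * \<bar>snd (\<sigma> u - X 0)\<bar> + \<bar>snd (v 0)\<bar> * \<bar>fst (\<sigma> u - X 0)\<bar>"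
   unfolding wedge_def by (metis abs_mult abs_triangle_ineq4)
  also have "\<dots> \<le> 1 * (l / 2) + 1 * (l / 2)"
   using bd[OF that] abs_fst_le_norm[of "v 0"] abs_snd_le_norm[of "v 0"] word_simps(6) by (intro add_mono mult_mono) auto
  also have "\<dots> \<le> l * (1 + Q * \<mu> ^ (3 * m + 2))"
   using l mu Q0 by (simp add: mult_left_mono)
  also have "\<dots> = S 0" by (simp add: S_def)
  finally show ?thesis .
 qed
 have \<rho>0: "norm (\<rho> 0) \<ge> Q"
  using norm_cauchy_schwarz[of "\<rho> 0" "v 0"] word_simps(5)[of 0] word_simps(6) by simp
 \<comment> \<open>As \<open>norm (\<rho> 0) \<ge> Q\<close>, the sides of the square lie well
   outside the box in the coordinate \<open>inner (\<rho> 0)\<close>.\<close>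
 have P0: "P 0 \<le> norm (\<rho> 0) * l / 4"
 proof -
  have "0 \<le> (1 / 2 :: real) ^ m" by simp
  then have "P 0 \<le> l * (2 + Q * \<mu>\<^sup>2)"
   unfolding P_def using l by (intro mult_left_mono) (auto simp: power2_eq_square)
  also have "\<dots> \<le> l * (Q / 4)"
  proof -
   have "\<mu>\<^sup>2 \<le> (1 / 100000)\<^sup>2" using mu by (intro power_mono) auto
   then have "Q * \<mu>\<^sup>2 \<le> Q * (1 / 100)" using Q0 by (intro mult_left_mono) (auto simp: power2_eq_square)
   then have "2 + Q * \<mu>\<^sup>2 \<le> Q / 4" using Q0 by linarith
   then show ?thesis using l by (intro mult_left_mono) auto
  qed
  also have "\<dots> \<le> l * (norm (\<rho> 0) / 4)"
   using \<rho>0 l by (intro mult_left_mono) auto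
  finally show ?thesis by (simp add: mult_ac)
 qed
 have split: "inner (\<rho> 0) \<xi> = fst (\<rho> 0) * fst \<xi> + snd (\<rho> 0) * snd \<xi>" for \<xi>
  by (simp add: inner_prod_def)
 have fst\<rho>: "\<bar>fst (\<rho> 0)\<bar> \<ge> norm (\<rho> 0) * (1 - \<mu>)"
  using norm_le_abs_add[of "\<rho> 0"] word_simps(12) by (simp add: algebra_simps)
 have small: "\<bar>snd (\<rho> 0) * snd (\<sigma> u - X 0)\<bar> \<le> norm (\<rho> 0) * \<mu> * (l / 2)" if "u \<in> closed_segment lo hi" for u
  unfolding abs_mult using word_simps(12) bd[OF that] mu l
  by (intro mult_mono) (auto simp: mult.commute)
 have big: "P 0 \<le> \<bar>fst (\<rho> 0)\<bar> * (l / 2) - norm (\<rho> 0) * \<mu> * (l / 2)"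
 proof -
  have "norm (\<rho> 0) * l / 4 \<le> (norm (\<rho> 0) * (1 - \<mu>) - norm (\<rho> 0) * \<mu>) * (l / 2)"
  proof -
   have "norm (\<rho> 0) * l * (1 / 4) \<le> norm (\<rho> 0) * l * ((1 - 2 * \<mu>) / 2)"
    using mu l by (intro mult_left_mono) auto
   then show ?thesis by (simp add: algebra_simps)
  qed
  also have "\<dots> \<le> (\<bar>fst (\<rho> 0)\<bar> - norm (\<rho> 0) * \<mu>) * (l / 2)"
   using fst\<rho> l by (intro mult_right_mono) auto
  finally show ?thesis using P0 by (simp add: algebra_simps)
 qed
 define A where "A = fst (\<rho> 0) * (l / 2)"
 have elo: "inner (\<rho> 0) (\<sigma> lo - X 0) = - A + snd (\<rho> 0) * snd (\<sigma> lo - X 0)"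
  and ehi: "inner (\<rho> 0) (\<sigma> hi - X 0) = A + snd (\<rho> 0) * snd (\<sigma> hi - X 0)"
  unfolding split ex A_def by simp_all
 have absA: "\<bar>fst (\<rho> 0)\<bar> * (l / 2) = \<bar>A\<bar>"
  using l by (simp add: A_def abs_mult)
 \<comment> \<open>If \<open>fst (\<rho> 0)\<close> is negative, the left side of the square has the
   larger coordinate, and the ends of the path are exchanged.\<close>
 have "\<exists>lo' hi'. closed_segment lo' hi' = closed_segment lo hi \<and> inner (\<rho> 0) (\<sigma> lo' - X 0) \<le> - P 0 \<and> P 0 \<le> inner (\<rho> 0) (\<sigma> hi' - X 0)"
 proof (cases "A \<ge> 0")
  case True
  then have "inner (\<rho> 0) (\<sigma> lo - X 0) \<le> - P 0" "P 0 \<le> inner (\<rho> 0) (\<sigma> hi - X 0)"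
   using big small[of lo] small[of hi] unfolding elo ehi absA abs_le_iff by simp_all
  then show ?thesis by blast
 next
  case False
  then have "inner (\<rho> 0) (\<sigma> hi - X 0) \<le> - P 0" "P 0 \<le> inner (\<rho> 0) (\<sigma> lo - X 0)"
   using big small[of lo] small[of hi] unfolding elo ehi absA abs_le_iff by simp_all
  then show ?thesis using closed_segment_commute by blast
 qed
 then obtain lo' hi' where lh: "closed_segment lo' hi' = closed_segment lo hi"
  "inner (\<rho> 0) (\<sigma> lo' - X 0) \<le> - P 0" "P 0 \<le> inner (\<rho> 0) (\<sigma> hi' - X 0)" by blast
 have "\<exists>a b. closed_segment a b \<subseteq> closed_segment lo' hi' \<and>
   inner (\<rho> m) ((G ^^ m) (\<sigma> a) - X m) = - P m \<and> inner (\<rho> m) ((G ^^ m) (\<sigma> b) - X m) = P m \<and>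
   (\<forall>u\<in>closed_segment a b. \<forall>j\<le>m. in_box j ((G ^^ j) (\<sigma> u) - X j))"
  by (rule word_chain[OF _ lh(2,3)]) (simp_all only: lh(1) \<sigma> w0 order_refl)
 then obtain a b where ab: "closed_segment a b \<subseteq> closed_segment lo hi"
   "inner (\<rho> m) ((G ^^ m) (\<sigma> a) - X m) = - P m" "inner (\<rho> m) ((G ^^ m) (\<sigma> b) - X m) = P m"
   and box: "\<And>u j. u \<in> closed_segment a b \<Longrightarrow> j \<le> m \<Longrightarrow> in_box j ((G ^^ j) (\<sigma> u) - X j)"
  using lh(1) by auto
 define \<xi> where "\<xi> u = (G ^^ m) (\<sigma> u) - X m" for u
 have \<xi>6: "norm (\<xi> u) \<le> 6 * l" if "u \<in> closed_segment a b" for u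
 proof -
  have "\<mu> ^ m \<le> \<mu> ^ 1" using mu m0 by (intro power_decreasing) auto
  then have "5 * l * (1 + \<mu> ^ m) \<le> 5 * l * (6 / 5)"
   using l mu by (intro mult_left_mono) auto
  then show ?thesis
   using in_box_norm_le[OF order_refl box[OF that order_refl]] by (simp add: \<xi>_def)
 qed
 have \<rho>m: "\<bar>fst (\<rho> m)\<bar> \<ge> 1 - \<mu>" "\<bar>fst (\<rho> m)\<bar> \<le> 1"
  using norm_le_abs_add[of "\<rho> m"] abs_fst_le_norm[of "\<rho> m"] word_simps(7,13) by auto
 have Pm: "P m \<ge> l"
  unfolding P_def using l mu Q0 by simp
 have split': "inner (\<rho> m) \<xi> = fst (\<rho> m) * fst \<xi> + snd (\<rho> m) * snd \<xi>" for \<xi>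
  by (simp add: inner_prod_def)
 have small': "\<bar>snd (\<rho> m) * snd (\<xi> u)\<bar> \<le> \<mu> * (6 * l)" if "u \<in> closed_segment a b" for u
  unfolding abs_mult using word_simps(13) \<xi>6[OF that] abs_snd_le_norm[of "\<xi> u"] mu by (intro mult_mono) auto
 have \<mu>l: "\<mu> * (6 * l) \<le> l / 100"
  using mult_right_mono[OF mu(2), of "6 * l"] l by simp
 have ina: "fst (\<rho> m) * fst (\<xi> a) \<le> - l + l / 100" and inb: "l - l / 100 \<le> fst (\<rho> m) * fst (\<xi> b)"
  using small'[of a] small'[of b] ab(2,3) Pm \<mu>l unfolding \<xi>_def[symmetric] split' abs_le_iff by auto
 have fstbig: "\<bar>fst (\<xi> u)\<bar> \<ge> l / 2" if "l - l / 100 \<le> \<bar>fst (\<rho> m) * fst (\<xi> u)\<bar>" for u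
 proof -
  have "\<bar>fst (\<rho> m) * fst (\<xi> u)\<bar> \<le> 1 * \<bar>fst (\<xi> u)\<bar>"
   unfolding abs_mult using \<rho>m by (intro mult_right_mono) auto
  then show ?thesis using that l by simp
 qed
 \<comment> \<open>\<open>v m\<close> is nearly horizontal and at least \<open>Q\<close> long,
   whereas \<open>S m\<close> is at most \<open>5 * \<mu> * l * Q\<close>; the wedge therefore
   squeezes the ordinate.\<close>
 have y: "\<bar>snd (\<xi> u)\<bar> \<le> l / 2" if u: "u \<in> closed_segment a b" for u
 proof -
  have vQ: "norm (v m) \<ge> Q"
   using norm_cauchy_schwarz[of "\<rho> m" "v m"] word_simps(5)[of m] word_simps(7) by simp
  have v0: "norm (v m) > 0" using vQ Q0 by linarith
  have vx: "\<bar>fst (v m)\<bar> \<ge> norm (v m) * (1 - \<mu>)"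
   using norm_le_abs_add[of "v m"] word_simps(11) by (simp add: algebra_simps)
  have "\<bar>fst (v m) * snd (\<xi> u)\<bar> \<le> \<bar>wedge (v m) (\<xi> u)\<bar> + \<bar>snd (v m) * fst (\<xi> u)\<bar>"
   unfolding wedge_def by linarith
  also have "\<dots> \<le> S m + \<mu> * norm (v m) * (6 * l)"
  proof (rule add_mono)
   show "\<bar>wedge (v m) (\<xi> u)\<bar> \<le> S m"
    using box[OF u order_refl] by (simp add: in_box_def \<xi>_def)
   show "\<bar>snd (v m) * fst (\<xi> u)\<bar> \<le> \<mu> * norm (v m) * (6 * l)"
    unfolding abs_mult using word_simps(11) \<xi>6[OF u] abs_fst_le_norm[of "\<xi> u"] mu by (intro mult_mono) auto
  qed
  also have "S m \<le> norm (v m) * (l / 100)"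
  proof -
   have "S m \<le> l * (2 ^ Suc m + Q * \<mu>\<^sup>2)"
    unfolding S_def using l by (intro mult_left_mono) (auto simp: power2_eq_square)
   also have "\<dots> \<le> l * (4 * \<mu> * Q + Q * \<mu>)"
    using word_Q(2) mu l Q0 by (intro mult_left_mono add_mono) (auto simp: power2_eq_square mult_le_cancel_right1)
   also have "\<dots> = 5 * \<mu> * (l * Q)" by simp
   also have "\<dots> \<le> (1 / 100) * (l * Q)"
    using mu l Q0 by (intro mult_right_mono) auto
   also have "\<dots> \<le> (1 / 100) * (l * norm (v m))"
    using vQ l by (intro mult_left_mono) auto
   finally show ?thesis by (simp add: mult_ac)
  qed
  also have "\<mu> * norm (v m) * (6 * l) \<le> norm (v m) * (l / 100)"
   using mult_left_mono[OF \<mu>l, of "norm (v m)"] by (simp add: mult_ac)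
  finally have 1: "\<bar>fst (v m) * snd (\<xi> u)\<bar> \<le> norm (v m) * (l / 50)"
   by (simp add: field_simps)
  have "norm (v m) * (1 / 2) \<le> \<bar>fst (v m)\<bar>"
  proof -
   have "norm (v m) * (1 / 2) \<le> norm (v m) * (1 - \<mu>)"
    using mu by (intro mult_left_mono) auto
   then show ?thesis using vx by linarith
  qed
  then have "norm (v m) * (1 / 2) * \<bar>snd (\<xi> u)\<bar> \<le> norm (v m) * (l / 50)"
   using 1 unfolding abs_mult by (meson abs_ge_zero mult_right_mono order_trans)
  then have "\<bar>snd (\<xi> u)\<bar> \<le> l / 25"
   using v0 by (simp add: field_simps)
  then show ?thesis using l by simp
 qed
 have cont: "continuous_on (closed_segment a b) (\<lambda>u. (G ^^ j) (\<sigma> u))" for j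
 proof (induction j)
  case 0
  then show ?case using \<sigma> ab(1) by (auto intro: continuous_on_subset)
 next
  case (Suc j)
  then show ?case
   by (auto intro: continuous_on_compose2[OF continuous_on_G[of UNIV]])
 qed
 have ends: "fst ((G ^^ m) (\<sigma> a)) \<le> fst (X m) - l / 2 \<and> fst (X m) + l / 2 \<le> fst ((G ^^ m) (\<sigma> b)) \<or>
    fst ((G ^^ m) (\<sigma> b)) \<le> fst (X m) - l / 2 \<and> fst (X m) + l / 2 \<le> fst ((G ^^ m) (\<sigma> a))"
 proof -
  have l99: "l - l / 100 > 0" using l by simp
  have A: "\<bar>fst (\<xi> a)\<bar> \<ge> l / 2" "\<bar>fst (\<xi> b)\<bar> \<ge> l / 2"
   using ina inb by (intro fstbig; linarith)+
  have "fst (\<rho> m) * fst (\<xi> a) < 0" "fst (\<rho> m) * fst (\<xi> b) > 0"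
   using ina inb l99 by linarith+
  then have "fst (\<xi> a) < 0 \<and> fst (\<xi> b) > 0 \<or> fst (\<xi> b) < 0 \<and> fst (\<xi> a) > 0"
   by (auto simp: mult_less_0_iff zero_less_mult_iff)
  then show ?thesis
   using A by (auto simp: \<xi>_def)
 qed
 obtain a' b' where "closed_segment a' b' \<subseteq> closed_segment a b" "crosses (\<lambda>u. (G ^^ m) (\<sigma> u)) a' b' (X m)"
  by (rule crossesI_cut[OF cont[of m] ends]) (use y in \<open>auto simp: \<xi>_def\<close>)
 then show thesis
  using that[of a' b'] ab(1) in_box_norm_le box by (meson subset_iff)
qed

end

end

section \<open>Concatenating orbit segments\<close>

text \<open>The increment from \<open>- \<beta>\<close> to \<open>\<beta>\<close> is
  \<open>2 * cos \<alpha> * sin \<beta>\<close>, and the second difference is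
  \<open>- 2 * sin \<alpha> * (1 - cos \<beta>)\<close>. If all increments were small, so would be
  both \<open>cos \<alpha>\<close> and \<open>sin \<alpha>\<close>. The order
  \<open>\<beta>\<^sup>2\<close> is what a critical point of the sine leaves.\<close>

lemma sin_oscillation:
 fixes \<alpha> \<beta> :: real
 assumes \<beta>: "0 < \<beta>" "\<beta> \<le> 1 / 4"
 obtains p q where "p \<in> {-\<beta>, 0, \<beta>}" "q \<in> {-\<beta>, 0, \<beta>}" "p < q" "\<beta>\<^sup>2 / 12 \<le> \<bar>sin (\<alpha> + q) - sin (\<alpha> + p)\<bar>"
proof -
 have "\<exists>p q. p \<in> {-\<beta>, 0, \<beta>} \<and> q \<in> {-\<beta>, 0, \<beta>} \<and> p < q \<and> \<beta>\<^sup>2 / 12 \<le> \<bar>sin (\<alpha> + q) - sin (\<alpha> + p)\<bar>"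
 proof (rule ccontr)
  assume neg: "\<not> ?thesis"
  have 1: "\<bar>sin (\<alpha> + \<beta>) - sin (\<alpha> - \<beta>)\<bar> < \<beta>\<^sup>2 / 12"
   using neg \<beta> by (force simp: not_le dest: spec[of _ "-\<beta>"])
  have 2: "\<bar>sin (\<alpha> + \<beta>) - sin \<alpha>\<bar> < \<beta>\<^sup>2 / 12"
   using neg \<beta> by (force simp: not_le dest: spec[of _ 0])
  have 3: "\<bar>sin \<alpha> - sin (\<alpha> - \<beta>)\<bar> < \<beta>\<^sup>2 / 12"
   using neg \<beta> by (force simp: not_le dest: spec[of _ "-\<beta>"])
  have s: "sin x \<ge> x / 2" if "0 < x" "x \<le> 1 / 4" for x :: real
  proof -
   have "\<bar>sin x - x\<bar> \<le> x\<^sup>2"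
    using abs_sin_remainder_le[of 0 x] by simp
   moreover have "x\<^sup>2 \<le> x / 2"
    using that by (simp add: power2_eq_square mult_left_mono field_simps)
   ultimately show ?thesis by linarith
  qed
  have sb: "sin \<beta> \<ge> \<beta> / 2" using s \<beta> by simp
  have "1 - cos \<beta> = 2 * (sin (\<beta> / 2))\<^sup>2"
   using cos_double_sin[of "\<beta> / 2"] by simp
  moreover have "(\<beta> / 4)\<^sup>2 \<le> (sin (\<beta> / 2))\<^sup>2"
   using s[of "\<beta> / 2"] \<beta> by (intro power_mono) auto
  ultimately have cb: "1 - cos \<beta> \<ge> \<beta>\<^sup>2 / 8"
   by (simp add: power2_eq_square)
  have "\<bar>cos \<alpha>\<bar> * (\<beta> / 2) \<le> \<bar>cos \<alpha>\<bar> * sin \<beta>"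
   using sb by (intro mult_left_mono) auto
  also have "2 * (\<bar>cos \<alpha>\<bar> * sin \<beta>) = \<bar>sin (\<alpha> + \<beta>) - sin (\<alpha> - \<beta>)\<bar>"
   using sb \<beta> by (simp add: sin_add sin_diff abs_mult)
  then have "\<bar>cos \<alpha>\<bar> * sin \<beta> < \<beta>\<^sup>2 / 24"
   using 1 by simp
  finally have "\<bar>cos \<alpha>\<bar> * (\<beta> / 2) < (\<beta> / 12) * (\<beta> / 2)"
   by (simp add: power2_eq_square)
  then have c: "\<bar>cos \<alpha>\<bar> < 1 / 48"
   using \<beta> by (simp add: mult_less_cancel_right_pos)
  have "\<bar>sin \<alpha>\<bar> * (\<beta>\<^sup>2 / 8) \<le> \<bar>sin \<alpha>\<bar> * (1 - cos \<beta>)"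
   using cb by (intro mult_left_mono) auto
  also have "2 * (\<bar>sin \<alpha>\<bar> * (1 - cos \<beta>)) = \<bar>(sin (\<alpha> + \<beta>) - sin \<alpha>) - (sin \<alpha> - sin (\<alpha> - \<beta>))\<bar>"
  proof -
   have "(sin (\<alpha> + \<beta>) - sin \<alpha>) - (sin \<alpha> - sin (\<alpha> - \<beta>)) = - (2 * (sin \<alpha> * (1 - cos \<beta>)))"
    by (simp add: sin_add sin_diff algebra_simps)
   then show ?thesis by (simp add: abs_mult)
  qed
  then have "\<bar>sin \<alpha>\<bar> * (1 - cos \<beta>) < \<beta>\<^sup>2 / 12"
   using 2 3 by linarith
  finally have "\<bar>sin \<alpha>\<bar> * (\<beta>\<^sup>2 / 8) < (2 / 3) * (\<beta>\<^sup>2 / 8)" by simp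
  then have s: "\<bar>sin \<alpha>\<bar> < 2 / 3"
   using \<beta> by (simp add: mult_less_cancel_right_pos)
  have "(sin \<alpha>)\<^sup>2 \<le> (2 / 3)\<^sup>2" "(cos \<alpha>)\<^sup>2 \<le> (1 / 48)\<^sup>2"
   using s c by (auto simp: abs_le_square_iff[symmetric])
  then show False
   using sin_cos_squared_add[of \<alpha>] by (simp add: power2_eq_square)
 qed
 then show thesis using that by blast
qed

context shadowing
begin

text \<open>A covering relation between the squares about \<open>c\<close> and \<open>c'\<close>. It
  quantifies over all crossing paths so that links compose, and the image path is a separate
  \<open>\<sigma>'\<close> because a lift of the image may have to be translated by a lattice
  vector.\<close>

definition link :: "real \<times> real \<Rightarrow> nat \<Rightarrow> real \<times> real \<Rightarrow> (nat \<Rightarrow> torus \<Rightarrow> bool) \<Rightarrow> bool" where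
 "link c T c' Tr \<longleftrightarrow> (\<forall>\<sigma> lo hi. crosses \<sigma> lo hi c \<longrightarrow>
   (\<exists>a b \<sigma>'. closed_segment a b \<subseteq> closed_segment lo hi \<and> crosses \<sigma>' a b c' \<and>
    (\<forall>u\<in>closed_segment a b. to_torus (\<sigma>' u) = (g ^^ T) (to_torus (\<sigma> u)) \<and>
     (\<forall>t\<le>T. Tr t ((g ^^ t) (to_torus (\<sigma> u)))))))"

lemma link_mono: "link c T c' Tr \<Longrightarrow> (\<And>t p. t \<le> T \<Longrightarrow> Tr t p \<Longrightarrow> Tr' t p) \<Longrightarrow> link c T c' Tr'"
 unfolding link_def by meson

lemma link_trans:
 assumes "link c T c' Tr" "link c' T' c'' Tr'"
 shows "link c (T + T') c'' (\<lambda>t p. (t \<le> T \<longrightarrow> Tr t p) \<and> (T \<le> t \<longrightarrow> Tr' (t - T) p))"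
 unfolding link_def
proof (intro allI impI)
 fix \<sigma> lo hi assume cr: "crosses \<sigma> lo hi c"
 obtain a b \<sigma>' where 1: "closed_segment a b \<subseteq> closed_segment lo hi" "crosses \<sigma>' a b c'"
  "\<And>u. u \<in> closed_segment a b \<Longrightarrow> to_torus (\<sigma>' u) = (g ^^ T) (to_torus (\<sigma> u))"
  "\<And>u t. u \<in> closed_segment a b \<Longrightarrow> t \<le> T \<Longrightarrow> Tr t ((g ^^ t) (to_torus (\<sigma> u)))"
  using assms(1) cr unfolding link_def by meson
 obtain a' b' \<sigma>'' where 2: "closed_segment a' b' \<subseteq> closed_segment a b" "crosses \<sigma>'' a' b' c''"
  "\<And>u. u \<in> closed_segment a' b' \<Longrightarrow> to_torus (\<sigma>'' u) = (g ^^ T') (to_torus (\<sigma>' u))"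
  "\<And>u t. u \<in> closed_segment a' b' \<Longrightarrow> t \<le> T' \<Longrightarrow> Tr' t ((g ^^ t) (to_torus (\<sigma>' u)))"
  using assms(2) 1(2) unfolding link_def by meson
 have pow: "(g ^^ (T + s)) (to_torus (\<sigma> u)) = (g ^^ s) (to_torus (\<sigma>' u))" if "u \<in> closed_segment a' b'" for u s
  using 1(3)[of u] that 2(1) by (simp add: funpow_add add.commute[of T] subset_iff)
 have "Tr t ((g ^^ t) (to_torus (\<sigma> u)))" if "u \<in> closed_segment a' b'" "t \<le> T" for u t
  using 1(4) 2(1) that by auto
 moreover have "Tr' (t - T) ((g ^^ t) (to_torus (\<sigma> u)))" if "u \<in> closed_segment a' b'" "t \<le> T + T'" "T \<le> t" for u t
  using 2(4)[OF that(1), of "t - T"] pow[OF that(1), of "t - T"] that by simp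
 moreover have "to_torus (\<sigma>'' u) = (g ^^ (T + T')) (to_torus (\<sigma> u))" if "u \<in> closed_segment a' b'" for u
  using pow[OF that, of T'] 2(3)[OF that] by simp
 ultimately show "\<exists>a b \<sigma>'. closed_segment a b \<subseteq> closed_segment lo hi \<and> crosses \<sigma>' a b c'' \<and>
    (\<forall>u\<in>closed_segment a b. to_torus (\<sigma>' u) = (g ^^ (T + T')) (to_torus (\<sigma> u)) \<and>
     (\<forall>t\<le>T + T'. (t \<le> T \<longrightarrow> Tr t ((g ^^ t) (to_torus (\<sigma> u)))) \<and>
       (T \<le> t \<longrightarrow> Tr' (t - T) ((g ^^ t) (to_torus (\<sigma> u))))))"
  using 1(1) 2(1,2) by (intro exI[of _ a'] exI[of _ b'] exI[of _ \<sigma>'']) auto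
qed

lemma link_exists:
 assumes "link c T c' Tr"
 obtains z where "\<And>t. t \<le> T \<Longrightarrow> Tr t ((g ^^ t) z)"
proof -
 define \<sigma> where "\<sigma> u = (fst c - l / 2 + u * l, snd c)" for u
 have "crosses \<sigma> 0 1 c"
  unfolding crosses_def \<sigma>_def using l
  by (auto intro!: continuous_intros simp: closed_segment_eq_real_ivl abs_le_iff field_simps
    mult_left_le_one_le mult_left_le)
 then obtain a b \<sigma>' where "\<forall>u\<in>closed_segment a b. \<forall>t\<le>T. Tr t ((g ^^ t) (to_torus (\<sigma> u)))"
  using assms unfolding link_def by meson
 then show thesis
  using that[of "to_torus (\<sigma> a)"] by auto
qed

lemma link_word:
 assumes "word m X v \<rho> Q"
 shows "link (X 0) m (X m) (\<lambda>t p. dist p (to_torus (X t)) \<le> 5 * l * (\<mu> ^ (m - t) + \<mu> ^ t))"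
 unfolding link_def
proof (intro allI impI)
 fix \<sigma> lo hi assume cr: "crosses \<sigma> lo hi (X 0)"
 obtain a b where ab: "closed_segment a b \<subseteq> closed_segment lo hi" "crosses (\<lambda>u. (G ^^ m) (\<sigma> u)) a b (X m)"
  "\<And>u j. u \<in> closed_segment a b \<Longrightarrow> j \<le> m \<Longrightarrow> norm ((G ^^ j) (\<sigma> u) - X j) \<le> 5 * l * (\<mu> ^ (m - j) + \<mu> ^ j)"
  using word_crossing[OF assms cr] by metis
 have "dist ((g ^^ t) (to_torus (\<sigma> u))) (to_torus (X t)) \<le> 5 * l * (\<mu> ^ (m - t) + \<mu> ^ t)"
  if "u \<in> closed_segment a b" "t \<le> m" for u t
  using dist_to_torus_le[of "(G ^^ t) (\<sigma> u)" "X t"] ab(3)[OF that] by (simp add: to_torus_funpow dist_norm)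
 then show "\<exists>a b \<sigma>'. closed_segment a b \<subseteq> closed_segment lo hi \<and> crosses \<sigma>' a b (X m) \<and>
    (\<forall>u\<in>closed_segment a b. to_torus (\<sigma>' u) = (g ^^ m) (to_torus (\<sigma> u)) \<and>
     (\<forall>t\<le>m. dist ((g ^^ t) (to_torus (\<sigma> u))) (to_torus (X t)) \<le> 5 * l * (\<mu> ^ (m - t) + \<mu> ^ t)))"
  using ab(1,2) by (intro exI[of _ a] exI[of _ b] exI[of _ "\<lambda>u. (G ^^ m) (\<sigma> u)"]) (auto simp: to_torus_funpow)
qed

lemma r_le_l: "r \<le> l / 4"
proof -
 have "1 \<le> k * (l * l)" using l_large by (simp add: power2_eq_square)
 also have "\<dots> \<le> k * (l * 1)"
  using l_le l k by (intro mult_left_mono) auto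
 finally have "1 \<le> k * l" by simp
 have "r * 1 \<le> r * (k * l)"
  using \<open>1 \<le> k * l\<close> r by (intro mult_left_mono) auto
 also have "\<dots> = (r * k) * l" by simp
 also have "\<dots> \<le> (1 / 1000) * l"
  using r_small l by (intro mult_right_mono) auto
 finally show ?thesis using l by simp
qed

text \<open>On every interval of length \<open>l / 2\<close> the function \<open>x \<mapsto> 2 x + k sin (2 \<pi> x)\<close> oscillates by more than
 \<open>2\<close>, even near its critical points. Hence any rectangle can be followed by any abscissa \<open>t\<close>.\<close>

lemma link_step: "link c 1 (t, fst c) (\<lambda>j p. j = 1 \<longrightarrow> dist p (to_torus (t, fst c)) \<le> l)"
 unfolding link_def
proof (intro allI impI)
 fix \<sigma> lo hi assume cr: "crosses \<sigma> lo hi c"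
 have \<sigma>: "continuous_on (closed_segment lo hi) \<sigma>"
  and ex: "fst (\<sigma> lo) = fst c - l / 2" "fst (\<sigma> hi) = fst c + l / 2"
  and bd: "\<And>u. u \<in> closed_segment lo hi \<Longrightarrow> \<bar>snd (\<sigma> u) - snd c\<bar> \<le> l / 2"
  using cr by (auto simp: crosses_def)
 \<comment> \<open>Only abscissas within \<open>l / 4\<close> of the centre are used: they become
   the ordinates of the image, which must lie within \<open>l / 2\<close> after a perturbation of at
   most \<open>r \<le> l / 4\<close>.\<close>
 define \<beta> where "\<beta> = 2 * pi * (l / 4)"
 have \<beta>: "0 < \<beta>" "\<beta> \<le> 1 / 4"
 proof -
  show "0 < \<beta>" using l by (simp add: \<beta>_def)
  have "\<beta> \<le> 2 * 3.15 * ((1 / 1000000) / 4)"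
   unfolding \<beta>_def using pi_bounds l l_le by (intro mult_mono) auto
  then show "\<beta> \<le> 1 / 4" by simp
 qed
 obtain p q where pq: "p \<in> {-\<beta>, 0, \<beta>}" "q \<in> {-\<beta>, 0, \<beta>}" "p < q"
  and osc: "\<beta>\<^sup>2 / 12 \<le> \<bar>sin (2 * pi * fst c + q) - sin (2 * pi * fst c + p)\<bar>"
  using sin_oscillation[OF \<beta>] .
 define xp where "xp = fst c + p / (2 * pi)"
 define xq where "xq = fst c + q / (2 * pi)"
 have \<beta>': "\<beta> / (2 * pi) = l / 4" by (simp add: \<beta>_def)
 have x: "fst c - l / 4 \<le> xp" "xp \<le> xq" "xq \<le> fst c + l / 4"
 proof -
  have "- \<beta> / (2 * pi) \<le> p / (2 * pi)" "q / (2 * pi) \<le> \<beta> / (2 * pi)" "p / (2 * pi) \<le> q / (2 * pi)"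
   using pq \<beta> by (intro divide_right_mono; auto)+
  then show "fst c - l / 4 \<le> xp" "xp \<le> xq" "xq \<le> fst c + l / 4"
   using \<beta>' by (simp_all add: xp_def xq_def)
 qed
 have osc': "9 \<le> \<bar>k * sin (2 * pi * xq) - k * sin (2 * pi * xp)\<bar>"
 proof -
  have "k * (\<beta>\<^sup>2 / 12) = (pi * pi) / 48 * (k * l\<^sup>2)"
   by (simp add: \<beta>_def power2_eq_square)
  moreover have "9 / 48 * 1000 \<le> (pi * pi) / 48 * (k * l\<^sup>2)"
  proof -
   have "3 * 3 \<le> pi * pi" using pi_bounds by (intro mult_mono) auto
   then show ?thesis using l_large by (intro mult_mono) auto
  qed
  moreover have "k * (\<beta>\<^sup>2 / 12) \<le> k * \<bar>sin (2 * pi * xq) - sin (2 * pi * xp)\<bar>"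
   using osc k by (intro mult_left_mono) (auto simp: xp_def xq_def distrib_left)
  moreover have "k * \<bar>sin (2 * pi * xq) - sin (2 * pi * xp)\<bar> = \<bar>k * sin (2 * pi * xq) - k * sin (2 * pi * xp)\<bar>"
   using k by (simp add: right_diff_distrib[symmetric] abs_mult)
  ultimately show ?thesis by linarith
 qed
 have "continuous_on (closed_segment lo hi) (\<lambda>u. fst (\<sigma> u))"
  by (intro continuous_intros \<sigma>)
 moreover have "fst (\<sigma> lo) \<le> xp" "xq \<le> fst (\<sigma> hi)"
  using ex x l by auto
 ultimately obtain a b where ab: "closed_segment a b \<subseteq> closed_segment lo hi" "fst (\<sigma> a) = xp" "fst (\<sigma> b) = xq"
  "\<And>u. u \<in> closed_segment a b \<Longrightarrow> xp \<le> fst (\<sigma> u) \<and> fst (\<sigma> u) \<le> xq"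
  using path_cut[of lo hi "\<lambda>u. fst (\<sigma> u)" xp xq] x(2) by metis
 have G1: "fst (G (\<sigma> u)) = 2 * fst (\<sigma> u) - snd (\<sigma> u) + k * sin (2 * pi * fst (\<sigma> u)) + fst (E (\<sigma> u))"
  and G2: "snd (G (\<sigma> u)) = fst (\<sigma> u) + snd (E (\<sigma> u))" for u
  by (simp_all add: G_eq standard_lift_def case_prod_unfold)
 have Er: "\<bar>fst (E p)\<bar> \<le> r" "\<bar>snd (E p)\<bar> \<le> r" for p
  using E_le[of p] abs_fst_le_norm[of "E p"] abs_snd_le_norm[of "E p"] by linarith+
 have diff: "4 \<le> \<bar>fst (G (\<sigma> b)) - fst (G (\<sigma> a))\<bar>"
 proof -
  have ab': "a \<in> closed_segment lo hi" "b \<in> closed_segment lo hi" using ab(1) by auto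
  have "\<bar>snd (\<sigma> b) - snd (\<sigma> a)\<bar> \<le> l"
   using bd[OF ab'(1)] bd[OF ab'(2)] by linarith
  moreover have "\<bar>2 * xq - 2 * xp\<bar> \<le> l"
   using x by linarith
  ultimately show ?thesis
   using osc' Er(1)[of "\<sigma> a"] Er(1)[of "\<sigma> b"] r_le_l l_le unfolding G1 ab(2,3) by linarith
 qed
 define M where "M = min (fst (G (\<sigma> a))) (fst (G (\<sigma> b)))"
 \<comment> \<open>The image spans an interval of length at least 4, so it contains an integer
   translate of the interval of length \<open>l\<close> about \<open>t\<close>.\<close>
 define j where "j = \<lceil>M + l / 2 - t\<rceil>"
 have j: "M \<le> t + of_int j - l / 2" "t + of_int j + l / 2 \<le> M + 4"
  using ceiling_correct[of "M + l / 2 - t"] l_le unfolding j_def[symmetric] by linarith+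
 define \<sigma>' where "\<sigma>' u = G (\<sigma> u) - (of_int j, 0)" for u
 have c': "continuous_on (closed_segment a b) \<sigma>'"
  unfolding \<sigma>'_def using continuous_on_subset[OF \<sigma> ab(1)]
  by (intro continuous_intros continuous_on_compose2[OF continuous_on_G[of UNIV]]) auto
 have ends: "fst (\<sigma>' a) \<le> fst (t, fst c) - l / 2 \<and> fst (t, fst c) + l / 2 \<le> fst (\<sigma>' b) \<or>
   fst (\<sigma>' b) \<le> fst (t, fst c) - l / 2 \<and> fst (t, fst c) + l / 2 \<le> fst (\<sigma>' a)"
  using diff j by (auto simp: \<sigma>'_def M_def min_def abs_if split: if_splits)
 have y: "\<bar>snd (\<sigma>' u) - snd (t, fst c)\<bar> \<le> l / 2" if "u \<in> closed_segment a b" for u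
  using ab(4)[OF that] x Er(2)[of "\<sigma> u"] r_le_l unfolding \<sigma>'_def snd_diff snd_conv G2 by linarith
 obtain a' b' where a'b': "closed_segment a' b' \<subseteq> closed_segment a b" "crosses \<sigma>' a' b' (t, fst c)"
  using crossesI_cut[OF c' ends y] by metis
 have tor: "to_torus (\<sigma>' u) = g (to_torus (\<sigma> u))" for u
  unfolding \<sigma>'_def by (subst to_torus_diff_lattice) (auto simp: int_lattice_def lift)
 have "dist (g (to_torus (\<sigma> u))) (to_torus (t, fst c)) \<le> l" if "u \<in> closed_segment a' b'" for u
 proof -
  have "dist (g (to_torus (\<sigma> u))) (to_torus (t, fst c)) \<le> norm (\<sigma>' u - (t, fst c))"
   using dist_to_torus_le[of "\<sigma>' u" "(t, fst c)"] by (simp add: tor dist_norm)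
  also have "\<dots> \<le> \<bar>fst (\<sigma>' u) - t\<bar> + \<bar>snd (\<sigma>' u) - fst c\<bar>"
   using norm_le_abs_add[of "\<sigma>' u - (t, fst c)"] by simp
  also have "\<dots> \<le> l / 2 + l / 2"
   using a'b'(2) that by (intro add_mono) (auto simp: crosses_def)
  finally show ?thesis by simp
 qed
 then show "\<exists>a b \<sigma>'. closed_segment a b \<subseteq> closed_segment lo hi \<and> crosses \<sigma>' a b (t, fst c) \<and>
    (\<forall>u\<in>closed_segment a b. to_torus (\<sigma>' u) = (g ^^ 1) (to_torus (\<sigma> u)) \<and>
     (\<forall>j\<le>1. j = 1 \<longrightarrow> dist ((g ^^ j) (to_torus (\<sigma> u))) (to_torus (t, fst c)) \<le> l))"
  using a'b' ab(1) tor by (intro exI[of _ a'] exI[of _ b'] exI[of _ \<sigma>']) auto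
qed

text \<open>In each step the new abscissa is free and the new ordinate is the old abscissa. Steering
  the abscissa to \<open>snd b\<close> and then to \<open>fst b\<close> reaches \<open>b\<close>
  after two steps, and \<open>snd c\<close>, \<open>fst c\<close> lead back in two more.\<close>

lemma link_loop: "link c 4 c (\<lambda>j p. j = 2 \<longrightarrow> dist p (to_torus b) \<le> l)"
proof -
 have "link c (1 + (1 + (1 + 1))) c (\<lambda>j p. j = 2 \<longrightarrow> dist p (to_torus b) \<le> l)"
 proof (rule link_mono)
  have 1: "link c 1 (snd b, fst c) (\<lambda>j p. j = 1 \<longrightarrow> dist p (to_torus (snd b, fst c)) \<le> l)"
   by (rule link_step)
  have 2: "link (snd b, fst c) 1 b (\<lambda>j p. j = 1 \<longrightarrow> dist p (to_torus b) \<le> l)"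
   using link_step[of "(snd b, fst c)" "fst b"] by simp
  have 3: "link b 1 (snd c, fst b) (\<lambda>j p. j = 1 \<longrightarrow> dist p (to_torus (snd c, fst b)) \<le> l)"
   by (rule link_step)
  have 4: "link (snd c, fst b) 1 c (\<lambda>j p. j = 1 \<longrightarrow> dist p (to_torus c) \<le> l)"
   using link_step[of "(snd c, fst b)" "fst c"] by simp
  show "link c (1 + (1 + (1 + 1))) c
   (\<lambda>t p. (t \<le> 1 \<longrightarrow> (t = 1 \<longrightarrow> dist p (to_torus (snd b, fst c)) \<le> l)) \<and>
     (1 \<le> t \<longrightarrow> (t - 1 \<le> 1 \<longrightarrow> (t - 1 = 1 \<longrightarrow> dist p (to_torus b) \<le> l)) \<and>
      (1 \<le> t - 1 \<longrightarrow> (t - 1 - 1 \<le> 1 \<longrightarrow> (t - 1 - 1 = 1 \<longrightarrow> dist p (to_torus (snd c, fst b)) \<le> l)) \<and>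
       (1 \<le> t - 1 - 1 \<longrightarrow> t - 1 - 1 - 1 = 1 \<longrightarrow> dist p (to_torus c) \<le> l))))"
   by (rule link_trans[OF 1 link_trans[OF 2 link_trans[OF 3 4]]])
 qed auto
 then show ?thesis by (simp add: numeral_eq_Suc)
qed

text \<open>Words are required between any two of the times, not only between neighbours, so that
  detours can be inserted at an arbitrary subset of \<open>H\<close>.\<close>

definition hyperbolic_times :: "(nat \<Rightarrow> real \<times> real) \<Rightarrow> nat set \<Rightarrow> bool" where
 "hyperbolic_times X H \<longleftrightarrow> (\<forall>i. X (Suc i) = G (X i)) \<and>
   (\<forall>p\<in>H. \<forall>q\<in>H. p < q \<longrightarrow> (\<exists>v \<rho> Q. word (q - p) (\<lambda>i. X (p + i)) v \<rho> Q))"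

text \<open>Time at which the orbit with a detour of length \<open>4\<close> inserted at every \<open>s \<in> A\<close> reaches \<open>X i\<close>.\<close>

definition arrival :: "nat set \<Rightarrow> nat \<Rightarrow> nat \<Rightarrow> nat" where
 "arrival A n0 i = i - n0 + 4 * card {s \<in> A. s < i}"

lemma link_hyperbolic_times:
 assumes X: "hyperbolic_times X H" and pq: "p \<in> H" "q \<in> H" "p < q"
 shows "link (X p) (q - p) (X q) (\<lambda>t z. \<forall>d. d \<le> t \<longrightarrow> d + t \<le> q - p \<longrightarrow> dist z (to_torus (X (p + t))) \<le> 10 * l * \<mu> ^ d)"
proof -
 obtain v \<rho> Q where w: "word (q - p) (\<lambda>i. X (p + i)) v \<rho> Q"
  using X pq unfolding hyperbolic_times_def by blast
 have "link (X (p + 0)) (q - p) (X (p + (q - p))) (\<lambda>t z. dist z (to_torus (X (p + t))) \<le> 5 * l * (\<mu> ^ (q - p - t) + \<mu> ^ t))"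
  by (rule link_word[OF w])
 then have "link (X p) (q - p) (X q) (\<lambda>t z. dist z (to_torus (X (p + t))) \<le> 5 * l * (\<mu> ^ (q - p - t) + \<mu> ^ t))"
  using pq by simp
 then show ?thesis
 proof (rule link_mono, intro allI impI)
  fix t z d assume *: "dist z (to_torus (X (p + t))) \<le> 5 * l * (\<mu> ^ (q - p - t) + \<mu> ^ t)" "d \<le> t" "d + t \<le> q - p"
  have "\<mu> ^ (q - p - t) \<le> \<mu> ^ d" "\<mu> ^ t \<le> \<mu> ^ d"
   using mu * by (auto intro!: power_decreasing)
  then have "5 * l * (\<mu> ^ (q - p - t) + \<mu> ^ t) \<le> 5 * l * (\<mu> ^ d + \<mu> ^ d)"
   using l by (intro mult_left_mono add_mono) auto
  then show "dist z (to_torus (X (p + t))) \<le> 10 * l * \<mu> ^ d"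
   using *(1) by simp
 qed
qed

text \<open>\<open>d\<close> is any lower bound for the distance in time from \<open>i\<close> to
  the two ends and to all cuts. A detour is at \<open>b\<close> two steps after its cut, halfway
  through the loop.\<close>

definition tracks :: "(nat \<Rightarrow> real \<times> real) \<Rightarrow> nat set \<Rightarrow> nat \<Rightarrow> nat \<Rightarrow> real \<times> real \<Rightarrow> nat \<Rightarrow> torus \<Rightarrow> bool" where
 "tracks X A n0 e b t z \<longleftrightarrow>
   (\<forall>i d. n0 \<le> i \<longrightarrow> i \<le> e \<longrightarrow> t = arrival A n0 i \<longrightarrow> (\<forall>s\<in>insert n0 (insert e A). d + i \<le> s \<or> d + s \<le> i) \<longrightarrow>
    dist z (to_torus (X i)) \<le> 10 * l * \<mu> ^ d) \<and>
   (\<forall>s\<in>A. t = arrival A n0 s + 2 \<longrightarrow> dist z (to_torus b) \<le> l)"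

text \<open>Cuts are added in increasing order: after the last cut \<open>M\<close> there follow one
  loop and a single word from \<open>M\<close> to \<open>e\<close>, which contains no further
  cut.\<close>

lemma link_with_detours:
 assumes X: "hyperbolic_times X H" and n0: "n0 \<in> H" and A: "finite A" "A \<subseteq> H"
  and e: "e \<in> H" "n0 < e" and Ae: "\<forall>s\<in>A. n0 < s \<and> s < e"
 shows "link (X n0) (e - n0 + 4 * card A) (X e) (tracks X A n0 e b)"
 using A e Ae
proof (induction A arbitrary: e rule: finite_linorder_max_induct)
 case empty
 show ?case
 proof (rule link_mono)
  show "link (X n0) (e - n0 + 4 * card {}) (X e)
    (\<lambda>t z. \<forall>d. d \<le> t \<longrightarrow> d + t \<le> e - n0 \<longrightarrow> dist z (to_torus (X (n0 + t))) \<le> 10 * l * \<mu> ^ d)"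
   using link_hyperbolic_times[OF X n0 empty(2,3)] by simp
  fix t z assume *: "\<forall>d. d \<le> t \<longrightarrow> d + t \<le> e - n0 \<longrightarrow> dist z (to_torus (X (n0 + t))) \<le> 10 * l * \<mu> ^ d"
  show "tracks X {} n0 e b t z"
   unfolding tracks_def
  proof (intro conjI allI impI ballI)
   fix i d assume i: "n0 \<le> i" "i \<le> e" "t = arrival {} n0 i" and d: "\<forall>s\<in>insert n0 (insert e {}). d + i \<le> s \<or> d + s \<le> i"
   have t: "t = i - n0" using i by (simp add: arrival_def)
   have "d \<le> t" "d + t \<le> e - n0"
    using d i t by auto
   then show "dist z (to_torus (X i)) \<le> 10 * l * \<mu> ^ d"
    using *[rule_format, of d] t i by simp
  qed auto
 qed
next
 case (insert M A)
 have M: "M \<in> H" "n0 < M" "M < e" and MA: "\<forall>s\<in>A. n0 < s \<and> s < M" "M \<notin> A"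
  using insert by auto
 let ?T1 = "M - n0 + 4 * card A"
 have 1: "link (X n0) ?T1 (X M) (tracks X A n0 M b)"
  using insert.IH[of M] insert.prems M MA by auto
 have 2: "link (X M) (4 + (e - M)) (X e)
  (\<lambda>t z. (t \<le> 4 \<longrightarrow> (t = 2 \<longrightarrow> dist z (to_torus b) \<le> l)) \<and>
    (4 \<le> t \<longrightarrow> (\<forall>d. d \<le> t - 4 \<longrightarrow> d + (t - 4) \<le> e - M \<longrightarrow> dist z (to_torus (X (M + (t - 4)))) \<le> 10 * l * \<mu> ^ d)))"
  by (rule link_trans[OF link_loop link_hyperbolic_times[OF X M(1) insert.prems(2) M(3)]])
 have T: "?T1 + (4 + (e - M)) = e - n0 + 4 * card (insert M A)"
  using M MA insert.hyps(1) by simp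
 have cardM: "{s \<in> insert M A. s < i} = (if i \<le> M then {s \<in> A. s < i} else insert M A)" for i
  using MA by auto
 \<comment> \<open>\<open>arrival\<close> counts the cuts strictly before \<open>i\<close>, so the
   cut \<open>M\<close> itself is reached before its own detour.\<close>
 have arr1: "arrival (insert M A) n0 i = arrival A n0 i" if "i \<le> M" for i
  by (simp only: arrival_def cardM that if_True)
 have arr2: "arrival (insert M A) n0 i = ?T1 + 4 + (i - M)" if "M < i" for i
  unfolding arrival_def cardM using that M MA insert.hyps(1) by simp
 have arr3: "arrival A n0 i \<le> ?T1" if "i \<le> M" for i
  unfolding arrival_def using that insert.hyps(1) by (intro add_mono diff_le_mono mult_le_mono card_mono) auto
 have arrM: "arrival A n0 M = ?T1"
 proof -
  have "{s \<in> A. s < M} = A" using MA by auto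
  then show ?thesis by (simp add: arrival_def)
 qed
 show ?case
  unfolding T[symmetric]
 proof (rule link_mono[OF link_trans[OF 1 2]])
  fix t z
  assume *: "(t \<le> ?T1 \<longrightarrow> tracks X A n0 M b t z) \<and>
    (?T1 \<le> t \<longrightarrow> (t - ?T1 \<le> 4 \<longrightarrow> t - ?T1 = 2 \<longrightarrow> dist z (to_torus b) \<le> l) \<and>
    (4 \<le> t - ?T1 \<longrightarrow> (\<forall>d\<le>t - ?T1 - 4. d + (t - ?T1 - 4) \<le> e - M \<longrightarrow> dist z (to_torus (X (M + (t - ?T1 - 4)))) \<le> 10 * l * \<mu> ^ d)))"
  show "tracks X (insert M A) n0 e b t z"
   unfolding tracks_def
  proof (intro conjI allI impI ballI)
   fix i d assume i: "n0 \<le> i" "i \<le> e" "t = arrival (insert M A) n0 i"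
    and d: "\<forall>s\<in>insert n0 (insert e (insert M A)). d + i \<le> s \<or> d + s \<le> i"
   show "dist z (to_torus (X i)) \<le> 10 * l * \<mu> ^ d"
   proof (cases "i \<le> M")
    case True
    then have "tracks X A n0 M b t z" "t = arrival A n0 i"
     using * i arr1 arr3 by auto
    then show ?thesis
     using i d True unfolding tracks_def by auto
   next
    case False
    then have t: "t = ?T1 + 4 + (i - M)"
     using i arr2 by simp
    have "d \<le> i - M" "d + (i - M) \<le> e - M"
     using d False i by auto
    then show ?thesis
     using * t False by auto
   qed
  next
   fix s assume s: "s \<in> insert M A" "t = arrival (insert M A) n0 s + 2"
   show "dist z (to_torus b) \<le> l"
   proof (cases "s = M")
    case True
    then have "t = ?T1 + 2" using s arr1[of M] arrM by simp
    then show ?thesis using * by auto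
   next
    case False
    then have sA: "s \<in> A" "s < M" using s MA by auto
    have "card {s' \<in> A. s' < s} < card A"
     using sA insert.hyps(1) by (intro psubset_card_mono) auto
    then have "arrival A n0 s + 2 \<le> ?T1"
     unfolding arrival_def using sA MA by auto
    then have "tracks X A n0 M b t z" "t = arrival A n0 s + 2"
     using * s arr1[of s] sA by auto
    then show ?thesis
     using sA unfolding tracks_def by auto
   qed
  qed
 qed
qed

lemma exists_orbit_with_detours:
 assumes X: "hyperbolic_times X H" and n0: "n0 \<in> H" and A: "finite A" "A \<subseteq> H"
  and e: "e \<in> H" "n0 < e" and Ae: "\<forall>s\<in>A. n0 < s \<and> s < e"
 obtains z where "\<And>i d. n0 \<le> i \<Longrightarrow> i \<le> e \<Longrightarrow> (\<forall>s\<in>insert n0 (insert e A). d + i \<le> s \<or> d + s \<le> i) \<Longrightarrow>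
    dist ((g ^^ arrival A n0 i) z) (to_torus (X i)) \<le> 10 * l * \<mu> ^ d"
  "\<And>s. s \<in> A \<Longrightarrow> dist ((g ^^ (arrival A n0 s + 2)) z) (to_torus b) \<le> l"
proof -
 obtain z where z: "\<And>t. t \<le> e - n0 + 4 * card A \<Longrightarrow> tracks X A n0 e b t ((g ^^ t) z)"
  using link_exists[OF link_with_detours[OF assms, of b]] by blast
 have arr: "arrival A n0 i \<le> e - n0 + 4 * card A" if "i \<le> e" for i
  unfolding arrival_def using that A(1) by (intro add_mono diff_le_mono mult_le_mono card_mono) auto
 show thesis
 proof (rule that[of z])
  show "dist ((g ^^ arrival A n0 i) z) (to_torus (X i)) \<le> 10 * l * \<mu> ^ d"
   if "n0 \<le> i" "i \<le> e" "\<forall>s\<in>insert n0 (insert e A). d + i \<le> s \<or> d + s \<le> i" for i d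
   using z[OF arr[OF that(2)]] that unfolding tracks_def by blast
  fix s assume s: "s \<in> A"
  have "card {s' \<in> A. s' < s} < card A"
   using s A(1) by (intro psubset_card_mono) auto
  then have "arrival A n0 s + 2 \<le> e - n0 + 4 * card A"
   unfolding arrival_def using s Ae by fastforce
  from z[OF this] show "dist ((g ^^ (arrival A n0 s + 2)) z) (to_torus b) \<le> l"
   using s unfolding tracks_def by blast
 qed
qed

end

section \<open>Hyperbolic times\<close>

text \<open>A bad time ends an interval on which the mean of \<open>a\<close> exceeds
  \<open>\<theta>\<close>. If \<open>N\<close> is bad, the interval that ends there contains at most
  as many bad times as its sum divided by \<open>\<theta>\<close>, and the induction continues at
  its left end; otherwise it continues at \<open>N - 1\<close>.\<close>

lemma pliss:
 fixes a :: "nat \<Rightarrow> real"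
 assumes a: "\<And>i. i < N \<Longrightarrow> 0 \<le> a i" and \<theta>: "0 < \<theta>"
 shows "\<theta> * card {n \<in> {1..N}. \<exists>j<n. \<theta> * real (n - j) < sum a {j..<n}} \<le> sum a {..<N}"
 using a
proof (induction N rule: less_induct)
 case (less N)
 define B where "B N = {n \<in> {1..N}. \<exists>j<n. \<theta> * real (n - j) < sum a {j..<n}}" for N
 show ?case
 proof (cases "N \<in> B N")
  case True
  then obtain j where j: "j < N" "\<theta> * real (N - j) < sum a {j..<N}"
   by (auto simp: B_def)
  have "B N \<subseteq> B j \<union> {j<..N}"
   by (auto simp: B_def)
  then have "card (B N) \<le> card (B j \<union> {j<..N})"
   by (intro card_mono) (auto simp: B_def)
  also have "\<dots> \<le> card (B j) + (N - j)"
   using card_Un_le[of "B j" "{j<..N}"] by simp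
  finally have "\<theta> * card (B N) \<le> \<theta> * (real (card (B j)) + real (N - j))"
   using \<theta> by (intro mult_left_mono) (simp_all add: of_nat_add[symmetric] del: of_nat_add)
  also have "\<dots> \<le> sum a {..<j} + sum a {j..<N}"
   using less.IH[OF j(1)] less.prems j by (simp add: B_def algebra_simps)
  also have "\<dots> = sum a {..<N}"
   using j(1) by (metis less_imp_le_nat lessThan_atLeast0 sum.atLeastLessThan_concat zero_le)
  finally show ?thesis by (simp add: B_def)
 next
  case False
  show ?thesis
  proof (cases N)
   case (Suc M)
   have "B N \<subseteq> B M"
   proof
    fix n assume n: "n \<in> B N"
    then have "n \<noteq> N" using False by auto
    with n show "n \<in> B M" by (auto simp: B_def Suc)
   qed
   then have "\<theta> * card (B N) \<le> \<theta> * card (B M)"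
    using \<theta> by (intro mult_left_mono) (auto intro!: card_mono simp: B_def)
   also have "\<dots> \<le> sum a {..<M}"
    using less.IH[of M] less.prems by (simp add: B_def Suc)
   also have "\<dots> \<le> sum a {..<N}"
    using less.prems by (simp add: Suc)
   finally show ?thesis by (simp add: B_def)
  qed simp
 qed
qed

text \<open>The time reversal \<open>i \<mapsto> N - Suc i\<close> of \<open>pliss\<close>, for
  intervals that begin at a bad time.\<close>

lemma pliss_backward:
 fixes b :: "nat \<Rightarrow> real"
 assumes b: "\<And>i. i < N \<Longrightarrow> 0 \<le> b i" and \<theta>: "0 < \<theta>"
 shows "\<theta> * card {n \<in> {..<N}. \<exists>j. n < j \<and> j \<le> N \<and> \<theta> * real (j - n) < sum b {n..<j}} \<le> sum b {..<N}"
proof -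
 define a where "a i = b (N - Suc i)" for i
 have sums: "sum a {j..<n} = sum b {N - n..<N - j}" if "j \<le> n" "n \<le> N" for j n
  unfolding a_def
  by (rule sum.reindex_bij_witness[of _ "\<lambda>i. N - Suc i" "\<lambda>i. N - Suc i"]) (use that in auto)
 let ?A = "{n \<in> {1..N}. \<exists>j<n. \<theta> * real (n - j) < sum a {j..<n}}"
 let ?B = "{n \<in> {..<N}. \<exists>j. n < j \<and> j \<le> N \<and> \<theta> * real (j - n) < sum b {n..<j}}"
 have "?B \<subseteq> (\<lambda>n. N - n) ` ?A"
 proof
  fix n assume "n \<in> ?B"
  then obtain j where j: "n < N" "n < j" "j \<le> N" "\<theta> * real (j - n) < sum b {n..<j}" by auto
  have "sum a {N - j..<N - n} = sum b {n..<j}"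
   using sums[of "N - j" "N - n"] j by simp
  then have "N - n \<in> ?A"
   using j by (auto intro!: exI[of _ "N - j"])
  then show "n \<in> (\<lambda>n. N - n) ` ?A"
   using j by (intro image_eqI[of _ _ "N - n"]) auto
 qed
 then have "card ?B \<le> card ?A"
  by (intro order_trans[OF card_mono card_image_le]) auto
 then have "\<theta> * card ?B \<le> \<theta> * card ?A"
  using \<theta> by (intro mult_left_mono) auto
 also have "\<dots> \<le> sum a {..<N}"
  using b by (intro pliss \<theta>) (auto simp: a_def)
 also have "\<dots> = sum b {..<N}"
  using sums[of 0 N] by (simp add: lessThan_atLeast0)
 finally show ?thesis .
qed

context near_standard
begin

primrec Dn :: "nat \<Rightarrow> real \<times> real \<Rightarrow> real \<times> real \<Rightarrow> real \<times> real" where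
 "Dn 0 p \<xi> = \<xi>"
| "Dn (Suc n) p \<xi> = D ((G ^^ n) p) (Dn n p \<xi>)"

end

context shadowing
begin

text \<open>The loss of expansion against \<open>ln L\<close> is nonnegative at each step, for the
  vector pushed forward and for a covector pulled back. Both total losses are at most
  \<open>C * n\<close>, the second because the pairing of covector and vector is constant. Pliss'
  lemma, forward for the vector and backward for the covector, bounds the times that are bad for
  either.\<close>

lemma exists_hyperbolic_times:
 fixes C \<theta> :: real
 assumes \<theta>: "0 < \<theta>" "\<tau> = exp \<theta>" and \<xi>: "norm \<xi> = 1" and big: "(L * exp (- C)) ^ n \<le> norm (Dn n p \<xi>)"
 obtains H where "H \<subseteq> {0<..<n}" "hyperbolic_times (\<lambda>i. (G ^^ i) p) H" "card ({..n} - H) \<le> 2 * C * n / \<theta> + 2"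
proof -
 define X where "X i = (G ^^ i) p" for i
 have XS: "X (Suc i) = G (X i)" for i by (simp add: X_def)
 define v where "v i = Dn i p \<xi>" for i
 have vS: "v (Suc i) = D (X i) (v i)" for i by (simp add: v_def X_def)
 have v0: "norm (v 0) = 1" by (simp add: v_def \<xi>)
 define Q where "Q = norm (v n)"
 have "0 < (L * exp (- C)) ^ n"
  using L_pos by simp
 then have Q0: "Q > 0"
  using big unfolding Q_def v_def by linarith
 \<comment> \<open>The covector starts at time \<open>n\<close> in the direction of
   \<open>v n\<close>, normalised so that it pairs with \<open>v n\<close> to \<open>Q\<close>;
   \<open>\<rho>'\<close> counts time backwards from \<open>n\<close>.\<close>
 define \<rho>' where "\<rho>' = rec_nat (v n /\<^sub>R Q) (\<lambda>j w. Dt (X (n - Suc j)) w)"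
 define \<rho> where "\<rho> i = \<rho>' (n - i)" for i
 have \<rho>n: "\<rho> n = v n /\<^sub>R Q"
  by (simp add: \<rho>_def \<rho>'_def)
 have \<rho>S: "\<rho> i = Dt (X i) (\<rho> (Suc i))" if "i < n" for i
 proof -
  have "n - i = Suc (n - Suc i)" using that by simp
  then show ?thesis using that by (simp add: \<rho>_def \<rho>'_def)
 qed
 have norm\<rho>n: "norm (\<rho> n) = 1"
  using Q0 by (simp add: \<rho>n Q_def)
 have inQ: "inner (\<rho> i) (v i) = Q" if "i \<le> n" for i
  using that
 proof (induction i rule: inc_induct)
  case base
  show ?case using Q0 by (simp add: \<rho>n Q_def dot_square_norm power2_eq_square)
 next
  case (step i)
  then show ?case
   using \<rho>S[of i] vS[of i] by (simp add: inner_Dt)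
 qed
 have pos: "norm (v i) > 0" "norm (\<rho> i) > 0" if "i \<le> n" for i
  using inQ[OF that] Q0 by auto
 define a where "a i = ln L - (ln (norm (v (Suc i))) - ln (norm (v i)))" for i
 define b where "b i = ln L - (ln (norm (\<rho> i)) - ln (norm (\<rho> (Suc i))))" for i
 have a0: "0 \<le> a i" if "i < n" for i
 proof -
  have "ln (norm (v (Suc i))) \<le> ln (L * norm (v i))"
   using norm_D_le[of "X i" "v i"] pos[of i] pos[of "Suc i"] that L_pos unfolding vS by (subst ln_le_cancel_iff) (auto simp: vS)
  then show ?thesis
   using pos[of i] that L_pos by (simp add: a_def ln_mult)
 qed
 have b0: "0 \<le> b i" if "i < n" for i
 proof -
  have "ln (norm (\<rho> i)) \<le> ln (L * norm (\<rho> (Suc i)))"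
   using norm_Dt_le[of "X i" "\<rho> (Suc i)"] pos[of i] pos[of "Suc i"] that L_pos \<rho>S[OF that] by (subst ln_le_cancel_iff) auto
  then show ?thesis
   using pos[of "Suc i"] that L_pos by (simp add: b_def ln_mult)
 qed
 have suma: "sum a {j..<m} = real (m - j) * ln L - (ln (norm (v m)) - ln (norm (v j)))" if "j \<le> m" for j m
  using sum_Suc_diff'[OF that, of "\<lambda>i. ln (norm (v i))"] by (simp add: a_def sum_subtractf)
 have sumb: "sum b {j..<m} = real (m - j) * ln L - (ln (norm (\<rho> j)) - ln (norm (\<rho> m)))" if "j \<le> m" for j m
  using sum_Suc_diff'[OF that, of "\<lambda>i. - ln (norm (\<rho> i))"] by (simp add: b_def sum_subtractf)
 have lnQ: "real n * ln L - ln Q \<le> C * n"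
 proof -
  have "ln ((L * exp (- C)) ^ n) \<le> ln Q"
   using big \<open>0 < (L * exp (- C)) ^ n\<close> Q0 unfolding Q_def v_def by (subst ln_le_cancel_iff) auto
  then show ?thesis
   using L_pos by (simp add: ln_realpow ln_mult algebra_simps)
 qed
 have sa: "sum a {..<n} \<le> C * n"
  using suma[of 0 n] lnQ v0 by (simp add: lessThan_atLeast0 Q_def)
 have sb: "sum b {..<n} \<le> C * n"
 proof -
  have "Q \<le> norm (\<rho> 0)"
   using norm_cauchy_schwarz[of "\<rho> 0" "v 0"] inQ[of 0] v0 by simp
  then have "ln Q \<le> ln (norm (\<rho> 0))"
   using Q0 pos[of 0] by (subst ln_le_cancel_iff) auto
  then show ?thesis
   using sumb[of 0 n] lnQ norm\<rho>n by (simp add: lessThan_atLeast0)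
 qed
 define Ba where "Ba = {m \<in> {1..n}. \<exists>j<m. \<theta> * real (m - j) < sum a {j..<m}}"
 define Bb where "Bb = {m \<in> {..<n}. \<exists>j. m < j \<and> j \<le> n \<and> \<theta> * real (j - m) < sum b {m..<j}}"
 have Ba: "\<theta> * card Ba \<le> C * n"
  using pliss[of n a \<theta>] a0 \<theta> sa unfolding Ba_def by fastforce
 have Bb: "\<theta> * card Bb \<le> C * n"
  using pliss_backward[of n b \<theta>] b0 \<theta> sb unfolding Bb_def by fastforce
 \<comment> \<open>Times 0 and \<open>n\<close> are left out, so that a hyperbolic time has a
   predecessor and a successor; the slopes of \<open>v\<close> and \<open>\<rho>\<close> are
   estimated from these.\<close>
 define H where "H = {0<..<n} - (Ba \<union> Bb)"
 have \<mu>2: "\<mu> / 2 = exp \<theta> / L"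
  unfolding \<mu>_def by (simp only: \<theta>(2)) simp
 have ln\<mu>: "ln (\<mu> / 2) = \<theta> - ln L"
  using L_pos unfolding \<mu>2 by (simp add: ln_div)
 have \<mu>pos: "\<mu> / 2 > 0" using mu by simp
 have Hv: "norm (v j) \<le> norm (v m) * (\<mu> / 2) ^ (m - j)" if "m \<in> H" "j \<le> m" for j m
 proof (cases "j = m")
  case False
  then have j: "j < m" "m \<in> {1..n}" "m \<notin> Ba"
   using that by (auto simp: H_def)
  then have "\<not> \<theta> * real (m - j) < sum a {j..<m}"
   unfolding Ba_def by blast
  then have "ln (norm (v j)) \<le> ln (norm (v m)) + real (m - j) * ln (\<mu> / 2)"
   using suma[OF that(2)] unfolding ln\<mu> right_diff_distrib by (simp only: mult.commute)
  also have "\<dots> = ln (norm (v m) * (\<mu> / 2) ^ (m - j))"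
   using pos[of m] j \<mu>pos by (simp add: ln_mult ln_realpow)
  finally show ?thesis
   using pos[of m] pos[of j] j \<mu>pos by (subst (asm) ln_le_cancel_iff) auto
 qed simp
 have H\<rho>: "norm (\<rho> j) \<le> norm (\<rho> m) * (\<mu> / 2) ^ (j - m)" if "m \<in> H" "m \<le> j" "j \<le> n" for j m
 proof (cases "j = m")
  case False
  then have j: "m < j" "m \<in> {..<n}" "m \<notin> Bb"
   using that by (auto simp: H_def)
  then have "\<not> \<theta> * real (j - m) < sum b {m..<j}"
   using that unfolding Bb_def by blast
  then have "ln (norm (\<rho> j)) \<le> ln (norm (\<rho> m)) + real (j - m) * ln (\<mu> / 2)"
   using sumb[OF that(2)] unfolding ln\<mu> right_diff_distrib by (simp only: mult.commute)
  also have "\<dots> = ln (norm (\<rho> m) * (\<mu> / 2) ^ (j - m))"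
   using pos[of m] j \<mu>pos by (simp add: ln_mult ln_realpow)
  finally show ?thesis
   using pos[of m] pos[of j] j that \<mu>pos by (subst (asm) ln_le_cancel_iff) auto
 qed simp
 have sndv: "\<bar>snd (v m)\<bar> \<le> \<mu> * norm (v m)" if m: "m \<in> H" for m
 proof -
  have m0: "0 < m" using m by (auto simp: H_def)
  then have "\<bar>snd (v m)\<bar> \<le> 2 * norm (v (m - 1))"
   using D_snd_le2[of "X (m - 1)" "v (m - 1)"] vS[of "m - 1"] by simp
  also have "\<dots> \<le> 2 * (norm (v m) * (\<mu> / 2))"
   using Hv[OF m, of "m - 1"] m0 by simp
  finally show ?thesis by (simp add: mult.commute)
 qed
 have snd\<rho>: "\<bar>snd (\<rho> m)\<bar> \<le> \<mu> * norm (\<rho> m)" if m: "m \<in> H" for m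
 proof -
  have m0: "m < n" using m by (auto simp: H_def)
  then have "\<bar>snd (\<rho> m)\<bar> \<le> 2 * norm (\<rho> (Suc m))"
   using Dt_snd_le2[of "X m" "\<rho> (Suc m)"] \<rho>S[of m] by simp
  also have "\<dots> \<le> 2 * (norm (\<rho> m) * (\<mu> / 2))"
   using H\<rho>[OF m, of "Suc m"] m0 by simp
  finally show ?thesis by (simp add: mult.commute)
 qed
 \<comment> \<open>At a hyperbolic time vector and covector are both nearly horizontal, so their
   pairing is comparable with the product of the norms. This turns growth relative to
   \<open>v m\<close> and \<open>\<rho> m\<close> into bounds in terms of \<open>Q\<close>.\<close>
 have HQ: "norm (v m) * norm (\<rho> m) \<le> 2 * Q" if m: "m \<in> H" for m
 proof -
  have mn: "m \<le> n" using m by (auto simp: H_def)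
  define V where "V = norm (v m)"
  define R where "R = norm (\<rho> m)"
  have fv: "\<bar>fst (v m)\<bar> \<ge> V * (1 - \<mu>)"
   using norm_le_abs_add[of "v m"] sndv[OF m] by (simp add: V_def algebra_simps)
  have f\<rho>: "\<bar>fst (\<rho> m)\<bar> \<ge> R * (1 - \<mu>)"
   using norm_le_abs_add[of "\<rho> m"] snd\<rho>[OF m] by (simp add: R_def algebra_simps)
  have VR: "0 \<le> V" "0 \<le> R" by (simp_all add: V_def R_def)
  have "V * (1 - \<mu>) * (R * (1 - \<mu>)) \<le> \<bar>fst (v m)\<bar> * \<bar>fst (\<rho> m)\<bar>"
   using fv f\<rho> mu VR by (intro mult_mono) auto
  moreover have "\<bar>snd (v m)\<bar> * \<bar>snd (\<rho> m)\<bar> \<le> (\<mu> * V) * (\<mu> * R)"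
   using sndv[OF m] snd\<rho>[OF m] mu VR unfolding V_def R_def by (intro mult_mono) auto
  moreover have "\<bar>fst (v m)\<bar> * \<bar>fst (\<rho> m)\<bar> \<le> Q + \<bar>snd (v m)\<bar> * \<bar>snd (\<rho> m)\<bar>"
  proof -
   have "fst (\<rho> m) * fst (v m) = Q - snd (\<rho> m) * snd (v m)"
    using inQ[OF mn] by (simp add: inner_prod_def)
   then have "\<bar>fst (\<rho> m) * fst (v m)\<bar> \<le> \<bar>Q\<bar> + \<bar>snd (\<rho> m) * snd (v m)\<bar>"
    using abs_triangle_ineq4[of Q "snd (\<rho> m) * snd (v m)"] by simp
   then show ?thesis using Q0 by (simp add: abs_mult mult.commute)
  qed
  ultimately have "V * R * ((1 - \<mu>) * (1 - \<mu>) - \<mu> * \<mu>) \<le> Q"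
   by (simp add: algebra_simps)
  moreover have "V * R * (1 / 2) \<le> V * R * ((1 - \<mu>) * (1 - \<mu>) - \<mu> * \<mu>)"
   using mu VR by (intro mult_left_mono) (auto simp: algebra_simps)
  ultimately show ?thesis by (simp add: V_def R_def)
 qed
 \<comment> \<open>Normalising the vector at \<open>p'\<close> and the covector at \<open>q\<close>
   divides their constant pairing by both norms.\<close>
 have word: "word (q - p') (\<lambda>i. X (p' + i)) (\<lambda>i. v (p' + i) /\<^sub>R norm (v p')) (\<lambda>i. \<rho> (p' + i) /\<^sub>R norm (\<rho> q))
   (Q / (norm (v p') * norm (\<rho> q)))" if pq: "p' \<in> H" "q \<in> H" "p' < q" for p' q
 proof -
  have n: "p' \<le> n" "q \<le> n" "0 < p'" "q < n" using pq by (auto simp: H_def)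
  have V: "norm (v p') > 0" "norm (\<rho> q) > 0" using pos n by auto
  have Dsc: "D x (c *\<^sub>R y) = c *\<^sub>R D x y" for x c y by (rule D_scaleR)
  have Dtsc: "Dt x (c *\<^sub>R y) = c *\<^sub>R Dt x y" for x c y by (simp add: Dt_def algebra_simps)
  have b1: "norm (v (p' + i)) / norm (v p') \<le> 2 * (Q / (norm (v p') * norm (\<rho> q))) * (\<mu> / 2) ^ (q - p' - i)"
   if "i \<le> q - p'" for i
  proof -
   have "norm (v (p' + i)) \<le> norm (v q) * (\<mu> / 2) ^ (q - p' - i)"
   proof -
    have "p' + i \<le> q" using that pq(3) by simp
    from Hv[OF pq(2) this] show ?thesis by simp
   qed
   also have "\<dots> \<le> (2 * Q / norm (\<rho> q)) * (\<mu> / 2) ^ (q - p' - i)"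
    using HQ[OF pq(2)] V \<mu>pos by (intro mult_right_mono) (auto simp: pos_le_divide_eq)
   finally have "norm (v (p' + i)) / norm (v p') \<le> (2 * Q / norm (\<rho> q)) * (\<mu> / 2) ^ (q - p' - i) / norm (v p')"
    using V by (intro divide_right_mono) auto
   then show ?thesis
    by (simp add: mult_ac)
  qed
  have b2: "norm (\<rho> (p' + i)) / norm (\<rho> q) \<le> 2 * (Q / (norm (v p') * norm (\<rho> q))) * (\<mu> / 2) ^ i"
   if "i \<le> q - p'" for i
  proof -
   have "norm (\<rho> (p' + i)) \<le> norm (\<rho> p') * (\<mu> / 2) ^ i"
   proof -
    have "p' \<le> p' + i" "p' + i \<le> n" using that pq(3) n by auto
    from H\<rho>[OF pq(1) this] show ?thesis by simp
   qed
   also have "\<dots> \<le> (2 * Q / norm (v p')) * (\<mu> / 2) ^ i"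
    using HQ[OF pq(1)] V \<mu>pos by (intro mult_right_mono) (auto simp: pos_le_divide_eq mult.commute)
   finally have "norm (\<rho> (p' + i)) / norm (\<rho> q) \<le> (2 * Q / norm (v p')) * (\<mu> / 2) ^ i / norm (\<rho> q)"
    using V by (intro divide_right_mono) auto
   then show ?thesis
    by (simp add: mult_ac)
  qed
  have e: "p' + (q - p') = q" using pq by simp
  have sc: "\<bar>snd (w /\<^sub>R c)\<bar> = \<bar>snd w\<bar> / c" "norm (w /\<^sub>R c) = norm w / c" if "c > 0" for w :: "real \<times> real" and c :: real
   using that by (simp_all add: abs_mult divide_inverse mult.commute)
  show ?thesis
   unfolding word_def e
  proof (intro conjI allI impI)
   show "0 < q - p'" using pq by simp
   show "X (p' + Suc i) = G (X (p' + i))" for i by (simp add: XS)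
   show "v (p' + Suc i) /\<^sub>R norm (v p') = D (X (p' + i)) (v (p' + i) /\<^sub>R norm (v p'))" for i
    by (simp add: vS Dsc)
   show "\<rho> (p' + i) /\<^sub>R norm (\<rho> q) = Dt (X (p' + i)) (\<rho> (p' + Suc i) /\<^sub>R norm (\<rho> q))" if "i < q - p'" for i
    using \<rho>S[of "p' + i"] that n by (simp add: Dtsc)
   show "inner (\<rho> (p' + i) /\<^sub>R norm (\<rho> q)) (v (p' + i) /\<^sub>R norm (v p')) = Q / (norm (v p') * norm (\<rho> q))" if "i \<le> q - p'" for i
   proof -
    have "p' + i \<le> n" using that n pq(3) by auto
    from inQ[OF this] show ?thesis by (simp add: divide_inverse mult_ac)
   qed
   show "norm (v (p' + 0) /\<^sub>R norm (v p')) = 1" "norm (\<rho> q /\<^sub>R norm (\<rho> q)) = 1"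
    unfolding sc(2)[OF V(1)] sc(2)[OF V(2)] using V by simp_all
   show "norm (v (p' + i) /\<^sub>R norm (v p')) \<le> 2 * (Q / (norm (v p') * norm (\<rho> q))) * (\<mu> / 2) ^ (q - p' - i)"
    if "i \<le> q - p'" for i
    unfolding sc(2)[OF V(1)] by (rule b1[OF that])
   show "norm (\<rho> (p' + i) /\<^sub>R norm (\<rho> q)) \<le> 2 * (Q / (norm (v p') * norm (\<rho> q))) * (\<mu> / 2) ^ i"
    if "i \<le> q - p'" for i
    unfolding sc(2)[OF V(2)] by (rule b2[OF that])
   show "\<bar>snd (v (p' + 0) /\<^sub>R norm (v p'))\<bar> \<le> \<mu>"
    unfolding sc(1)[OF V(1)] using sndv[OF pq(1)] V by (simp add: pos_divide_le_eq)
   show "\<bar>snd (v q /\<^sub>R norm (v p'))\<bar> \<le> \<mu> * norm (v q /\<^sub>R norm (v p'))"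
    unfolding sc(1)[OF V(1)] sc(2)[OF V(1)]
    using divide_right_mono[OF sndv[OF pq(2)] less_imp_le[OF V(1)]] by simp
   show "\<bar>snd (\<rho> (p' + 0) /\<^sub>R norm (\<rho> q))\<bar> \<le> \<mu> * norm (\<rho> (p' + 0) /\<^sub>R norm (\<rho> q))"
    unfolding sc(1)[OF V(2)] sc(2)[OF V(2)]
    using divide_right_mono[OF snd\<rho>[OF pq(1)] less_imp_le[OF V(2)]] by simp
   show "\<bar>snd (\<rho> q /\<^sub>R norm (\<rho> q))\<bar> \<le> \<mu>"
    unfolding sc(1)[OF V(2)] using snd\<rho>[OF pq(2)] V by (simp add: pos_divide_le_eq)
  qed
 qed
 have hyp: "hyperbolic_times X H"
  unfolding hyperbolic_times_def by (intro conjI allI ballI impI XS exI) (rule word)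
 have "{..n} - H \<subseteq> Ba \<union> Bb \<union> {0, n}"
  by (auto simp: H_def)
 then have "card ({..n} - H) \<le> card (Ba \<union> Bb \<union> {0, n})"
  by (intro card_mono) (auto simp: Ba_def Bb_def)
 also have "\<dots> \<le> card Ba + card Bb + 2"
  using card_Un_le[of "Ba \<union> Bb" "{0, n}"] card_Un_le[of Ba Bb] card_insert_le_m1[of 2 "{n}" 0] by simp
 finally have cnt: "card ({..n} - H) \<le> card Ba + card Bb + 2" .
 have "real (card Ba) \<le> C * n / \<theta>" "real (card Bb) \<le> C * n / \<theta>"
  using Ba Bb \<theta>(1) by (simp_all add: pos_le_divide_eq mult.commute)
 moreover have "2 * C * n / \<theta> = C * n / \<theta> + C * n / \<theta>"
  by (simp add: add_divide_distrib[symmetric])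
 ultimately have "real (card ({..n} - H)) \<le> 2 * C * n / \<theta> + 2"
  using cnt by linarith
 moreover have "X = (\<lambda>i. (G ^^ i) p)"
  by (simp add: fun_eq_iff X_def)
 ultimately show thesis
  using that[of H] hyp by (auto simp: H_def)
qed

end

section \<open>Bounds for the topological entropy\<close>

definition sq :: "nat \<Rightarrow> int \<times> int \<Rightarrow> (real \<times> real) set" where
 "sq m c = {p. \<lfloor>real m * fst p\<rfloor> = fst c \<and> \<lfloor>real m * snd p\<rfloor> = snd c}"

lemma norm_diff_sq:
 assumes "m > 0" "p \<in> sq m c" "q \<in> sq m c"
 shows "norm (p - q) < 2 / m"
proof -
 have "\<bar>x - y\<bar> < 1 / m" if "\<lfloor>real m * x\<rfloor> = \<lfloor>real m * y\<rfloor>" for x y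
 proof -
  have "\<bar>real m * x - real m * y\<bar> < 1"
   using that by linarith
  then have "real m * \<bar>x - y\<bar> < 1"
   using assms(1) by (simp add: right_diff_distrib[symmetric] abs_mult)
  then show ?thesis
   using assms(1) by (simp add: field_simps)
 qed
 from this[of "fst p" "fst q"] this[of "snd p" "snd q"] show ?thesis
  using norm_le_abs_add[of "p - q"] assms(2,3) by (simp add: sq_def)
qed

lemma torus_cells:
 assumes "m > 0"
 shows "UNIV = (\<Union>c\<in>{0..<int m} \<times> {0..<int m}. to_torus ` sq m c)" "card ({0..<int m} \<times> {0..<int m}) = m ^ 2"
proof -
 have "a \<in> (\<Union>c\<in>{0..<int m} \<times> {0..<int m}. to_torus ` sq m c)" for a
 proof -
  obtain p where p: "to_torus p = a"
   using to_torus_surj by blast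
  let ?q = "(frac (fst p), frac (snd p))"
  have q: "to_torus ?q = a"
   using p by (simp add: p[symmetric] to_torus_eq_iff int_lattice_def frac_def minus_prod_def)
  have "0 \<le> \<lfloor>real m * frac x\<rfloor> \<and> \<lfloor>real m * frac x\<rfloor> < int m" for x
  proof -
   have "real m * frac x < real m * 1"
    using assms frac_lt_1[of x] by (intro mult_strict_left_mono) auto
   then show ?thesis
    by (simp add: floor_less_iff frac_ge_0)
  qed
  then have "(\<lfloor>real m * frac (fst p)\<rfloor>, \<lfloor>real m * frac (snd p)\<rfloor>) \<in> {0..<int m} \<times> {0..<int m}"
   by simp
  moreover have "?q \<in> sq m (\<lfloor>real m * frac (fst p)\<rfloor>, \<lfloor>real m * frac (snd p)\<rfloor>)"
   by (simp add: sq_def)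
  ultimately show ?thesis
   using q by blast
 qed
 then show "UNIV = (\<Union>c\<in>{0..<int m} \<times> {0..<int m}. to_torus ` sq m c)" by blast
 show "card ({0..<int m} \<times> {0..<int m}) = m ^ 2"
  by (simp add: card_cartesian_product power2_eq_square)
qed

lemma card_separated_le_cover:
 assumes E: "bowen_separated g T e E" and fin: "finite \<A>" and cov: "E \<subseteq> \<Union>\<A>"
  and small: "\<And>A. A \<in> \<A> \<Longrightarrow> bowen_small g T e A"
 shows "finite E" "card E \<le> card \<A>"
proof -
 define f where "f x = (SOME A. A \<in> \<A> \<and> x \<in> A)" for x
 have f: "f x \<in> \<A> \<and> x \<in> f x" if "x \<in> E" for x
  unfolding f_def by (rule someI_ex[of "\<lambda>A. A \<in> \<A> \<and> x \<in> A"]) (use that cov in blast)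
 have inj: "inj_on f E"
 proof (rule inj_onI, rule ccontr)
  fix x y assume xy: "x \<in> E" "y \<in> E" "f x = f y" "x \<noteq> y"
  then obtain i where i: "i < T" "e < dist ((g ^^ i) x) ((g ^^ i) y)"
   using E unfolding bowen_separated_def by blast
  have "bowen_small g T e (f x)" "x \<in> f x" "y \<in> f x"
   using small f[OF xy(1)] f[OF xy(2)] xy(3) by auto
  then have "dist ((g ^^ i) x) ((g ^^ i) y) < e"
   using i(1) unfolding bowen_small_def by blast
  with i(2) show False by simp
 qed
 have sub: "f ` E \<subseteq> \<A>" using f by auto
 show "finite E"
  using inj sub fin by (metis finite_imageD finite_subset)
 show "card E \<le> card \<A>"
  using card_inj_on_le[OF inj sub fin] .
qed

context near_standard
begin

lemma L_power_pos: "L ^ n > 0"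
 using L_ge by simp

lemma bowen_small_cell:
 assumes m: "real m \<ge> 2 * L ^ T / e" and e: "e > 0"
 shows "bowen_small g T e (to_torus ` sq m c)"
 unfolding bowen_small_def
proof (intro ballI allI impI)
 fix x y i assume xy: "x \<in> to_torus ` sq m c" "y \<in> to_torus ` sq m c" and i: "i < T"
 have "0 < 2 * L ^ T / e"
  using e L_power_pos by simp
 then have m0: "m > 0" using m by linarith
 obtain p q where pq: "p \<in> sq m c" "q \<in> sq m c" "x = to_torus p" "y = to_torus q"
  using xy by auto
 have "dist x y \<le> norm (p - q)"
  using dist_to_torus_le[of p q] pq by (simp add: dist_norm)
 also have "\<dots> < 2 / m"
  by (rule norm_diff_sq[OF m0 pq(1,2)])
 finally have d: "dist x y < 2 / m" .
 have "dist ((g ^^ i) x) ((g ^^ i) y) \<le> L ^ i * dist x y"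
  by (rule dist_funpow_le)
 also have "\<dots> \<le> L ^ T * dist x y"
  using i L_ge by (intro mult_right_mono power_increasing) auto
 also have "\<dots> < L ^ T * (2 / m)"
  using d L_power_pos by (intro mult_strict_left_mono)
 also have "\<dots> \<le> e"
  using m m0 e by (simp add: field_simps)
 finally show "dist ((g ^^ i) x) ((g ^^ i) y) < e" .
qed

lemma exists_bowen_cover:
 assumes "e > 0"
 obtains \<A> where "finite \<A>" "UNIV = \<Union>\<A>" "\<forall>A\<in>\<A>. bowen_small g T e A"
  "card \<A> \<le> (2 * L ^ T / e + 1)\<^sup>2"
proof -
 define m where "m = nat \<lceil>2 * L ^ T / e\<rceil>"
 have p: "0 < 2 * L ^ T / e"
  using assms L_power_pos by simp
 then have m: "2 * L ^ T / e \<le> m" "m \<le> 2 * L ^ T / e + 1" "m > 0"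
  unfolding m_def by linarith+
 let ?A = "(\<lambda>c. to_torus ` sq m c) ` ({0..<int m} \<times> {0..<int m})"
 have "card ?A \<le> m ^ 2"
  unfolding torus_cells(2)[OF m(3), symmetric] by (rule card_image_le) simp
 then have "real (card ?A) \<le> real (m ^ 2)"
  by (simp only: of_nat_le_iff)
 also have "real (m ^ 2) \<le> (2 * L ^ T / e + 1)\<^sup>2"
  using m(2) by (simp add: power_mono)
 finally have card: "card ?A \<le> (2 * L ^ T / e + 1)\<^sup>2" .
 show thesis
 proof (rule that[OF _ _ _ card])
  show "UNIV = \<Union>?A" by (rule torus_cells(1)[OF m(3)])
  show "\<forall>A\<in>?A. bowen_small g T e A" using bowen_small_cell[OF m(1) assms] by blast
 qed simp
qed

lemma ln_card_separated_le:
 fixes n :: nat and e :: real and F :: "torus set"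
 assumes e: "e > 0" and F: "finite F" "bowen_separated g n e F" and n: "2 * ln (2 / e + 1) \<le> n"
 shows "ln (card F) \<le> n * (2 * ln L + 1)"
proof -
 obtain \<A> where A: "finite \<A>" "UNIV = \<Union>\<A>" "\<forall>A\<in>\<A>. bowen_small g n e A"
  "card \<A> \<le> (2 * L ^ n / e + 1)\<^sup>2"
  using exists_bowen_cover[OF e, of n] .
 have "card F \<le> card \<A>"
  using card_separated_le_cover(2)[OF F(2) A(1)] A(2,3) by blast
 then have c: "card F \<le> (2 * L ^ n / e + 1)\<^sup>2"
  using A(4) by linarith
 have "1 \<le> L ^ n" using L_ge by (intro one_le_power) auto
 then have "2 * L ^ n / e + 1 \<le> L ^ n * (2 / e + 1)"
  by (simp add: distrib_left mult.commute)
 then have "(2 * L ^ n / e + 1)\<^sup>2 \<le> (L ^ n * (2 / e + 1))\<^sup>2"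
  using e L_power_pos[of n] by (intro power_mono add_nonneg_nonneg divide_nonneg_pos) auto
 with c have c2: "card F \<le> (L ^ n * (2 / e + 1))\<^sup>2" by linarith
 show "ln (card F) \<le> n * (2 * ln L + 1)"
 proof (cases "card F = 0")
  case True
  have "0 \<le> ln L" using L_ge by simp
  with True show ?thesis by simp
 next
  case False
  then have "ln (card F) \<le> ln ((L ^ n * (2 / e + 1))\<^sup>2)"
   using c2 by (subst ln_le_cancel_iff) (use False c2 in linarith)+
  also have "\<dots> = 2 * (n * ln L) + 2 * ln (2 / e + 1)"
  proof -
   have "2 / e + 1 > 0" using e by (simp add: add_pos_pos)
   then have "ln ((L ^ n * (2 / e + 1))\<^sup>2) = 2 * ln (L ^ n * (2 / e + 1))"
    using mult_pos_pos[OF L_power_pos[of n] \<open>2 / e + 1 > 0\<close>] by (simp only: ln_realpow)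
   also have "ln (L ^ n * (2 / e + 1)) = n * ln L + ln (2 / e + 1)"
    using ln_mult_pos[OF L_power_pos[of n] \<open>2 / e + 1 > 0\<close>] L_ge by (simp add: ln_realpow)
   finally show ?thesis by simp
  qed
  also have "\<dots> \<le> n * (2 * ln L + 1)"
  proof -
   show ?thesis using n unfolding distrib_left by linarith
  qed
  finally show ?thesis .
 qed
qed

text \<open>Its purpose is to make the topological entropy a real number; covering by squares of
  side about \<open>L ^ (- n)\<close> gives a finite bound.\<close>

lemma topological_entropy_le: "topological_entropy g \<le> ereal (2 * ln L + 1)"
 unfolding topological_entropy_def
proof (rule SUP_least)
 fix e :: real assume "e \<in> {0<..}"
 then have e: "e > 0" by simp
 obtain T0 :: nat where T0: "2 * ln (2 / e + 1) \<le> T0"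
  using real_arch_simple by blast
 have "(SUP E\<in>{E. finite E \<and> bowen_separated g n e E}. ereal (ln (real (card E)) / real n)) \<le> ereal (2 * ln L + 1)"
  if n: "n \<ge> Suc T0" for n
 proof (rule SUP_least)
  fix E assume "E \<in> {E. finite E \<and> bowen_separated g n e E}"
  then have "ln (card E) \<le> n * (2 * ln L + 1)"
   using T0 n by (intro ln_card_separated_le[OF e]) auto
  then show "ereal (ln (real (card E)) / real n) \<le> ereal (2 * ln L + 1)"
   using n by (simp add: pos_divide_le_eq mult.commute)
 qed
 then have "\<forall>\<^sub>F n in sequentially. (SUP E\<in>{E. finite E \<and> bowen_separated g n e E}. ereal (ln (real (card E)) / real n)) \<le> ereal (2 * ln L + 1)"
  unfolding eventually_sequentially by blast
 then show "limsup (\<lambda>n. SUP E\<in>{E. finite E \<and> bowen_separated g n e E}. ereal (ln (real (card E)) / real n)) \<le> ereal (2 * ln L + 1)"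
  by (rule Limsup_bounded)
qed

text \<open>The part \<open>-1/8 \<le> x \<le> 1/8\<close> of a roughly horizontal curve is stretched over about \<open>1.4 k\<close>
 fundamental domains; the symbol \<open>j\<close> says over which of them the image is taken.\<close>

definition visits :: "int \<Rightarrow> torus \<Rightarrow> bool" where
 "visits j z \<longleftrightarrow> (\<exists>p. to_torus p = z \<and> \<bar>fst p\<bar> \<le> 1 / 8 \<and> \<bar>snd p\<bar> \<le> 3 / 16 \<and> \<bar>fst (G p) - j\<bar> \<le> 1 / 8)"

text \<open>The induction carries the path at time \<open>n\<close>, each of whose points remembers
  an initial point \<open>z\<close>. As \<open>sin (pi / 4) > 0.7\<close>, the image covers all
  abscissas up to nearly \<open>0.7 * k\<close>, beyond every admissible symbol; its ordinates are
  the old abscissas up to the perturbation, hence \<open>1 / 8\<close> becomes at most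
  \<open>3 / 16\<close>.\<close>

lemma exists_itinerary_path:
 fixes f :: "nat \<Rightarrow> int"
 assumes f: "\<And>t. \<bar>f t\<bar> \<le> k / 2 + 1"
 shows "\<exists>a b \<sigma>. continuous_on (closed_segment a b) \<sigma> \<and> fst (\<sigma> a) = - 1 / 8 \<and> fst (\<sigma> b) = 1 / 8 \<and>
  (\<forall>u\<in>closed_segment a (b :: real). \<bar>fst (\<sigma> u)\<bar> \<le> 1 / 8 \<and> \<bar>snd (\<sigma> u)\<bar> \<le> 3 / 16 \<and>
    (\<exists>z. to_torus (\<sigma> u) = (g ^^ n) z \<and> (\<forall>t<n. visits (f t) ((g ^^ t) z))))"
proof (induction n)
 case 0
 show ?case
  by (intro exI[of _ "-1/8"] exI[of _ "1/8"] exI[of _ "\<lambda>u. (u, 0)"])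
    (auto intro!: continuous_intros simp: closed_segment_eq_real_ivl)
next
 case (Suc n)
 then obtain a b \<sigma> where \<sigma>: "continuous_on (closed_segment a b) \<sigma>" "fst (\<sigma> a) = - 1 / 8" "fst (\<sigma> b) = 1 / 8"
  and all: "\<forall>u\<in>closed_segment a (b :: real). \<bar>fst (\<sigma> u)\<bar> \<le> 1 / 8 \<and> \<bar>snd (\<sigma> u)\<bar> \<le> 3 / 16 \<and>
    (\<exists>z. to_torus (\<sigma> u) = (g ^^ n) z \<and> (\<forall>t<n. visits (f t) ((g ^^ t) z)))"
  by (elim exE conjE)
 have in_strip: "\<bar>fst (\<sigma> u)\<bar> \<le> 1 / 8 \<and> \<bar>snd (\<sigma> u)\<bar> \<le> 3 / 16"
  and orb: "\<exists>z. to_torus (\<sigma> u) = (g ^^ n) z \<and> (\<forall>t<n. visits (f t) ((g ^^ t) z))" if "u \<in> closed_segment a b" for u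
  using all that by simp_all
 have G1: "fst (G (\<sigma> u)) = 2 * fst (\<sigma> u) - snd (\<sigma> u) + k * sin (2 * pi * fst (\<sigma> u)) + fst (E (\<sigma> u))"
  and G2: "snd (G (\<sigma> u)) = fst (\<sigma> u) + snd (E (\<sigma> u))" for u
  by (simp_all add: G_eq standard_lift_def case_prod_unfold)
 have Er: "\<bar>fst (E p)\<bar> \<le> 1 / 1000" "\<bar>snd (E p)\<bar> \<le> 1 / 1000" for p
  using E_le[of p] abs_fst_le_norm[of "E p"] abs_snd_le_norm[of "E p"] r_small(1) by linarith+
 have s2: "sqrt 2 \<ge> 1.4"
  by (rule real_le_rsqrt) (simp add: power2_eq_square)
 have sin: "sin (2 * pi * (1 / 8)) \<ge> 0.7" "sin (2 * pi * (- 1 / 8)) \<le> - 0.7"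
  using s2 sin_45 by simp_all
 have ks: "k * sin (2 * pi * (1 / 8)) \<ge> k * 0.7" "k * sin (2 * pi * (- 1 / 8)) \<le> k * (- 0.7)"
  using sin k by (intro mult_left_mono; simp)+
 have cont: "continuous_on (closed_segment a b) (\<lambda>u. fst (G (\<sigma> u)))"
  using \<sigma>(1) by (intro continuous_intros continuous_on_compose2[OF continuous_on_G[of UNIV]]) auto
 have fn: "- (k / 2 + 1) \<le> f n" "f n \<le> k / 2 + 1"
  using f[of n] by linarith+
 define sa where "sa = k * sin (2 * pi * fst (\<sigma> a))"
 define sb where "sb = k * sin (2 * pi * fst (\<sigma> b))"
 have ka: "sa \<le> k * (- 0.7)" and kb: "k * 0.7 \<le> sb"
  unfolding sa_def sb_def \<sigma>(2,3) using ks by simp_all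
 have inab: "\<bar>snd (\<sigma> a)\<bar> \<le> 3 / 16" "\<bar>snd (\<sigma> b)\<bar> \<le> 3 / 16"
  using in_strip[of a] in_strip[of b] by simp_all
 have e1: "fst (G (\<sigma> a)) \<le> f n - 1 / 8"
  using inab Er(1)[of "\<sigma> a"] ka fn k G1[of a, folded sa_def] \<sigma>(2) by linarith
 have e2: "f n + 1 / 8 \<le> fst (G (\<sigma> b))"
  using inab Er(1)[of "\<sigma> b"] kb fn k G1[of b, folded sb_def] \<sigma>(3) by linarith
 obtain a' b' where ab: "closed_segment a' b' \<subseteq> closed_segment a b" "fst (G (\<sigma> a')) = f n - 1 / 8"
  "fst (G (\<sigma> b')) = f n + 1 / 8"
  and mid: "\<And>u. u \<in> closed_segment a' b' \<Longrightarrow> f n - 1 / 8 \<le> fst (G (\<sigma> u)) \<and> fst (G (\<sigma> u)) \<le> f n + 1 / 8"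
  using path_cut[OF cont e1 e2] by auto
 define \<sigma>' where "\<sigma>' u = G (\<sigma> u) - (of_int (f n), 0)" for u
 have tor: "to_torus (\<sigma>' u) = g (to_torus (\<sigma> u))" for u
  unfolding \<sigma>'_def by (subst to_torus_diff_lattice) (auto simp: int_lattice_def lift)
 have 1: "continuous_on (closed_segment a' b') \<sigma>'"
  unfolding \<sigma>'_def using continuous_on_subset[OF \<sigma>(1) ab(1)]
  by (intro continuous_intros continuous_on_compose2[OF continuous_on_G[of UNIV]]) auto
 have 2: "fst (\<sigma>' a') = - 1 / 8" "fst (\<sigma>' b') = 1 / 8"
  using ab(2,3) by (simp_all add: \<sigma>'_def)
 have 3: "\<bar>fst (\<sigma>' u)\<bar> \<le> 1 / 8 \<and> \<bar>snd (\<sigma>' u)\<bar> \<le> 3 / 16 \<and>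
    (\<exists>z. to_torus (\<sigma>' u) = (g ^^ Suc n) z \<and> (\<forall>t<Suc n. visits (f t) ((g ^^ t) z)))"
  if u: "u \<in> closed_segment a' b'" for u
 proof -
  have u': "u \<in> closed_segment a b" using ab(1) u by auto
  have m: "\<bar>fst (G (\<sigma> u)) - f n\<bar> \<le> 1 / 8"
   using mid[OF u] unfolding abs_le_iff by linarith
  then have x: "\<bar>fst (\<sigma>' u)\<bar> \<le> 1 / 8"
   by (simp add: \<sigma>'_def)
  have y: "\<bar>snd (\<sigma>' u)\<bar> \<le> 3 / 16"
   using in_strip[OF u'] Er(2)[of "\<sigma> u"] unfolding \<sigma>'_def snd_diff G2 snd_conv by linarith
  obtain z where z: "to_torus (\<sigma> u) = (g ^^ n) z" "\<forall>t<n. visits (f t) ((g ^^ t) z)"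
   using orb[OF u'] by blast
  have "visits (f n) ((g ^^ n) z)"
   unfolding visits_def z(1)[symmetric] using in_strip[OF u'] m by blast
  then have "\<forall>t<Suc n. visits (f t) ((g ^^ t) z)"
   using z(2) less_Suc_eq by blast
  moreover have "to_torus (\<sigma>' u) = (g ^^ Suc n) z"
   using z(1) tor by simp
  ultimately show ?thesis using x y by blast
 qed
 show ?case
  using 1 2 3 by blast
qed

text \<open>The lifts in the strip are so close to each other that nearness on the torus is nearness
  of these lifts. Their images would then be at most \<open>1 / 3\<close> apart, while the abscissas
  lie within \<open>1 / 8\<close> of different integers.\<close>

lemma visits_separated:
 assumes z: "visits i z" "visits j w" "i \<noteq> j"
 shows "1 / (3 * L) < dist z w"
proof (rule ccontr)
 assume "\<not> ?thesis"
 then have d: "dist z w \<le> 1 / (3 * L)" by simp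
 obtain p where p: "to_torus p = z" "\<bar>fst p\<bar> \<le> 1 / 8" "\<bar>snd p\<bar> \<le> 3 / 16" "\<bar>fst (G p) - i\<bar> \<le> 1 / 8"
  using z(1) by (auto simp: visits_def)
 obtain p' where p': "to_torus p' = w" "\<bar>fst p'\<bar> \<le> 1 / 8" "\<bar>snd p'\<bar> \<le> 3 / 16" "\<bar>fst (G p') - j\<bar> \<le> 1 / 8"
  using z(2) by (auto simp: visits_def)
 obtain q where q: "to_torus q = w" "dist p q = dist (to_torus p) w"
  by (rule exists_nearest_lift)
 have pq: "norm (p - q) \<le> 1 / (3 * L)"
  using q d p by (simp add: dist_norm)
 have L3: "1 / (3 * L) \<le> 1 / 10"
  using L_ge by (simp add: field_simps)
 have "q - p' \<in> int_lattice"
  using q p' by (simp add: to_torus_eq_iff[symmetric])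
 moreover have "norm (q - p') < 1"
 proof -
  have "\<bar>fst (p - q)\<bar> \<le> 1 / 10" "\<bar>snd (p - q)\<bar> \<le> 1 / 10"
   using abs_fst_le_norm[of "p - q"] abs_snd_le_norm[of "p - q"] pq L3 by linarith+
  then have "\<bar>fst (q - p')\<bar> + \<bar>snd (q - p')\<bar> \<le> (1 / 10 + 1 / 4) + (1 / 10 + 3 / 8)"
   using p p' unfolding fst_diff snd_diff by linarith
  then show ?thesis
   using norm_le_abs_add[of "q - p'"] by simp
 qed
 ultimately have "q = p'"
  using int_lattice_norm_less_1 by (metis eq_iff_diff_eq_0)
 then have "norm (G p - G p') \<le> L * (1 / (3 * L))"
 proof -
  have "norm (G p - G p') \<le> L * norm (p - p')" by (rule norm_G_diff_le)
  also have "\<dots> \<le> L * (1 / (3 * L))"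
   using pq L_ge \<open>q = p'\<close> by (intro mult_left_mono) auto
  finally show ?thesis .
 qed
 then have "\<bar>fst (G p) - fst (G p')\<bar> \<le> 1 / 3"
  using abs_fst_le_norm[of "G p - G p'"] L_ge by simp
 moreover have "1 \<le> \<bar>real_of_int i - real_of_int j\<bar>"
  using z(3) by linarith
 ultimately show False
  using p(4) p'(4) by linarith
qed

text \<open>All sequences of the \<open>2 * K + 1 \<ge> k\<close> symbols occur as itineraries, and
  different itineraries are separated at a scale that does not depend on their length.\<close>

lemma topological_entropy_ge: "ereal (ln k) \<le> topological_entropy g"
proof -
 define e where "e = 1 / (3 * L)"
 have e: "e > 0" using L_ge by (simp add: e_def)
 define K where "K = \<lceil>k / 2\<rceil>"
 have K: "k / 2 \<le> K" "K \<le> k / 2 + 1"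
  unfolding K_def by linarith+
 have K0: "K \<ge> 0" using K k by linarith
 define F where "F n = PiE {..<n} (\<lambda>_. {-K..K})" for n :: nat
 have sep: "\<exists>E. finite E \<and> bowen_separated g n e E \<and> card E = card (F n)" for n
 proof -
  have "\<exists>z. \<forall>t<n. visits (f t) ((g ^^ t) z)" if "f \<in> F n" for f
  proof -
   define f' where "f' t = (if t < n then f t else 0)" for t
   have fb: "\<bar>f' t\<bar> \<le> k / 2 + 1" for t
   proof -
    have "- K \<le> f' t" "f' t \<le> K"
     using that K0 PiE_mem[of f "{..<n}" "\<lambda>_. {-K..K}" t] by (auto simp: f'_def F_def)
    then show ?thesis using K(2) by linarith
   qed
   obtain a b \<sigma> where
    "\<forall>u\<in>closed_segment a (b :: real). \<bar>fst (\<sigma> u)\<bar> \<le> 1 / 8 \<and> \<bar>snd (\<sigma> u)\<bar> \<le> 3 / 16 \<and>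
      (\<exists>z. to_torus (\<sigma> u) = (g ^^ n) z \<and> (\<forall>t<n. visits (f' t) ((g ^^ t) z)))"
    using exists_itinerary_path[of f' n, OF fb] by (elim exE conjE)
   then have "\<exists>z. \<forall>t<n. visits (f' t) ((g ^^ t) z)"
    using ends_in_segment(1)[of a b] by blast
   then show ?thesis by (auto simp: f'_def)
  qed
  then obtain Z where Z: "\<And>f t. f \<in> F n \<Longrightarrow> t < n \<Longrightarrow> visits (f t) ((g ^^ t) (Z f))"
   by metis
  have sp: "\<exists>i<n. e < dist ((g ^^ i) (Z f)) ((g ^^ i) (Z f'))" if "f \<in> F n" "f' \<in> F n" "f \<noteq> f'" for f f'
  proof -
   have "\<exists>t<n. f t \<noteq> f' t"
   proof (rule ccontr)
    assume "\<not> ?thesis"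
    then have "f = f'"
     using that(1,2) unfolding F_def by (intro PiE_ext[of f "{..<n}" "\<lambda>_. {-K..K}" f']) auto
    with that(3) show False by simp
   qed
   then obtain t where "t < n" "f t \<noteq> f' t" by blast
   then show ?thesis
    using visits_separated[OF Z[OF that(1)] Z[OF that(2)]] unfolding e_def by blast
  qed
  have "inj_on Z (F n)"
  proof (rule inj_onI, rule ccontr)
   fix f f' assume "f \<in> F n" "f' \<in> F n" "Z f = Z f'" "f \<noteq> f'"
   then show False using sp[of f f'] e by auto
  qed
  then show ?thesis
   using sp by (intro exI[of _ "Z ` F n"])
    (auto simp: card_image F_def bowen_separated_def intro!: finite_PiE)
 qed
 have "ereal (ln k) \<le> limsup (\<lambda>n. SUP E\<in>{E. finite E \<and> bowen_separated g n e E}. ereal (ln (real (card E)) / real n))"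
 proof (rule le_Limsup)
  show "\<forall>\<^sub>F n in sequentially. ereal (ln k) \<le> (SUP E\<in>{E. finite E \<and> bowen_separated g n e E}. ereal (ln (real (card E)) / real n))"
   using eventually_gt_at_top[of 0]
  proof eventually_elim
   case (elim n)
   obtain E where E: "finite E" "bowen_separated g n e E" "card E = card (F n)"
    using sep by blast
   have "card (F n) = nat (2 * K + 1) ^ n"
    unfolding F_def using K0 by (simp add: card_PiE)
   then have "real (card E) = (2 * K + 1) ^ n"
    using E(3) K0 by (simp add: of_nat_power)
   then have "k ^ n \<le> real (card E)"
    using K k by (simp add: power_mono)
   then have "ln (k ^ n) \<le> ln (real (card E))"
   proof (subst ln_le_cancel_iff)
    show "0 < k ^ n" using k by simp
    then show "0 < real (card E)" using \<open>k ^ n \<le> real (card E)\<close> by linarith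
   qed
   then have "ln k \<le> ln (real (card E)) / real n"
    using elim k by (simp add: ln_realpow field_simps)
   then have "ereal (ln k) \<le> ereal (ln (real (card E)) / real n)" by simp
   also have "\<dots> \<le> (SUP E\<in>{E. finite E \<and> bowen_separated g n e E}. ereal (ln (real (card E)) / real n))"
    using E by (intro SUP_upper) auto
   finally show ?case .
  qed
 qed simp
 also have "\<dots> \<le> topological_entropy g"
  unfolding topological_entropy_def using e by (intro SUP_upper) auto
 finally show ?thesis .
qed

lemma topological_entropy_real:
 obtains h where "topological_entropy g = ereal h" "ln k \<le> h"
proof -
 have "topological_entropy g \<noteq> \<infinity>" "topological_entropy g \<noteq> - \<infinity>"
  using topological_entropy_le topological_entropy_ge by auto
 then obtain h where "topological_entropy g = ereal h"
  by (metis ereal_cases)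
 then show thesis
  using that topological_entropy_ge by auto
qed

end

section \<open>Expansion along typical orbits\<close>

lemma card_int_interval_le:
 fixes x y :: real
 assumes "x \<le> y + 2"
 shows "real (card {\<lfloor>x\<rfloor>..\<lfloor>y\<rfloor>}) \<le> y - x + 2"
proof -
 have "real (card {\<lfloor>x\<rfloor>..\<lfloor>y\<rfloor>}) = real (nat (\<lfloor>y\<rfloor> - \<lfloor>x\<rfloor> + 1))" by simp
 also have "\<dots> \<le> max 0 (real_of_int (\<lfloor>y\<rfloor> - \<lfloor>x\<rfloor> + 1))" by simp
 also have "\<dots> \<le> y - x + 2"
  using assms by (intro max.boundedI; linarith)
 finally show ?thesis .
qed

text \<open>Decompose \<open>\<rho>2\<close> along \<open>\<rho>1\<close> and its normal; the normal
  part has length \<open>\<bar>wedge \<rho>1 \<rho>2\<bar> / norm \<rho>1\<close>.\<close>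

lemma abs_inner_le_wedge:
 fixes \<rho>1 \<rho>2 \<zeta> :: "real \<times> real"
 assumes "1 \<le> norm \<rho>1" "norm \<rho>2 \<le> norm \<rho>1"
 shows "\<bar>inner \<rho>2 \<zeta>\<bar> \<le> \<bar>inner \<rho>1 \<zeta>\<bar> + \<bar>wedge \<rho>1 \<rho>2\<bar> * norm \<zeta>"
proof -
 define n where "n = norm \<rho>1"
 have n: "n \<ge> 1" using assms by (simp add: n_def)
 have "n\<^sup>2 * inner \<rho>2 \<zeta> = inner \<rho>1 \<rho>2 * inner \<rho>1 \<zeta> + wedge \<rho>1 \<rho>2 * wedge \<rho>1 \<zeta>"
  unfolding n_def power2_norm_eq_inner by (simp add: inner_prod_def wedge_def algebra_simps)
 then have "n\<^sup>2 * \<bar>inner \<rho>2 \<zeta>\<bar> = \<bar>inner \<rho>1 \<rho>2 * inner \<rho>1 \<zeta> + wedge \<rho>1 \<rho>2 * wedge \<rho>1 \<zeta>\<bar>"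
  by (metis abs_mult abs_power2)
 also have "\<dots> \<le> \<bar>inner \<rho>1 \<rho>2\<bar> * \<bar>inner \<rho>1 \<zeta>\<bar> + \<bar>wedge \<rho>1 \<rho>2\<bar> * \<bar>wedge \<rho>1 \<zeta>\<bar>"
  by (metis abs_mult abs_triangle_ineq)
 also have "\<dots> \<le> n\<^sup>2 * \<bar>inner \<rho>1 \<zeta>\<bar> + \<bar>wedge \<rho>1 \<rho>2\<bar> * (n * norm \<zeta>)"
 proof (intro add_mono mult_right_mono mult_left_mono)
  have "\<bar>inner \<rho>1 \<rho>2\<bar> \<le> n * norm \<rho>2"
   unfolding n_def by (rule Cauchy_Schwarz_ineq2)
  also have "\<dots> \<le> n * n"
   using assms n by (intro mult_left_mono) (auto simp: n_def)
  finally show "\<bar>inner \<rho>1 \<rho>2\<bar> \<le> n\<^sup>2" by (simp add: power2_eq_square)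
  show "\<bar>wedge \<rho>1 \<zeta>\<bar> \<le> n * norm \<zeta>"
   unfolding n_def by (rule abs_wedge_le)
 qed auto
 also have "\<bar>wedge \<rho>1 \<rho>2\<bar> * (n * norm \<zeta>) \<le> \<bar>wedge \<rho>1 \<rho>2\<bar> * (n\<^sup>2 * norm \<zeta>)"
  using n by (intro mult_left_mono mult_right_mono) (auto simp: power2_eq_square mult_le_cancel_left1)
 finally have "n\<^sup>2 * \<bar>inner \<rho>2 \<zeta>\<bar> \<le> n\<^sup>2 * (\<bar>inner \<rho>1 \<zeta>\<bar> + \<bar>wedge \<rho>1 \<rho>2\<bar> * norm \<zeta>)"
  by (simp add: algebra_simps)
 moreover have "n\<^sup>2 > 0" using n by simp
 ultimately show ?thesis
  by (simp only: mult_le_cancel_left_pos)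
qed

text \<open>The image of a cell under the matrix with rows \<open>\<rho>1\<close>,
  \<open>\<rho>2\<close> is a thin parallelogram. It meets about \<open>norm \<rho>1\<close> columns
  of the grid, and within a column the area bound \<open>d\<close> limits the spread of the second
  coordinate. So the count is linear in the length, and not quadratic. The errors of size 1 make
  room for nonlinearity.\<close>

lemma grid_count:
 fixes \<rho>1 \<rho>2 :: "real \<times> real" and w1 w2 :: "'p \<Rightarrow> real" and \<eta> :: "'p \<Rightarrow> real \<times> real"
 assumes \<rho>: "1 \<le> norm \<rho>1" "norm \<rho>2 \<le> norm \<rho>1" and d: "\<bar>wedge \<rho>1 \<rho>2\<bar> \<le> d"
  and B: "\<And>p. p \<in> B \<Longrightarrow> norm (\<eta> p) \<le> 2"
  "\<And>p. p \<in> B \<Longrightarrow> \<bar>w1 p - c1 - inner \<rho>1 (\<eta> p)\<bar> \<le> 1" "\<And>p. p \<in> B \<Longrightarrow> \<bar>w2 p - c2 - inner \<rho>2 (\<eta> p)\<bar> \<le> 1"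
 shows "finite ((\<lambda>p. (\<lfloor>w1 p\<rfloor>, \<lfloor>w2 p\<rfloor>)) ` B)"
  "card ((\<lambda>p. (\<lfloor>w1 p\<rfloor>, \<lfloor>w2 p\<rfloor>)) ` B) \<le> (4 * norm \<rho>1 + 4) * (12 + 8 * d)"
proof -
 have d0: "d \<ge> 0" using d by linarith
 define I where "I = {\<lfloor>c1 - 2 * norm \<rho>1 - 1\<rfloor>..\<lfloor>c1 + 2 * norm \<rho>1 + 1\<rfloor>}"
 \<comment> \<open>A reference height for each column: the parallelogram may be steep, so heights
   are compared within a column and not with \<open>c2\<close>.\<close>
 define ref where "ref a = w2 (SOME p. p \<in> B \<and> \<lfloor>w1 p\<rfloor> = a)" for a
 define J where "J a = {\<lfloor>ref a - (5 + 4 * d)\<rfloor>..\<lfloor>ref a + (5 + 4 * d)\<rfloor>}" for a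
 have sub: "(\<lambda>p. (\<lfloor>w1 p\<rfloor>, \<lfloor>w2 p\<rfloor>)) ` B \<subseteq> Sigma I J"
 proof (rule image_subsetI)
  fix p assume p: "p \<in> B"
  have "\<bar>inner \<rho>1 (\<eta> p)\<bar> \<le> norm \<rho>1 * 2"
   using Cauchy_Schwarz_ineq2[of \<rho>1 "\<eta> p"] mult_left_mono[OF B(1)[OF p], of "norm \<rho>1"] by simp
  then have "c1 - 2 * norm \<rho>1 - 1 \<le> w1 p" "w1 p \<le> c1 + 2 * norm \<rho>1 + 1"
   using B(2)[OF p] by linarith+
  then have "\<lfloor>w1 p\<rfloor> \<in> I"
   unfolding I_def atLeastAtMost_iff mem_Times_iff fst_conv snd_conv by - (intro conjI floor_mono; assumption)
  moreover have "\<lfloor>w2 p\<rfloor> \<in> J \<lfloor>w1 p\<rfloor>"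
  proof -
   define q where "q = (SOME q. q \<in> B \<and> \<lfloor>w1 q\<rfloor> = \<lfloor>w1 p\<rfloor>)"
   have "q \<in> B \<and> \<lfloor>w1 q\<rfloor> = \<lfloor>w1 p\<rfloor>"
    unfolding q_def by (rule someI[of _ p]) (use p in auto)
   then have q: "q \<in> B" "\<lfloor>w1 q\<rfloor> = \<lfloor>w1 p\<rfloor>" by auto
   have refq: "ref \<lfloor>w1 p\<rfloor> = w2 q" by (simp add: ref_def q_def)
   define \<zeta> where "\<zeta> = \<eta> p - \<eta> q"
   have z4: "norm \<zeta> \<le> 4"
    using norm_triangle_ineq4[of "\<eta> p" "\<eta> q"] B(1)[OF p] B(1)[OF q(1)] by (simp add: \<zeta>_def)
   have "\<bar>w1 p - w1 q\<bar> \<le> 1" using q(2) by linarith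
   then have "\<bar>inner \<rho>1 \<zeta>\<bar> \<le> 3"
    using B(2)[OF p] B(2)[OF q(1)] unfolding \<zeta>_def inner_diff_right by linarith
   moreover have "\<bar>wedge \<rho>1 \<rho>2\<bar> * norm \<zeta> \<le> d * 4"
    using d z4 d0 by (intro mult_mono) auto
   ultimately have "\<bar>inner \<rho>2 \<zeta>\<bar> \<le> 3 + d * 4"
    using abs_inner_le_wedge[OF \<rho>, of \<zeta>] by linarith
   then have "\<bar>w2 p - w2 q\<bar> \<le> 5 + 4 * d"
    using B(3)[OF p] B(3)[OF q(1)] unfolding \<zeta>_def inner_diff_right by linarith
   then have "ref \<lfloor>w1 p\<rfloor> - (5 + 4 * d) \<le> w2 p" "w2 p \<le> ref \<lfloor>w1 p\<rfloor> + (5 + 4 * d)"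
    unfolding refq by linarith+
   then show ?thesis
    unfolding J_def atLeastAtMost_iff by - (intro conjI floor_mono; assumption)
  qed
  ultimately show "(\<lfloor>w1 p\<rfloor>, \<lfloor>w2 p\<rfloor>) \<in> Sigma I J" by simp
 qed
 have finI: "finite I" and finJ: "finite (J a)" for a by (auto simp: I_def J_def)
 have fin: "finite (Sigma I J)" using finI finJ by auto
 show "finite ((\<lambda>p. (\<lfloor>w1 p\<rfloor>, \<lfloor>w2 p\<rfloor>)) ` B)"
  using finite_subset[OF sub fin] .
 have cI: "real (card I) \<le> 4 * norm \<rho>1 + 4"
  using card_int_interval_le[of "c1 - 2 * norm \<rho>1 - 1" "c1 + 2 * norm \<rho>1 + 1"] norm_ge_zero[of \<rho>1]
  unfolding I_def by linarith
 have cJ: "real (card (J a)) \<le> 12 + 8 * d" for a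
  using card_int_interval_le[of "ref a - (5 + 4 * d)" "ref a + (5 + 4 * d)"] d0
  unfolding J_def by linarith
 have "card ((\<lambda>p. (\<lfloor>w1 p\<rfloor>, \<lfloor>w2 p\<rfloor>)) ` B) \<le> card (Sigma I J)"
  by (rule card_mono[OF fin sub])
 also have "card (Sigma I J) = (\<Sum>a\<in>I. card (J a))"
  using finI finJ by simp
 finally have "real (card ((\<lambda>p. (\<lfloor>w1 p\<rfloor>, \<lfloor>w2 p\<rfloor>)) ` B)) \<le> (\<Sum>a\<in>I. real (card (J a)))"
  by (simp only: of_nat_le_iff of_nat_sum[symmetric])
 also have "\<dots> \<le> (\<Sum>a\<in>I. 12 + 8 * d)"
  by (intro sum_mono cJ)
 also have "\<dots> = card I * (12 + 8 * d)" by simp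
 also have "\<dots> \<le> (4 * norm \<rho>1 + 4) * (12 + 8 * d)"
  using cI d0 by (intro mult_right_mono) auto
 finally show "card ((\<lambda>p. (\<lfloor>w1 p\<rfloor>, \<lfloor>w2 p\<rfloor>)) ` B) \<le> (4 * norm \<rho>1 + 4) * (12 + 8 * d)" .
qed

lemma grid_count_small:
 fixes w1 w2 :: "'p \<Rightarrow> real"
 assumes B: "\<And>p. p \<in> B \<Longrightarrow> \<bar>w1 p - c1\<bar> \<le> 3" "\<And>p. p \<in> B \<Longrightarrow> \<bar>w2 p - c2\<bar> \<le> 3"
 shows "finite ((\<lambda>p. (\<lfloor>w1 p\<rfloor>, \<lfloor>w2 p\<rfloor>)) ` B)"
  "real (card ((\<lambda>p. (\<lfloor>w1 p\<rfloor>, \<lfloor>w2 p\<rfloor>)) ` B)) \<le> 64"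
proof -
 define I where "I c = {\<lfloor>c - 3\<rfloor>..\<lfloor>c + 3\<rfloor>}" for c :: real
 have sub: "(\<lambda>p. (\<lfloor>w1 p\<rfloor>, \<lfloor>w2 p\<rfloor>)) ` B \<subseteq> I c1 \<times> I c2"
 proof (rule image_subsetI)
  fix p assume p: "p \<in> B"
  have "c1 - 3 \<le> w1 p" "w1 p \<le> c1 + 3" "c2 - 3 \<le> w2 p" "w2 p \<le> c2 + 3"
   using B[OF p] by linarith+
  then show "(\<lfloor>w1 p\<rfloor>, \<lfloor>w2 p\<rfloor>) \<in> I c1 \<times> I c2"
   unfolding I_def atLeastAtMost_iff mem_Times_iff fst_conv snd_conv by - (intro conjI floor_mono; assumption)
 qed
 have fin: "finite (I c1 \<times> I c2)" by (simp add: I_def)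
 show "finite ((\<lambda>p. (\<lfloor>w1 p\<rfloor>, \<lfloor>w2 p\<rfloor>)) ` B)"
  using finite_subset[OF sub fin] .
 have c: "real (card (I c)) \<le> 8" for c
  using card_int_interval_le[of "c - 3" "c + 3"] unfolding I_def by linarith
 have "real (card ((\<lambda>p. (\<lfloor>w1 p\<rfloor>, \<lfloor>w2 p\<rfloor>)) ` B)) \<le> real (card (I c1 \<times> I c2))"
  using card_mono[OF fin sub] by simp
 also have "\<dots> = real (card (I c1)) * real (card (I c2))"
  by (simp add: card_cartesian_product)
 also have "\<dots> \<le> 8 * 8"
  by (intro mult_mono c) auto
 finally show "real (card ((\<lambda>p. (\<lfloor>w1 p\<rfloor>, \<lfloor>w2 p\<rfloor>)) ` B)) \<le> 64" by simp
qed

text \<open>The mean number of visits is at least \<open>a * card I\<close>, and points outside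
  \<open>Y\<close> contribute fewer than \<open>b * card I\<close> each. Only the expectation is
  used, so the events may be dependent.\<close>

lemma (in prob_space) measure_frequent_visits:
 fixes a b :: real
 assumes I: "finite I" "I \<noteq> {}" and A: "\<And>i. i \<in> I \<Longrightarrow> A i \<in> events" "\<And>i. i \<in> I \<Longrightarrow> a \<le> prob (A i)" and b: "b \<ge> 0"
 defines "Y \<equiv> {x \<in> space M. b * card I \<le> card {i \<in> I. x \<in> A i}}"
 shows "Y \<in> events" "a - b \<le> prob Y"
proof -
 define f where "f x = (\<Sum>i\<in>I. indicator (A i) x :: real)" for x
 have f: "f x = card {i \<in> I. x \<in> A i}" for x
 proof -
  have "{i \<in> I. x \<in> A i} = I \<inter> {i. x \<in> A i}" by blast
  then show ?thesis using I(1) by (simp add: f_def indicator_def)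
 qed
 have fm: "f \<in> borel_measurable M"
  unfolding f_def using A by (intro borel_measurable_sum borel_measurable_indicator) auto
 have Y: "Y = {x \<in> space M. b * card I \<le> f x}"
  unfolding Y_def f ..
 show Ym: "Y \<in> events"
  unfolding Y using fm by measurable
 have c: "real (card I) > 0" using I by (simp add: card_gt_0_iff)
 have "a * card I = (\<Sum>i\<in>I. a)" by simp
 also have "\<dots> \<le> (\<Sum>i\<in>I. prob (A i))"
  by (rule sum_mono) (rule A)
 also have "\<dots> = expectation f"
  unfolding f_def using A by (subst Bochner_Integration.integral_sum) (auto simp: emeasure_eq_measure)
 also have "\<dots> \<le> expectation (\<lambda>x. card I * indicat_real Y x + b * card I)"
 proof (rule integral_mono)
  show "integrable M f"
   unfolding f_def using A by (intro Bochner_Integration.integrable_sum) (auto simp: emeasure_eq_measure)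
  show "integrable M (\<lambda>x. card I * indicat_real Y x + b * card I)"
   using Ym by (auto simp: emeasure_eq_measure)
  show "f x \<le> card I * indicat_real Y x + b * card I" if "x \<in> space M" for x
  proof (cases "x \<in> Y")
   case True
   have "card {i \<in> I. x \<in> A i} \<le> card I" using I by (intro card_mono) auto
   then have "f x \<le> card I" by (simp add: f)
   moreover have "0 \<le> b * card I" using b by simp
   ultimately show ?thesis using True by simp
  next
   case False
   then show ?thesis using that by (simp add: Y)
  qed
 qed
 also have "\<dots> = card I * prob Y + b * card I"
  using Ym by (subst Bochner_Integration.integral_add) (auto simp: prob_space emeasure_eq_measure)
 finally have "card I * (a - b) \<le> card I * prob Y"
  by (simp add: algebra_simps)
 then show "a - b \<le> prob Y"
  using c by simp
qed

lemma invariant_prob_measure_vimage: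
 assumes "invariant_prob g \<mu>" "A \<in> sets borel"
 shows "(g ^^ i) -` A \<in> sets borel" "measure \<mu> ((g ^^ i) -` A) = measure \<mu> A"
proof -
 have g: "g \<in> borel \<rightarrow>\<^sub>M borel" and s: "sets \<mu> = sets borel" and inv: "distr \<mu> borel g = \<mu>"
  using assms(1) by (auto simp: invariant_prob_def)
 have m: "(g ^^ i) -` A \<in> sets borel" for i
  using measurable_sets[OF measurable_funpow[OF g] assms(2), of i] by simp
 then show "(g ^^ i) -` A \<in> sets borel" .
 have sp: "space \<mu> = UNIV" using sets_eq_imp_space_eq[OF s] by simp
 have gm: "g \<in> \<mu> \<rightarrow>\<^sub>M borel" using g by (simp only: measurable_cong_sets[OF s refl])
 show "measure \<mu> ((g ^^ i) -` A) = measure \<mu> A"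
 proof (induction i)
  case (Suc i)
  have "(g ^^ Suc i) -` A = g -` ((g ^^ i) -` A)"
   by (simp only: funpow_Suc_right vimage_comp)
  then have "measure \<mu> ((g ^^ Suc i) -` A) = measure (distr \<mu> borel g) ((g ^^ i) -` A)"
   using measure_distr[OF gm m[of i]] by (simp add: sp)
  then show ?case unfolding inv Suc.IH .
 qed simp
qed

context near_standard
begin

section \<open>The iterated derivative as a cocycle\<close>

lemma D_cong: "to_torus p = to_torus q \<Longrightarrow> D p = D q"
 using D_periodic[of "p - q" q] by (simp add: to_torus_eq_iff)

lemma Dn_cong: "to_torus p = to_torus q \<Longrightarrow> Dn n p = Dn n q"
proof (induction n)
 case (Suc n)
 have "D ((G ^^ n) p) = D ((G ^^ n) q)"
  using Suc by (intro D_cong) (simp add: to_torus_funpow)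
 then show ?case using Suc by (intro ext) simp
qed (simp add: fun_eq_iff)

lemma Dn_add: "Dn n p (u + v) = Dn n p u + Dn n p v"
 and Dn_scaleR: "Dn n p (c *\<^sub>R u) = c *\<^sub>R Dn n p u"
 by (induction n) (simp_all add: D_add D_scaleR)

lemma norm_Dn_le: "norm (Dn n p u) \<le> L ^ n * norm u"
proof (induction n)
 case (Suc n)
 have "norm (Dn (Suc n) p u) \<le> L * norm (Dn n p u)"
  using norm_D_le by simp
 also have "\<dots> \<le> L * (L ^ n * norm u)"
  using Suc L_ge by (intro mult_left_mono) auto
 finally show ?case by simp
qed simp

lemma abs_wedge_Dn_le: "\<bar>wedge (Dn n p u) (Dn n p v)\<bar> \<le> 2 ^ n * \<bar>wedge u v\<bar>"
proof (induction n)
 case (Suc n)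
 have "\<bar>wedge (Dn (Suc n) p u) (Dn (Suc n) p v)\<bar> = \<bar>det ((G ^^ n) p)\<bar> * \<bar>wedge (Dn n p u) (Dn n p v)\<bar>"
  by (simp add: wedge_D abs_mult)
 also have "\<dots> \<le> 2 * (2 ^ n * \<bar>wedge u v\<bar>)"
  using Suc abs_det_le by (intro mult_mono) auto
 finally show ?case by simp
qed simp

lemma funpow_G_remainder:
 obtains C where "C \<ge> 0"
  "\<And>p q. norm ((G ^^ n) q - (G ^^ n) p - Dn n p (q - p)) \<le> C * (norm (q - p))\<^sup>2"
proof -
 have "\<exists>C\<ge>0. \<forall>p q. norm ((G ^^ n) q - (G ^^ n) p - Dn n p (q - p)) \<le> C * (norm (q - p))\<^sup>2"
 proof (induction n)
  case 0
  show ?case by (intro exI[of _ 0]) auto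
 next
  case (Suc n)
  then obtain C where C: "C \<ge> 0" "\<And>p q. norm ((G ^^ n) q - (G ^^ n) p - Dn n p (q - p)) \<le> C * (norm (q - p))\<^sup>2"
   by blast
  have Lip: "norm ((G ^^ n) q - (G ^^ n) p) \<le> L ^ n * norm (q - p)" for p q
  proof (induction n)
   case (Suc n)
   have "norm ((G ^^ Suc n) q - (G ^^ Suc n) p) \<le> L * norm ((G ^^ n) q - (G ^^ n) p)"
    using norm_G_diff_le by simp
   also have "\<dots> \<le> L * (L ^ n * norm (q - p))"
    using Suc L_ge by (intro mult_left_mono) auto
   finally show ?case by simp
  qed simp
  let ?C = "L * C + 50 * k * (L ^ n)\<^sup>2"
  have "norm ((G ^^ Suc n) q - (G ^^ Suc n) p - Dn (Suc n) p (q - p)) \<le> ?C * (norm (q - p))\<^sup>2" for p q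
  proof -
   define e where "e = (G ^^ n) q - (G ^^ n) p"
   have "(G ^^ Suc n) q - (G ^^ Suc n) p - Dn (Suc n) p (q - p) =
     D ((G ^^ n) p) (e - Dn n p (q - p)) + N ((G ^^ n) p) e"
    using G_add[of "(G ^^ n) p" e] by (simp add: e_def D_diff)
   then have "norm ((G ^^ Suc n) q - (G ^^ Suc n) p - Dn (Suc n) p (q - p)) \<le>
     L * norm (e - Dn n p (q - p)) + 50 * k * (norm e)\<^sup>2"
    using norm_triangle_ineq[of "D ((G ^^ n) p) (e - Dn n p (q - p))" "N ((G ^^ n) p) e"]
     norm_D_le[of "(G ^^ n) p" "e - Dn n p (q - p)"] norm_N_le[of "(G ^^ n) p" e] by simp
   also have "\<dots> \<le> L * (C * (norm (q - p))\<^sup>2) + 50 * k * (L ^ n * norm (q - p))\<^sup>2"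
    using C(2)[of q p] Lip[of q p] L_ge k unfolding e_def
    by (intro add_mono mult_left_mono power_mono) auto
   also have "\<dots> = ?C * (norm (q - p))\<^sup>2"
    by (simp add: power_mult_distrib algebra_simps)
   finally show ?thesis .
  qed
  moreover have "?C \<ge> 0" using C L_ge k by simp
  ultimately show ?case by blast
 qed
 then show thesis using that by blast
qed

text \<open>On a fine grid \<open>G ^^ n\<close> is linear on a cell up to one cell width, so the
  expansion \<open>s\<close> at the single point \<open>p0\<close> bounds how many cells the image
  meets. The area enters through \<open>2 ^ n\<close>. The larger row of the matrix plays the part
  of \<open>\<rho>1\<close>.\<close>

lemma cell_transitions:
 fixes m :: nat and C s :: real and c :: "int \<times> int"
 assumes m: "m > 0" "4 * C \<le> real m"
  and C: "\<And>p q. norm ((G ^^ n) q - (G ^^ n) p - Dn n p (q - p)) \<le> C * (norm (q - p))\<^sup>2" and C0: "C \<ge> 0"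
  and B: "B \<subseteq> sq m c" and p0: "p0 \<in> B" and s: "s \<ge> 1" "\<And>\<xi>. norm \<xi> = 1 \<Longrightarrow> norm (Dn n p0 \<xi>) \<le> s"
 defines "Z \<equiv> (\<lambda>p. (\<lfloor>real m * fst ((G ^^ n) p)\<rfloor>, \<lfloor>real m * snd ((G ^^ n) p)\<rfloor>)) ` B"
 shows "finite Z" "real (card Z) \<le> 320 * s * 2 ^ n"
proof -
 define a where "a = Dn n p0 (1, 0)"
 define b where "b = Dn n p0 (0, 1)"
 define \<rho>1 where "\<rho>1 = (fst a, fst b)"
 define \<rho>2 where "\<rho>2 = (snd a, snd b)"
 have lin: "Dn n p0 \<xi> = (inner \<rho>1 \<xi>, inner \<rho>2 \<xi>)" for \<xi>
 proof -
  have "\<xi> = fst \<xi> *\<^sub>R (1, 0) + snd \<xi> *\<^sub>R (0, 1)" by (simp add: prod_eq_iff)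
  then have "Dn n p0 \<xi> = fst \<xi> *\<^sub>R a + snd \<xi> *\<^sub>R b"
   unfolding a_def b_def by (metis Dn_add Dn_scaleR)
  then show ?thesis
   by (simp add: \<rho>1_def \<rho>2_def prod_eq_iff inner_prod_def algebra_simps)
 qed
 have w: "\<bar>wedge \<rho>1 \<rho>2\<bar> \<le> 2 ^ n"
  using abs_wedge_Dn_le[of n p0 "(1, 0)" "(0, 1)"]
  by (simp add: wedge_def \<rho>1_def \<rho>2_def a_def b_def mult.commute)
 have row: "norm \<rho> \<le> s" if \<rho>: "\<rho> = \<rho>1 \<or> \<rho> = \<rho>2" for \<rho>
 proof (cases "\<rho> = 0")
  case True
  then show ?thesis using s by simp
 next
  case False
  define \<xi> where "\<xi> = \<rho> /\<^sub>R norm \<rho>"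
  have "norm \<xi> = 1" using False by (simp add: \<xi>_def)
  have "norm \<rho> = inner \<rho> \<xi>"
   using False by (simp add: \<xi>_def dot_square_norm power2_eq_square)
  also have "\<dots> \<le> norm (Dn n p0 \<xi>)"
   using abs_fst_le_norm[of "Dn n p0 \<xi>"] abs_snd_le_norm[of "Dn n p0 \<xi>"] \<rho> unfolding lin by auto
  finally show ?thesis using s(2)[OF \<open>norm \<xi> = 1\<close>] by simp
 qed
 define \<eta> where "\<eta> p = real m *\<^sub>R (p - p0)" for p
 have \<eta>2: "norm (\<eta> p) \<le> 2" if "p \<in> B" for p
 proof -
  have "norm (p - p0) \<le> 2 / m"
   using norm_diff_sq[OF m(1) subsetD[OF B that] subsetD[OF B p0]] by simp
  then show ?thesis using m(1) by (simp add: \<eta>_def pos_le_divide_eq mult.commute)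
 qed
 have err: "norm (real m *\<^sub>R ((G ^^ n) p - (G ^^ n) p0 - Dn n p0 (p - p0))) \<le> 1" if "p \<in> B" for p
 proof -
  have "norm (p - p0) \<le> 2 / m"
   using norm_diff_sq[OF m(1) subsetD[OF B that] subsetD[OF B p0]] by simp
  then have "(norm (p - p0))\<^sup>2 \<le> (2 / m)\<^sup>2"
   by (intro power_mono) auto
  then have "C * (norm (p - p0))\<^sup>2 \<le> C * (2 / m)\<^sup>2"
   using C0 by (rule mult_left_mono)
  then have "norm ((G ^^ n) p - (G ^^ n) p0 - Dn n p0 (p - p0)) \<le> C * (2 / m)\<^sup>2"
   using C[of p p0] by linarith
  then have "real m * norm ((G ^^ n) p - (G ^^ n) p0 - Dn n p0 (p - p0)) \<le> real m * (C * (2 / real m)\<^sup>2)"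
   by (intro mult_left_mono) auto
  also have "\<dots> = 4 * C / m"
   using m(1) by (simp add: power2_eq_square)
  also have "\<dots> \<le> 1" using m by (simp add: divide_le_eq)
  finally show ?thesis by simp
 qed
 define w1 where "w1 p = real m * fst ((G ^^ n) p)" for p
 define w2 where "w2 p = real m * snd ((G ^^ n) p)" for p
 have e1: "\<bar>w1 p - w1 p0 - inner \<rho>1 (\<eta> p)\<bar> \<le> 1" and e2: "\<bar>w2 p - w2 p0 - inner \<rho>2 (\<eta> p)\<bar> \<le> 1" if "p \<in> B" for p
 proof -
  let ?v = "real m *\<^sub>R ((G ^^ n) p - (G ^^ n) p0 - Dn n p0 (p - p0))"
  have "fst ?v = w1 p - w1 p0 - inner \<rho>1 (\<eta> p)" "snd ?v = w2 p - w2 p0 - inner \<rho>2 (\<eta> p)"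
   by (simp_all add: lin w1_def w2_def \<eta>_def algebra_simps)
  then show "\<bar>w1 p - w1 p0 - inner \<rho>1 (\<eta> p)\<bar> \<le> 1" "\<bar>w2 p - w2 p0 - inner \<rho>2 (\<eta> p)\<bar> \<le> 1"
   using abs_fst_le_norm[of ?v] abs_snd_le_norm[of ?v] err[OF that] by linarith+
 qed
 have Z: "Z = (\<lambda>p. (\<lfloor>w1 p\<rfloor>, \<lfloor>w2 p\<rfloor>)) ` B"
  by (simp add: Z_def w1_def w2_def)
 have n1: "(1 :: real) \<le> 2 ^ n" by simp
 have big: "(4 * x + 4) * (12 + 8 * 2 ^ n) \<le> 320 * s * 2 ^ n" if "x \<le> s" "0 \<le> x" for x :: real
 proof -
  have "(4 * x + 4) * (12 + 8 * 2 ^ n) \<le> (8 * s) * (20 * 2 ^ n)"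
   using that s(1) n1 by (intro mult_mono) auto
  also have "\<dots> \<le> 320 * s * 2 ^ n" using s(1) n1 by simp
  finally show ?thesis .
 qed
 have "finite Z \<and> real (card Z) \<le> 320 * s * 2 ^ n"
 proof (cases "norm \<rho>1 < 1 \<and> norm \<rho>2 < 1")
  case True
  have inn: "\<bar>inner \<rho> (\<eta> p)\<bar> \<le> 2" if "norm \<rho> < 1" "p \<in> B" for \<rho> p
  proof -
   have "\<bar>inner \<rho> (\<eta> p)\<bar> \<le> norm \<rho> * norm (\<eta> p)" by (rule Cauchy_Schwarz_ineq2)
   also have "\<dots> \<le> 1 * 2" using that(1) \<eta>2[OF that(2)] by (intro mult_mono) auto
   finally show ?thesis by simp
  qed
  have "\<bar>w1 p - w1 p0\<bar> \<le> 3" "\<bar>w2 p - w2 p0\<bar> \<le> 3" if "p \<in> B" for p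
  proof -
   have "\<bar>inner \<rho>1 (\<eta> p)\<bar> \<le> 2" "\<bar>inner \<rho>2 (\<eta> p)\<bar> \<le> 2"
    using inn True that by blast+
   then show "\<bar>w1 p - w1 p0\<bar> \<le> 3" "\<bar>w2 p - w2 p0\<bar> \<le> 3"
    using e1[OF that] e2[OF that] by linarith+
  qed
  from grid_count_small[of B w1 "w1 p0" w2 "w2 p0", OF this]
  have "finite Z" "real (card Z) \<le> 64" unfolding Z by auto
  moreover have "64 \<le> 320 * s * 2 ^ n"
   using mult_mono[of 1 s 1 "2 ^ n :: real"] s(1) n1 by simp
  ultimately show ?thesis by linarith
 next
  case False
  show ?thesis
  proof (cases "norm \<rho>2 \<le> norm \<rho>1")
   case True
   then have "1 \<le> norm \<rho>1" using False by linarith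
   note gc = grid_count[where B = B and \<eta> = \<eta> and ?w1.0 = w1 and ?w2.0 = w2, OF this True w \<eta>2 e1 e2]
   have "finite Z" "real (card Z) \<le> (4 * norm \<rho>1 + 4) * (12 + 8 * 2 ^ n)"
    unfolding Z using gc by simp_all
   then show ?thesis
    using big[of "norm \<rho>1"] row[of \<rho>1] by simp
  next
   case F2: False
   then have 1: "1 \<le> norm \<rho>2" "norm \<rho>1 \<le> norm \<rho>2" using False by linarith+
   have w': "\<bar>wedge \<rho>2 \<rho>1\<bar> \<le> 2 ^ n"
    using w abs_minus_commute[of "fst \<rho>1 * snd \<rho>2" "snd \<rho>1 * fst \<rho>2"] by (simp add: wedge_def mult.commute)
   let ?W = "(\<lambda>p. (\<lfloor>w2 p\<rfloor>, \<lfloor>w1 p\<rfloor>)) ` B"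
   have W: "finite ?W" "real (card ?W) \<le> (4 * norm \<rho>2 + 4) * (12 + 8 * 2 ^ n)"
    using grid_count[where B = B and \<eta> = \<eta> and ?w1.0 = w2 and ?w2.0 = w1, OF 1 w' \<eta>2 e2 e1] by simp_all
   have sw: "Z = prod.swap ` ?W"
    unfolding Z image_image by (simp only: prod.swap_def fst_conv snd_conv)
   have "finite Z" unfolding sw using W(1) by (rule finite_imageI)
   moreover have "real (card Z) \<le> real (card ?W)"
    unfolding sw of_nat_le_iff by (rule card_image_le[OF W(1)])
   ultimately show ?thesis
    using W(2) big[of "norm \<rho>2"] row[of \<rho>2] by simp
  qed
 qed
 then show "finite Z" "real (card Z) \<le> 320 * s * 2 ^ n" by auto
qed

definition expanding :: "real \<Rightarrow> nat \<Rightarrow> torus set" where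
 "expanding c n = {z. \<exists>p \<xi>. to_torus p = z \<and> norm \<xi> = 1 \<and> c \<le> norm (Dn n p \<xi>)}"

lemma continuous_on_Dn: "continuous_on UNIV (\<lambda>x. Dn n (fst x) (snd x))"
proof (induction n)
 case 0
 show ?case by (auto intro!: continuous_intros)
next
 case (Suc n)
 have cG: "continuous_on UNIV (\<lambda>x::(real \<times> real) \<times> (real \<times> real). (G ^^ n) (fst x))" for n
 proof (induction n)
  case (Suc n)
  then show ?case by (auto intro: continuous_on_compose2[OF continuous_on_G[of UNIV]])
 qed (auto intro!: continuous_intros)
 have "isCont (\<lambda>y. D (fst y) (snd y)) y0" for y0 :: "(real \<times> real) \<times> (real \<times> real)"
 proof -
  have "((\<lambda>y. D (fst y0) (snd y - snd y0) + (D (fst y) (snd y) - D (fst y0) (snd y))) \<longlongrightarrow> 0) (at y0)"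
  proof (rule tendsto_add_zero; rule Lim_null_comparison[OF always_eventually])
   show "\<forall>y. norm (D (fst y0) (snd y - snd y0)) \<le> L * norm (snd y - snd y0)"
    using norm_D_le by blast
   show "((\<lambda>y. L * norm (snd y - snd y0)) \<longlongrightarrow> 0) (at y0)"
    by (auto intro!: tendsto_eq_intros)
   show "\<forall>y. norm (D (fst y) (snd y) - D (fst y0) (snd y)) \<le> 50 * k * norm (fst y - fst y0) * norm (snd y)"
    using norm_D_diff_le by blast
   show "((\<lambda>y. 50 * k * norm (fst y - fst y0) * norm (snd y)) \<longlongrightarrow> 0) (at y0)"
    by (auto intro!: tendsto_eq_intros)
  qed
  then have "((\<lambda>y. D (fst y) (snd y) - D (fst y0) (snd y0)) \<longlongrightarrow> 0) (at y0)"
   by (simp add: D_diff algebra_simps)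
  then show ?thesis
   unfolding isCont_def using LIM_zero_iff by blast
 qed
 then have cD: "continuous_on UNIV (\<lambda>y. D (fst y) (snd y))"
  by (simp add: continuous_at_imp_continuous_on)
 have "continuous_on UNIV (\<lambda>x. ((G ^^ n) (fst x), Dn n (fst x) (snd x)))"
  by (intro continuous_on_Pair cG Suc)
 from continuous_on_compose2[OF cD this] show ?case by simp
qed

text \<open>This gives measurability. By periodicity the base point can be taken in the closed unit
  square, so the set is the image of a compact set.\<close>

lemma closed_expanding: "closed (expanding c n)"
proof -
 define S where "S = {x \<in> (cbox (0, 0) (1, 1)) \<times> sphere (0, 0) 1. c \<le> norm (Dn n (fst x) (snd x))}"
 have "closed {x. c \<le> norm (Dn n (fst x) (snd x))}"
  by (intro closed_Collect_le continuous_intros continuous_on_Dn)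
 then have "compact (((cbox (0, 0) (1, 1)) \<times> sphere (0, 0) 1) \<inter> {x. c \<le> norm (Dn n (fst x) (snd x))})"
  by (intro compact_Int_closed compact_Times) auto
 then have "compact S" by (simp add: S_def Int_def conj_commute Collect_conj_eq[symmetric])
 then have "compact ((\<lambda>x. to_torus (fst x)) ` S)"
  by (intro compact_continuous_image continuous_on_compose2[OF continuous_on_to_torus[of UNIV]])
    (auto intro!: continuous_intros)
 moreover have "expanding c n = (\<lambda>x. to_torus (fst x)) ` S"
 proof
  show "(\<lambda>x. to_torus (fst x)) ` S \<subseteq> expanding c n"
   by (force simp: expanding_def S_def zero_prod_def[symmetric])
  show "expanding c n \<subseteq> (\<lambda>x. to_torus (fst x)) ` S"
  proof
   fix z assume "z \<in> expanding c n"
   then obtain p \<xi> where p: "to_torus p = z" "norm \<xi> = 1" "c \<le> norm (Dn n p \<xi>)"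
    by (auto simp: expanding_def)
   let ?q = "(frac (fst p), frac (snd p))"
   have q: "to_torus ?q = to_torus p"
    by (simp add: to_torus_eq_iff int_lattice_def frac_def minus_prod_def)
   have "?q \<in> cbox (0, 0) (1, 1)"
    using less_imp_le[OF frac_lt_1] by (auto simp: cbox_Pair_eq frac_ge_0)
   moreover have "Dn n ?q = Dn n p" by (rule Dn_cong[OF q])
   ultimately have "(?q, \<xi>) \<in> S"
    using p by (simp add: S_def zero_prod_def[symmetric])
   then show "z \<in> (\<lambda>x. to_torus (fst x)) ` S"
    using q p by (intro image_eqI[of _ _ "(?q, \<xi>)"]) auto
  qed
 qed
 ultimately show ?thesis by (simp add: compact_imp_closed)
qed

lemma not_expanding: "z \<notin> expanding c n \<Longrightarrow> to_torus p = z \<Longrightarrow> norm \<xi> = 1 \<Longrightarrow> norm (Dn n p \<xi>) \<le> c"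
 unfolding expanding_def using linear by blast

text \<open>Orbits are listed by their cells at multiples of \<open>n\<close>. A block in
  \<open>J\<close> is known not to expand by more than \<open>c\<close>, and so multiplies the
  number of continuations by about \<open>c * 2 ^ n\<close> in place of
  \<open>L ^ n * 2 ^ n\<close>.\<close>

lemma exists_pattern_cover:
 fixes m :: nat and C c :: real
 assumes m: "m > 0" "4 * C \<le> real m"
  and C: "\<And>p q. norm ((G ^^ n) q - (G ^^ n) p - Dn n p (q - p)) \<le> C * (norm (q - p))\<^sup>2" and C0: "C \<ge> 0"
  and c: "c \<ge> 1"
 shows "\<exists>\<A>. finite \<A> \<and> {x. \<forall>i\<in>J. i < M \<longrightarrow> (g ^^ (i * n)) x \<notin> expanding c n} \<subseteq> \<Union>\<A> \<and>
   real (card \<A>) \<le> (real m)\<^sup>2 * (\<Prod>i<M. 320 * (if i \<in> J then c else L ^ n) * 2 ^ n) \<and>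
   (\<forall>A\<in>\<A>. \<forall>i\<le>M. \<exists>d. \<forall>x\<in>A. (g ^^ (i * n)) x \<in> to_torus ` sq m d)"
proof (induction M)
 case 0
 let ?A = "(\<lambda>c. to_torus ` sq m c) ` ({0..<int m} \<times> {0..<int m})"
 have "card ?A \<le> m ^ 2"
  unfolding torus_cells(2)[OF m(1), symmetric] by (rule card_image_le) simp
 then have 1: "real (card ?A) \<le> (real m)\<^sup>2"
  by (metis of_nat_le_iff of_nat_power)
 have 2: "UNIV \<subseteq> \<Union>?A" using torus_cells(1)[OF m(1)] by (rule equalityD1)
 show ?case
  by (rule exI[of _ ?A]) (use 1 2 in auto)
next
 case (Suc M)
 let ?Y = "\<lambda>M. {x. \<forall>i\<in>J. i < M \<longrightarrow> (g ^^ (i * n)) x \<notin> expanding c n}"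
 obtain \<A> where A: "finite \<A>" "?Y M \<subseteq> \<Union>\<A>"
  "real (card \<A>) \<le> (real m)\<^sup>2 * (\<Prod>i<M. 320 * (if i \<in> J then c else L ^ n) * 2 ^ n)"
  "\<forall>A\<in>\<A>. \<forall>i\<le>M. \<exists>d. \<forall>x\<in>A. (g ^^ (i * n)) x \<in> to_torus ` sq m d"
  using Suc by blast
 define s where "s = (if M \<in> J then c else L ^ n)"
 have s1: "s \<ge> 1" using c L_ge by (auto simp: s_def intro: one_le_power)
 define R where "R A = A \<inter> ?Y (Suc M)" for A
 have "\<exists>I. finite I \<and> real (card I) \<le> 320 * s * 2 ^ n \<and> (\<forall>x\<in>R A. \<exists>d\<in>I. (g ^^ (Suc M * n)) x \<in> to_torus ` sq m d)"
  if AA: "A \<in> \<A>" for A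
 proof -
  obtain d where d: "\<forall>x\<in>A. (g ^^ (M * n)) x \<in> to_torus ` sq m d"
   using A(4) AA by blast
  define B where "B = {p \<in> sq m d. \<exists>x\<in>R A. to_torus p = (g ^^ (M * n)) x}"
  define I where "I = (\<lambda>p. (\<lfloor>real m * fst ((G ^^ n) p)\<rfloor>, \<lfloor>real m * snd ((G ^^ n) p)\<rfloor>)) ` B"
  have "finite I \<and> real (card I) \<le> 320 * s * 2 ^ n"
  proof (cases "B = {}")
   case False
   then obtain p0 where p0: "p0 \<in> B" by blast
   have "norm (Dn n p0 \<xi>) \<le> s" if \<xi>: "norm \<xi> = 1" for \<xi>
   proof (cases "M \<in> J")
    case True
    obtain x where x: "x \<in> R A" "to_torus p0 = (g ^^ (M * n)) x"
     using p0 by (auto simp: B_def)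
    then have "to_torus p0 \<notin> expanding c n"
     using True by (auto simp: R_def)
    then show ?thesis
     using not_expanding[OF _ refl \<xi>] True by (simp add: s_def)
   next
    case False
    then show ?thesis
     using norm_Dn_le[of n p0 \<xi>] \<xi> by (simp add: s_def)
   qed
   then show ?thesis
    using cell_transitions[OF m C C0, of B d p0 s] p0 s1 unfolding I_def B_def by blast
  qed (use s1 in \<open>simp add: I_def\<close>)
  moreover have "\<exists>d'\<in>I. (g ^^ (Suc M * n)) x \<in> to_torus ` sq m d'" if x: "x \<in> R A" for x
  proof -
   obtain p where p: "p \<in> sq m d" "to_torus p = (g ^^ (M * n)) x"
    using d x by (force simp: R_def)
   then have "p \<in> B" using x by (auto simp: B_def)
   moreover have "(g ^^ (Suc M * n)) x = to_torus ((G ^^ n) p)"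
    unfolding to_torus_funpow p(2) by (simp add: funpow_add)
   moreover have "(G ^^ n) p \<in> sq m (\<lfloor>real m * fst ((G ^^ n) p)\<rfloor>, \<lfloor>real m * snd ((G ^^ n) p)\<rfloor>)"
    by (simp add: sq_def)
   ultimately show ?thesis unfolding I_def by blast
  qed
  ultimately show ?thesis by blast
 qed
 then obtain I where I: "\<And>A. A \<in> \<A> \<Longrightarrow> finite (I A) \<and> real (card (I A)) \<le> 320 * s * 2 ^ n \<and>
   (\<forall>x\<in>R A. \<exists>d\<in>I A. (g ^^ (Suc M * n)) x \<in> to_torus ` sq m d)"
  by metis
 define \<A>' where "\<A>' = (\<lambda>(A, d). R A \<inter> {x. (g ^^ (Suc M * n)) x \<in> to_torus ` sq m d}) ` (Sigma \<A> I)"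
 have finS: "finite (Sigma \<A> I)" using A(1) I by auto
 have 1: "finite \<A>'" unfolding \<A>'_def using finS by simp
 have 2: "?Y (Suc M) \<subseteq> \<Union>\<A>'"
 proof
  fix x assume x: "x \<in> ?Y (Suc M)"
  then obtain A' where A': "A' \<in> \<A>" "x \<in> A'" using A(2) by force
  then have "x \<in> R A'" using x by (simp add: R_def)
  then obtain d where "d \<in> I A'" "(g ^^ (Suc M * n)) x \<in> to_torus ` sq m d"
   using I[OF A'(1)] by blast
  then show "x \<in> \<Union>\<A>'"
   unfolding \<A>'_def using A' \<open>x \<in> R A'\<close> by blast
 qed
 have 3: "real (card \<A>') \<le> (real m)\<^sup>2 * (\<Prod>i<Suc M. 320 * (if i \<in> J then c else L ^ n) * 2 ^ n)"
 proof -
  have "card \<A>' \<le> card (Sigma \<A> I)"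
   unfolding \<A>'_def by (rule card_image_le[OF finS])
  also have "\<dots> = (\<Sum>A\<in>\<A>. card (I A))"
   using A(1) I by simp
  finally have "real (card \<A>') \<le> (\<Sum>A\<in>\<A>. real (card (I A)))"
   by (simp only: of_nat_le_iff of_nat_sum[symmetric])
  also have "\<dots> \<le> (\<Sum>A\<in>\<A>. 320 * s * 2 ^ n)"
   using I by (intro sum_mono) blast
  also have "\<dots> = card \<A> * (320 * s * 2 ^ n)" by simp
  also have "\<dots> \<le> ((real m)\<^sup>2 * (\<Prod>i<M. 320 * (if i \<in> J then c else L ^ n) * 2 ^ n)) * (320 * s * 2 ^ n)"
   using A(3) s1 by (intro mult_right_mono) auto
  also have "\<dots> = (real m)\<^sup>2 * (\<Prod>i<Suc M. 320 * (if i \<in> J then c else L ^ n) * 2 ^ n)"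
   by (simp add: s_def)
  finally show ?thesis .
 qed
 have 4: "\<forall>A\<in>\<A>'. \<forall>i\<le>Suc M. \<exists>d. \<forall>x\<in>A. (g ^^ (i * n)) x \<in> to_torus ` sq m d"
 proof (intro ballI allI impI)
  fix A' i assume A': "A' \<in> \<A>'" and i: "i \<le> Suc M"
  obtain A'' d where Ad: "A'' \<in> \<A>" "A' = R A'' \<inter> {x. (g ^^ (Suc M * n)) x \<in> to_torus ` sq m d}"
   using A' unfolding \<A>'_def by auto
  show "\<exists>d. \<forall>x\<in>A'. (g ^^ (i * n)) x \<in> to_torus ` sq m d"
  proof (cases "i = Suc M")
   case True
   then show ?thesis using Ad(2) by blast
  next
   case False
   then obtain d' where "\<forall>x\<in>A''. (g ^^ (i * n)) x \<in> to_torus ` sq m d'"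
    using A(4) Ad(1) i le_Suc_eq by blast
   then show ?thesis using Ad(2) unfolding R_def by blast
  qed
 qed
 show ?case
  using 1 2 3 4 by blast
qed

text \<open>Otherwise a set of measure at least \<open>1 / 20\<close> would consist of points for
  which a twentieth of the blocks of length \<open>n\<close> lose a factor
  \<open>exp (400 * n)\<close>. The average loss of \<open>exp (20 * n)\<close> per block outweighs
  the factors \<open>320\<close>, \<open>2 ^ n\<close>, the choice of the bad blocks and the
  constant 7 between \<open>L\<close> and \<open>k\<close>, so too few sets would cover.\<close>

lemma measure_expanding_ge:
 assumes mme: "maximal_entropy_measure g \<mu>" and k400: "exp 400 \<le> k" and n: "n \<ge> 1"
 shows "9 / 10 \<le> measure \<mu> (expanding ((L * exp (- 400)) ^ n) n)"
proof (rule ccontr)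
 assume neg: "\<not> ?thesis"
 define c where "c = (L * exp (- 400)) ^ n"
 define V where "V = - expanding c n"
 have Lk: "L = 7 * k" by (simp add: L_def)
 have "L * exp (- 400) \<ge> 1"
  using k400 k by (simp add: Lk exp_minus field_simps)
 then have c1: "c \<ge> 1" unfolding c_def by (rule one_le_power)
 obtain h where h: "topological_entropy g = ereal h" "ln k \<le> h"
  by (rule topological_entropy_real)
 have inv: "invariant_prob g \<mu>"
  using mme by (simp add: maximal_entropy_measure_def)
 interpret prob_space \<mu> using inv by (simp add: invariant_prob_def)
 have sets: "sets \<mu> = sets borel" using inv by (simp add: invariant_prob_def)
 then have sp: "space \<mu> = UNIV" using sets_eq_imp_space_eq[of \<mu> borel] by simp
 have V: "V \<in> sets borel"
  unfolding V_def using closed_expanding by (simp add: borel_closed)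
 have ex: "expanding c n \<in> events" using closed_expanding by (simp add: sets borel_closed)
 have "prob V = 1 - prob (expanding c n)"
  using prob_compl[OF ex] by (simp add: V_def sp Compl_eq_Diff_UNIV)
 then have pV: "1 / 10 \<le> prob V" using neg by (simp add: c_def)
 obtain \<delta> where \<delta>: "\<delta> > 0" and freq: "\<exists>\<^sub>F T in sequentially. \<forall>Y \<A>. Y \<in> sets \<mu> \<longrightarrow> 1 / 20 \<le> measure \<mu> Y \<longrightarrow>
   finite \<A> \<longrightarrow> Y \<subseteq> \<Union>\<A> \<longrightarrow> (\<forall>A\<in>\<A>. bowen_small g T \<delta> A) \<longrightarrow> exp (T * (h - 1)) \<le> card \<A>"
  using maximal_entropy_cover_lower_bound[OF mme h(1), of 1 "1 / 20"] by auto
 obtain C where C0: "C \<ge> 0" and C: "\<And>p q. norm ((G ^^ n) q - (G ^^ n) p - Dn n p (q - p)) \<le> C * (norm (q - p))\<^sup>2"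
  using funpow_G_remainder[of n] by blast
 \<comment> \<open>The grid is fine enough both for linear approximation over \<open>n\<close> steps
   and for points of a common cell to stay \<open>\<delta>\<close>-close during a block.\<close>
 obtain m where m: "max (4 * C + 1) (2 * L ^ n / \<delta>) < real m"
  using reals_Archimedean2 by blast
 then have m0: "m > 0" and m1: "4 * C \<le> real m" and m2: "2 * L ^ n / \<delta> < real m" using C0 by auto
 have m3: "L ^ n * (2 / m) < \<delta>"
  using m2 m0 \<delta> by (simp add: field_simps)
 obtain T where T: "T > n + m\<^sup>2" and low: "\<forall>Y \<A>. Y \<in> sets \<mu> \<longrightarrow> 1 / 20 \<le> measure \<mu> Y \<longrightarrow>
   finite \<A> \<longrightarrow> Y \<subseteq> \<Union>\<A> \<longrightarrow> (\<forall>A\<in>\<A>. bowen_small g T \<delta> A) \<longrightarrow> exp (T * (h - 1)) \<le> card \<A>"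
  using frequently_eventually_frequently[OF freq eventually_gt_at_top[of "n + m\<^sup>2"]]
  by (auto dest: frequently_ex)
 define M where "M = T div n"
 have M: "M > 0" "n * M \<le> T"
  using T n by (auto simp: M_def div_greater_zero_iff)
 define Y where "Y = {x \<in> space \<mu>. 1 / 20 * card {..<M} \<le> card {i \<in> {..<M}. x \<in> (g ^^ (i * n)) -` V}}"
 have Y: "Y \<in> sets \<mu>" "1 / 10 - 1 / 20 \<le> measure \<mu> Y"
 proof -
  have A: "(g ^^ (i * n)) -` V \<in> events" "1 / 10 \<le> prob ((g ^^ (i * n)) -` V)" for i
   using invariant_prob_measure_vimage[OF inv V, of "i * n"] pV by (simp_all add: sets)
  have ne: "{..<M} \<noteq> {}" using M(1) by (simp add: lessThan_empty_iff)
  show "Y \<in> sets \<mu>"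
   unfolding Y_def by (rule measure_frequent_visits(1)[OF _ ne A]) auto
  show "1 / 10 - 1 / 20 \<le> measure \<mu> Y"
   unfolding Y_def by (rule measure_frequent_visits(2)[OF _ ne A]) auto
 qed
 have ex: "\<forall>J. \<exists>\<A>. finite \<A> \<and> {x. \<forall>i\<in>J. i < M \<longrightarrow> (g ^^ (i * n)) x \<notin> expanding c n} \<subseteq> \<Union>\<A> \<and>
   real (card \<A>) \<le> (real m)\<^sup>2 * (\<Prod>i<M. 320 * (if i \<in> J then c else L ^ n) * 2 ^ n) \<and>
   (\<forall>A\<in>\<A>. \<forall>i\<le>M. \<exists>d. \<forall>x\<in>A. (g ^^ (i * n)) x \<in> to_torus ` sq m d)"
  by (intro allI exists_pattern_cover[OF m0 m1 C C0 c1])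
 obtain \<A> where AA: "\<forall>J. finite (\<A> J) \<and> {x. \<forall>i\<in>J. i < M \<longrightarrow> (g ^^ (i * n)) x \<notin> expanding c n} \<subseteq> \<Union>(\<A> J) \<and>
   real (card (\<A> J)) \<le> (real m)\<^sup>2 * (\<Prod>i<M. 320 * (if i \<in> J then c else L ^ n) * 2 ^ n) \<and>
   (\<forall>A\<in>\<A> J. \<forall>i\<le>M. \<exists>d. \<forall>x\<in>A. (g ^^ (i * n)) x \<in> to_torus ` sq m d)"
  using choice[OF ex] by (rule exE)
 have \<A>: "\<And>J. finite (\<A> J)" "\<And>J. {x. \<forall>i\<in>J. i < M \<longrightarrow> (g ^^ (i * n)) x \<notin> expanding c n} \<subseteq> \<Union>(\<A> J)"
   "\<And>J. real (card (\<A> J)) \<le> (real m)\<^sup>2 * (\<Prod>i<M. 320 * (if i \<in> J then c else L ^ n) * 2 ^ n)"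
   "\<And>J. (\<forall>A\<in>\<A> J. \<forall>i\<le>M. \<exists>d. \<forall>x\<in>A. (g ^^ (i * n)) x \<in> to_torus ` sq m d)"
  by (fact AA[THEN spec, THEN conjunct1] AA[THEN spec, THEN conjunct2, THEN conjunct1]
    AA[THEN spec, THEN conjunct2, THEN conjunct2, THEN conjunct1] AA[THEN spec, THEN conjunct2, THEN conjunct2, THEN conjunct2])+
 \<comment> \<open>The possible sets of non-expanding blocks. There are at most \<open>2 ^ M\<close>
   of them, a price of a factor 2 per block.\<close>
 define \<J> where "\<J> = {J. J \<subseteq> {..<M} \<and> real M / 20 \<le> card J}"
 have finJ: "finite \<J>" and cardJ: "card \<J> \<le> 2 ^ M"
 proof -
  have s: "\<J> \<subseteq> Pow {..<M}" by (auto simp: \<J>_def)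
  show "finite \<J>" by (rule finite_subset[OF s]) simp
  show "card \<J> \<le> 2 ^ M"
   using card_mono[OF _ s] by (simp add: card_Pow)
 qed
 define \<B> where "\<B> = (\<Union>J\<in>\<J>. \<A> J)"
 have finB: "finite \<B>" using finJ \<A>(1) by (simp add: \<B>_def)
 have Ysub: "Y \<subseteq> \<Union>\<B>"
 proof
  fix x assume x: "x \<in> Y"
  define J where "J = {i \<in> {..<M}. x \<in> (g ^^ (i * n)) -` V}"
  have "J \<in> \<J>" using x by (auto simp: \<J>_def J_def Y_def)
  moreover have "x \<in> {x. \<forall>i\<in>J. i < M \<longrightarrow> (g ^^ (i * n)) x \<notin> expanding c n}"
   by (auto simp: J_def V_def)
  ultimately show "x \<in> \<Union>\<B>"
   using subsetD[OF \<A>(2)[of J]] unfolding \<B>_def by blast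
 qed
 have small: "\<forall>A\<in>\<B>. bowen_small g T \<delta> A"
  unfolding bowen_small_def
 proof (intro ballI allI impI)
  fix A x y i assume A: "A \<in> \<B>" and xy: "x \<in> A" "y \<in> A" and i: "i < T"
  define q where "q = i div n"
  have iq: "i = i mod n + q * n" by (simp add: q_def)
  have "q \<le> M" using i by (simp add: q_def M_def div_le_mono)
  then obtain d where "\<forall>x\<in>A. (g ^^ (q * n)) x \<in> to_torus ` sq m d"
   using A \<A>(4) unfolding \<B>_def by blast
  then obtain px py where p: "px \<in> sq m d" "py \<in> sq m d" "(g ^^ (q * n)) x = to_torus px" "(g ^^ (q * n)) y = to_torus py"
   using xy by blast
  have "dist ((g ^^ (q * n)) x) ((g ^^ (q * n)) y) \<le> 2 / m"
   using dist_to_torus_le[of px py] norm_diff_sq[OF m0 p(1,2)] by (simp add: p dist_norm)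
  moreover have "L ^ (i mod n) \<le> L ^ n"
   using n L_ge by (intro power_increasing) (auto simp: less_imp_le)
  ultimately have "L ^ (i mod n) * dist ((g ^^ (q * n)) x) ((g ^^ (q * n)) y) \<le> L ^ n * (2 / m)"
   using L_ge by (intro mult_mono) auto
  moreover have "dist ((g ^^ i) x) ((g ^^ i) y) \<le> L ^ (i mod n) * dist ((g ^^ (q * n)) x) ((g ^^ (q * n)) y)"
   using dist_funpow_le[of "i mod n" "(g ^^ (q * n)) x" "(g ^^ (q * n)) y"]
   by (subst (1 2) iq) (simp add: funpow_add)
  ultimately show "dist ((g ^^ i) x) ((g ^^ i) y) < \<delta>" using m3 by linarith
 qed
 have L0: "L > 0" using L_ge by linarith
 have two: "2 ^ j \<le> exp (real j)" for j
 proof -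
  have "(2::real) ^ j \<le> exp 1 ^ j" using exp_ge_add_one_self[of 1] by (intro power_mono) auto
  then show ?thesis by (simp add: exp_of_nat_mult[symmetric])
 qed
 have piece: "(\<Prod>i<M. 320 * (if i \<in> J then c else L ^ n) * 2 ^ n) \<le> (320 * L ^ n * 2 ^ n * exp (- 20 * n)) ^ M" if J: "J \<in> \<J>" for J
 proof -
  have "(\<Prod>i<M. 320 * (if i \<in> J then c else L ^ n) * 2 ^ n) =
    (\<Prod>i<M. (320 * L ^ n * 2 ^ n) * (if i \<in> J then exp (- 400 * n) else 1))"
   by (intro prod.cong refl) (simp add: c_def power_mult_distrib exp_of_nat_mult[symmetric] mult.commute)
  also have "\<dots> = (320 * L ^ n * 2 ^ n) ^ M * exp (- 400 * n) ^ card J"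
   using J by (simp add: prod.distrib prod.If_cases \<J>_def inf.absorb2 del: exp_of_nat_mult)
  also have "exp (- 400 * n) ^ card J \<le> exp (- 20 * n) ^ M"
  proof -
   have "n * (M / 20) \<le> n * real (card J)"
    using J by (intro mult_left_mono) (auto simp: \<J>_def)
   then show ?thesis
    by (simp add: exp_of_nat_mult[symmetric] algebra_simps)
  qed
  finally show ?thesis
   using L0 by (simp add: power_mult_distrib)
 qed
 \<comment> \<open>The leading factor 2 pays for the choice of \<open>J\<close>; together
   \<open>640 * 2 ^ n\<close> is at most \<open>exp (11 * n)\<close>, which leaves
   \<open>exp (- 9 * n)\<close>.\<close>
 have step: "2 * (320 * L ^ n * 2 ^ n * exp (- 20 * n)) \<le> (L * exp (- 9)) ^ n"
 proof -
  have "(640::real) \<le> 2 ^ 10" by simp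
  also have "\<dots> \<le> exp (real 10)" by (rule two)
  also have "\<dots> \<le> exp (10 * real n)" using n by simp
  finally have "640 * 2 ^ n * exp (- 20 * real n) \<le> exp (10 * real n) * exp (real n) * exp (- 20 * real n)"
   using two[of n] by (intro mult_mono) auto
  also have "\<dots> = exp (- 9 * real n)" by (simp add: exp_add[symmetric])
  finally have "L ^ n * (640 * 2 ^ n * exp (- 20 * real n)) \<le> L ^ n * exp (- 9 * real n)"
   using L0 by (intro mult_left_mono) auto
  also have "\<dots> = (L * exp (- 9)) ^ n"
   by (simp add: power_mult_distrib exp_of_nat_mult[symmetric] mult.commute)
  finally show ?thesis by (simp add: mult_ac)
 qed
 have Le: "L * exp (- 9) \<ge> 1"
 proof -
  have "exp 9 \<le> exp (400::real)" by simp
  then have "exp 9 \<le> L" using k400 k unfolding Lk by linarith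
  then show ?thesis by (simp add: exp_minus pos_le_divide_eq flip: divide_inverse)
 qed
 have "real (card \<B>) \<le> (\<Sum>J\<in>\<J>. real (card (\<A> J)))"
  unfolding \<B>_def using card_UN_le[OF finJ, of \<A>] by (simp only: of_nat_le_iff of_nat_sum[symmetric])
 also have "\<dots> \<le> (\<Sum>J\<in>\<J>. (real m)\<^sup>2 * (320 * L ^ n * 2 ^ n * exp (- 20 * n)) ^ M)"
  by (intro sum_mono order_trans[OF \<A>(3)] mult_left_mono piece) auto
 also have "\<dots> = real (card \<J>) * ((real m)\<^sup>2 * (320 * L ^ n * 2 ^ n * exp (- 20 * n)) ^ M)"
  by simp
 also have "\<dots> \<le> 2 ^ M * ((real m)\<^sup>2 * (320 * L ^ n * 2 ^ n * exp (- 20 * n)) ^ M)"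
  using cardJ L0 by (intro mult_right_mono) (auto simp: numeral_power_le_of_nat_cancel_iff of_nat_le_numeral_power_cancel_iff)
 also have "\<dots> = (real m)\<^sup>2 * (2 * (320 * L ^ n * 2 ^ n * exp (- 20 * n))) ^ M"
  by (simp only: power_mult_distrib mult_ac)
 also have "\<dots> \<le> (real m)\<^sup>2 * ((L * exp (- 9)) ^ n) ^ M"
  using L0 step by (intro mult_left_mono power_mono) auto
 also have "\<dots> \<le> (real m)\<^sup>2 * (L * exp (- 9)) ^ T"
  unfolding power_mult[symmetric] using M(2) Le by (intro mult_left_mono power_increasing) auto
 finally have up: "real (card \<B>) \<le> (real m)\<^sup>2 * (L * exp (- 9)) ^ T" .
 have "exp (T * (h - 1)) \<le> card \<B>"
  using low Y finB Ysub small by auto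
 \<comment> \<open>From \<open>7 \<le> exp 3\<close> and \<open>k \<le> exp h\<close>. The gap
   between \<open>exp (- 4)\<close> and \<open>exp (- 9)\<close> is a factor
   \<open>exp (5 * T)\<close>, which the fixed \<open>m\<close> cannot make up for.\<close>
 moreover have "(L * exp (- 4)) ^ T \<le> exp (T * (h - 1))"
 proof -
  have "L * exp (- 4) = k * 7 * exp (- 4)" by (simp add: Lk)
  also have "\<dots> \<le> k * exp 3 * exp (- 4)"
   using two[of 3] k by (intro mult_right_mono mult_left_mono) auto
  also have "\<dots> = k * exp (- 1)" by (simp add: exp_add[symmetric] mult.assoc)
  also have "\<dots> = exp (ln k - 1)" using k by (simp add: exp_diff exp_minus field_simps)
  also have "\<dots> \<le> exp (h - 1)" using h by simp
  finally have "(L * exp (- 4)) ^ T \<le> exp (h - 1) ^ T"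
   using L0 by (intro power_mono) auto
  then show ?thesis by (simp add: exp_of_nat_mult[symmetric])
 qed
 ultimately have "(L * exp (- 4)) ^ T \<le> (real m)\<^sup>2 * (L * exp (- 9)) ^ T"
  using up by linarith
 moreover have "(L * exp (- 4)) ^ T = exp (5 * T) * (L * exp (- 9)) ^ T"
 proof -
  have "L * exp (- 4) = exp 5 * (L * exp (- 9))" by (simp add: mult.left_commute exp_add[symmetric])
  then have "(L * exp (- 4)) ^ T = exp 5 ^ T * (L * exp (- 9)) ^ T"
   by (simp only: power_mult_distrib)
  then show ?thesis by (simp only: exp_of_nat_mult[symmetric] of_nat_mult of_nat_numeral mult.commute)
 qed
 moreover have "(L * exp (- 9)) ^ T > 0" using L0 by simp
 ultimately have "exp (5 * T) \<le> (real m)\<^sup>2"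
  by (simp only: mult_le_cancel_right_pos)
 moreover have "1 + 5 * T \<le> exp (5 * T)" using exp_ge_add_one_self[of "5 * real T"] by simp
 moreover have "real T > (real m)\<^sup>2"
  using T by (metis add_lessD1 add.commute of_nat_less_iff of_nat_power)
 ultimately show False by linarith
qed

end

section \<open>The Hausdorff dimension of measures of maximal entropy\<close>

lemma hausdorff_null_cover:
 fixes X :: "'a::metric_space set"
 assumes null: "hausdorff_measure s X = 0" and s: "s > 0" and \<zeta>: "\<zeta> > 0"
 obtains U :: "nat \<Rightarrow> 'a set" where "X \<subseteq> (\<Union>i. U i)" "\<And>i. bounded (U i)"
  "summable (\<lambda>i. diameter (U i) powr s)" "(\<Sum>i. diameter (U i) powr s) \<le> \<zeta>"
proof -
 have "hausdorff_premeasure s 1 X \<le> hausdorff_measure s X"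
  unfolding hausdorff_measure_def by (rule SUP_upper) simp
 also have "\<dots> < ennreal \<zeta>" using null \<zeta> by simp
 finally have "\<exists>U\<in>{U :: nat \<Rightarrow> 'a set. X \<subseteq> (\<Union>i. U i) \<and> (\<forall>i. bounded (U i) \<and> diameter (U i) \<le> 1)}.
   (\<Sum>i. hausdorff_weight s (U i)) < ennreal \<zeta>"
  unfolding hausdorff_premeasure_def by (simp only: INF_less_iff)
 then obtain U :: "nat \<Rightarrow> 'a set" where U: "X \<subseteq> (\<Union>i. U i)" "\<And>i. bounded (U i)"
  "(\<Sum>i. hausdorff_weight s (U i)) < ennreal \<zeta>" by auto
 have w: "hausdorff_weight s (U i) = ennreal (diameter (U i) powr s)" for i
  using s by (simp add: hausdorff_weight_def)
 have sm: "summable (\<lambda>i. diameter (U i) powr s)"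
  using U(3) unfolding w by (intro summable_suminf_not_top) auto
 have "ennreal (\<Sum>i. diameter (U i) powr s) < ennreal \<zeta>"
  using U(3) unfolding w by (subst (asm) suminf_ennreal2[OF _ sm]) auto
 then have "(\<Sum>i. diameter (U i) powr s) \<le> \<zeta>"
  using \<zeta> by (simp add: ennreal_less_iff suminf_nonneg[OF sm])
 then show thesis using that U sm by blast
qed

text \<open>Vitali's covering argument: keep an interval of largest radius and discard those that
  meet it; their centres lie within \<open>2 * \<nu> d\<close> of \<open>d\<close>.\<close>

lemma exists_disjoint_intervals:
 fixes P :: "nat set" and \<nu> :: "nat \<Rightarrow> nat"
 assumes "finite P"
 shows "\<exists>D\<subseteq>P. (\<forall>c\<in>D. \<forall>d\<in>D. c < d \<longrightarrow> c + \<nu> c + \<nu> d < d) \<and> card P \<le> 2 * (\<Sum>d\<in>D. 2 * \<nu> d + 1)"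
 using assms
proof (induction P rule: finite_psubset_induct)
 case (psubset P)
 show ?case
 proof (cases "P = {}")
  case False
  have "Max (\<nu> ` P) \<in> \<nu> ` P" using psubset(1) False by (intro Max_in) auto
  then obtain d where d: "d \<in> P" "Max (\<nu> ` P) = \<nu> d" by blast
  then have mx: "\<nu> c \<le> \<nu> d" if "c \<in> P" for c
   using psubset(1) that by (metis Max_ge finite_imageI imageI)
  define P' where "P' = {c \<in> P. c + \<nu> c + \<nu> d < d \<or> d + \<nu> d + \<nu> c < c}"
  have sub: "P' \<subseteq> P" and "d \<notin> P'" by (auto simp: P'_def)
  then have "P' \<subset> P" using d(1) by blast
  from psubset(2)[OF this] obtain D' where D': "D' \<subseteq> P'" "\<forall>c\<in>D'. \<forall>d\<in>D'. c < d \<longrightarrow> c + \<nu> c + \<nu> d < d"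
   "card P' \<le> 2 * (\<Sum>d\<in>D'. 2 * \<nu> d + 1)"
   by blast
  have fin: "finite D'" by (rule finite_subset[OF subset_trans[OF D'(1) sub] psubset(1)])
  have dD: "d \<notin> D'" using D'(1) by (auto simp: P'_def)
  have "P \<subseteq> P' \<union> {d - 2 * \<nu> d..d + 2 * \<nu> d}"
  proof
   fix c assume c: "c \<in> P"
   then show "c \<in> P' \<union> {d - 2 * \<nu> d..d + 2 * \<nu> d}"
    using mx[OF c] by (auto simp: P'_def)
  qed
  then have "card P \<le> card (P' \<union> {d - 2 * \<nu> d..d + 2 * \<nu> d})"
   using psubset(1) by (intro card_mono) (auto simp: P'_def)
  also have "\<dots> \<le> card P' + card {d - 2 * \<nu> d..d + 2 * \<nu> d}" by (rule card_Un_le)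
  also have "\<dots> \<le> card P' + 2 * (2 * \<nu> d + 1)" by simp
  finally have "card P \<le> 2 * (\<Sum>d\<in>insert d D'. 2 * \<nu> d + 1)"
   using D'(3) fin dD by (simp add: algebra_simps)
  moreover have "\<forall>c\<in>insert d D'. \<forall>e\<in>insert d D'. c < e \<longrightarrow> c + \<nu> c + \<nu> e < e"
   using D' by (fastforce simp: P'_def)
  moreover have "insert d D' \<subseteq> P" using d D'(1) by (auto simp: P'_def)
  ultimately show ?thesis by blast
 qed simp
qed

text \<open>During the window of radius \<open>\<nu> d\<close> about \<open>d\<close> the orbit is
  known from membership in \<open>S d\<close>, so only the gaps between the windows are paid for, at
  rate \<open>h\<close> and with a constant \<open>C\<close> for each of the
  \<open>card D + 1\<close> gaps.\<close>

lemma exists_window_cover: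
 fixes g :: "'a::metric_space \<Rightarrow> 'a" and C h \<delta> :: real and \<nu> :: "nat \<Rightarrow> nat" and D :: "nat set" and T :: nat
 assumes cov: "\<And>t. \<exists>\<A>. finite \<A> \<and> \<Union>\<A> = UNIV \<and> (\<forall>A\<in>\<A>. bowen_small g t \<delta> A) \<and> real (card \<A>) \<le> C * exp (t * h)"
  and C: "C \<ge> 1"
  and "finite D"
  and W: "\<And>d. d \<in> D \<Longrightarrow> \<nu> d \<le> d" "\<And>d x y j. d \<in> D \<Longrightarrow> x \<in> S d \<Longrightarrow> y \<in> S d \<Longrightarrow> d \<le> j + \<nu> d \<Longrightarrow> j \<le> d + \<nu> d \<Longrightarrow>
    dist ((g ^^ j) x) ((g ^^ j) y) < \<delta>"
  and disj: "\<forall>c\<in>D. \<forall>d\<in>D. c < d \<longrightarrow> c + \<nu> c + \<nu> d < d" and T: "\<forall>d\<in>D. d + \<nu> d < T"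
 shows "\<exists>\<A>. finite \<A> \<and> (\<Inter>d\<in>D. S d) \<subseteq> \<Union>\<A> \<and> (\<forall>A\<in>\<A>. bowen_small g T \<delta> A) \<and>
  real (card \<A>) \<le> C ^ (card D + 1) * exp (h * (real T - (\<Sum>d\<in>D. 2 * \<nu> d + 1)))"
 using assms(3-)
proof (induction D arbitrary: T rule: finite_linorder_max_induct)
 case empty
 then show ?case using cov[of T] by (auto simp: mult.commute)
next
 case (insert b D)
 define T1 where "T1 = b - \<nu> b"
 define T2 where "T2 = b + \<nu> b + 1"
 have T2: "T2 \<le> T" using insert.prems(4) by (auto simp: T2_def)
 have b: "\<nu> b \<le> b" using insert.prems(1) by simp
 have lt: "\<forall>d\<in>D. d + \<nu> d < T1"
  using insert.prems(3) insert.hyps(2) by (force simp: T1_def)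
 have "\<exists>\<A>. finite \<A> \<and> (\<Inter>d\<in>D. S d) \<subseteq> \<Union>\<A> \<and> (\<forall>A\<in>\<A>. bowen_small g T1 \<delta> A) \<and>
  real (card \<A>) \<le> C ^ (card D + 1) * exp (h * (real T1 - (\<Sum>d\<in>D. 2 * \<nu> d + 1)))"
 proof (rule insert.IH)
  show "\<nu> d \<le> d" if "d \<in> D" for d using insert.prems(1) that by simp
  show "dist ((g ^^ j) x) ((g ^^ j) y) < \<delta>"
   if "d \<in> D" "x \<in> S d" "y \<in> S d" "d \<le> j + \<nu> d" "j \<le> d + \<nu> d" for d x y j
   using insert.prems(2)[of d x y j] that by simp
  show "\<forall>c\<in>D. \<forall>d\<in>D. c < d \<longrightarrow> c + \<nu> c + \<nu> d < d" using insert.prems(3) by simp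
  show "\<forall>d\<in>D. d + \<nu> d < T1" by (rule lt)
 qed
 then obtain \<A> where A: "finite \<A>" "(\<Inter>d\<in>D. S d) \<subseteq> \<Union>\<A>" "\<forall>A\<in>\<A>. bowen_small g T1 \<delta> A"
  "real (card \<A>) \<le> C ^ (card D + 1) * exp (h * (real T1 - (\<Sum>d\<in>D. 2 * \<nu> d + 1)))"
  by blast
 obtain \<B> where B: "finite \<B>" "\<Union>\<B> = UNIV" "\<forall>A\<in>\<B>. bowen_small g (T - T2) \<delta> A"
  "real (card \<B>) \<le> C * exp ((T - T2) * h)"
  using cov[of "T - T2"] by blast
 define \<A>' where "\<A>' = (\<lambda>(A, B). A \<inter> S b \<inter> (g ^^ T2) -` B) ` (\<A> \<times> \<B>)"
 have bD: "b \<notin> D" using insert.hyps(2) by auto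
 have 1: "finite \<A>'" using A(1) B(1) by (simp add: \<A>'_def)
 have 2: "(\<Inter>d\<in>insert b D. S d) \<subseteq> \<Union>\<A>'"
 proof
  fix x assume x: "x \<in> (\<Inter>d\<in>insert b D. S d)"
  obtain A' where "A' \<in> \<A>" "x \<in> A'" using A(2) x by blast
  moreover obtain B' where "B' \<in> \<B>" "(g ^^ T2) x \<in> B'" using B(2) by blast
  moreover have "x \<in> S b" using x by simp
  ultimately show "x \<in> \<Union>\<A>'"
   unfolding \<A>'_def by (intro UnionI[of "A' \<inter> S b \<inter> (g ^^ T2) -` B'"]) auto
 qed
 have 3: "bowen_small g T \<delta> A" if AA: "A \<in> \<A>'" for A
  unfolding bowen_small_def
 proof (intro ballI allI impI)
  fix x y j assume xy: "x \<in> A" "y \<in> A" and j: "j < T"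
  obtain A' B' where AB: "A' \<in> \<A>" "B' \<in> \<B>" "A = A' \<inter> S b \<inter> (g ^^ T2) -` B'"
   using AA unfolding \<A>'_def by auto
  consider "j < T1" | "T1 \<le> j" "j < T2" | "T2 \<le> j" by linarith
  then show "dist ((g ^^ j) x) ((g ^^ j) y) < \<delta>"
  proof cases
   case 1
   then show ?thesis using A(3) AB xy unfolding bowen_small_def by blast
  next
   case 2
   then show ?thesis
    using insert.prems(2)[of b x y j] AB xy by (auto simp: T1_def T2_def)
  next
   case 3
   then have "dist ((g ^^ (j - T2)) ((g ^^ T2) x)) ((g ^^ (j - T2)) ((g ^^ T2) y)) < \<delta>"
    using B(3) AB xy j unfolding bowen_small_def by (metis IntE diff_less_mono vimageE)
   then show ?thesis using 3
    by (metis comp_apply funpow_add le_add_diff_inverse2)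
  qed
 qed
 have "card \<A>' \<le> card (\<A> \<times> \<B>)"
  unfolding \<A>'_def using A(1) B(1) by (intro card_image_le) auto
 then have "real (card \<A>') \<le> real (card \<A>) * real (card \<B>)"
  by (metis card_cartesian_product of_nat_le_iff of_nat_mult)
 also have "\<dots> \<le> (C ^ (card D + 1) * exp (h * (real T1 - (\<Sum>d\<in>D. 2 * \<nu> d + 1)))) * (C * exp ((T - T2) * h))"
  using A(4) B(4) C by (intro mult_mono) auto
 also have "\<dots> = C ^ (card (insert b D) + 1) * exp (h * (real T - (\<Sum>d\<in>insert b D. 2 * \<nu> d + 1)))"
 proof -
  define t3 where "t3 = real (T - T2)"
  define \<sigma> where "\<sigma> = real (\<Sum>d\<in>D. 2 * \<nu> d + 1)"
  have "t3 = real T - real b - real (\<nu> b) - 1" using T2 by (simp add: t3_def of_nat_diff T2_def)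
  moreover have "real T1 = real b - real (\<nu> b)" using b by (simp add: T1_def of_nat_diff)
  ultimately have e: "real T = real T1 + (2 * real (\<nu> b) + 1) + t3" by simp
  have "real (\<Sum>d\<in>insert b D. 2 * \<nu> d + 1) = 2 * real (\<nu> b) + 1 + \<sigma>"
   using insert.hyps(1) bD by (simp add: \<sigma>_def)
  moreover have "h * (real T1 - \<sigma>) + t3 * h = h * (real T - (2 * real (\<nu> b) + 1 + \<sigma>))"
   unfolding e by (simp add: algebra_simps)
  ultimately have "h * (real T1 - (\<Sum>d\<in>D. 2 * \<nu> d + 1)) + (T - T2) * h = h * (real T - (\<Sum>d\<in>insert b D. 2 * \<nu> d + 1))"
   unfolding t3_def[symmetric] \<sigma>_def[symmetric] by simp
  moreover have "card (insert b D) = card D + 1" using insert.hyps(1) bD by simp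
  moreover have "(C ^ (card D + 1) * exp u) * (C * exp v) = C ^ (card D + 1 + 1) * exp (u + v)" for u v
   by (simp only: power_add power_one_right exp_add mult_ac)
  ultimately show ?thesis by (simp only: )
 qed
 finally show ?case using 1 2 3 by blast
qed

context near_standard
begin

text \<open>The constant \<open>C\<close> absorbs the finitely many times at which the entropy bound
  does not yet hold, so that gaps of any length can be treated alike.\<close>

lemma exists_entropy_cover:
 assumes h: "topological_entropy g = ereal h" and \<kappa>: "\<kappa> > 0" and \<delta>: "\<delta> > 0"
 shows "\<exists>C\<ge>1. \<forall>T. \<exists>\<A>. finite \<A> \<and> \<Union>\<A> = UNIV \<and> (\<forall>A\<in>\<A>. bowen_small g T \<delta> A) \<and>
  real (card \<A>) \<le> C * exp (T * (h + \<kappa>))"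
proof -
 have "ereal (ln k) \<le> ereal h" using topological_entropy_ge h by simp
 moreover have "0 \<le> ln k" using k by (intro ln_ge_zero) simp
 ultimately have h0: "h \<ge> 0" by simp
 have "\<delta> / 3 > 0" using \<delta> by simp
 from eventually_card_separated_le[OF h \<kappa> this] obtain T0 where T0: "\<And>T E. T \<ge> T0 \<Longrightarrow> finite E \<Longrightarrow>
   bowen_separated g T (\<delta> / 3) E \<Longrightarrow> card E \<le> exp (T * (h + \<kappa>))"
  unfolding eventually_sequentially by blast
 define C where "C = (2 * L ^ T0 / \<delta> + 1)\<^sup>2"
 have C: "C \<ge> 1" unfolding C_def using L_power_pos[of T0] \<delta> by (intro one_le_power) simp
 have "\<exists>\<A>. finite \<A> \<and> \<Union>\<A> = UNIV \<and> (\<forall>A\<in>\<A>. bowen_small g T \<delta> A) \<and> real (card \<A>) \<le> C * exp (T * (h + \<kappa>))" for T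
 proof (cases "T \<ge> T0")
  case True
  have "\<exists>E\<subseteq>UNIV. finite E \<and> bowen_separated g T (\<delta> / 3) E \<and>
      (\<forall>y\<in>UNIV. \<exists>x\<in>E. \<forall>i<T. dist ((g ^^ i) x) ((g ^^ i) y) \<le> \<delta> / 3)"
  proof (rule exists_maximal_bowen_separated)
   show "card E \<le> nat \<lfloor>exp (T * (h + \<kappa>))\<rfloor>" if "finite E" "bowen_separated g T (\<delta> / 3) E" for E
    using T0[OF True that] by (simp add: le_nat_floor)
  qed (use \<delta> in simp)
  then obtain E where E: "finite E" "bowen_separated g T (\<delta> / 3) E"
   "\<And>y. \<exists>x\<in>E. \<forall>i<T. dist ((g ^^ i) x) ((g ^^ i) y) \<le> \<delta> / 3" by blast
  define B where "B x = {y. \<forall>i<T. dist ((g ^^ i) x) ((g ^^ i) y) \<le> \<delta> / 3}" for x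
  have "bowen_small g T \<delta> (B x)" for x
   unfolding bowen_small_def
  proof (intro ballI allI impI)
   fix y z i assume "y \<in> B x" "z \<in> B x" "i < T"
   then show "dist ((g ^^ i) y) ((g ^^ i) z) < \<delta>"
    using dist_triangle3[of "(g ^^ i) y" "(g ^^ i) z" "(g ^^ i) x"] \<delta> unfolding B_def by force
  qed
  moreover have "\<Union>(B ` E) = UNIV" using E(3) by (auto simp: B_def)
  moreover have "real (card (B ` E)) \<le> C * exp (T * (h + \<kappa>))"
  proof -
   have "real (card (B ` E)) \<le> real (card E)" using card_image_le[OF E(1)] by simp
   also have "\<dots> \<le> 1 * exp (T * (h + \<kappa>))" using T0[OF True E(1,2)] by simp
   also have "\<dots> \<le> C * exp (T * (h + \<kappa>))" using C by (intro mult_right_mono) auto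
   finally show ?thesis .
  qed
  ultimately show ?thesis using E(1) by (intro exI[of _ "B ` E"]) auto
 next
  case False
  obtain \<A> where A: "finite \<A>" "UNIV = \<Union>\<A>" "\<forall>A\<in>\<A>. bowen_small g T \<delta> A"
   "card \<A> \<le> (2 * L ^ T / \<delta> + 1)\<^sup>2"
   using exists_bowen_cover[OF \<delta>] by blast
  have "(2 * L ^ T / \<delta> + 1)\<^sup>2 \<le> C"
  proof -
   have "L ^ T \<le> L ^ T0" using False L_ge by (intro power_increasing) auto
   then show ?thesis
    unfolding C_def using \<delta> L_power_pos[of T] by (intro power_mono add_right_mono divide_right_mono) auto
  qed
  then have "real (card \<A>) \<le> C" using A(4) by linarith
  also have "\<dots> \<le> C * exp (T * (h + \<kappa>))"
   using C h0 \<kappa> by (simp add: mult_le_cancel_left1)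
  finally show ?thesis using A by (intro exI[of _ \<A>]) auto
 qed
 then show ?thesis using C by blast
qed

text \<open>Diameters are converted into times: up to a factor \<open>L\<close>, the diameter of
  \<open>U i\<close> is \<open>\<delta> * L powr (- n i)\<close>, so a small sum of
  \<open>diameter (U i) powr s\<close> becomes a Kraft inequality for the times
  \<open>n i\<close>.\<close>

lemma exists_dynamical_cover:
 assumes null: "hausdorff_measure s X = 0" and s: "s > 0" and \<delta>: "\<delta> > 0"
 obtains U :: "nat \<Rightarrow> torus set" and n :: "nat \<Rightarrow> nat" where "X \<subseteq> (\<Union>i. U i)" "\<And>i. closed (U i)" "\<And>i. n0 \<le> n i"
  "\<And>i x y. x \<in> U i \<Longrightarrow> y \<in> U i \<Longrightarrow> L ^ n i * dist x y < \<delta>"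
  "\<And>m. (\<Sum>i<m. L powr (- s * n i)) \<le> 1"
proof -
 have L1: "L > 1" "L > 0" using L_ge by auto
 \<comment> \<open>The first bound normalises the final sum to 1, and the second forces
   \<open>n i \<ge> n0\<close>.\<close>
 define \<zeta> where "\<zeta> = min ((\<delta> / L) powr s / 2) ((\<delta> / L ^ n0) powr s / 4)"
 have \<zeta>: "\<zeta> > 0" "2 * \<zeta> \<le> (\<delta> / L) powr s" "2 * \<zeta> < (\<delta> / L ^ n0) powr s"
 proof -
  have "(\<delta> / L) powr s > 0" "(\<delta> / L ^ n0) powr s > 0" using \<delta> L1 by auto
  then show "\<zeta> > 0" "2 * \<zeta> \<le> (\<delta> / L) powr s" "2 * \<zeta> < (\<delta> / L ^ n0) powr s"
   unfolding \<zeta>_def by linarith+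
 qed
 obtain U :: "nat \<Rightarrow> torus set" where U: "X \<subseteq> (\<Union>i. U i)" "\<And>i. bounded (U i)"
  "summable (\<lambda>i. diameter (U i) powr s)" "(\<Sum>i. diameter (U i) powr s) \<le> \<zeta>"
  using hausdorff_null_cover[OF null s \<zeta>(1)] by metis
 \<comment> \<open>A set of diameter 0 would have no finite time \<open>n i\<close>; the geometric
   term makes all sizes positive at a total cost of \<open>\<zeta>\<close>.\<close>
 define q where "q i = diameter (U i) powr s + \<zeta> * (1 / 2) ^ Suc i" for i
 have q0: "q i > 0" for i unfolding q_def using \<zeta>(1) by (intro add_nonneg_pos) auto
 have half: "(\<lambda>i. \<zeta> * (1 / 2) ^ Suc i) sums (\<zeta> * 1)"
  by (intro sums_mult power_half_series)
 have sq: "summable q" unfolding q_def using U(3) half by (intro summable_add) (auto simp: sums_iff)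
 have "suminf q \<le> 2 * \<zeta>"
 proof -
  have "suminf q = (\<Sum>i. diameter (U i) powr s) + (\<Sum>i. \<zeta> * (1 / 2) ^ Suc i)"
   unfolding q_def using U(3) half by (intro suminf_add[symmetric]) (auto simp: sums_iff)
  also have "(\<Sum>i. \<zeta> * (1 / 2) ^ Suc i) = \<zeta>" using sums_unique[OF half] by simp
  finally show ?thesis using U(4) by linarith
 qed
 then have sum_q: "(\<Sum>i<m. q i) \<le> 2 * \<zeta>" for m
  using sum_le_suminf[OF sq, of "{..<m}"] q0 by (meson finite_lessThan less_imp_le order_trans)
 define t where "t i = q i powr (1 / s)" for i
 have t0: "t i > 0" for i using q0[of i] by (simp add: t_def)
 have ts: "t i powr s = q i" for i using q0[of i] s by (simp add: t_def powr_powr)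
 have dt: "diameter (U i) \<le> t i" for i
 proof -
  have "diameter (U i) powr s \<le> t i powr s" unfolding ts q_def using \<zeta>(1) by simp
  then show ?thesis
   using powr_less_mono2[OF s, of "t i" "diameter (U i)"] t0[of i] by linarith
 qed
 have tn0: "L ^ n0 * t i < \<delta>" for i
 proof -
  have "q i \<le> 2 * \<zeta>"
   using sum_q[of "Suc i"] sum_nonneg[of "{..<i}" q] q0 by (simp add: less_imp_le)
  then have lt: "t i powr s < (\<delta> / L ^ n0) powr s" unfolding ts using \<zeta>(3) by linarith
  have "t i < \<delta> / L ^ n0"
  proof (rule ccontr)
   assume "\<not> ?thesis"
   then have "(\<delta> / L ^ n0) powr s \<le> t i powr s" using s \<delta> L1 by (intro powr_mono2) auto
   then show False using lt by linarith
  qed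
  then show ?thesis using L_power_pos[of n0] by (simp add: pos_less_divide_eq mult.commute)
 qed
 have "\<exists>n\<ge>n0. L ^ n * t i < \<delta> \<and> \<delta> \<le> L ^ Suc n * t i" for i
 proof -
  obtain N where "\<delta> / t i < L ^ N" using real_arch_pow[OF L1(1)] by blast
  then have ex: "\<exists>N. \<delta> \<le> L ^ N * t i" using t0[of i] by (metis less_imp_le pos_divide_less_eq)
  define N where "N = (LEAST N. \<delta> \<le> L ^ N * t i)"
  have N1: "\<delta> \<le> L ^ N * t i" unfolding N_def by (rule LeastI_ex[OF ex])
  have "N > n0"
  proof (rule ccontr)
   assume "\<not> n0 < N"
   then have "L ^ N * t i \<le> L ^ n0 * t i" using L1 t0[of i] by (intro mult_right_mono power_increasing) auto
   then show False using N1 tn0[of i] by linarith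
  qed
  then obtain n where n: "N = Suc n" "n0 \<le> n" by (metis less_imp_Suc_add le_add1)
  then have "\<not> \<delta> \<le> L ^ n * t i" unfolding N_def using not_less_Least[of n] by (metis lessI)
  then show ?thesis using n N1 by (intro exI[of _ n]) auto
 qed
 then obtain n where n: "\<And>i. n0 \<le> n i" "\<And>i. L ^ n i * t i < \<delta>" "\<And>i. \<delta> \<le> L ^ Suc (n i) * t i"
  by metis
 show thesis
 \<comment> \<open>The closures are Borel sets of the same diameters.\<close>
 proof (rule that[of "\<lambda>i. closure (U i)" n])
  show "X \<subseteq> (\<Union>i. closure (U i))" using U(1) by (rule order_trans) (intro UN_mono order_refl closure_subset)
  show "closed (closure (U i))" for i by simp
  show "n0 \<le> n i" for i by (rule n)
  show "L ^ n i * dist x y < \<delta>" if "x \<in> closure (U i)" "y \<in> closure (U i)" for i x y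
  proof -
   have "dist x y \<le> diameter (closure (U i))"
    using that U(2) by (intro diameter_bounded_bound bounded_closure)
   also have "\<dots> \<le> t i" using dt U(2) by (simp add: diameter_closure)
   finally have "L ^ n i * dist x y \<le> L ^ n i * t i" using L_power_pos[of "n i"] by (intro mult_left_mono) auto
   then show ?thesis using n(2)[of i] by linarith
  qed
  have trm: "(\<delta> / L) powr s * L powr (- s * n i) \<le> q i" for i
  proof -
   have "(\<delta> / L) * L powr (- real (n i)) \<le> t i"
    using n(3)[of i] L1 L_power_pos[of "n i"] by (simp add: powr_minus powr_realpow divide_simps) (simp add: mult_ac)
   then have "((\<delta> / L) * L powr (- real (n i))) powr s \<le> t i powr s"
    using \<delta> L1 s by (intro powr_mono2) auto
   then show ?thesis unfolding ts using \<delta> L1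
    by (simp only: powr_mult powr_powr mult_ac minus_mult_left[symmetric] minus_mult_right[symmetric])
  qed
  show "(\<Sum>i<m. L powr (- s * n i)) \<le> 1" for m
  proof -
   have "(\<delta> / L) powr s * (\<Sum>i<m. L powr (- s * n i)) \<le> (\<Sum>i<m. q i)"
    unfolding sum_distrib_left by (intro sum_mono trm)
   also have "\<dots> \<le> (\<delta> / L) powr s * 1" using sum_q[of m] \<zeta>(2) by linarith
   finally show ?thesis using \<delta> L1 by (simp add: mult_le_cancel_left_pos)
  qed
 qed
qed

end

text \<open>The visits fill half of the middle range, hence at least \<open>T / 4\<close> times, and
  disjoint windows keep half of that. The margins of length \<open>b\<close> at both ends keep the
  windows inside \<open>{..<T}\<close>.\<close>

lemma exists_many_disjoint_visits:
 fixes n :: "nat \<Rightarrow> nat" and g :: "'a \<Rightarrow> 'a"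
 assumes n: "\<And>i. n i \<le> b" and T: "4 * b \<le> T"
  and vis: "1 / 2 * card {b..<T - b} \<le> card {c \<in> {b..<T - b}. (g ^^ c) x \<in> (\<Union>i<m. U i)}"
 obtains D :: "nat set" and i where "D \<subseteq> {..<T}" "i \<in> D \<rightarrow>\<^sub>E {..<m}" "\<forall>d\<in>D. n (i d) \<le> d \<and> d + n (i d) < T"
  "\<forall>c\<in>D. \<forall>d\<in>D. c < d \<longrightarrow> c + n (i c) + n (i d) < d" "real T / 8 \<le> (\<Sum>d\<in>D. 2 * n (i d) + 1)"
  "\<forall>d\<in>D. (g ^^ d) x \<in> U (i d)"
proof -
 define P where "P = {c \<in> {b..<T - b}. (g ^^ c) x \<in> (\<Union>i<m. U i)}"
 define j where "j c = (SOME i. i < m \<and> (g ^^ c) x \<in> U i)" for c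
 have j: "j c < m \<and> (g ^^ c) x \<in> U (j c)" if "c \<in> P" for c
 proof -
  have "\<exists>i. i < m \<and> (g ^^ c) x \<in> U i" using that by (auto simp: P_def)
  then show ?thesis unfolding j_def by (rule someI_ex)
 qed
 have "finite P" by (simp add: P_def)
 from exists_disjoint_intervals[OF this, of "\<lambda>c. n (j c)"] obtain D where D: "D \<subseteq> P"
  "\<forall>c\<in>D. \<forall>d\<in>D. c < d \<longrightarrow> c + n (j c) + n (j d) < d" "card P \<le> 2 * (\<Sum>d\<in>D. 2 * n (j d) + 1)"
  by blast
 have "real (card {b..<T - b}) = real T - 2 * real b" using T by simp
 then have "real T / 4 \<le> real (card P)" using vis T unfolding P_def by simp
 moreover have "real (card P) \<le> real (2 * (\<Sum>d\<in>D. 2 * n (j d) + 1))" using D(3) by (simp only: of_nat_le_iff)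
 ultimately have s: "real T / 8 \<le> (\<Sum>d\<in>D. 2 * n (j d) + 1)" by simp
 show thesis
 proof (rule that[of D "restrict j D"])
  show "D \<subseteq> {..<T}" using D(1) by (auto simp: P_def)
  show "restrict j D \<in> D \<rightarrow>\<^sub>E {..<m}" using D(1) j by auto
  show "\<forall>d\<in>D. n (restrict j D d) \<le> d \<and> d + n (restrict j D d) < T"
  proof
   fix d assume d: "d \<in> D"
   then have "b \<le> d" "d < T - b" using D(1) by (auto simp: P_def)
   then show "n (restrict j D d) \<le> d \<and> d + n (restrict j D d) < T"
    using n[of "j d"] d by auto
  qed
  show "\<forall>c\<in>D. \<forall>d\<in>D. c < d \<longrightarrow> c + n (restrict j D c) + n (restrict j D d) < d" using D(2) by simp
  show "real T / 8 \<le> (\<Sum>d\<in>D. 2 * n (restrict j D d) + 1)" using s by simp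
  show "\<forall>d\<in>D. (g ^^ d) x \<in> U (restrict j D d)" using D(1) j by auto
 qed
qed

lemma sum_Pow_power_card:
 fixes z :: "'b::comm_semiring_1"
 assumes "finite A"
 shows "(\<Sum>X\<in>Pow A. z ^ card X) = (1 + z) ^ card A"
 using prod_add[OF assms, of "\<lambda>_. z" "\<lambda>_. 1"] by (simp add: add.commute)

context near_standard
begin

text \<open>Naming a set \<open>U i\<close> costs \<open>s * n i * ln L\<close>, by the Kraft
  inequality, and reveals about \<open>2 * n i\<close> steps of the orbit, since both
  \<open>g\<close> and its inverse are \<open>L\<close>-Lipschitz. If this is cheaper than the
  \<open>2 * n i * h\<close> that those steps are worth, orbits that visit the sets all the time are
  too few for the entropy.\<close>

lemma hausdorff_measure_nonzero:
 assumes mme: "maximal_entropy_measure g \<mu>" and h: "topological_entropy g = ereal h"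
  and X: "X \<in> sets \<mu>" "measure \<mu> X = 1" and s: "s > 0" "s * ln L < 2 * h"
 shows "hausdorff_measure s X \<noteq> 0"
proof
 assume null: "hausdorff_measure s X = 0"
 have L1: "L > 1" "L > 0" using L_ge by auto
 \<comment> \<open>A third of the gap, so that
   \<open>2 * (h - \<kappa>0) = s * ln L + \<kappa>0\<close>. The windows fill at least
   \<open>T / 8\<close>, so a gain of \<open>\<kappa>0\<close> per step inside them is a gain of
   \<open>8 * \<kappa>\<close> per step overall.\<close>
 define \<kappa>0 where "\<kappa>0 = (2 * h - s * ln L) / 3"
 define \<kappa> where "\<kappa> = \<kappa>0 / 64"
 have \<kappa>: "\<kappa>0 > 0" "\<kappa> > 0" "\<kappa>0 = 64 * \<kappa>" using s by (auto simp: \<kappa>_def \<kappa>0_def)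
 have inv: "invariant_prob g \<mu>" using mme by (simp add: maximal_entropy_measure_def)
 interpret prob_space \<mu> using inv by (simp add: invariant_prob_def)
 have sets: "sets \<mu> = sets borel" using inv by (simp add: invariant_prob_def)
 then have sp: "space \<mu> = UNIV" using sets_eq_imp_space_eq[of \<mu> borel] by simp
 obtain \<delta> where \<delta>: "\<delta> > 0" and freq: "\<exists>\<^sub>F T in sequentially. \<forall>Y \<A>. Y \<in> sets \<mu> \<longrightarrow> 1 / 4 \<le> measure \<mu> Y \<longrightarrow>
   finite \<A> \<longrightarrow> Y \<subseteq> \<Union>\<A> \<longrightarrow> (\<forall>A\<in>\<A>. bowen_small g T \<delta> A) \<longrightarrow> exp (T * (h - \<kappa>)) \<le> card \<A>"
  using maximal_entropy_cover_lower_bound[OF mme h \<kappa>(2), of "1 / 4"] by auto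
 obtain C where C: "C \<ge> 1" and cov: "\<And>T. \<exists>\<A>. finite \<A> \<and> \<Union>\<A> = UNIV \<and> (\<forall>A\<in>\<A>. bowen_small g T \<delta> A) \<and>
   real (card \<A>) \<le> C * exp (T * (h + \<kappa>))"
  using exists_entropy_cover[OF h \<kappa>(2) \<delta>] by blast
 obtain n0 :: nat where "C / (\<kappa> * \<kappa>0) \<le> n0" using real_arch_simple by blast
 then have n0: "C / \<kappa> \<le> \<kappa>0 * n0" using \<kappa> by (simp add: field_simps)
 \<comment> \<open>Every window opens a new gap and so costs a factor \<open>C\<close>; windows of
   radius at least \<open>n0\<close> gain enough to pay for it.\<close>
 have Cn0: "C * exp (- \<kappa>0 * n0) \<le> \<kappa>"
 proof -
  have "C / \<kappa> \<le> exp (\<kappa>0 * n0)" using n0 exp_ge_add_one_self[of "\<kappa>0 * n0"] by linarith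
  then show ?thesis using \<kappa>(2) by (simp add: exp_minus field_simps)
 qed
 obtain U :: "nat \<Rightarrow> torus set" and n :: "nat \<Rightarrow> nat" where U: "X \<subseteq> (\<Union>i. U i)" "\<And>i. closed (U i)" "\<And>i. n0 \<le> n i"
  "\<And>i x y. x \<in> U i \<Longrightarrow> y \<in> U i \<Longrightarrow> L ^ n i * dist x y < \<delta>" "\<And>m. (\<Sum>i<m. L powr (- s * n i)) \<le> 1"
  by (rule exists_dynamical_cover[OF null s(1) \<delta>, of n0]) (rule that, assumption+)
 \<comment> \<open>Finitely many of the sets suffice, and for these the radii are bounded by some
   \<open>b\<close>.\<close>
 have "(\<lambda>m. prob (\<Union>i<m. U i)) \<longlonglongrightarrow> prob (\<Union>m. \<Union>i<m. U i)"
  using U(2) by (intro finite_Lim_measure_incseq) (auto simp: sets incseq_def intro!: borel_closed closed_UN less_le_trans)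
 moreover have "prob (\<Union>m. \<Union>i<m. U i) \<ge> 1"
 proof -
  have "X \<subseteq> (\<Union>m. \<Union>i<m. U i)" using U(1) by blast
  moreover have "(\<Union>m. \<Union>i<m. U i) \<in> events" using U(2) by (auto simp: sets intro!: borel_closed)
  ultimately have "prob X \<le> prob (\<Union>m. \<Union>i<m. U i)" by (intro finite_measure_mono)
  then show ?thesis using X by simp
 qed
 ultimately have "\<forall>\<^sub>F m in sequentially. 3 / 4 < prob (\<Union>i<m. U i)"
  by (intro order_tendstoD(1)[where y = "prob (\<Union>m. \<Union>i<m. U i)"]) auto
 then obtain m where m: "3 / 4 < prob (\<Union>i<m. U i)" by (auto dest: eventually_happens)
 define V where "V = (\<Union>i<m. U i)"
 have V: "V \<in> sets borel" unfolding V_def using U(2) by (auto intro!: borel_closed)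
 define b where "b = Max (insert 0 (n ` {..<m}))"
 \<comment> \<open>The default 0 makes the bound by \<open>b\<close> hold for all indices; only
   indices below \<open>m\<close> occur.\<close>
 define n' where "n' i = (if i < m then n i else 0)" for i
 have n'b: "n' i \<le> b" for i unfolding b_def n'_def by (auto intro!: Max_ge)
 obtain T where T: "T > 4 * b + 1 + nat \<lceil>C / \<kappa>\<rceil>" and low: "\<forall>Y \<A>. Y \<in> sets \<mu> \<longrightarrow> 1 / 4 \<le> measure \<mu> Y \<longrightarrow>
   finite \<A> \<longrightarrow> Y \<subseteq> \<Union>\<A> \<longrightarrow> (\<forall>A\<in>\<A>. bowen_small g T \<delta> A) \<longrightarrow> exp (T * (h - \<kappa>)) \<le> card \<A>"
  using frequently_eventually_frequently[OF freq eventually_gt_at_top[of "4 * b + 1 + nat \<lceil>C / \<kappa>\<rceil>"]]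
  by (auto dest: frequently_ex)
 define I where "I = {b..<T - b}"
 have I: "finite I" "I \<noteq> {}" using T by (auto simp: I_def)
 define Y where "Y = {x \<in> space \<mu>. 1 / 2 * card I \<le> card {c \<in> I. x \<in> (g ^^ c) -` V}}"
 have Y: "Y \<in> sets \<mu>" "1 / 4 \<le> measure \<mu> Y"
 proof -
  have A: "(g ^^ c) -` V \<in> events" "3 / 4 \<le> prob ((g ^^ c) -` V)" for c
   using invariant_prob_measure_vimage[OF inv V, of c] m by (simp_all add: sets V_def)
  show "Y \<in> sets \<mu>"
   unfolding Y_def by (rule measure_frequent_visits(1)[OF I A]) auto
  have "3 / 4 - 1 / 2 \<le> measure \<mu> Y"
   unfolding Y_def by (rule measure_frequent_visits(2)[OF I A]) auto
  then show "1 / 4 \<le> measure \<mu> Y" by simp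
 qed
 define K where "K D = {i \<in> D \<rightarrow>\<^sub>E {..<m}. (\<forall>d\<in>D. n (i d) \<le> d \<and> d + n (i d) < T) \<and>
  (\<forall>c\<in>D. \<forall>d\<in>D. c < d \<longrightarrow> c + n (i c) + n (i d) < d) \<and> real T / 8 \<le> (\<Sum>d\<in>D. 2 * n (i d) + 1)}" for D :: "nat set"
 define S where "S i d = {x. (g ^^ d) x \<in> U (i d)}" for i :: "nat \<Rightarrow> nat" and d
 \<comment> \<open>The price of a window of type \<open>i\<close>: a factor \<open>C\<close> for the
   new gap, against the entropy saved over its length. A part \<open>\<kappa>0\<close> of the saving
   is set aside and makes the final count too small.\<close>
 define w where "w i = C * exp (- (h + \<kappa> - \<kappa>0) * (2 * real (n i) + 1))" for i
 have fK: "finite (K D)" "K D \<subseteq> D \<rightarrow>\<^sub>E {..<m}" if "finite D" for D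
 proof -
  show s: "K D \<subseteq> D \<rightarrow>\<^sub>E {..<m}" by (auto simp: K_def)
  show "finite (K D)" by (rule finite_subset[OF s]) (use that in \<open>auto intro: finite_PiE\<close>)
 qed
 have window: "dist ((g ^^ j) x) ((g ^^ j) y) < \<delta>"
  if "x \<in> S i d" "y \<in> S i d" "d \<le> j + n (i d)" "j \<le> d + n (i d)" for x y i d j
 proof -
  have U': "L ^ n (i d) * dist ((g ^^ d) x) ((g ^^ d) y) < \<delta>"
   using U(4) that(1,2) by (simp add: S_def)
  define e where "e = (if j \<le> d then d - j else j - d)"
  have "dist ((g ^^ j) x) ((g ^^ j) y) \<le> L ^ e * dist ((g ^^ d) x) ((g ^^ d) y)"
  proof (cases "j \<le> d")
   case True
   then show ?thesis
    using dist_le_funpow[of "(g ^^ j) x" "(g ^^ j) y" "d - j"]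
    by (simp add: e_def) (metis comp_apply funpow_add le_add_diff_inverse2)
  next
   case False
   then show ?thesis
    using dist_funpow_le[of "j - d" "(g ^^ d) x" "(g ^^ d) y"]
    by (simp add: e_def) (metis comp_apply funpow_add le_add_diff_inverse2 nat_le_linear)
  qed
  also have "\<dots> \<le> L ^ n (i d) * dist ((g ^^ d) x) ((g ^^ d) y)"
   using that(3,4) L1 by (intro mult_right_mono power_increasing) (auto simp: e_def)
  finally show ?thesis using U' by linarith
 qed
 define Q where "Q D i \<A> \<longleftrightarrow> finite \<A> \<and> (\<Inter>d\<in>D. S i d) \<subseteq> \<Union>\<A> \<and> (\<forall>A\<in>\<A>. bowen_small g T \<delta> A) \<and>
  real (card \<A>) \<le> C * exp (T * (h + \<kappa> - 8 * \<kappa>)) * (\<Prod>d\<in>D. w (i d))" for D :: "nat set" and i :: "nat \<Rightarrow> nat" and \<A>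
 have exQ: "\<exists>\<A>. Q D i \<A>" if D: "finite D" and i: "i \<in> K D" for D i
 proof -
  have "\<exists>\<A>. finite \<A> \<and> (\<Inter>d\<in>D. S i d) \<subseteq> \<Union>\<A> \<and> (\<forall>A\<in>\<A>. bowen_small g T \<delta> A) \<and>
   real (card \<A>) \<le> C ^ (card D + 1) * exp ((h + \<kappa>) * (real T - (\<Sum>d\<in>D. 2 * n (i d) + 1)))"
   using i by (intro exists_window_cover[OF cov C D, where \<nu> = "\<lambda>d. n (i d)"] window) (auto simp: K_def)
  then obtain \<A> where A: "finite \<A>" "(\<Inter>d\<in>D. S i d) \<subseteq> \<Union>\<A>" "\<forall>A\<in>\<A>. bowen_small g T \<delta> A"
   "real (card \<A>) \<le> C ^ (card D + 1) * exp ((h + \<kappa>) * (real T - (\<Sum>d\<in>D. 2 * n (i d) + 1)))"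
   by blast
  define \<sigma> where "\<sigma> = (\<Sum>d\<in>D. 2 * real (n (i d)) + 1)"
  have \<sigma>2: "real (\<Sum>d\<in>D. 2 * n (i d) + 1) = \<sigma>" by (simp add: \<sigma>_def add.commute)
  have "real T / 8 \<le> real (\<Sum>d\<in>D. 2 * n (i d) + 1)" using i unfolding K_def by blast
  then have \<sigma>: "real T / 8 \<le> \<sigma>" unfolding \<sigma>2 .
  define a where "a = exp (T * (h + \<kappa> - 8 * \<kappa>))"
  define b where "b = exp (- (h + \<kappa> - \<kappa>0) * \<sigma>)"
  have "(h + \<kappa>) * (real T - \<sigma>) \<le> T * (h + \<kappa> - 8 * \<kappa>) + - (h + \<kappa> - \<kappa>0) * \<sigma>"
   using mult_left_mono[OF \<sigma>, of \<kappa>0] \<kappa> by (simp add: algebra_simps)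
  then have le: "exp ((h + \<kappa>) * (real T - \<sigma>)) \<le> a * b"
   unfolding a_def b_def exp_add[symmetric] exp_le_cancel_iff .
  have "b = (\<Prod>d\<in>D. exp (- (h + \<kappa> - \<kappa>0) * (2 * real (n (i d)) + 1)))"
   unfolding b_def \<sigma>_def sum_distrib_left by (rule exp_sum[OF D])
  then have prd: "C ^ card D * b = (\<Prod>d\<in>D. w (i d))"
   unfolding w_def prod.distrib prod_constant by (rule arg_cong)
  have "C ^ (card D + 1) * exp ((h + \<kappa>) * (real T - \<sigma>)) \<le> C ^ (card D + 1) * (a * b)"
   using le C by (intro mult_left_mono) auto
  also have "\<dots> = C * a * (C ^ card D * b)" by (simp only: power_add power_one_right mult_ac)
  finally have "C ^ (card D + 1) * exp ((h + \<kappa>) * (real T - \<sigma>)) \<le> C * exp (T * (h + \<kappa> - 8 * \<kappa>)) * (\<Prod>d\<in>D. w (i d))"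
   unfolding prd a_def .
  with A(4)[unfolded \<sigma>2] have "real (card \<A>) \<le> C * exp (T * (h + \<kappa> - 8 * \<kappa>)) * (\<Prod>d\<in>D. w (i d))"
   by (rule order_trans)
  then show ?thesis unfolding Q_def using A(1-3) by blast
 qed
 define \<A> where "\<A> D i = (SOME \<A>. Q D i \<A>)" for D i
 have "Q D i (\<A> D i)" if "finite D" "i \<in> K D" for D i
  unfolding \<A>_def by (rule someI_ex[OF exQ[OF that]])
 then have \<A>: "finite (\<A> D i)" "(\<Inter>d\<in>D. S i d) \<subseteq> \<Union>(\<A> D i)" "\<forall>A\<in>\<A> D i. bowen_small g T \<delta> A"
  "real (card (\<A> D i)) \<le> C * exp (T * (h + \<kappa> - 8 * \<kappa>)) * (\<Prod>d\<in>D. w (i d))" if "finite D" "i \<in> K D" for D i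
  using that unfolding Q_def by blast+
 have fD: "finite D" if "D \<in> Pow {..<T}" for D using that finite_subset by blast
 define \<B> where "\<B> = (\<Union>D\<in>Pow {..<T}. \<Union>i\<in>K D. \<A> D i)"
 have finB: "finite \<B>" unfolding \<B>_def using fD fK(1) \<A>(1) by (intro finite_UN_I) auto
 have small: "\<forall>A\<in>\<B>. bowen_small g T \<delta> A" unfolding \<B>_def using fD \<A>(3) by blast
 have Ysub: "Y \<subseteq> \<Union>\<B>"
 proof
  fix x assume x: "x \<in> Y"
  have vis: "1 / 2 * card {b..<T - b} \<le> card {c \<in> {b..<T - b}. (g ^^ c) x \<in> (\<Union>i<m. U i)}"
   using x unfolding Y_def I_def V_def by simp
  have T4: "4 * b \<le> T" using T by simp
  obtain D i where D: "D \<subseteq> {..<T}" "i \<in> D \<rightarrow>\<^sub>E {..<m}" "\<forall>d\<in>D. n' (i d) \<le> d \<and> d + n' (i d) < T"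
   "\<forall>c\<in>D. \<forall>d\<in>D. c < d \<longrightarrow> c + n' (i c) + n' (i d) < d" "real T / 8 \<le> (\<Sum>d\<in>D. 2 * n' (i d) + 1)"
   "\<forall>d\<in>D. (g ^^ d) x \<in> U (i d)"
   by (rule exists_many_disjoint_visits[OF n'b T4 vis])
  have n': "n' (i d) = n (i d)" if "d \<in> D" for d
   using D(2) that by (auto simp: n'_def)
  have iK: "i \<in> K D"
  proof -
   have e: "(\<Sum>d\<in>D. 2 * n' (i d) + 1) = (\<Sum>d\<in>D. 2 * n (i d) + 1)"
    by (rule sum.cong) (simp_all add: n')
   have "\<forall>d\<in>D. n (i d) \<le> d \<and> d + n (i d) < T" using D(3) n' by simp
   moreover have "\<forall>c\<in>D. \<forall>d\<in>D. c < d \<longrightarrow> c + n (i c) + n (i d) < d" using D(4) n' by simp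
   ultimately show ?thesis using D(2,5) unfolding K_def e by blast
  qed
  have xS: "x \<in> (\<Inter>d\<in>D. S i d)" using D(6) by (simp add: S_def)
  have DP: "D \<in> Pow {..<T}" using D(1) by simp
  have "x \<in> \<Union>(\<A> D i)" by (rule subsetD[OF \<A>(2)[OF fD[OF DP] iK] xS])
  then obtain A where "A \<in> \<A> D i" "x \<in> A" by (rule UnionE)
  then show "x \<in> \<Union>\<B>" unfolding \<B>_def by (intro UnionI[of A] UN_I[OF DP] UN_I[OF iK])
 qed
 have w0: "w i \<ge> 0" for i using C by (simp add: w_def)
 have sumw: "(\<Sum>i<m. w i) \<le> \<kappa>"
 proof -
  have "w i \<le> \<kappa> * L powr (- s * n i)" for i
  proof -
   have *: "2 * (h - \<kappa>0) = s * ln L + \<kappa>0" by (simp add: \<kappa>0_def field_simps)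
   have "0 \<le> s * ln L" using s(1) L1 by (simp add: less_imp_le)
   then have "0 \<le> 2 * (h - \<kappa>0)" unfolding * using \<kappa>(1) by (intro add_nonneg_nonneg) auto
   then have "0 \<le> (h - \<kappa>0) + \<kappa>" using \<kappa>(2) by (intro add_nonneg_nonneg) auto
   then have "0 \<le> h + \<kappa> - \<kappa>0" by (simp add: algebra_simps)
   moreover have "(s * ln L + \<kappa>0) * n i \<le> (h + \<kappa> - \<kappa>0) * (2 * real (n i))"
    unfolding *[symmetric] using \<kappa>(2) by (simp add: algebra_simps)
   ultimately have "- (h + \<kappa> - \<kappa>0) * (2 * real (n i) + 1) \<le> - \<kappa>0 * n i + - s * n i * ln L"
    by (simp add: algebra_simps)
   also have "\<dots> \<le> - \<kappa>0 * n0 + - s * n i * ln L"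
    using U(3)[of i] \<kappa>(1) by simp
   finally have "w i \<le> C * (exp (- \<kappa>0 * n0) * exp (- s * n i * ln L))"
    unfolding w_def exp_add[symmetric] using C by (intro mult_left_mono) auto
   also have "\<dots> = (C * exp (- \<kappa>0 * n0)) * L powr (- s * n i)"
    using L1 by (simp add: powr_def)
   also have "\<dots> \<le> \<kappa> * L powr (- s * n i)"
    using Cn0 by (intro mult_right_mono) auto
   finally show ?thesis .
  qed
  then have "(\<Sum>i<m. w i) \<le> (\<Sum>i<m. \<kappa> * L powr (- s * n i))" by (intro sum_mono)
  also have "\<dots> = \<kappa> * (\<Sum>i<m. L powr (- s * n i))" by (simp add: sum_distrib_left)
  also have "\<dots> \<le> \<kappa> * 1" using U(5) \<kappa>(2) by (intro mult_left_mono) auto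
  finally show ?thesis by simp
 qed
 have "real (card \<B>) \<le> (\<Sum>D\<in>Pow {..<T}. real (card (\<Union>i\<in>K D. \<A> D i)))"
  unfolding \<B>_def using card_UN_le[of "Pow {..<T}" "\<lambda>D. \<Union>i\<in>K D. \<A> D i"]
  by (simp only: finite_Pow_iff finite_lessThan of_nat_le_iff of_nat_sum[symmetric])
 also have "\<dots> \<le> (\<Sum>D\<in>Pow {..<T}. C * exp (T * (h + \<kappa> - 8 * \<kappa>)) * (\<Sum>i<m. w i) ^ card D)"
 proof (rule sum_mono)
  fix D assume "D \<in> Pow {..<T}"
  then have D: "finite D" by (rule fD)
  let ?E = "C * exp (T * (h + \<kappa> - 8 * \<kappa>))"
  have E0: "?E \<ge> 0" using C by simp
  have "real (card (\<Union>i\<in>K D. \<A> D i)) \<le> (\<Sum>i\<in>K D. real (card (\<A> D i)))"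
   using card_UN_le[OF fK(1)[OF D], of "\<A> D"] by (simp only: of_nat_le_iff of_nat_sum[symmetric])
  also have "\<dots> \<le> (\<Sum>i\<in>K D. ?E * (\<Prod>d\<in>D. w (i d)))"
   using \<A>(4)[OF D] by (intro sum_mono)
  also have "\<dots> \<le> (\<Sum>i\<in>D \<rightarrow>\<^sub>E {..<m}. ?E * (\<Prod>d\<in>D. w (i d)))"
   using fK(2)[OF D] D E0 w0 by (intro sum_mono2) (auto intro!: finite_PiE mult_nonneg_nonneg prod_nonneg)
  also have "\<dots> = ?E * (\<Prod>d\<in>D. \<Sum>i<m. w i)"
   unfolding sum_distrib_left[symmetric] using D by (subst prod_sum_PiE) auto
  finally show "real (card (\<Union>i\<in>K D. \<A> D i)) \<le> ?E * (\<Sum>i<m. w i) ^ card D" by simp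
 qed
 \<comment> \<open>The sum over all position sets \<open>D\<close> is a binomial expansion. As the
   prices add up to at most \<open>\<kappa>\<close>, the choice of positions and types costs no more
   than \<open>exp (\<kappa> * T)\<close>.\<close>
 also have "\<dots> = C * exp (T * (h + \<kappa> - 8 * \<kappa>)) * (1 + (\<Sum>i<m. w i)) ^ T"
  unfolding sum_distrib_left[symmetric] by (simp add: sum_Pow_power_card)
 also have "\<dots> \<le> C * exp (T * (h + \<kappa> - 8 * \<kappa>)) * exp \<kappa> ^ T"
 proof -
  have "1 + (\<Sum>i<m. w i) \<le> exp \<kappa>" using sumw exp_ge_add_one_self[of \<kappa>] by linarith
  then show ?thesis using C w0 by (intro mult_left_mono power_mono) (auto intro!: sum_nonneg add_nonneg_nonneg)
 qed
 also have "\<dots> = C * exp (T * (h - 6 * \<kappa>))"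
  by (simp add: exp_of_nat_mult[symmetric] mult.assoc exp_add[symmetric] algebra_simps)
 finally have up: "real (card \<B>) \<le> C * exp (T * (h - 6 * \<kappa>))" .
 have "exp (T * (h - \<kappa>)) \<le> real (card \<B>)" using low Y finB Ysub small by blast
 then have "exp (5 * \<kappa> * T) * exp (T * (h - 6 * \<kappa>)) \<le> C * exp (T * (h - 6 * \<kappa>))"
  using up by (simp add: exp_add[symmetric] algebra_simps)
 then have "exp (5 * \<kappa> * T) \<le> C" by simp
 moreover have "1 + 5 * \<kappa> * T \<le> exp (5 * \<kappa> * T)" by (rule exp_ge_add_one_self)
 moreover have "C \<le> \<kappa> * T"
 proof -
  have "C / \<kappa> \<le> T" using T by linarith
  then show ?thesis using \<kappa>(2) by (simp add: field_simps)
 qed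
 moreover have "0 \<le> \<kappa> * T" using \<kappa>(2) by simp
 ultimately show False by linarith
qed

lemma measure_hausdorff_dim_ge:
 assumes mme: "maximal_entropy_measure g \<mu>" and s0: "s0 * ln L < 2 * ln k"
 shows "ereal s0 \<le> measure_hausdorff_dim \<mu>"
 unfolding measure_hausdorff_dim_def hausdorff_dim_def
proof (intro INF_greatest)
 fix X s assume "X \<in> {X \<in> sets \<mu>. emeasure \<mu> X = 1}" and "s \<in> {s. 0 \<le> s \<and> hausdorff_measure s X = 0}"
 then have X: "X \<in> sets \<mu>" "measure \<mu> X = 1" "emeasure \<mu> X = 1" and s: "0 \<le> s" "hausdorff_measure s X = 0"
  by (auto simp: measure_def)
 obtain h where h: "topological_entropy g = ereal h" "ln k \<le> h"
  by (rule topological_entropy_real)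
 have lnL: "ln L > 0" using L_ge by simp
 show "ereal s0 \<le> ereal s"
 proof (cases "s = 0")
  \<comment> \<open>For \<open>s = 0\<close> every nonempty set has weight 1, so a null set has only
    the empty cover.\<close>
  case True
  have "hausdorff_premeasure 0 1 X \<le> hausdorff_measure 0 X"
   unfolding hausdorff_measure_def by (rule SUP_upper) simp
  also have "\<dots> < 1" using s True by simp
  finally have "\<exists>U\<in>{U :: nat \<Rightarrow> torus set. X \<subseteq> (\<Union>i. U i) \<and> (\<forall>i. bounded (U i) \<and> diameter (U i) \<le> 1)}.
    (\<Sum>i. hausdorff_weight 0 (U i)) < 1"
   unfolding hausdorff_premeasure_def by (simp only: INF_less_iff)
  then obtain U :: "nat \<Rightarrow> torus set" where U: "X \<subseteq> (\<Union>i. U i)" "(\<Sum>i. hausdorff_weight 0 (U i)) < 1" by auto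
  have "U i = {}" for i
  proof (rule ccontr)
   assume "U i \<noteq> {}"
   then have "1 = hausdorff_weight 0 (U i)" by (simp add: hausdorff_weight_def)
   also have "\<dots> \<le> (\<Sum>i. hausdorff_weight 0 (U i))"
    using sum_le_suminf[of "\<lambda>i. hausdorff_weight 0 (U i)" "{i}"] by simp
   finally show False using U(2) by simp
  qed
  then have "X = {}" using U(1) by simp
  then show ?thesis using X(2) by simp
 next
  case False
  then have "\<not> s * ln L < 2 * h"
   using hausdorff_measure_nonzero[OF mme h(1) X(1,2)] s by (metis order_le_less)
  then have "s0 * ln L \<le> s * ln L" using s0 h by linarith
  then show ?thesis using lnL by simp
 qed
qed

end

section \<open>Recovering an orbit from its detours\<close>

context shadowing
begin

lemma mu_small: "\<mu>\<^sup>2 * L \<le> 1 / 100000" "2 * \<tau> * \<mu> \<le> 1 / 100000" "\<mu> * L = 2 * \<tau>"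
proof -
 show e: "\<mu> * L = 2 * \<tau>" using L_pos by (simp add: \<mu>_def)
 have "4 * \<tau>\<^sup>2 \<le> 1 / 100000 * L" using L_large zero_le_power2[of \<tau>] by linarith
 then have "4 * \<tau>\<^sup>2 / L \<le> 1 / 100000" using L_pos by (simp add: pos_divide_le_eq)
 moreover have "2 * \<tau> * \<mu> = 4 * \<tau>\<^sup>2 / L" "\<mu>\<^sup>2 * L = 4 * \<tau>\<^sup>2 / L"
  using L_pos by (simp_all add: \<mu>_def power2_eq_square)
 ultimately show "\<mu>\<^sup>2 * L \<le> 1 / 100000" "2 * \<tau> * \<mu> \<le> 1 / 100000" by linarith+
qed

lemma sum_quarter_le: "(\<Sum>i<t. (1 / 4) ^ i) \<le> (4 / 3 :: real)"
proof -
 have "(\<Sum>i<t. (1 / 4) ^ i) = 4 / 3 * (1 - (1 / 4 :: real) ^ t)"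
  by (subst sum_gp_strict) simp
 then show ?thesis by simp
qed

lemma norm_orbit_diff_le:
 assumes X: "\<And>i. X (Suc i) = G (X i)" and Y: "\<And>i. u \<le> i \<Longrightarrow> Y (Suc i) = G (Y i)" and "u \<le> i"
 shows "norm (Y (i + j) - X (i + j)) \<le> L ^ j * norm (Y i - X i)" "norm (Y i - X i) \<le> L ^ j * norm (Y (i + j) - X (i + j))"
proof -
 show "norm (Y (i + j) - X (i + j)) \<le> L ^ j * norm (Y i - X i)"
 proof (induction j)
  case (Suc j)
  have "norm (Y (i + Suc j) - X (i + Suc j)) \<le> L * norm (Y (i + j) - X (i + j))"
   using norm_G_diff_le[of "Y (i + j)" "X (i + j)"] X[of "i + j"] Y[of "i + j"] assms(3) by simp
  also have "\<dots> \<le> L * (L ^ j * norm (Y i - X i))" using Suc L_pos by (intro mult_left_mono) auto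
  finally show ?case by simp
 qed simp
 show "norm (Y i - X i) \<le> L ^ j * norm (Y (i + j) - X (i + j))"
 proof (induction j)
  case (Suc j)
  have "norm (Y (i + j) - X (i + j)) \<le> L * norm (Y (i + Suc j) - X (i + Suc j))"
   using norm_diff_le_G[of "Y (i + j)" "X (i + j)"] X[of "i + j"] Y[of "i + j"] assms(3) by simp
  then have "L ^ j * norm (Y (i + j) - X (i + j)) \<le> L ^ j * (L * norm (Y (i + Suc j) - X (i + Suc j)))"
   using L_pos by (intro mult_left_mono) auto
  then show ?case using Suc by (simp add: mult_ac)
 qed simp
qed

text \<open>In the two lemmas below \<open>\<delta>\<close> is the difference of two orbits. The quadratic remainders are estimated
 by the given bounds times the bounds \<open>L ^ i * norm (\<delta> 0)\<close> and \<open>L ^ (t - i) * norm (\<delta> t)\<close>.\<close>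

lemma abs_inner_rho_le:
 assumes w: "word m X v \<rho> Q" and Q: "Q > 0" and t: "1 \<le> t" "t \<le> m"
  and \<delta>: "\<And>i. i < t \<Longrightarrow> \<delta> (Suc i) = D (X i) (\<delta> i) + N (X i) (\<delta> i)"
  and up: "\<And>i. i \<le> t \<Longrightarrow> norm (\<delta> i) \<le> L ^ i * norm (\<delta> 0)"
  and down: "\<And>i. i \<le> t \<Longrightarrow> norm (\<delta> i) \<le> L ^ (t - i) * norm (\<delta> t)"
  and b: "\<And>i. i \<le> t \<Longrightarrow> norm (\<delta> i) \<le> 50 * l * \<mu> ^ min i (t - i)"
  and M: "norm (\<delta> 0) \<le> M" "norm (\<delta> t) / 4 ^ t \<le> M"
 shows "\<bar>inner (\<rho> 0) (\<delta> 0)\<bar> \<le> Q / 100 * M"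
proof -
 have M0: "M \<ge> 0" using M(1) norm_ge_zero order_trans by blast
 have \<mu>0: "\<mu> > 0" using mu by simp
 \<comment> \<open>One factor \<open>norm (\<delta> i)\<close> is bounded by \<open>b\<close>, the
   other by growth from the nearer end. In the second half that end value is known only up to
   \<open>4 ^ t * M\<close>, which the powers of \<open>\<mu>\<close> still beat.\<close>
 have term_le: "(\<mu> / 2) ^ Suc i * (50 * k * (norm (\<delta> i))\<^sup>2) \<le> 1 / 2000 * (1 / 4) ^ i * M" if i: "i < t" for i
 proof -
  define j where "j = t - i"
  have c: "50 * (k * \<mu>) / 2 * (50 * l) \<le> 1 / 2000"
   using l_small unfolding mu(4) by simp
  have c0: "0 \<le> 50 * (k * \<mu>) / 2 * (50 * l)" using k \<mu>0 l by simp
  have split: "(\<mu> / 2) ^ Suc i * (50 * k * (p * q)) = 50 * (k * \<mu>) / 2 * p * ((\<mu> / 2) ^ i * q)" for p q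
   by simp
  have "(norm (\<delta> i))\<^sup>2 \<le> 50 * l * \<mu> ^ min i j * norm (\<delta> i)"
   using b[of i] i unfolding power2_eq_square j_def by (intro mult_right_mono) auto
  also have "\<dots> = 50 * l * (\<mu> ^ min i j * norm (\<delta> i))" by simp
  finally have "(\<mu> / 2) ^ Suc i * (50 * k * (norm (\<delta> i))\<^sup>2) \<le> (\<mu> / 2) ^ Suc i * (50 * k * (50 * l * (\<mu> ^ min i j * norm (\<delta> i))))"
   using k \<mu>0 by (intro mult_left_mono) auto
  also have "\<dots> = 50 * (k * \<mu>) / 2 * (50 * l) * ((\<mu> / 2) ^ i * (\<mu> ^ min i j * norm (\<delta> i)))"
   by (rule split)
  also have "\<dots> \<le> 1 / 2000 * ((1 / 4) ^ i * M)"
  proof (rule mult_mono[OF c])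
   show "(\<mu> / 2) ^ i * (\<mu> ^ min i j * norm (\<delta> i)) \<le> (1 / 4) ^ i * M"
   proof (cases "i \<le> j")
    case True
    have "(\<mu> / 2) ^ i * (\<mu> ^ min i j * norm (\<delta> i)) \<le> (\<mu> / 2) ^ i * (\<mu> ^ i * (L ^ i * M))"
     using True i up[of i] M(1) \<mu>0 L_pos
     by (intro mult_left_mono) (auto intro!: mult_left_mono order_trans[OF up])
    also have "\<dots> = (\<mu>\<^sup>2 * L / 2) ^ i * M"
     by (simp add: power_mult_distrib power_divide power2_eq_square mult_ac)
    also have "\<dots> \<le> (1 / 4) ^ i * M"
     using mu(3) \<mu>0 L_pos M0 by (intro mult_right_mono power_mono) (auto simp: mult.commute)
    finally show ?thesis .
   next
    case False
    then obtain e where e: "i = j + e" using le_Suc_ex[of j i] by auto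
    have tj: "t = j + j + e" using i e unfolding j_def by linarith
    have nt: "norm (\<delta> t) \<le> 4 ^ t * M" using M(2) by (simp add: pos_divide_le_eq mult.commute)
    have "norm (\<delta> i) \<le> L ^ j * norm (\<delta> t)" using down[of i] i by (simp add: j_def)
    also have "\<dots> \<le> L ^ j * (4 ^ t * M)" using nt L_pos by (intro mult_left_mono) auto
    finally have "(\<mu> / 2) ^ i * (\<mu> ^ min i j * norm (\<delta> i)) \<le> (\<mu> / 2) ^ i * (\<mu> ^ j * (L ^ j * (4 ^ t * M)))"
     using False \<mu>0 by (intro mult_left_mono) (auto simp: min_def)
    also have "\<dots> = ((\<mu> / 2 * (\<mu> * (L * (4 * 4)))) ^ j * (\<mu> / 2 * 4) ^ e) * M"
     unfolding e tj by (simp only: power_add power_mult_distrib mult_ac)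
    also have "\<dots> \<le> ((1 / 4) ^ j * (1 / 4) ^ e) * M"
    proof (intro mult_right_mono mult_mono power_mono)
     show "\<mu> / 2 * (\<mu> * (L * (4 * 4))) \<le> 1 / 4"
      using mu_small(1) by (simp add: power2_eq_square mult_ac)
    qed (use mu(2) \<mu>0 L_pos M0 in auto)
    finally show ?thesis by (simp add: e power_add)
   qed
  qed (use M0 \<mu>0 in auto)
  finally show ?thesis by simp
 qed
 \<comment> \<open>The linear part preserves the pairing of covector and difference, so the pairing
   changes along the word only by the remainders.\<close>
 have step: "\<bar>inner (\<rho> 0) (\<delta> 0)\<bar> \<le> \<bar>inner (\<rho> j) (\<delta> j)\<bar> + (\<Sum>i<j. 2 * Q * (1 / 2000 * (1 / 4) ^ i * M))" if "j \<le> t" for j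
  using that
 proof (induction j)
  case (Suc j)
  then have jt: "j < t" "j < m" using t by auto
  have "inner (\<rho> j) (\<delta> j) = inner (\<rho> (Suc j)) (\<delta> (Suc j)) - inner (\<rho> (Suc j)) (N (X j) (\<delta> j))"
   using word_simps(4)[OF w jt(2)] \<delta>[OF jt(1)] by (simp add: inner_Dt inner_add_right)
  moreover have "\<bar>inner (\<rho> (Suc j)) (N (X j) (\<delta> j))\<bar> \<le> 2 * Q * (1 / 2000 * (1 / 4) ^ j * M)"
  proof -
   have "\<bar>inner (\<rho> (Suc j)) (N (X j) (\<delta> j))\<bar> \<le> norm (\<rho> (Suc j)) * norm (N (X j) (\<delta> j))"
    by (rule Cauchy_Schwarz_ineq2)
   also have "\<dots> \<le> (2 * Q * (\<mu> / 2) ^ Suc j) * (50 * k * (norm (\<delta> j))\<^sup>2)"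
    using word_simps(9)[OF w, of "Suc j"] jt norm_N_le Q \<mu>0 by (intro mult_mono) auto
   also have "\<dots> = 2 * Q * ((\<mu> / 2) ^ Suc j * (50 * k * (norm (\<delta> j))\<^sup>2))" by (simp only: mult.assoc)
   also have "\<dots> \<le> 2 * Q * (1 / 2000 * (1 / 4) ^ j * M)"
    using term_le[OF jt(1)] Q by (intro mult_left_mono) auto
   finally show ?thesis .
  qed
  ultimately show ?case using Suc by simp
 qed simp
 have last: "\<bar>inner (\<rho> t) (\<delta> t)\<bar> \<le> Q * (1 / 200 * M)"
 proof -
  have "\<bar>inner (\<rho> t) (\<delta> t)\<bar> \<le> norm (\<rho> t) * norm (\<delta> t)" by (rule Cauchy_Schwarz_ineq2)
  also have "\<dots> \<le> (2 * Q * (\<mu> / 2) ^ t) * (4 ^ t * M)"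
   using word_simps(9)[OF w t(2)] M(2) Q \<mu>0 by (intro mult_mono) (auto simp: pos_divide_le_eq mult.commute)
  also have "\<dots> = 2 * Q * ((2 * \<mu>) ^ t * M)"
  proof -
   have "\<mu> / 2 * 4 = 2 * \<mu>" by simp
   then have e: "(2 * \<mu>) ^ t = (\<mu> / 2) ^ t * 4 ^ t" using power_mult_distrib[of "\<mu> / 2" 4 t] by (simp only:)
   show ?thesis unfolding e by (simp only: mult_ac)
  qed
  also have "\<dots> \<le> 2 * Q * (1 / 400 * M)"
  proof -
   have "(2 * \<mu>) ^ t \<le> (2 * \<mu>) ^ 1" using t mu \<mu>0 by (intro power_decreasing) auto
   then show ?thesis using mu(2) Q M0 by (intro mult_left_mono mult_right_mono) auto
  qed
  finally show ?thesis by (simp add: mult.commute)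
 qed
 have "(\<Sum>i<t. 2 * Q * (1 / 2000 * (1 / 4) ^ i * M)) = Q / 1000 * M * (\<Sum>i<t. (1 / 4) ^ i)"
  by (simp add: sum_distrib_left mult_ac)
 also have "\<dots> \<le> Q / 1000 * M * (4 / 3)"
  using sum_quarter_le Q M0 by (intro mult_left_mono) auto
 finally have "\<bar>inner (\<rho> 0) (\<delta> 0)\<bar> \<le> Q * (1 / 200 * M) + Q / 1000 * M * (4 / 3)"
  using step[OF order_refl] last by linarith
 also have "\<dots> \<le> Q / 100 * M" using mult_nonneg_nonneg[of Q M] Q M0 by simp
 finally show ?thesis .
qed

lemma abs_wedge_v_le:
 assumes w: "word m X v \<rho> Q" and Q: "Q > 0" and u: "u < m" and \<tau>l: "10000000 * \<tau>\<^sup>2 * l \<le> 1"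
  and \<delta>: "\<And>i. u \<le> i \<Longrightarrow> i < m \<Longrightarrow> \<delta> (Suc i) = D (X i) (\<delta> i) + N (X i) (\<delta> i)"
  and up: "\<And>i. u \<le> i \<Longrightarrow> i \<le> m \<Longrightarrow> norm (\<delta> i) \<le> L ^ (i - u) * norm (\<delta> u)"
  and down: "\<And>i. u \<le> i \<Longrightarrow> i \<le> m \<Longrightarrow> norm (\<delta> i) \<le> L ^ (m - i) * norm (\<delta> m)"
  and b: "\<And>i. u \<le> i \<Longrightarrow> i \<le> m \<Longrightarrow> norm (\<delta> i) \<le> 50 * l * \<mu> ^ min (i - u) (m - i)"
  and M: "norm (\<delta> m) \<le> M" "norm (\<delta> u) / 4 ^ (m - u) \<le> M"
 shows "\<bar>wedge (v m) (\<delta> m)\<bar> \<le> Q / 100 * M"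
proof -
 have M0: "M \<ge> 0" using M(1) norm_ge_zero order_trans by blast
 have \<mu>0: "\<mu> > 0" using mu by simp
 define c where "c j = 1 / 2000 * (1 / 4) ^ (j - 1) * M" for j :: nat
 \<comment> \<open>The factor \<open>2 ^ (j - 1)\<close> anticipates the doubling by the
   determinant. The large component of \<open>v (Suc i)\<close> meets the remainder of size
   \<open>r\<close>; the large remainder meets \<open>snd (v (Suc i))\<close>, which is smaller by a
   factor of order \<open>\<mu>\<close>.\<close>
 have term_le: "2 ^ (j - 1) * ((\<mu> / 2) ^ (j - 1) * (r * (norm (\<delta> i))\<^sup>2) + 2 * (\<mu> / 2) ^ j * (50 * k * (norm (\<delta> i))\<^sup>2)) \<le> c j"
  if i: "u \<le> i" "i < m" and j: "j = m - i" for i j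
 proof -
  obtain j' where j': "j = Suc j'" using i j by (metis Suc_diff_Suc)
  define e where "e = i - u"
  have kmu: "r + 50 * (k * \<mu>) \<le> 15 * \<tau>" using r_small(1) \<tau> unfolding mu(4) by simp
  have "2 ^ (j - 1) * ((\<mu> / 2) ^ (j - 1) * (r * (norm (\<delta> i))\<^sup>2) + 2 * (\<mu> / 2) ^ j * (50 * k * (norm (\<delta> i))\<^sup>2))
    = (r + 50 * (k * \<mu>)) * (\<mu> ^ j' * (norm (\<delta> i))\<^sup>2)"
   unfolding j' by (simp add: power_divide algebra_simps)
  also have "\<dots> \<le> 15 * \<tau> * (\<mu> ^ j' * (norm (\<delta> i))\<^sup>2)"
   using kmu \<mu>0 by (intro mult_right_mono) auto
  also have "\<dots> \<le> 15 * \<tau> * (\<mu> ^ j' * (50 * l * (\<mu> ^ min e j * norm (\<delta> i))))"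
  proof -
   have "(norm (\<delta> i))\<^sup>2 \<le> 50 * l * \<mu> ^ min e j * norm (\<delta> i)"
    using b[of i] i j unfolding power2_eq_square e_def by (intro mult_right_mono) auto
   then show ?thesis using \<mu>0 \<tau> by (intro mult_left_mono) (auto simp: mult.assoc)
  qed
  also have "\<dots> = 750 * \<tau> * l * (\<mu> ^ j' * (\<mu> ^ min e j * norm (\<delta> i)))" by simp
  also have "\<dots> \<le> 750 * \<tau> * l * (4 * \<tau> * ((1 / 4) ^ j' * M))"
  proof (rule mult_left_mono)
   show "\<mu> ^ j' * (\<mu> ^ min e j * norm (\<delta> i)) \<le> 4 * \<tau> * ((1 / 4) ^ j' * M)"
   proof (cases "j \<le> e")
    case True
    have "norm (\<delta> i) \<le> L ^ j * M"
     using down[of i] i j M(1) L_pos by (auto intro!: mult_left_mono order_trans[OF down])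
    then have "\<mu> ^ j' * (\<mu> ^ min e j * norm (\<delta> i)) \<le> \<mu> ^ j' * (\<mu> ^ j * (L ^ j * M))"
     using True \<mu>0 by (intro mult_left_mono) auto
    also have "\<dots> = (2 * \<tau> * \<mu>) ^ j' * ((\<mu> * L) * M)"
     unfolding j' mu_small(3)[symmetric] by (simp add: power_mult_distrib mult_ac)
    also have "\<dots> \<le> (1 / 4) ^ j' * ((\<mu> * L) * M)"
     using mu_small(2) \<mu>0 \<tau> L_pos M0 by (intro mult_right_mono power_mono) auto
    also have "\<dots> \<le> (1 / 4) ^ j' * ((4 * \<tau>) * M)"
     unfolding mu_small(3) using \<tau> M0 by (intro mult_left_mono mult_right_mono) auto
    finally show ?thesis by (simp add: mult_ac)
   next
    case False
    then obtain d where d: "j' = e + d" using j' by (metis less_Suc_eq_le not_le le_add_diff_inverse)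
    have mu': "m - u = e + e + d + 1" using i j j' d by (simp add: e_def)
    have nu: "norm (\<delta> u) \<le> 4 ^ (m - u) * M" using M(2) by (simp add: pos_divide_le_eq mult.commute)
    have "norm (\<delta> i) \<le> L ^ e * norm (\<delta> u)" using up[of i] i by (simp add: e_def)
    also have "\<dots> \<le> L ^ e * (4 ^ (m - u) * M)" using nu L_pos by (intro mult_left_mono) auto
    finally have "\<mu> ^ j' * (\<mu> ^ min e j * norm (\<delta> i)) \<le> \<mu> ^ j' * (\<mu> ^ e * (L ^ e * (4 ^ (m - u) * M)))"
     using False \<mu>0 by (intro mult_left_mono) (auto simp: min_def)
    also have "\<dots> = (\<mu> * (\<mu> * (L * (4 * 4)))) ^ e * (\<mu> * 4) ^ d * (4 * M)"
     unfolding mu' d by (simp only: power_add power_one_right power_mult_distrib mult_ac)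
    also have "\<dots> \<le> (1 / 4 / 4) ^ e * (1 / 4 / 4) ^ d * (4 * M)"
    proof (intro mult_right_mono mult_mono power_mono)
     show "\<mu> * (\<mu> * (L * (4 * 4))) \<le> 1 / 4 / 4"
      using mu_small(1) by (simp add: power2_eq_square mult_ac)
    qed (use mu(2) \<mu>0 L_pos M0 in auto)
    also have "\<dots> = (1 / 4) ^ j' * ((1 / 4) ^ j' * (4 * M))"
     unfolding d power_divide[of "1 / 4" 4] by (simp add: power_add power_divide)
    finally have *: "\<mu> ^ j' * (\<mu> ^ min e j * norm (\<delta> i)) \<le> (1 / 4) ^ j' * ((1 / 4) ^ j' * (4 * M))" .
    have "(1 / 4 :: real) ^ j' * (4 * M) \<le> 1 * (4 * M)"
     using M0 by (intro mult_right_mono power_le_one) auto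
    also have "\<dots> \<le> 4 * \<tau> * M" using mult_right_mono[OF \<tau> M0] by simp
    finally have "(1 / 4) ^ j' * ((1 / 4) ^ j' * (4 * M)) \<le> (1 / 4) ^ j' * (4 * \<tau> * M)"
     by (intro mult_left_mono) auto
    then show ?thesis using * by (simp add: mult_ac)
   qed
  qed (use \<tau> l in auto)
  also have "\<dots> = (3000 * \<tau>\<^sup>2 * l) * ((1 / 4) ^ j' * M)" by (simp add: power2_eq_square)
  also have "\<dots> \<le> 1 / 2000 * ((1 / 4) ^ j' * M)"
   using \<tau>l M0 by (intro mult_right_mono) auto
  finally show ?thesis by (simp add: c_def j')
 qed
 have step: "2 ^ (m - i) * \<bar>wedge (v i) (\<delta> i)\<bar> \<le> 2 ^ (m - u) * \<bar>wedge (v u) (\<delta> u)\<bar> + (\<Sum>j\<in>{u..<i}. 2 * Q * c (m - j))"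
  if "u \<le> i" "i \<le> m" for i
  using that
 proof (induction i rule: dec_induct)
  case (step i)
  then have im: "i < m" by simp
  obtain j' where j': "m - i = Suc j'" "m - Suc i = j'" using im by (metis Suc_diff_Suc)
  have "wedge (v (Suc i)) (\<delta> (Suc i)) = det (X i) * wedge (v i) (\<delta> i) + wedge (v (Suc i)) (N (X i) (\<delta> i))"
   using word_simps(3)[OF w im] \<delta>[OF step(1) im] by (simp add: wedge_add_right wedge_D)
  moreover have "\<bar>det (X i) * wedge (v i) (\<delta> i)\<bar> \<le> 2 * \<bar>wedge (v i) (\<delta> i)\<bar>"
   using abs_det_le[of "X i"] by (simp add: abs_mult mult_right_mono)
  moreover have "\<bar>wedge (v (Suc i)) (N (X i) (\<delta> i))\<bar> \<le>
    2 * Q * ((\<mu> / 2) ^ j' * (r * (norm (\<delta> i))\<^sup>2) + 2 * (\<mu> / 2) ^ Suc j' * (50 * k * (norm (\<delta> i))\<^sup>2))"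
  proof -
   have "\<bar>wedge (v (Suc i)) (N (X i) (\<delta> i))\<bar> \<le> \<bar>fst (v (Suc i))\<bar> * \<bar>snd (N (X i) (\<delta> i))\<bar> + \<bar>snd (v (Suc i))\<bar> * \<bar>fst (N (X i) (\<delta> i))\<bar>"
    unfolding wedge_def by (metis abs_mult abs_triangle_ineq4)
   also have "\<dots> \<le> (2 * Q * (\<mu> / 2) ^ j') * (r * (norm (\<delta> i))\<^sup>2) + (2 * (2 * Q * (\<mu> / 2) ^ Suc j')) * (50 * k * (norm (\<delta> i))\<^sup>2)"
   proof (intro add_mono mult_mono)
    show "\<bar>fst (v (Suc i))\<bar> \<le> 2 * Q * (\<mu> / 2) ^ j'"
     using abs_fst_le_norm[of "v (Suc i)"] word_simps(8)[OF w, of "Suc i"] im j' by simp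
    show "\<bar>snd (v (Suc i))\<bar> \<le> 2 * (2 * Q * (\<mu> / 2) ^ Suc j')"
     using D_snd_le2[of "X i" "v i"] word_simps(3)[OF w im] word_simps(8)[OF w, of i] im j' by simp
    show "\<bar>fst (N (X i) (\<delta> i))\<bar> \<le> 50 * k * (norm (\<delta> i))\<^sup>2"
     using abs_fst_le_norm[of "N (X i) (\<delta> i)"] norm_N_le[of "X i" "\<delta> i"] by linarith
   qed (use snd_N_le Q \<mu>0 in auto)
   finally show ?thesis by (simp add: algebra_simps)
  qed
  ultimately have "\<bar>wedge (v (Suc i)) (\<delta> (Suc i))\<bar> \<le> 2 * \<bar>wedge (v i) (\<delta> i)\<bar> +
    2 * Q * ((\<mu> / 2) ^ j' * (r * (norm (\<delta> i))\<^sup>2) + 2 * (\<mu> / 2) ^ Suc j' * (50 * k * (norm (\<delta> i))\<^sup>2))"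
   by linarith
  then have "2 ^ j' * \<bar>wedge (v (Suc i)) (\<delta> (Suc i))\<bar> \<le> 2 ^ j' * (2 * \<bar>wedge (v i) (\<delta> i)\<bar> +
    2 * Q * ((\<mu> / 2) ^ j' * (r * (norm (\<delta> i))\<^sup>2) + 2 * (\<mu> / 2) ^ Suc j' * (50 * k * (norm (\<delta> i))\<^sup>2)))"
   by (intro mult_left_mono) auto
  also have "\<dots> = 2 ^ Suc j' * \<bar>wedge (v i) (\<delta> i)\<bar> +
    2 * Q * (2 ^ j' * ((\<mu> / 2) ^ j' * (r * (norm (\<delta> i))\<^sup>2) + 2 * (\<mu> / 2) ^ Suc j' * (50 * k * (norm (\<delta> i))\<^sup>2)))"
   by (simp only: distrib_left power_Suc mult_ac)
  also have "\<dots> \<le> 2 ^ Suc j' * \<bar>wedge (v i) (\<delta> i)\<bar> + 2 * Q * c (m - i)"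
   using term_le[OF step(1) im refl] Q unfolding j' by (intro add_left_mono mult_left_mono) auto
  finally show ?case
   using step.IH im step.hyps by (simp add: j' sum.atLeastLessThan_Suc)
 qed simp
 have last: "2 ^ (m - u) * \<bar>wedge (v u) (\<delta> u)\<bar> \<le> Q * (1 / 200 * M)"
 proof -
  have "\<bar>wedge (v u) (\<delta> u)\<bar> \<le> norm (v u) * norm (\<delta> u)" by (rule abs_wedge_le)
  also have "\<dots> \<le> (2 * Q * (\<mu> / 2) ^ (m - u)) * (4 ^ (m - u) * M)"
   using word_simps(8)[OF w, of u] u M(2) Q \<mu>0 by (intro mult_mono) (auto simp: pos_divide_le_eq mult.commute)
  finally have "2 ^ (m - u) * \<bar>wedge (v u) (\<delta> u)\<bar> \<le> 2 ^ (m - u) * ((2 * Q * (\<mu> / 2) ^ (m - u)) * (4 ^ (m - u) * M))"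
   by (intro mult_left_mono) auto
  also have "\<dots> = 2 * Q * ((4 * \<mu>) ^ (m - u) * M)"
   by (simp add: power_divide power_mult_distrib)
  also have "\<dots> \<le> 2 * Q * (1 / 400 * M)"
  proof -
   have "(4 * \<mu>) ^ (m - u) \<le> (4 * \<mu>) ^ 1" using u mu \<mu>0 by (intro power_decreasing) auto
   then show ?thesis using mu(2) Q M0 by (intro mult_left_mono mult_right_mono) auto
  qed
  finally show ?thesis by (simp add: mult.commute)
 qed
 have stepm: "\<bar>wedge (v m) (\<delta> m)\<bar> \<le> 2 ^ (m - u) * \<bar>wedge (v u) (\<delta> u)\<bar> + (\<Sum>j\<in>{u..<m}. 2 * Q * c (m - j))"
  using step[of m] u by simp
 have "(\<Sum>j\<in>{u..<m}. 2 * Q * c (m - j)) = (\<Sum>j<m - u. 2 * Q * c (Suc j))"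
  by (rule sum.reindex_bij_witness[of _ "\<lambda>j. m - Suc j" "\<lambda>j. m - Suc j"]) (use u in \<open>auto simp: Suc_diff_Suc\<close>)
 also have "\<dots> = Q / 1000 * M * (\<Sum>i<m - u. (1 / 4) ^ i)"
  by (simp add: c_def sum_distrib_left mult_ac)
 also have "\<dots> \<le> Q / 1000 * M * (4 / 3)"
  using sum_quarter_le Q M0 by (intro mult_left_mono) auto
 finally have "\<bar>wedge (v m) (\<delta> m)\<bar> \<le> Q * (1 / 200 * M) + Q / 1000 * M * (4 / 3)"
  using stepm last by linarith
 also have "\<dots> \<le> Q / 100 * M" using mult_nonneg_nonneg[of Q M] Q M0 by simp
 finally show ?thesis .
qed

text \<open>With both \<open>\<rho>\<close> and \<open>v\<close> nearly horizontal,
  \<open>inner \<rho>\<close> reads off the abscissa and \<open>wedge v\<close> the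
  ordinate.\<close>

lemma norm_le_of_inner_wedge:
 fixes \<rho> v \<delta> :: "real \<times> real"
 assumes \<rho>: "\<bar>snd \<rho>\<bar> \<le> \<mu> * norm \<rho>" "norm \<rho> > 0" and v: "\<bar>snd v\<bar> \<le> \<mu> * norm v" "norm v > 0"
  and 1: "\<bar>inner \<rho> \<delta>\<bar> \<le> norm \<rho> / 100 * M" and 2: "\<bar>wedge v \<delta>\<bar> \<le> norm v / 100 * M"
 shows "norm \<delta> \<le> 1 / 10 * M"
proof -
 have main: "\<bar>a\<bar> \<le> 1 / 50 * M + 2 * \<mu> * norm \<delta>"
  if u: "\<bar>snd u\<bar> \<le> \<mu> * norm u" "norm u > 0" and b: "\<bar>b\<bar> \<le> norm \<delta>"
   and le: "\<bar>fst u * a + c * snd u * b\<bar> \<le> norm u / 100 * M" and c: "\<bar>c\<bar> = 1" for u :: "real \<times> real" and a b c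
 proof -
  have "norm u \<le> \<bar>fst u\<bar> + \<bar>snd u\<bar>" by (rule norm_le_abs_add)
  moreover have "\<mu> * norm u \<le> 1 / 2 * norm u" using mu(2) u(2) by (intro mult_right_mono) auto
  ultimately have f: "1 / 2 * norm u \<le> \<bar>fst u\<bar>" using u(1) by linarith
  have "\<bar>c * snd u * b\<bar> \<le> \<mu> * norm u * norm \<delta>"
   unfolding abs_mult c using u b mu(1) by (simp add: mult_mono)
  then have "\<bar>fst u * a\<bar> \<le> norm u / 100 * M + \<mu> * norm u * norm \<delta>" using le by linarith
  moreover have "1 / 2 * norm u * \<bar>a\<bar> \<le> \<bar>fst u * a\<bar>" unfolding abs_mult using f by (intro mult_right_mono) auto
  ultimately have "norm u * \<bar>a\<bar> \<le> norm u * (1 / 50 * M + 2 * \<mu> * norm \<delta>)" by (simp add: algebra_simps)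
  then show ?thesis using u(2) by (simp only: mult_le_cancel_left_pos)
 qed
 have "\<bar>fst \<delta>\<bar> \<le> 1 / 50 * M + 2 * \<mu> * norm \<delta>"
  by (rule main[OF \<rho>, of "snd \<delta>" _ 1]) (use 1 abs_snd_le_norm[of \<delta>] in \<open>simp_all add: inner_prod_def\<close>)
 moreover have "\<bar>snd \<delta>\<bar> \<le> 1 / 50 * M + 2 * \<mu> * norm \<delta>"
  by (rule main[OF v, of "fst \<delta>" _ "- 1"]) (use 2 abs_fst_le_norm[of \<delta>] in \<open>simp_all add: wedge_def\<close>)
 moreover have "2 * \<mu> * norm \<delta> \<le> 1 / 8 * norm \<delta>" using mu(2) by (intro mult_right_mono) auto
 ultimately show ?thesis using norm_le_abs_add[of \<delta>] by linarith
qed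

text \<open>Expansivity at a cut: the vector of the word on the left controls one coordinate of the
  difference, and the covector of the word on the right the other. The discount of 4 per step is far
  weaker than the true contraction, so that the estimate can be iterated from cut to cut.\<close>

lemma norm_diff_at_cut_le:
 assumes wl: "word m X v \<rho> Q" and wr: "word m' (\<lambda>i. X (m + i)) v' \<rho>' Q'" and X: "\<And>i. X (Suc i) = G (X i)"
  and Y: "\<And>i. u \<le> i \<Longrightarrow> Y (Suc i) = G (Y i)" and \<tau>l: "10000000 * \<tau>\<^sup>2 * l \<le> 1"
  and u: "u < m" and t: "1 \<le> t" "t \<le> m'"
  and bl: "\<And>i. u \<le> i \<Longrightarrow> i \<le> m \<Longrightarrow> norm (Y i - X i) \<le> 50 * l * \<mu> ^ min (i - u) (m - i)"
  and br: "\<And>i. i \<le> t \<Longrightarrow> norm (Y (m + i) - X (m + i)) \<le> 50 * l * \<mu> ^ min i (t - i)"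
  and M: "norm (Y (m + t) - X (m + t)) / 4 ^ t \<le> M" "norm (Y u - X u) / 4 ^ (m - u) \<le> M"
 shows "norm (Y m - X m) \<le> 1 / 10 * M"
proof -
 \<comment> \<open>The remainders also involve the difference at \<open>m\<close> itself. Including
   it in the maximum is harmless: were it the larger, it would be at most a tenth of itself.\<close>
 define M' where "M' = max M (norm (Y m - X m))"
 have \<delta>: "Y (Suc i) - X (Suc i) = D (X i) (Y i - X i) + N (X i) (Y i - X i)" if "u \<le> i" for i
  using G_add[of "X i" "Y i - X i"] X Y[OF that] by simp
 note le = norm_orbit_diff_le[where X = X and u = u and Y = Y, OF X Y]
 have Q: "Q > 0" "Q' > 0" using word_Q(1)[OF wl] word_Q(1)[OF wr] by auto
 have "\<bar>inner (\<rho>' 0) (Y (m + 0) - X (m + 0))\<bar> \<le> Q' / 100 * M'"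
 proof (rule abs_inner_rho_le[OF wr Q(2) t])
  fix i assume i: "i \<le> t"
  show "norm (Y (m + i) - X (m + i)) \<le> L ^ i * norm (Y (m + 0) - X (m + 0))"
   using le(1)[of m i] u by simp
  show "norm (Y (m + i) - X (m + i)) \<le> L ^ (t - i) * norm (Y (m + t) - X (m + t))"
   using le(2)[of "m + i" "t - i"] u i by simp
 qed (use \<delta> u br M in \<open>auto simp: M'_def\<close>)
 moreover have "\<bar>wedge (v m) (Y m - X m)\<bar> \<le> Q / 100 * M'"
 proof (rule abs_wedge_v_le[OF wl Q(1) u \<tau>l])
  fix i assume i: "u \<le> i" "i \<le> m"
  show "norm (Y i - X i) \<le> L ^ (i - u) * norm (Y u - X u)"
   using le(1)[of u "i - u"] i by simp
  show "norm (Y i - X i) \<le> L ^ (m - i) * norm (Y m - X m)"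
   using le(2)[of i "m - i"] i by simp
 qed (use \<delta> bl M in \<open>auto simp: M'_def\<close>)
 moreover have "Q' \<le> norm (\<rho>' 0)" "Q \<le> norm (v m)"
  using Cauchy_Schwarz_ineq2[of "\<rho>' 0" "v' 0"] word_simps(5)[OF wr, of 0] word_simps(6)[OF wr]
   Cauchy_Schwarz_ineq2[of "\<rho> m" "v m"] word_simps(5)[OF wl, of m] word_simps(7)[OF wl] by auto
 moreover have M'0: "0 \<le> M'" unfolding M'_def by (simp add: le_max_iff_disj)
 moreover have "q / 100 * M' \<le> n / 100 * M'" if "q \<le> n" for q n
  using that M'0 by (intro mult_right_mono) auto
 ultimately have "norm (Y m - X m) \<le> 1 / 10 * M'"
  using word_simps(12)[OF wr] word_simps(11)[OF wl] Q
  by (intro norm_le_of_inner_wedge[of "\<rho>' 0" "v m"]) (auto intro: order_trans)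
 moreover have "0 \<le> M" by (rule order_trans[OF _ M(1)]) simp
 ultimately show ?thesis unfolding M'_def using norm_ge_zero[of "Y m - X m"] by (simp add: max_def split: if_splits)
qed

lemma norm_lift_diff_le:
 assumes "norm (q - p) < 1 / 2" "dist (to_torus q) (to_torus p) \<le> c" "c < 1 / 2"
 shows "norm (q - p) \<le> c"
proof -
 obtain q' where q': "to_torus q' = to_torus q" "dist p q' = dist (to_torus p) (to_torus q)"
  by (rule exists_nearest_lift)
 have le: "norm (q' - p) \<le> c" using q'(2) assms(2) by (simp add: dist_commute dist_norm norm_minus_commute)
 have "norm (q' - q) < 1" using norm_triangle_ineq4[of "q' - p" "q - p"] le assms by simp
 moreover have "q' - q \<in> int_lattice" using q'(1) by (simp add: to_torus_eq_iff)
 ultimately have "q' - q = 0" by (intro int_lattice_norm_less_1)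
 then show ?thesis using le by simp
qed

lemma abs_snd_G_diff_le: "\<bar>snd (G q - G p) - fst (q - p)\<bar> \<le> norm (q - p) / 1000"
proof -
 have "snd (G q - G p) - fst (q - p) = snd (E q - E p)"
  by (simp add: G_eq standard_lift_def case_prod_unfold)
 then have "\<bar>snd (G q - G p) - fst (q - p)\<bar> \<le> r * norm (q - p)"
  using abs_snd_le_norm[of "E q - E p"] norm_E_diff_le[of q p] by simp
 also have "\<dots> \<le> 1 / 1000 * norm (q - p)" using r_small(1) by (intro mult_right_mono) auto
 finally show ?thesis by simp
qed

text \<open>Two orbits that are close on the torus, except at isolated times, have close lifts: an exceptional
 time is controlled by its two neighbours, because \<open>snd (G p)\<close> is almost \<open>fst p\<close>.\<close>

lemma exists_close_lift:
 fixes S :: "nat set" and X :: "nat \<Rightarrow> real \<times> real"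
 assumes X: "\<And>i. X (Suc i) = G (X i)" and R: "R \<ge> 1" and S: "\<forall>s\<in>S. a + 2 \<le> s \<and> s + 2 \<le> b" "\<forall>s\<in>S. \<forall>s'\<in>S. s < s' \<longrightarrow> s + 2 \<le> s'"
  and ab: "a + 2 \<le> b"
  and cl: "\<And>i d. a \<le> i \<Longrightarrow> i \<le> b \<Longrightarrow> d \<le> R \<Longrightarrow> (\<forall>s\<in>insert a (insert b S). d + i \<le> s \<or> d + s \<le> i) \<Longrightarrow>
   dist ((g ^^ i) y) (to_torus (X i)) \<le> 21 * l * \<mu> ^ d"
 obtains Y where "\<And>i. a + 1 \<le> i \<Longrightarrow> Y (Suc i) = G (Y i)" "\<And>i. a + 1 \<le> i \<Longrightarrow> to_torus (Y i) = (g ^^ i) y"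
  "\<And>i d. a < i \<Longrightarrow> i < b \<Longrightarrow> d \<le> R \<Longrightarrow> (\<forall>s\<in>insert a (insert b S). d + i \<le> s \<or> d + s \<le> i) \<Longrightarrow>
   norm (Y i - X i) \<le> 50 * l * \<mu> ^ d"
proof -
 have \<mu>0: "\<mu> > 0" using mu by simp
 define \<eta> where "\<eta> = l * \<mu>"
 have "1 * l \<le> \<tau> * l" using \<tau> l by (intro mult_right_mono) auto
 then have l1: "l \<le> 1 / 1000000" using l_small by simp
 have \<eta>0: "\<eta> > 0" using l \<mu>0 by (simp add: \<eta>_def)
 have "l * \<mu> \<le> 1 / 1000000 * 1" using l1 mu l by (intro mult_mono) auto
 then have \<eta>1: "\<eta> \<le> 1 / 1000000" by (simp add: \<eta>_def)
 have L\<eta>: "L * \<eta> \<le> 1 / 500000"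
 proof -
  have "L * \<eta> = 2 * (\<tau> * l)" unfolding \<eta>_def using mu_small(3) by (metis mult.assoc mult.commute)
  then show ?thesis using l_small by simp
 qed
 obtain q where q: "to_torus q = (g ^^ (a + 1)) y" "dist (X (a + 1)) q = dist (to_torus (X (a + 1))) ((g ^^ (a + 1)) y)"
  by (rule exists_nearest_lift)
 define Y where "Y i = (G ^^ (i - (a + 1))) q" for i
 have YS: "Y (Suc i) = G (Y i)" if "a + 1 \<le> i" for i
 proof -
  have "Suc i - (a + 1) = Suc (i - (a + 1))" using that by simp
  then show ?thesis by (simp only: Y_def funpow.simps comp_apply)
 qed
 have Yt: "to_torus (Y i) = (g ^^ i) y" if "a + 1 \<le> i" for i
 proof -
  have "(g ^^ i) y = (g ^^ (i - (a + 1))) ((g ^^ (a + 1)) y)"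
   using that by (metis comp_apply funpow_add le_add_diff_inverse2)
  then show ?thesis unfolding Y_def to_torus_funpow q(1) ..
 qed
 have c1: "dist (to_torus (Y i)) (to_torus (X i)) \<le> 21 * \<eta>" if "a < i" "i < b" "i \<notin> S" for i
 proof -
  have "1 + i \<le> s \<or> 1 + s \<le> i" if s: "s \<in> insert a (insert b S)" for s
   using that \<open>a < i\<close> \<open>i < b\<close> \<open>i \<notin> S\<close> by (cases s i rule: linorder_cases) auto
  then have "dist ((g ^^ i) y) (to_torus (X i)) \<le> 21 * l * \<mu> ^ 1" using that R by (intro cl) auto
  then show ?thesis using that by (simp add: Yt \<eta>_def)
 qed
 have main: "(i \<notin> S \<longrightarrow> norm (Y i - X i) \<le> 21 * \<eta>) \<and> (i \<in> S \<longrightarrow> norm (Y i - X i) \<le> 50 * \<eta>)" if "a + 1 \<le> i" "i < b" for i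
  using that
 proof (induction i rule: dec_induct)
  case base
  have "a + 1 \<notin> S" using S by auto
  then have "dist (to_torus (Y (a + 1))) (to_torus (X (a + 1))) \<le> 21 * \<eta>" using ab by (intro c1) auto
  then have "norm (Y (a + 1) - X (a + 1)) \<le> 21 * \<eta>"
   using q(2) Yt[of "a + 1"] by (simp add: Y_def dist_norm norm_minus_commute dist_commute)
  then show ?case using \<open>a + 1 \<notin> S\<close> by blast
 next
  case (step i)
  have IH: "norm (Y i - X i) \<le> 50 * \<eta>" "i \<notin> S \<Longrightarrow> norm (Y i - X i) \<le> 21 * \<eta>"
   using step \<eta>0 by fastforce+
  have "norm (Y (Suc i) - X (Suc i)) \<le> L * norm (Y i - X i)"
   using norm_G_diff_le YS[OF step(1)] X by simp
  also have "\<dots> \<le> L * (50 * \<eta>)" using IH L_pos by (intro mult_left_mono) auto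
  finally have n1: "norm (Y (Suc i) - X (Suc i)) \<le> 1 / 10000" using L\<eta> by simp
  show ?case
  proof (cases "Suc i \<in> S")
   case False
   then have "norm (Y (Suc i) - X (Suc i)) \<le> 21 * \<eta>"
    using n1 step c1[of "Suc i"] \<eta>1 by (intro norm_lift_diff_le) auto
   then show ?thesis using False by blast
  next
   case True
   have iS: "i \<notin> S" "Suc (Suc i) \<notin> S" "Suc (Suc i) < b" using S True by force+
   define \<delta> where "\<delta> = Y (Suc i) - X (Suc i)"
   have e: "\<delta> = G (Y i) - G (X i)" unfolding \<delta>_def using X[of i] YS[OF step(1)] by simp
   have s1: "\<bar>snd \<delta>\<bar> \<le> 22 * \<eta>"
    using abs_snd_G_diff_le[of "Y i" "X i"] IH(2)[OF iS(1)] abs_fst_le_norm[of "Y i - X i"] \<eta>0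
    unfolding e by linarith
   have G2: "\<bar>snd (Y (Suc (Suc i)) - X (Suc (Suc i))) - fst \<delta>\<bar> \<le> norm \<delta> / 1000"
    using abs_snd_G_diff_le[of "Y (Suc i)" "X (Suc i)"] X[of "Suc i"] YS[of "Suc i"] step(1) unfolding \<delta>_def by simp
   \<comment> \<open>At the time after the exception the abscissa is not yet under control, but the
     ordinate differs little from \<open>fst \<delta>\<close>. So the integer between the two lifts
     vanishes in the second coordinate, and this bounds \<open>fst \<delta>\<close>.\<close>
   obtain q' where q': "to_torus q' = to_torus (Y (Suc (Suc i)))"
    "dist (X (Suc (Suc i))) q' = dist (to_torus (X (Suc (Suc i)))) (to_torus (Y (Suc (Suc i))))"
    by (rule exists_nearest_lift)
   have nq: "norm (q' - X (Suc (Suc i))) \<le> 21 * \<eta>"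
    using q'(2) c1[of "Suc (Suc i)"] iS step(1) by (simp add: dist_commute dist_norm norm_minus_commute)
   have "snd (q' - Y (Suc (Suc i))) \<in> \<int>"
    using q'(1) by (auto simp: to_torus_eq_iff int_lattice_def mem_Times_iff)
   moreover have "\<bar>snd (q' - Y (Suc (Suc i)))\<bar> < 1"
    using nq abs_snd_le_norm[of "q' - X (Suc (Suc i))"] G2 n1 abs_fst_le_norm[of \<delta>] \<eta>1 unfolding \<delta>_def[symmetric] snd_diff by linarith
   ultimately have "snd (q' - Y (Suc (Suc i))) = 0"
    by (rule Ints_nonzero_abs_less1)
   then have "\<bar>snd (Y (Suc (Suc i)) - X (Suc (Suc i)))\<bar> \<le> 21 * \<eta>"
    using nq abs_snd_le_norm[of "q' - X (Suc (Suc i))"] by simp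
   then have "norm \<delta> \<le> 50 * \<eta>"
    using G2 s1 norm_le_abs_add[of \<delta>] \<eta>0 by linarith
   then show ?thesis using True unfolding \<delta>_def by blast
  qed
 qed
 show thesis
 proof (rule that[of Y])
  fix i d assume i: "a < i" "i < b" "d \<le> R" "\<forall>s\<in>insert a (insert b S). d + i \<le> s \<or> d + s \<le> i"
  show "norm (Y i - X i) \<le> 50 * l * \<mu> ^ d"
  proof (cases "i \<in> S")
   case True
   then have "d = 0" using i(4) by auto
   moreover have "50 * \<eta> \<le> 50 * l" unfolding \<eta>_def using mu l by (simp add: mult_left_le)
   moreover have "norm (Y i - X i) \<le> 50 * \<eta>" using main[of i] i True by simp
   ultimately show ?thesis by simp
  next
   case False
   have le: "21 * l * \<mu> ^ d \<le> 50 * l * \<mu> ^ d" using l \<mu>0 by simp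
   have "21 * l * \<mu> ^ d \<le> 21 * l * 1" using l mu by (intro mult_left_mono power_le_one) auto
   then have "21 * l * \<mu> ^ d < 1 / 2" using l1 by simp
   moreover have "norm (Y i - X i) < 1 / 2" using main[of i] i False \<eta>1 by simp
   moreover have "dist (to_torus (Y i)) (to_torus (X i)) \<le> 21 * l * \<mu> ^ d"
    using cl[OF _ _ i(3,4)] i Yt by simp
   ultimately have "norm (Y i - X i) \<le> 21 * l * \<mu> ^ d" by (intro norm_lift_diff_le)
   then show ?thesis using le by linarith
  qed
 qed (use YS Yt in auto)
qed

text \<open>The points \<open>y\<close> below have the same cuts \<open>S\<close> as the orbit \<open>X\<close>, and are close to it away from the cuts.\<close>

definition decoding_margin :: "real \<Rightarrow> nat \<Rightarrow> bool" where
 "decoding_margin e R \<longleftrightarrow> (\<forall>X H a b S y i. hyperbolic_times X H \<longrightarrow> a \<in> H \<longrightarrow> b \<in> H \<longrightarrow> finite S \<longrightarrow> S \<subseteq> H \<longrightarrow>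
   (\<forall>s\<in>S. a + 2 \<le> s \<and> s + 2 \<le> b) \<longrightarrow> (\<forall>s\<in>S. \<forall>s'\<in>S. s < s' \<longrightarrow> s + 2 \<le> s') \<longrightarrow>
   (\<forall>i d. a \<le> i \<longrightarrow> i \<le> b \<longrightarrow> d \<le> R \<longrightarrow> (\<forall>s\<in>insert a (insert b S). d + i \<le> s \<or> d + s \<le> i) \<longrightarrow>
    dist ((g ^^ i) y) (to_torus (X i)) \<le> 21 * l * \<mu> ^ d) \<longrightarrow>
   a + 2 * R < i \<longrightarrow> i + 2 * R < b \<longrightarrow> dist ((g ^^ i) y) (to_torus (X i)) < e)"

text \<open>A maximum principle along the cuts: the difference at a cut is at most a tenth of the
  discounted differences at neighbouring control times, so differences at cuts decay like
  \<open>4 ^ (- d)\<close> with the distance \<open>d\<close> from the ends, up to \<open>R\<close>.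
  Times near a cut inherit this up to a fixed growth factor, and for the other times the hypothesis
  is enough.\<close>

lemma exists_decoding_margin:
 fixes e :: real
 assumes \<tau>l: "10000000 * \<tau>\<^sup>2 * l \<le> 1" and e: "e > 0"
 obtains R where "decoding_margin e R"
proof -
 have \<mu>0: "\<mu> > 0" using mu by simp
 define \<eta> where "\<eta> = 50 * l"
 have \<eta>0: "\<eta> > 0" using l by (simp add: \<eta>_def)
 have "(\<lambda>R. \<eta> * \<mu> ^ R) \<longlonglongrightarrow> \<eta> * 0" using mu by (intro tendsto_intros LIMSEQ_power_zero) auto
 then have "\<forall>\<^sub>F R in sequentially. \<eta> * \<mu> ^ R < e" using e by (intro order_tendstoD(2)[where y = "\<eta> * 0"]) auto
 \<comment> \<open>\<open>R1\<close> is the distance from the cuts at which the hypothesis alone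
   gives \<open>e\<close>; \<open>R\<close> then makes the differences at the cuts so small that
   they stay below \<open>e\<close> during \<open>R1\<close> steps of growth.\<close>
 then obtain R1 where R1: "\<eta> * \<mu> ^ R1 < e" by (auto dest: eventually_happens)
 have "(\<lambda>R. L ^ R1 * \<eta> * (1 / 4) ^ R) \<longlonglongrightarrow> L ^ R1 * \<eta> * 0" by (intro tendsto_intros LIMSEQ_power_zero) auto
 then have "\<forall>\<^sub>F R in sequentially. L ^ R1 * \<eta> * (1 / 4) ^ R < e \<and> R \<ge> R1 + 1"
  using e by (intro eventually_conj order_tendstoD(2)[where y = "L ^ R1 * \<eta> * 0"] eventually_ge_at_top) auto
 then obtain R where R: "L ^ R1 * \<eta> * (1 / 4) ^ R < e" "R \<ge> R1 + 1" by (auto dest: eventually_happens)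
 show thesis
 proof (rule that[of R], unfold decoding_margin_def, intro allI impI)
  fix X H a b S y i
  assume X: "hyperbolic_times X H" and ab: "a \<in> H" "b \<in> H" and S: "finite S" "S \<subseteq> H" "\<forall>s\<in>S. a + 2 \<le> s \<and> s + 2 \<le> b"
   "\<forall>s\<in>S. \<forall>s'\<in>S. s < s' \<longrightarrow> s + 2 \<le> s'"
   and cl0: "\<forall>i d. a \<le> i \<longrightarrow> i \<le> b \<longrightarrow> d \<le> R \<longrightarrow> (\<forall>s\<in>insert a (insert b S). d + i \<le> s \<or> d + s \<le> i) \<longrightarrow>
    dist ((g ^^ i) y) (to_torus (X i)) \<le> 21 * l * \<mu> ^ d"
   and i: "a + 2 * R < i" "i + 2 * R < b"
  have cl: "dist ((g ^^ i) y) (to_torus (X i)) \<le> 21 * l * \<mu> ^ d"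
   if "a \<le> i" "i \<le> b" "d \<le> R" "\<forall>s\<in>insert a (insert b S). d + i \<le> s \<or> d + s \<le> i" for i d
   using cl0 that by blast
  have XS: "X (Suc i) = G (X i)" for i using X by (simp add: hyperbolic_times_def)
  have R0: "R \<ge> 1" using R by simp
  have ab2: "a + 2 \<le> b" using i R0 by simp
  obtain Y where Y: "\<And>i. a + 1 \<le> i \<Longrightarrow> Y (Suc i) = G (Y i)" "\<And>i. a + 1 \<le> i \<Longrightarrow> to_torus (Y i) = (g ^^ i) y"
   and bd: "\<And>i d. a < i \<Longrightarrow> i < b \<Longrightarrow> d \<le> R \<Longrightarrow> (\<forall>s\<in>insert a (insert b S). d + i \<le> s \<or> d + s \<le> i) \<Longrightarrow>
    norm (Y i - X i) \<le> 50 * l * \<mu> ^ d"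
   by (rule exists_close_lift[where y = y and X = X, OF XS R0 S(3,4) ab2 cl]) (assumption+, rule that, assumption+)
  define f where "f i = norm (Y i - X i)" for i
  have f\<eta>: "f i \<le> \<eta>" if "a < i" "i < b" for i 
  proof -
   have "\<forall>s\<in>insert a (insert b S). 0 + i \<le> s \<or> 0 + s \<le> i" by (simp add: linear)
   from bd[OF that le0 this] show ?thesis by (simp add: f_def \<eta>_def)
  qed
  \<comment> \<open>Distance to the ends of the window, truncated at \<open>R\<close>. Being
    1-Lipschitz (\<open>lip\<close>), it lets the weight \<open>4 ^ \<phi> s\<close> change by no
    more than the discount does.\<close>
  define \<phi> where "\<phi> s = min R (min (s - (a + 1)) (b - 1 - s))" for s
  have cut: "\<exists>t u. s < t \<and> t < b \<and> a < u \<and> u < s \<and> (t \<in> S \<or> \<phi> s \<le> t - s) \<and> (u \<in> S \<or> \<phi> s \<le> s - u) \<and>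
    (\<forall>M. f t / 4 ^ (t - s) \<le> M \<longrightarrow> f u / 4 ^ (s - u) \<le> M \<longrightarrow> f s \<le> 1 / 10 * M)" if s: "s \<in> S" for s
  proof -
   have sab: "a + 2 \<le> s" "s + 2 \<le> b" using S(3) s by auto
   define n where "n = Min {c \<in> insert b S. s < c}"
   define p where "p = Max {c \<in> insert a S. c < s}"
   have "n \<in> {c \<in> insert b S. s < c}" unfolding n_def using S(1) sab by (intro Min_in) auto
   then have n: "n \<in> insert b S" "s < n" by auto
   have nmin: "n \<le> c" if "c \<in> insert b S" "s < c" for c unfolding n_def using S(1) that by (intro Min_le) auto
   have "p \<in> {c \<in> insert a S. c < s}" unfolding p_def using S(1) sab by (intro Max_in) auto
   then have p: "p \<in> insert a S" "p < s" by auto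
   have pmax: "c \<le> p" if "c \<in> insert a S" "c < s" for c unfolding p_def using S(1) that by (intro Max_ge) auto
   have nb: "n \<le> b" and pa: "a \<le> p" using nmin[of b] pmax[of a] sab by auto
   \<comment> \<open>The control times \<open>t\<close> and \<open>u\<close> are the neighbouring
     cuts, except that they are at most \<open>R\<close> away and remain inside the window.\<close>
   define t where "t = min (s + R) (if n = b then b - 1 else n)"
   define u where "u = max (s - R) (if p = a then a + 1 else p)"
   have t: "s < t" "t < b" "t \<le> n" using n R0 sab nb by (auto simp: t_def)
   have u: "a < u" "u < s" "p \<le> u" using p R0 sab pa by (auto simp: u_def)
   have tR: "t - s \<le> R" "s - u \<le> R" by (auto simp: t_def u_def)
   have tS: "t \<in> S \<or> \<phi> s \<le> t - s" using n by (auto simp: t_def \<phi>_def)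
   have uS: "u \<in> S \<or> \<phi> s \<le> s - u" using p sab by (auto simp: u_def \<phi>_def)
   obtain v \<rho> Q where wl: "word (s - p) (\<lambda>i. X (p + i)) v \<rho> Q"
    using X p(2) ab S(2) s p(1) unfolding hyperbolic_times_def by blast
   obtain v' \<rho>' Q' where wr: "word (n - s) (\<lambda>i. X (s + i)) v' \<rho>' Q'"
    using X n ab S(2) s unfolding hyperbolic_times_def by blast
   have sep: "(c \<le> p \<or> c = s \<or> n \<le> c)" if "c \<in> insert a (insert b S)" for c
    using nmin[of c] pmax[of c] that sab by (cases c s rule: linorder_cases) auto
   have "f s \<le> 1 / 10 * M" if M: "f t / 4 ^ (t - s) \<le> M" "f u / 4 ^ (s - u) \<le> M" for M
   proof -
    have wr': "word (n - s) (\<lambda>i. X (p + (s - p + i))) v' \<rho>' Q'" using wr p by (simp add: add.assoc[symmetric])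
    have "norm (Y (p + (s - p)) - X (p + (s - p))) \<le> 1 / 10 * M"
    proof (rule norm_diff_at_cut_le[where X = "\<lambda>i. X (p + i)" and Y = "\<lambda>i. Y (p + i)" and u = "u - p" and t = "t - s", OF wl wr'])
     show "X (p + Suc i) = G (X (p + i))" for i using XS by simp
     show "Y (p + Suc i) = G (Y (p + i))" if "u - p \<le> i" for i using Y(1)[of "p + i"] that u by simp
     show "u - p < s - p" "1 \<le> t - s" "t - s \<le> n - s" using u t p by auto
     show "norm (Y (p + i) - X (p + i)) \<le> 50 * l * \<mu> ^ min (i - (u - p)) (s - p - i)" if "u - p \<le> i" "i \<le> s - p" for i
     proof (rule bd)
      show "min (i - (u - p)) (s - p - i) \<le> R" using tR(2) that by auto
      show "\<forall>c\<in>insert a (insert b S). min (i - (u - p)) (s - p - i) + (p + i) \<le> c \<or> min (i - (u - p)) (s - p - i) + c \<le> p + i"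
      proof
       fix c assume "c \<in> insert a (insert b S)"
       from sep[OF this] show "min (i - (u - p)) (s - p - i) + (p + i) \<le> c \<or> min (i - (u - p)) (s - p - i) + c \<le> p + i"
        using that u p n by linarith
      qed
     qed (use that u p sab in auto)
     show "norm (Y (p + (s - p + i)) - X (p + (s - p + i))) \<le> 50 * l * \<mu> ^ min i (t - s - i)" if "i \<le> t - s" for i
     proof (rule bd)
      show "min i (t - s - i) \<le> R" using tR(1) that by auto
      show "\<forall>c\<in>insert a (insert b S). min i (t - s - i) + (p + (s - p + i)) \<le> c \<or> min i (t - s - i) + c \<le> p + (s - p + i)"
      proof
       fix c assume "c \<in> insert a (insert b S)"
       from sep[OF this] show "min i (t - s - i) + (p + (s - p + i)) \<le> c \<or> min i (t - s - i) + c \<le> p + (s - p + i)"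
        using that t p n by linarith
      qed
     qed (use that t p sab in auto)
     show "norm (Y (p + (s - p + (t - s))) - X (p + (s - p + (t - s)))) / 4 ^ (t - s) \<le> M" using M(1) t p by (simp add: f_def)
     show "norm (Y (p + (u - p)) - X (p + (u - p))) / 4 ^ (s - p - (u - p)) \<le> M" using M(2) u p by (simp add: f_def)
    qed (use \<tau>l in auto)
    then show ?thesis using p by (simp add: f_def)
   qed
   then show ?thesis using t u tS uS by (intro exI[of _ t] exI[of _ u]) auto
  qed
  have lip: "\<phi> s \<le> \<phi> t + d" if "t \<le> s + d" "s \<le> t + d" for s t d
  proof -
   have "\<phi> s \<le> R" "\<phi> s \<le> s - (a + 1)" "\<phi> s \<le> b - 1 - s" by (simp_all add: \<phi>_def)
   then have "\<phi> s \<le> R + d" "\<phi> s \<le> (t - (a + 1)) + d" "\<phi> s \<le> (b - 1 - t) + d" using that by linarith+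
   then show ?thesis unfolding \<phi>_def[of t] min_add_distrib_left by simp
  qed
  \<comment> \<open>At the cut \<open>s0\<close> with the greatest weighted difference, the weighted
    value is at most a tenth of the maximum of \<open>\<eta>\<close> and itself, hence at most
    \<open>\<eta>\<close>.\<close>
  have fS: "f s * 4 ^ \<phi> s \<le> \<eta>" if "s \<in> S" for s
  proof -
   have "Max ((\<lambda>s. f s * 4 ^ \<phi> s) ` S) \<in> (\<lambda>s. f s * 4 ^ \<phi> s) ` S" using S(1) that by (intro Max_in) auto
   then obtain s0 where s0: "s0 \<in> S" "Max ((\<lambda>s. f s * 4 ^ \<phi> s) ` S) = f s0 * 4 ^ \<phi> s0" by blast
   have mx: "f s * 4 ^ \<phi> s \<le> f s0 * 4 ^ \<phi> s0" if "s \<in> S" for s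
    unfolding s0(2)[symmetric] using S(1) that by (intro Max_ge) auto
   define M where "M = max \<eta> (f s0 * 4 ^ \<phi> s0)"
   have aux: "f t / 4 ^ d \<le> M / 4 ^ \<phi> s0" if "a < t" "t < b" "t \<in> S \<or> \<phi> s0 \<le> d" "\<phi> s0 \<le> \<phi> t + d" for t d
   proof -
    have "f t * 4 ^ \<phi> s0 \<le> M * 4 ^ d"
    proof (cases "t \<in> S")
     case True
     have "f t * 4 ^ \<phi> s0 \<le> f t * 4 ^ (\<phi> t + d)" using that(4) by (intro mult_left_mono power_increasing) (auto simp: f_def)
     also have "\<dots> = (f t * 4 ^ \<phi> t) * 4 ^ d" by (simp add: power_add)
     also have "\<dots> \<le> M * 4 ^ d" using mx[OF True] by (intro mult_right_mono) (auto simp: M_def)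
     finally show ?thesis .
    next
     case False
     then have "f t * 4 ^ \<phi> s0 \<le> \<eta> * 4 ^ d" using that f\<eta>[OF that(1,2)] \<eta>0 by (intro mult_mono power_increasing) auto
     also have "\<dots> \<le> M * 4 ^ d" by (intro mult_right_mono) (auto simp: M_def)
     finally show ?thesis .
    qed
    then show ?thesis by (simp add: field_simps)
   qed
   obtain t u where tu: "s0 < t" "t < b" "a < u" "u < s0" "t \<in> S \<or> \<phi> s0 \<le> t - s0" "u \<in> S \<or> \<phi> s0 \<le> s0 - u"
    "\<forall>M. f t / 4 ^ (t - s0) \<le> M \<longrightarrow> f u / 4 ^ (s0 - u) \<le> M \<longrightarrow> f s0 \<le> 1 / 10 * M"
    using cut[OF s0(1)] by blast
   have "f t / 4 ^ (t - s0) \<le> M / 4 ^ \<phi> s0" using tu by (intro aux lip) auto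
   moreover have "f u / 4 ^ (s0 - u) \<le> M / 4 ^ \<phi> s0" using tu by (intro aux lip) auto
   ultimately have "f s0 \<le> 1 / 10 * (M / 4 ^ \<phi> s0)" using tu(7) by blast
   then have "f s0 * 4 ^ \<phi> s0 \<le> 1 / 10 * M" by (simp add: field_simps)
   then have "f s0 * 4 ^ \<phi> s0 \<le> \<eta>" using \<eta>0 by (simp add: M_def max_def split: if_splits)
   then show ?thesis using mx[OF that] by linarith
  qed
  have "f i < e"
  proof (cases "\<forall>s\<in>insert a (insert b S). R1 + i \<le> s \<or> R1 + s \<le> i")
   case True
   then show ?thesis using bd[of i R1] i R R1 by (simp add: f_def \<eta>_def)
  next
   case False
   then obtain s where s: "s \<in> insert a (insert b S)" "s < R1 + i" "i < R1 + s" by (auto simp: not_le)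
   have sS: "s \<in> S" using s i R(2) by auto
   have \<phi>R: "\<phi> s = R" using s i R(2) by (auto simp: \<phi>_def)
   have "f i \<le> L ^ R1 * f s"
   proof -
    define j where "j = (if i \<le> s then s - i else i - s)"
    have "f i \<le> L ^ j * f s"
    proof (cases "i \<le> s")
     case True
     then show ?thesis
      using norm_orbit_diff_le(2)[where X = X and u = "a + 1" and Y = Y, OF XS Y(1), of i "s - i"] i by (simp add: f_def j_def)
    next
     case False
     then show ?thesis
      using norm_orbit_diff_le(1)[where X = X and u = "a + 1" and Y = Y, OF XS Y(1), of s "i - s"] S(3) sS by (force simp: f_def j_def)
    qed
    also have "\<dots> \<le> L ^ R1 * f s" using s L_ge by (intro mult_right_mono power_increasing) (auto simp: j_def f_def)
    finally show ?thesis .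
   qed
   also have "\<dots> \<le> L ^ R1 * (\<eta> * (1 / 4) ^ R)"
    using fS[OF sS] L_pos unfolding \<phi>R by (intro mult_left_mono) (auto simp: power_divide field_simps)
   finally show ?thesis using R(1) by (simp add: mult.assoc)
  qed
  moreover have "dist ((g ^^ i) y) (to_torus (X i)) \<le> f i"
   using dist_to_torus_le[of "Y i" "X i"] Y(2)[of i] i by (simp add: f_def dist_norm)
  ultimately show "dist ((g ^^ i) y) (to_torus (X i)) < e" by linarith
 qed
qed

end

section \<open>Density of the support\<close>

text \<open>A bound on separated sets is available only for a middle window of times. Its
  complement, the first \<open>u\<close> and the last \<open>v\<close> times, is covered at the cost
  of the full entropy.\<close>

lemma exists_cover_of_separated_bound:
 fixes g :: "'a::metric_space \<Rightarrow> 'a" and C h \<delta> K :: real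
 assumes cov: "\<And>t. \<exists>\<A>. finite \<A> \<and> \<Union>\<A> = UNIV \<and> (\<forall>A\<in>\<A>. bowen_small g t (\<delta> / 3) A) \<and> real (card \<A>) \<le> C * exp (t * h)"
  and \<delta>: "\<delta> > 0" and C: "C \<ge> 1"
  and K: "\<And>E. finite E \<Longrightarrow> E \<subseteq> W \<Longrightarrow> \<forall>x\<in>E. \<forall>y\<in>E. x \<noteq> y \<longrightarrow> (\<exists>i<m. \<delta> / 3 < dist ((g ^^ (u + i)) x) ((g ^^ (u + i)) y)) \<Longrightarrow>
   real (card E) \<le> K"
 shows "\<exists>\<B>. finite \<B> \<and> W \<subseteq> \<Union>\<B> \<and> (\<forall>B\<in>\<B>. bowen_small g (u + m + v) \<delta> B) \<and>
  real (card \<B>) \<le> (C * exp (u * h)) * K * (C * exp (v * h))"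
proof -
 obtain \<U> where U: "finite \<U>" "\<Union>\<U> = UNIV" "\<forall>A\<in>\<U>. bowen_small g u (\<delta> / 3) A" "real (card \<U>) \<le> C * exp (u * h)"
  using cov[of u] by blast
 obtain \<M> where M: "finite \<M>" "\<Union>\<M> = UNIV" "\<forall>A\<in>\<M>. bowen_small g m (\<delta> / 3) A"
  using cov[of m] by blast
 obtain \<V> where V: "finite \<V>" "\<Union>\<V> = UNIV" "\<forall>A\<in>\<V>. bowen_small g v (\<delta> / 3) A" "real (card \<V>) \<le> C * exp (v * h)"
  using cov[of v] by blast
 have "\<exists>E\<subseteq>(g ^^ u) ` W. finite E \<and> bowen_separated g m (\<delta> / 3) E \<and>
   (\<forall>y\<in>(g ^^ u) ` W. \<exists>x\<in>E. \<forall>i<m. dist ((g ^^ i) x) ((g ^^ i) y) \<le> \<delta> / 3)"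
 proof (rule exists_maximal_bowen_separated)
  show "card E \<le> card \<M>" if "finite E" "bowen_separated g m (\<delta> / 3) E" for E
   using card_separated_le_cover(2)[OF that(2) M(1)] M(2,3) by auto
 qed (use \<delta> in simp)
 then obtain E where E: "E \<subseteq> (g ^^ u) ` W" "finite E" "bowen_separated g m (\<delta> / 3) E"
  "\<forall>y\<in>(g ^^ u) ` W. \<exists>x\<in>E. \<forall>i<m. dist ((g ^^ i) x) ((g ^^ i) y) \<le> \<delta> / 3" by blast
 have "\<forall>y\<in>E. \<exists>w. w \<in> W \<and> (g ^^ u) w = y" using E(1) by blast
 then obtain pre where pre: "\<And>y. y \<in> E \<Longrightarrow> pre y \<in> W" "\<And>y. y \<in> E \<Longrightarrow> (g ^^ u) (pre y) = y" by metis
 have it: "(g ^^ (u + i)) x = (g ^^ i) ((g ^^ u) x)" for i x by (simp add: funpow_add add.commute)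
 have "inj_on pre E" using pre(2) by (metis inj_onI)
 then have "card E = card (pre ` E)" by (simp add: card_image)
 moreover have "real (card (pre ` E)) \<le> K"
 proof (rule K)
  show "\<forall>x\<in>pre ` E. \<forall>y\<in>pre ` E. x \<noteq> y \<longrightarrow> (\<exists>i<m. \<delta> / 3 < dist ((g ^^ (u + i)) x) ((g ^^ (u + i)) y))"
  proof (intro ballI impI)
   fix x y assume "x \<in> pre ` E" "y \<in> pre ` E" "x \<noteq> y"
   then obtain x' y' where xy: "x' \<in> E" "y' \<in> E" "x = pre x'" "y = pre y'" "x' \<noteq> y'" by blast
   then obtain i where "i < m" "\<delta> / 3 < dist ((g ^^ i) x') ((g ^^ i) y')"
    using E(3) unfolding bowen_separated_def by blast
   then show "\<exists>i<m. \<delta> / 3 < dist ((g ^^ (u + i)) x) ((g ^^ (u + i)) y)"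
    unfolding it xy(3,4) pre(2)[OF xy(1)] pre(2)[OF xy(2)] by blast
  qed
 qed (use E(2) pre(1) in auto)
 ultimately have EK: "real (card E) \<le> K" by simp
 define B where "B A y V = A \<inter> {x. \<forall>i<m. dist ((g ^^ i) y) ((g ^^ (u + i)) x) \<le> \<delta> / 3} \<inter> (g ^^ (u + m)) -` V" for A y V
 define \<B> where "\<B> = (\<lambda>(A, y, V). B A y V) ` (\<U> \<times> E \<times> \<V>)"
 have fin: "finite (\<U> \<times> E \<times> \<V>)" using U(1) E(2) V(1) by simp
 have 1: "finite \<B>" unfolding \<B>_def using fin by simp
 have 2: "W \<subseteq> \<Union>\<B>"
 proof
  fix x assume x: "x \<in> W"
  obtain A where A: "A \<in> \<U>" "x \<in> A" using U(2) by blast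
  obtain y where y: "y \<in> E" "\<forall>i<m. dist ((g ^^ i) y) ((g ^^ i) ((g ^^ u) x)) \<le> \<delta> / 3" using E(4) x by blast
  obtain V' where V': "V' \<in> \<V>" "(g ^^ (u + m)) x \<in> V'" using V(2) by blast
  have "x \<in> B A y V'" using A(2) y(2) V'(2) by (simp add: B_def it)
  moreover have "B A y V' \<in> \<B>" unfolding \<B>_def using A(1) y(1) V'(1) by force
  ultimately show "x \<in> \<Union>\<B>" by blast
 qed
 have 3: "bowen_small g (u + m + v) \<delta> Z" if Z: "Z \<in> \<B>" for Z
  unfolding bowen_small_def
 proof (intro ballI allI impI)
  fix x y j assume xy: "x \<in> Z" "y \<in> Z" and j: "j < u + m + v"
  obtain A c V' where AV: "A \<in> \<U>" "V' \<in> \<V>" "Z = B A c V'" using Z unfolding \<B>_def by auto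
  consider "j < u" | i where "j = u + i" "i < m" | i where "j = u + m + i" "i < v"
   using j by (metis add.assoc add_less_cancel_left le_Suc_ex not_le)
  then show "dist ((g ^^ j) x) ((g ^^ j) y) < \<delta>"
  proof cases
   case 1
   then have "dist ((g ^^ j) x) ((g ^^ j) y) < \<delta> / 3"
    using U(3) AV xy unfolding bowen_small_def B_def by blast
   then show ?thesis using \<delta> by simp
  next
   case 2
   then have "dist ((g ^^ i) c) ((g ^^ j) x) \<le> \<delta> / 3" "dist ((g ^^ i) c) ((g ^^ j) y) \<le> \<delta> / 3"
    using AV xy unfolding B_def by auto
   then show ?thesis using dist_triangle3[of "(g ^^ j) x" "(g ^^ j) y" "(g ^^ i) c"] \<delta> by linarith
  next
   case 3
   have "(g ^^ (u + m)) x \<in> V'" "(g ^^ (u + m)) y \<in> V'" using AV xy unfolding B_def by auto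
   then have "dist ((g ^^ i) ((g ^^ (u + m)) x)) ((g ^^ i) ((g ^^ (u + m)) y)) < \<delta> / 3"
    using V(3) AV(2) 3(2) unfolding bowen_small_def by blast
   moreover have "(g ^^ j) x = (g ^^ i) ((g ^^ (u + m)) x)" for x
    unfolding 3(1) by (metis add.commute comp_apply funpow_add)
   ultimately show ?thesis using \<delta> by simp
  qed
 qed
 have "card \<B> \<le> card (\<U> \<times> E \<times> \<V>)"
  unfolding \<B>_def by (rule card_image_le[OF fin])
 then have "real (card \<B>) \<le> real (card \<U>) * real (card E) * real (card \<V>)"
  by (simp only: card_cartesian_product of_nat_mult[symmetric] of_nat_le_iff mult.assoc)
 also have "\<dots> \<le> (C * exp (u * h)) * K * (C * exp (v * h))"
  using U(4) EK V(4) C by (intro mult_mono mult_nonneg_nonneg) (auto intro: order_trans[OF of_nat_0_le_iff EK])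
 finally show ?thesis using 1 2 3 by blast
qed

text \<open>A quarter of the times lie in the residue class of \<open>a\<close> modulo 4; removing
  the few that \<open>H\<close> lacks leaves a fifth. The common residue makes cuts belonging to
  different orbits coincide or differ by at least 4. The exact cardinality makes the number of
  choices of cuts the same for all orbits.\<close>

lemma exists_spread_times:
 fixes H :: "nat set"
 assumes H: "H \<subseteq> {0<..<T}" and bad: "real (card ({..T} - H)) \<le> T / 100 + 2" and T: "T \<ge> 10000"
 obtains a e Q where "a \<in> H" "e \<in> H" "e < T" "real a + T / 2 \<le> e" "Q \<subseteq> H" "finite Q"
  "\<forall>s\<in>Q. a < s \<and> s + 2 \<le> e \<and> 4 dvd s - a" "card Q = nat \<lfloor>real (e - a) / 5\<rfloor>"
proof -
 have fH: "finite H" using H finite_subset by blast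
 have ne: "H \<noteq> {}" using bad T by (auto simp: field_simps)
 define a where "a = Min H"
 define e where "e = Max H"
 have a: "a \<in> H" and e: "e \<in> H" unfolding a_def e_def using fH ne by auto
 have mn: "a \<le> x" "x \<le> e" if "x \<in> H" for x unfolding a_def e_def using fH that by auto
 have eT: "e < T" using H e by auto
 have "card {..<a} \<le> card ({..T} - H)" using mn a eT mn[OF a] by (intro card_mono) force+
 then have a1: "real a \<le> T / 100 + 2" using bad by simp
 have "card {e<..T} \<le> card ({..T} - H)" using mn by (intro card_mono) force+
 then have e1: "real T - e \<le> T / 100 + 2" using bad eT by simp
 define n where "n = e - a"
 have n: "real n = real e - real a" using mn(1)[OF e] by (simp add: n_def)
 have n1: "real n \<ge> real T - T / 50 - 4" using a1 e1 n by linarith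
 define J where "J = {1..(n - 2) div 4}"
 define P where "P = (\<lambda>j. a + 4 * j) ` J"
 have P: "a < s \<and> s + 2 \<le> e \<and> 4 dvd s - a" if sP: "s \<in> P" for s
 proof -
  obtain j where j: "s = a + 4 * j" "1 \<le> j" "j \<le> (n - 2) div 4" using sP by (auto simp: P_def J_def)
  then have "4 * j \<le> n - 2" by presburger
  then show ?thesis using j n_def by auto
 qed
 have cP: "card P = (n - 2) div 4" unfolding P_def by (subst card_image) (auto simp: inj_on_def J_def)
 have "real ((n - 2) div 4) \<ge> real n / 4 - 2"
 proof -
  have "n \<le> 4 * ((n - 2) div 4) + 5" by presburger
  then have "real n \<le> real (4 * ((n - 2) div 4) + 5)" by (simp only: of_nat_le_iff)
  then show ?thesis by simp
 qed
 then have cP': "real (card P) \<ge> real n / 4 - 2" unfolding cP .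
 have "P - H \<subseteq> {..T} - H" using P eT by force
 then have "card (P - H) \<le> card ({..T} - H)" by (intro card_mono) auto
 then have "real (card (P - H)) \<le> T / 100 + 2" using bad by linarith
 moreover have "card P \<le> card (P \<inter> H) + card (P - H)"
  using card_Un_le[of "P \<inter> H" "P - H"] by (simp add: Int_Diff_Un)
 ultimately have "real n / 5 \<le> real (card (P \<inter> H))" using cP' n1 T by linarith
 then have cPH: "nat \<lfloor>real n / 5\<rfloor> \<le> card (P \<inter> H)" by linarith
 obtain Q where Q: "Q \<subseteq> P \<inter> H" "card Q = nat \<lfloor>real n / 5\<rfloor>" "finite Q"
  by (rule obtain_subset_with_card_n[OF cPH])
 show thesis
 proof (rule that[OF a e eT])
  show "real a + T / 2 \<le> e" using n n1 T by linarith
  show "Q \<subseteq> H" using Q(1) by blast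
  show "finite Q" by (rule Q)
  show "\<forall>s\<in>Q. a < s \<and> s + 2 \<le> e \<and> 4 dvd s - a" using Q(1) P by blast
  show "card Q = nat \<lfloor>real (e - a) / 5\<rfloor>" using Q(2) unfolding n_def .
 qed
qed

context shadowing
begin

section \<open>Counting orbits with detours\<close>

lemma arrival_le:
 fixes A :: "nat set"
 shows "i \<le> j \<Longrightarrow> finite A \<Longrightarrow> arrival A a i \<le> j - a + 4 * card A"
 unfolding arrival_def by (intro add_mono diff_le_mono mult_le_mono card_mono) auto

text \<open>If only \<open>S\<close> had a cut at \<open>s\<close>, then two steps later
  \<open>z\<close> would be within \<open>l\<close> of \<open>x0\<close>, and \<open>z'\<close>
  within \<open>10 * l\<close> of \<open>X' (s + 2)\<close>, since the residue condition also
  excludes a cut of \<open>S'\<close> at \<open>Suc s\<close>. With the distance \<open>l\<close>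
  between the two orbits this adds up to the forbidden \<open>12 * l\<close>.\<close>

lemma cut_determined:
 fixes S S' :: "nat set" and x0 z z' :: torus
 assumes S: "finite S" "\<forall>s\<in>S. a < s \<and> s + 2 \<le> e \<and> 4 dvd s - a" "\<forall>s\<in>S'. a < s \<and> s + 2 \<le> e \<and> 4 dvd s - a"
  and tr': "\<And>i. a \<le> i \<Longrightarrow> i \<le> e \<Longrightarrow> dist ((g ^^ arrival S' a i) z') (to_torus (X' i)) \<le> 10 * l"
  and de: "\<And>s. s \<in> S \<Longrightarrow> dist ((g ^^ (arrival S a s + 2)) z) x0 \<le> l"
  and av': "\<And>i. i \<le> e \<Longrightarrow> 12 * l < dist x0 (to_torus (X' i))"
  and cl: "\<And>t. t < e - a + 4 * card S + 1 \<Longrightarrow> dist ((g ^^ t) z) ((g ^^ t) z') \<le> l"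
  and s: "s \<in> S" "\<And>s'. s' < s \<Longrightarrow> s' \<in> S \<longleftrightarrow> s' \<in> S'"
 shows "s \<in> S'"
proof (rule ccontr)
 assume n: "s \<notin> S'"
 have sa: "a < s" "s + 2 \<le> e" "4 dvd s - a" using S(2) s(1) by auto
 have "Suc s \<notin> S'"
 proof
  assume "Suc s \<in> S'"
  then have "4 dvd Suc s - a" using S(3) by blast
  then show False using sa by presburger
 qed
 then have "{s' \<in> S'. s' < s + 2} = {s' \<in> S'. s' < s}" using n by (auto simp: less_Suc_eq)
 then have 1: "arrival S' a (s + 2) = arrival S' a s + 2" using sa by (simp add: arrival_def)
 have "{s' \<in> S. s' < s} = {s' \<in> S'. s' < s}" using s(2) by blast
 then have 2: "arrival S' a s = arrival S a s" by (simp add: arrival_def)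
 have "dist ((g ^^ (arrival S a s + 2)) z') (to_torus (X' (s + 2))) \<le> 10 * l"
  using tr'[of "s + 2"] sa unfolding 1 2 by simp
 moreover have "dist ((g ^^ (arrival S a s + 2)) z) ((g ^^ (arrival S a s + 2)) z') \<le> l"
 proof (rule cl)
  show "arrival S a s + 2 < e - a + 4 * card S + 1"
   using arrival_le[of s s S a] S(1) sa by simp
 qed
 moreover have "dist x0 (to_torus (X' (s + 2))) > 12 * l" using av' sa by simp
 ultimately show False
  using de[OF s(1)] dist_triangle2[of x0 "to_torus (X' (s + 2))" "(g ^^ (arrival S a s + 2)) z"]
   dist_triangle[of "(g ^^ (arrival S a s + 2)) z" "to_torus (X' (s + 2))" "(g ^^ (arrival S a s + 2)) z'"]
   dist_commute[of x0 "(g ^^ (arrival S a s + 2)) z"] dist_commute[of "to_torus (X' (s + 2))" "(g ^^ (arrival S a s + 2)) z"]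
  by linarith
qed

text \<open>Different pairs of an orbit and a set of cuts give separated detoured orbits. Comparing
  at the first discrepancy recovers the cuts; then the arrival times agree, and
  \<open>decoding_margin\<close> recovers the orbit.\<close>

lemma card_orbits_with_detours_le:
 fixes X :: "'w \<Rightarrow> nat \<Rightarrow> real \<times> real" and H Q :: "'w \<Rightarrow> nat set" and x0 :: torus and d3 B :: real
 assumes fin: "finite W" and X: "\<And>w. w \<in> W \<Longrightarrow> hyperbolic_times (X w) (H w)"
  and H: "\<And>w. w \<in> W \<Longrightarrow> a \<in> H w" "\<And>w. w \<in> W \<Longrightarrow> e \<in> H w" "a < e"
  and Q: "\<And>w. w \<in> W \<Longrightarrow> Q w \<subseteq> H w" "\<And>w. w \<in> W \<Longrightarrow> finite (Q w)"
   "\<And>w. w \<in> W \<Longrightarrow> \<forall>s\<in>Q w. a < s \<and> s + 2 \<le> e \<and> 4 dvd s - a" "\<And>w. w \<in> W \<Longrightarrow> card (Q w) = m"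
  and av: "\<And>w i. w \<in> W \<Longrightarrow> i \<le> e \<Longrightarrow> 12 * l < dist x0 (to_torus (X w i))"
  and dec: "decoding_margin d3 R"
  and sep: "\<And>w w'. w \<in> W \<Longrightarrow> w' \<in> W \<Longrightarrow> w \<noteq> w' \<Longrightarrow> \<exists>i. a + 2 * R < i \<and> i + 2 * R < e \<and> d3 \<le> dist (to_torus (X w' i)) (to_torus (X w i))"
  and B: "\<And>Z. finite Z \<Longrightarrow> bowen_separated g (e - a + 4 * c + 1) (l * \<mu> ^ R) Z \<Longrightarrow> real (card Z) \<le> B"
 shows "real (card W) * real (m choose c) \<le> B"
proof -
 have \<mu>0: "\<mu> > 0" using mu by simp
 obtain b where b: "to_torus b = x0" using to_torus_surj by blast
 define I where "I = Sigma W (\<lambda>w. {S. S \<subseteq> Q w \<and> card S = c})"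
 have cI: "card I = card W * (m choose c)"
  unfolding I_def using fin Q by (subst card_SigmaI) (auto simp: n_subsets)
 have finI: "finite I" unfolding I_def using fin Q(2) by (intro finite_SigmaI) auto
 define coded where "coded w S z \<longleftrightarrow> (\<forall>i d. a \<le> i \<longrightarrow> i \<le> e \<longrightarrow> (\<forall>s\<in>insert a (insert e S). d + i \<le> s \<or> d + s \<le> i) \<longrightarrow>
    dist ((g ^^ arrival S a i) z) (to_torus (X w i)) \<le> 10 * l * \<mu> ^ d) \<and>
   (\<forall>s\<in>S. dist ((g ^^ (arrival S a s + 2)) z) x0 \<le> l)" for w S z
 have ex: "\<exists>z. coded w S z" if "(w, S) \<in> I" for w S
 proof -
  have x: "w \<in> W" "w \<in> W" "S \<subseteq> Q w" using that by (auto simp: I_def)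
  have S: "finite S" "S \<subseteq> H w" "\<forall>s\<in>S. a < s \<and> s < e"
  proof -
   show "finite S" by (rule finite_subset[OF x(3) Q(2)[OF x(2)]])
   show "S \<subseteq> H w" by (rule subset_trans[OF x(3) Q(1)[OF x(2)]])
   show "\<forall>s\<in>S. a < s \<and> s < e"
   proof
    fix s assume "s \<in> S"
    then have "a < s \<and> s + 2 \<le> e \<and> 4 dvd s - a" using Q(3)[OF x(2)] x(3) by blast
    then show "a < s \<and> s < e" by simp
   qed
  qed
  obtain z where z: "\<And>i d. a \<le> i \<Longrightarrow> i \<le> e \<Longrightarrow> (\<forall>s\<in>insert a (insert e S). d + i \<le> s \<or> d + s \<le> i) \<Longrightarrow>
    dist ((g ^^ arrival S a i) z) (to_torus (X w i)) \<le> 10 * l * \<mu> ^ d"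
   "\<And>s. s \<in> S \<Longrightarrow> dist ((g ^^ (arrival S a s + 2)) z) (to_torus b) \<le> l"
   by (rule exists_orbit_with_detours[OF X[OF x(2)] H(1)[OF x(2)] S(1,2) H(2)[OF x(2)] H(3) S(3), of b]) (rule that, assumption+)
  then have "coded w S z" unfolding coded_def b[symmetric] by blast
  then show ?thesis by blast
 qed
 define z where "z x = (SOME z. coded (fst x) (snd x) z)" for x
 have cz: "coded w S (z (w, S))" if "(w, S) \<in> I" for w S
  unfolding z_def fst_conv snd_conv by (rule someI_ex[OF ex[OF that]])
 have tr: "dist ((g ^^ arrival S a i) (z (w, S))) (to_torus (X w i)) \<le> 10 * l * \<mu> ^ d"
  if "(w, S) \<in> I" "a \<le> i" "i \<le> e" "\<forall>s\<in>insert a (insert e S). d + i \<le> s \<or> d + s \<le> i" for w S i d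
  using cz[OF that(1), unfolded coded_def, THEN conjunct1, rule_format, of i d] that(2-) by simp
 have de: "dist ((g ^^ (arrival S a s + 2)) (z (w, S))) x0 \<le> l" if "(w, S) \<in> I" "s \<in> S" for w S s
  using cz[OF that(1), unfolded coded_def, THEN conjunct2] that(2) by (rule bspec)
 have tr0: "dist ((g ^^ arrival S a i) (z (w, S))) (to_torus (X w i)) \<le> 10 * l"
  if "(w, S) \<in> I" "a \<le> i" "i \<le> e" for w S i
 proof -
  have "\<forall>s\<in>insert a (insert e S). 0 + i \<le> s \<or> 0 + s \<le> i" by (simp add: linear)
  from tr[OF that this] show ?thesis by simp
 qed
 have main: "(w, S) = (w', S')" if I1: "(w, S) \<in> I" "(w', S') \<in> I"
  and cl: "\<And>t. t < e - a + 4 * c + 1 \<Longrightarrow> dist ((g ^^ t) (z (w, S))) ((g ^^ t) (z (w', S'))) \<le> l * \<mu> ^ R" for w S w' S'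
 proof -
  have S: "w \<in> W" "S \<subseteq> Q w" "card S = c" "w' \<in> W" "S' \<subseteq> Q w'" "card S' = c" using I1 by (auto simp: I_def)
  have fS: "finite S" "finite S'" using S Q(2) finite_subset by blast+
  have S4: "\<forall>s\<in>S. a < s \<and> s + 2 \<le> e \<and> 4 dvd s - a" "\<forall>s\<in>S'. a < s \<and> s + 2 \<le> e \<and> 4 dvd s - a"
   using S Q(3)[OF S(1)] Q(3)[OF S(4)] by blast+
  have "l * \<mu> ^ R \<le> l * 1" using l mu by (intro mult_left_mono power_le_one) auto
  then have cl': "dist ((g ^^ t) (z (w, S))) ((g ^^ t) (z (w', S'))) \<le> l" "dist ((g ^^ t) (z (w', S'))) ((g ^^ t) (z (w, S))) \<le> l"
   if "t < e - a + 4 * c + 1" for t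
   using cl[OF that] by (simp_all add: dist_commute)
  have SS: "S = S'"
  proof (rule ccontr)
   assume "S \<noteq> S'"
   define s where "s = (LEAST s. (s \<in> S) \<noteq> (s \<in> S'))"
   have "\<exists>s. (s \<in> S) \<noteq> (s \<in> S')" using \<open>S \<noteq> S'\<close> by blast
   then have s: "(s \<in> S) \<noteq> (s \<in> S')" unfolding s_def by (rule LeastI_ex)
   have less: "s' \<in> S \<longleftrightarrow> s' \<in> S'" if "s' < s" for s' using not_less_Least that unfolding s_def by blast
   show False
   proof (cases "s \<in> S")
    case True
    have "s \<in> S'"
    proof (rule cut_determined[where S = S and S' = S' and z = "z (w, S)" and z' = "z (w', S')" and X' = "X w'" and ?x0.0 = x0, OF fS(1) S4(1) S4(2)])
     show "dist ((g ^^ arrival S' a i) (z (w', S'))) (to_torus (X w' i)) \<le> 10 * l" if "a \<le> i" "i \<le> e" for i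
      by (rule tr0[OF I1(2) that])
     show "dist ((g ^^ (arrival S a s + 2)) (z (w, S))) x0 \<le> l" if "s \<in> S" for s
      by (rule de[OF I1(1) that])
     show "12 * l < dist x0 (to_torus (X w' i))" if "i \<le> e" for i by (rule av[OF S(4) that])
     show "dist ((g ^^ t) (z (w, S))) ((g ^^ t) (z (w', S'))) \<le> l" if "t < e - a + 4 * card S + 1" for t
      by (rule cl'(1)) (use that in \<open>simp only: S(3)\<close>)
     show "s \<in> S" by (rule True)
     show "s' \<in> S \<longleftrightarrow> s' \<in> S'" if "s' < s" for s' using less[OF that] by (rule asm_rl)
    qed
    then show False using s True by simp
   next
    case False
    then have True: "s \<in> S'" using s by simp
    have "s \<in> S"
    proof (rule cut_determined[where S = S' and S' = S and z = "z (w', S')" and z' = "z (w, S)" and X' = "X w" and ?x0.0 = x0, OF fS(2) S4(2) S4(1)])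
     show "dist ((g ^^ arrival S a i) (z (w, S))) (to_torus (X w i)) \<le> 10 * l" if "a \<le> i" "i \<le> e" for i
      by (rule tr0[OF I1(1) that])
     show "dist ((g ^^ (arrival S' a s + 2)) (z (w', S'))) x0 \<le> l" if "s \<in> S'" for s
      by (rule de[OF I1(2) that])
     show "12 * l < dist x0 (to_torus (X w i))" if "i \<le> e" for i by (rule av[OF S(1) that])
     show "dist ((g ^^ t) (z (w', S'))) ((g ^^ t) (z (w, S))) \<le> l" if "t < e - a + 4 * card S' + 1" for t
      by (rule cl'(2)) (use that in \<open>simp only: S(6)\<close>)
     show "s \<in> S'" by (rule True)
     show "s' \<in> S' \<longleftrightarrow> s' \<in> S" if "s' < s" for s' using less[OF that] by (rule sym)
    qed
    then show False using False by simp
   qed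
  qed
  have "w = w'"
  proof (rule ccontr)
   assume "w \<noteq> w'"
   then obtain i where i: "a + 2 * R < i" "i + 2 * R < e" "d3 \<le> dist (to_torus (X w' i)) (to_torus (X w i))"
    using sep S by blast
   have orb: "to_torus (X w' i) = (g ^^ i) (to_torus (X w' 0))" for i
   proof -
    have XS: "X w' (Suc i) = G (X w' i)" for i
     using X[OF S(4), unfolded hyperbolic_times_def] by (rule conjunct1[THEN spec])
    have "X w' i = (G ^^ i) (X w' 0)" by (induction i) (simp_all add: XS)
    then show ?thesis by (simp add: to_torus_funpow)
   qed
   have sp: "s + 2 \<le> s'" if "s \<in> S" "s' \<in> S" "s < s'" for s s'
   proof -
    have "a < s" "4 dvd s - a" "4 dvd s' - a" using S4(1) that by auto
    then show ?thesis using that(3) by presburger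
   qed
   have a2: "a + 2 \<le> s" if "s \<in> S" for s
   proof -
    have "a < s" "4 dvd s - a" using S4(1) that by auto
    then show ?thesis by presburger
   qed
   have "dist ((g ^^ i) (to_torus (X w' 0))) (to_torus (X w i)) < d3"
   proof (rule dec[unfolded decoding_margin_def, THEN spec[of _ "X w"], THEN spec[of _ "H w"], THEN spec[of _ a], THEN spec[of _ e],
      THEN spec[of _ S], THEN spec[of _ "to_torus (X w' 0)"], THEN spec[of _ i], THEN mp, THEN mp, THEN mp, THEN mp, THEN mp,
      THEN mp, THEN mp, THEN mp, THEN mp, THEN mp])
    show "hyperbolic_times (X w) (H w)" by (rule X[OF S(1)])
    show "a \<in> H w" by (rule H(1)[OF S(1)])
    show "e \<in> H w" by (rule H(2)[OF S(1)])
    show "finite S" by (rule fS(1))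
    show "a + 2 * R < i" "i + 2 * R < e" by (rule i)+
    show "S \<subseteq> H w" using S(2) Q(1)[OF S(1)] by blast
    show "\<forall>s\<in>S. a + 2 \<le> s \<and> s + 2 \<le> e" using S4(1) a2 by blast
    show "\<forall>s\<in>S. \<forall>s'\<in>S. s < s' \<longrightarrow> s + 2 \<le> s'" using sp by blast
    show "\<forall>i d. a \<le> i \<longrightarrow> i \<le> e \<longrightarrow> d \<le> R \<longrightarrow> (\<forall>s\<in>insert a (insert e S). d + i \<le> s \<or> d + s \<le> i) \<longrightarrow>
      dist ((g ^^ i) (to_torus (X w' 0))) (to_torus (X w i)) \<le> 21 * l * \<mu> ^ d"
    proof (intro allI impI)
    fix i d assume id: "a \<le> i" "i \<le> e" "d \<le> R" "\<forall>s\<in>insert a (insert e S). d + i \<le> s \<or> d + s \<le> i"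
    have 1: "dist ((g ^^ arrival S a i) (z (w, S))) (to_torus (X w i)) \<le> 10 * l * \<mu> ^ d"
     by (rule tr[OF I1(1) id(1,2,4)])
    have 2: "dist ((g ^^ arrival S a i) (z (w', S'))) (to_torus (X w' i)) \<le> 10 * l * \<mu> ^ d"
     using tr[OF I1(2) id(1,2)] id(4) unfolding SS by blast
    have "arrival S a i < e - a + 4 * c + 1" using arrival_le[OF id(2) fS(1), of a] S(3) by simp
    then have "dist ((g ^^ arrival S a i) (z (w, S))) ((g ^^ arrival S a i) (z (w', S'))) \<le> l * \<mu> ^ R" by (rule cl)
    also have "\<dots> \<le> l * \<mu> ^ d" using l mu id(3) by (intro mult_left_mono power_decreasing) auto
    finally have 3: "dist ((g ^^ arrival S a i) (z (w, S))) ((g ^^ arrival S a i) (z (w', S'))) \<le> l * \<mu> ^ d" .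
    \<comment> \<open>Two tracking errors of \<open>10 * l * \<mu> ^ d\<close> and the distance of
      the detoured orbits add up to the factor 21.\<close>
    show "dist ((g ^^ i) (to_torus (X w' 0))) (to_torus (X w i)) \<le> 21 * l * \<mu> ^ d"
     unfolding orb[symmetric]
     using 1 2 3 dist_triangle3[of "to_torus (X w' i)" "to_torus (X w i)" "(g ^^ arrival S a i) (z (w', S'))"]
      dist_triangle3[of "(g ^^ arrival S a i) (z (w', S'))" "to_torus (X w i)" "(g ^^ arrival S a i) (z (w, S))"]
     by linarith
    qed
   qed
   then have "dist (to_torus (X w' i)) (to_torus (X w i)) < d3" unfolding orb[symmetric] .
   then show False using i(3) by linarith
  qed
  then show ?thesis using SS by simp
 qed
 have inj: "inj_on z I"
 proof (rule inj_onI)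
  fix x y assume "x \<in> I" "y \<in> I" "z x = z y"
  then show "x = y"
  proof -
   have "0 \<le> l * \<mu> ^ R" using l \<mu>0 by simp
   then have "(fst x, snd x) = (fst y, snd y)" using \<open>x \<in> I\<close> \<open>y \<in> I\<close> \<open>z x = z y\<close> by (intro main) simp_all
   then show ?thesis by simp
  qed
 qed
 have "bowen_separated g (e - a + 4 * c + 1) (l * \<mu> ^ R) (z ` I)"
  unfolding bowen_separated_def
 proof (intro ballI impI)
  fix p q assume "p \<in> z ` I" "q \<in> z ` I" "p \<noteq> q"
  then obtain x y where xy: "x \<in> I" "y \<in> I" "p = z x" "q = z y" "x \<noteq> y" by blast
  show "\<exists>i<e - a + 4 * c + 1. l * \<mu> ^ R < dist ((g ^^ i) p) ((g ^^ i) q)"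
  proof (rule ccontr)
   assume "\<not> ?thesis"
   then have "dist ((g ^^ t) (z x)) ((g ^^ t) (z y)) \<le> l * \<mu> ^ R" if "t < e - a + 4 * c + 1" for t
    using that xy(3,4) by (meson not_le)
   then have "(fst x, snd x) = (fst y, snd y)" using xy(1,2) by (intro main) simp_all
   then show False using xy(5) by simp
  qed
 qed
 then have "real (card (z ` I)) \<le> B" using finI by (intro B) auto
 then show ?thesis unfolding card_image[OF inj] cI by simp
qed

text \<open>If the ball is null, almost all orbits avoid it. Detours through its centre at
  \<open>c\<close> of the hyperbolic times multiply the number of orbits by a binomial coefficient
  of at least \<open>exp (c * (4 * h + 5))\<close>, while they lengthen the orbits by
  \<open>4 * c\<close> steps, worth about \<open>exp (4 * c * h)\<close>. So the undetoured orbits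
  are fewer than the entropy requires by a factor of about \<open>exp (4 * c)\<close>.\<close>

lemma cball_not_null:
 fixes x0 :: torus
 assumes mme: "maximal_entropy_measure g \<mu>'" and k400: "exp 400 \<le> k" and \<tau>8: "\<tau> = exp 80000"
  and \<tau>l: "10000000 * \<tau>\<^sup>2 * l \<le> 1"
 shows "measure \<mu>' (cball x0 (12 * l)) \<noteq> 0"
proof
 assume null: "measure \<mu>' (cball x0 (12 * l)) = 0"
 have \<mu>0: "\<mu> > 0" using mu by simp
 obtain h where h: "topological_entropy g = ereal h" "ln k \<le> h" by (rule topological_entropy_real)
 have "ln (exp 400) \<le> ln k" using k400 k by (subst ln_le_cancel_iff) auto
 then have h0: "h \<ge> 400" using h(2) by simp
 \<comment> \<open>With \<open>c\<close> about \<open>q * n\<close> and about \<open>n / 5\<close>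
   hyperbolic times to choose from, there are at least \<open>exp (4 * h + 5)\<close> times as many
   candidates as detours; one more factor \<open>exp 1\<close> allows for rounding.\<close>
 define q where "q = exp (- (4 * h + 6)) / 5"
 have q0: "q > 0" "q \<le> 1 / 5" using h0 by (auto simp: q_def)
 \<comment> \<open>Since \<open>n \<ge> T / 2\<close>, the gain \<open>4 * c\<close> is at least
   \<open>8 * \<kappa> * T\<close> up to a constant, against errors of
   \<open>\<kappa> * T\<close>.\<close>
 define \<kappa> where "\<kappa> = q / 4"
 have \<kappa>: "\<kappa> > 0" "\<kappa> \<le> 1 / 20" using q0 by (auto simp: \<kappa>_def)
 define h' where "h' = h + \<kappa>"
 have inv: "invariant_prob g \<mu>'" using mme by (simp add: maximal_entropy_measure_def)
 interpret prob_space \<mu>' using inv by (simp add: invariant_prob_def)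
 have sets: "sets \<mu>' = sets borel" using inv by (simp add: invariant_prob_def)
 then have sp: "space \<mu>' = UNIV" using sets_eq_imp_space_eq[of \<mu>' borel] by simp
 obtain \<delta> where \<delta>: "\<delta> > 0" and freq: "\<exists>\<^sub>F T in sequentially. \<forall>Y \<A>. Y \<in> sets \<mu>' \<longrightarrow> 1 / 2 \<le> measure \<mu>' Y \<longrightarrow>
   finite \<A> \<longrightarrow> Y \<subseteq> \<Union>\<A> \<longrightarrow> (\<forall>A\<in>\<A>. bowen_small g T \<delta> A) \<longrightarrow> exp (T * (h - \<kappa>)) \<le> card \<A>"
  using maximal_entropy_cover_lower_bound[OF mme h(1) \<kappa>(1), of "1 / 2"] by auto
 have \<delta>3: "\<delta> / 3 > 0" using \<delta> by simp
 obtain C where C: "C \<ge> 1" and cov: "\<And>T. \<exists>\<A>. finite \<A> \<and> \<Union>\<A> = UNIV \<and> (\<forall>A\<in>\<A>. bowen_small g T (\<delta> / 3) A) \<and>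
   real (card \<A>) \<le> C * exp (T * h')"
  using exists_entropy_cover[OF h(1) \<kappa>(1) \<delta>3] unfolding h'_def by blast
 obtain R where dec: "decoding_margin (\<delta> / 3) R"
  by (rule exists_decoding_margin[OF \<tau>l \<delta>3])
 have "l * \<mu> ^ R > 0" using l \<mu>0 by simp
 from eventually_card_separated_le[OF h(1) \<kappa>(1) this] obtain T1 where T1: "\<And>T E. T \<ge> T1 \<Longrightarrow> finite E \<Longrightarrow>
   bowen_separated g T (l * \<mu> ^ R) E \<Longrightarrow> card E \<le> exp (T * h')"
  unfolding eventually_sequentially h'_def by blast
 \<comment> \<open>Orbits are recovered only at times further than \<open>2 * R\<close> from both
   ends; the margins are left to the entropy cover.\<close>
 define R' where "R' = 2 * R + 1"
 define c1 where "c1 = (2 * real R' + 1) * h' + 4"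
 define C2 where "C2 = C\<^sup>2 * exp c1"
 \<comment> \<open>The last bound on \<open>T\<close> makes the gain
   \<open>exp (6 * \<kappa> * T) > (2 * \<kappa> * T) ^ 3\<close> exceed \<open>C2\<close> times the
   square of \<open>T\<close>, the latter bounding the number of pairs
   \<open>(a, e)\<close>.\<close>
 obtain T where T: "T > 10000 + 2 * T1 + 8 * R' + nat \<lceil>C2 / (8 * \<kappa> ^ 3)\<rceil>" and low: "\<forall>Y \<A>. Y \<in> sets \<mu>' \<longrightarrow> 1 / 2 \<le> measure \<mu>' Y \<longrightarrow>
   finite \<A> \<longrightarrow> Y \<subseteq> \<Union>\<A> \<longrightarrow> (\<forall>A\<in>\<A>. bowen_small g T \<delta> A) \<longrightarrow> exp (T * (h - \<kappa>)) \<le> card \<A>"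
  using frequently_eventually_frequently[OF freq eventually_gt_at_top[of "10000 + 2 * T1 + 8 * R' + nat \<lceil>C2 / (8 * \<kappa> ^ 3)\<rceil>"]]
  by (auto dest: frequently_ex)
 have TC: "C2 / (8 * \<kappa> ^ 3) \<le> T" using T by linarith
 define V where "V = (\<Union>i\<in>{..T}. (g ^^ i) -` cball x0 (12 * l))"
 define Y where "Y = expanding ((L * exp (- 400)) ^ T) T - V"
 have ballb: "cball x0 (12 * l) \<in> sets borel" by simp
 have "(g ^^ i) -` cball x0 (12 * l) \<in> null_sets \<mu>'" for i
  using invariant_prob_measure_vimage[OF inv ballb, of i] null by (intro null_setsI) (auto simp: emeasure_eq_measure sets)
 then have Vn: "V \<in> null_sets \<mu>'" unfolding V_def by (intro null_sets_UN') auto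
 have ex: "expanding ((L * exp (- 400)) ^ T) T \<in> events" using closed_expanding by (simp add: sets borel_closed)
 have Ys: "Y \<in> sets \<mu>'" unfolding Y_def using ex Vn by auto
 have Ym: "1 / 2 \<le> measure \<mu>' Y"
  using measure_expanding_ge[OF mme k400, of T] T unfolding Y_def
  by (subst measure_Diff_null_set[OF ex Vn]) auto
 define m where "m a e = nat \<lfloor>real (e - a) / 5\<rfloor>" for a e :: nat
 define \<Phi> where "\<Phi> a e x t \<longleftrightarrow> to_torus (fst t) = x \<and> hyperbolic_times (\<lambda>i. (G ^^ i) (fst t)) (fst (snd t)) \<and>
   a \<in> fst (snd t) \<and> e \<in> fst (snd t) \<and> snd (snd t) \<subseteq> fst (snd t) \<and> finite (snd (snd t)) \<and>
   (\<forall>s\<in>snd (snd t). a < s \<and> s + 2 \<le> e \<and> 4 dvd s - a) \<and> card (snd (snd t)) = m a e"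
  for a e :: nat and x :: torus and t :: "(real \<times> real) \<times> nat set \<times> nat set"
 \<comment> \<open>The first and last hyperbolic times depend on the point. Fixing them divides
   \<open>Y\<close> into boundedly many classes in terms of \<open>T\<close>, each with a common
   time frame.\<close>
 define J where "J = {(a, e). e < T \<and> real a + T / 2 \<le> e}"
 define W where "W = (\<lambda>(a, e). {x \<in> Y. \<exists>t. \<Phi> a e x t})"
 have J: "J \<subseteq> {..<T} \<times> {..<T}" by (auto simp: J_def)
 have finJ: "finite J" by (rule finite_subset[OF J]) simp
 have YW: "Y \<subseteq> (\<Union>j\<in>J. W j)"
 proof
  fix x assume x: "x \<in> Y"
  then obtain p \<xi> where p: "to_torus p = x" "norm \<xi> = 1" "(L * exp (- 400)) ^ T \<le> norm (Dn T p \<xi>)"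
   unfolding Y_def expanding_def by blast
  have \<theta>: "(0::real) < 80000" by simp
  \<comment> \<open>With a loss of 400 per step and the threshold 80000, the density of bad times is
    \<open>2 * 400 / 80000 = 1 / 100\<close>; this is the origin of the exponent in
    \<open>\<tau>\<close>.\<close>
  obtain H where H: "H \<subseteq> {0<..<T}" "hyperbolic_times (\<lambda>i. (G ^^ i) p) H" "card ({..T} - H) \<le> 2 * 400 * real T / 80000 + 2"
   by (rule exists_hyperbolic_times[OF \<theta> \<tau>8 p(2,3)])
  have bad: "real (card ({..T} - H)) \<le> T / 100 + 2" using H(3) by simp
  have T4: "T \<ge> 10000" using T by simp
  obtain a e Q where Q: "a \<in> H" "e \<in> H" "e < T" "real a + T / 2 \<le> e" "Q \<subseteq> H" "finite Q"
   "\<forall>s\<in>Q. a < s \<and> s + 2 \<le> e \<and> 4 dvd s - a" "card Q = nat \<lfloor>real (e - a) / 5\<rfloor>"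
   by (rule exists_spread_times[OF H(1) bad T4])
  have "\<Phi> a e x (p, H, Q)" unfolding \<Phi>_def m_def using Q p(1) H(2) by simp
  then have "x \<in> W (a, e)" using x unfolding W_def prod.case by blast
  moreover have "(a, e) \<in> J" using Q by (simp add: J_def)
  ultimately show "x \<in> (\<Union>j\<in>J. W j)" by blast
 qed
 have cover: "\<exists>\<B>. finite \<B> \<and> W j \<subseteq> \<Union>\<B> \<and> (\<forall>B\<in>\<B>. bowen_small g T \<delta> B) \<and> real (card \<B>) \<le> C2 * exp (T * (h - 7 * \<kappa>))"
  if j: "j \<in> J" for j
 proof -
  obtain a e where ae: "j = (a, e)" "e < T" "real a + T / 2 \<le> e" using j by (auto simp: J_def)
  define n where "n = e - a"
  have n: "real n = real e - real a" "real n \<ge> T / 2" using ae by (auto simp: n_def of_nat_diff)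
  have aen: "e = a + n" "a < e" using n T ae by (auto simp: n_def)
  have nR: "2 * R' \<le> n" using n(2) T by linarith
  define c where "c = nat \<lfloor>q * n\<rfloor>"
  have c: "real c \<le> q * n" "real c \<ge> q * n - 1" using q0 by (auto simp: c_def)
  have mm: "real (m a e) \<ge> real n / 5 - 1" "real (m a e) \<le> real n / 5" unfolding m_def n_def by linarith+
  have "q * n \<le> 1 / 5 * n" using q0 by (intro mult_right_mono) auto
  then have cm: "c \<le> m a e" unfolding c_def m_def n_def[symmetric] by (intro nat_mono floor_mono) simp
  have ch: "exp (c * (4 * h + 5)) \<le> real (m a e choose c)"
  proof (cases "c = 0")
   case False
   have "real c * exp (4 * h + 5) \<le> q * n * exp (4 * h + 5)" using c(1) by (intro mult_right_mono) auto
   also have "\<dots> = n / 5 * exp (- 1)" by (simp add: q_def exp_add[symmetric])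
   also have "\<dots> \<le> n / 5 * (1 / 2)"
    using exp_ge_add_one_self[of 1] by (intro mult_left_mono) (auto simp: exp_minus field_simps)
   also have "\<dots> \<le> real (m a e)" using mm(1) n(2) T by linarith
   finally have "exp (4 * h + 5) \<le> real (m a e) / real c" using False by (simp add: field_simps)
   then have "exp (4 * h + 5) ^ c \<le> (real (m a e) / real c) ^ c" by (intro power_mono) auto
   also have "\<dots> \<le> real (m a e choose c)" by (rule binomial_ge_n_over_k_pow_k[OF cm])
   finally show ?thesis by (simp add: exp_of_nat_mult[symmetric])
  qed simp
  define t where "t x = (SOME t. \<Phi> a e x t)" for x
  have t: "\<Phi> a e x (t x)" if "x \<in> W j" for x
  proof -
   have "\<exists>t. \<Phi> a e x t" using that unfolding W_def ae(1) by simp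
   then show ?thesis unfolding t_def by (rule someI_ex)
  qed
  define X where "X x i = (G ^^ i) (fst (t x))" for x i
  have Xt: "to_torus (X x i) = (g ^^ i) x" if "x \<in> W j" for x i
   using t[OF that] unfolding X_def to_torus_funpow \<Phi>_def by simp
  define B where "B = exp ((n + 4 * c + 1) * h')"
  define K where "K = B / real (m a e choose c)"
  have mc0: "real (m a e choose c) > 0" using cm by simp
  have cov1: "\<exists>\<B>. finite \<B> \<and> W j \<subseteq> \<Union>\<B> \<and> (\<forall>B\<in>\<B>. bowen_small g ((a + R') + (n - 2 * R') + (T - (e - R'))) \<delta> B) \<and>
    real (card \<B>) \<le> (C * exp ((a + R') * h')) * K * (C * exp ((T - (e - R')) * h'))"
  proof (rule exists_cover_of_separated_bound[OF cov \<delta> C])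
   fix E' assume E': "finite E'" "E' \<subseteq> W j"
    "\<forall>x\<in>E'. \<forall>y\<in>E'. x \<noteq> y \<longrightarrow> (\<exists>i<n - 2 * R'. \<delta> / 3 < dist ((g ^^ (a + R' + i)) x) ((g ^^ (a + R' + i)) y))"
   have "real (card E') * real (m a e choose c) \<le> B"
   proof (rule card_orbits_with_detours_le[where X = X and H = "\<lambda>x. fst (snd (t x))" and Q = "\<lambda>x. snd (snd (t x))"
      and ?x0.0 = x0 and ?d3.0 = "\<delta> / 3" and R = R and a = a and e = e and c = c and m = "m a e", OF E'(1)])
    fix w assume "w \<in> E'"
    then have w: "w \<in> W j" using E'(2) by blast
    note tw = t[OF w, unfolded \<Phi>_def]
    show "hyperbolic_times (X w) (fst (snd (t w)))" unfolding X_def using tw by blast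
    show "a \<in> fst (snd (t w))" "e \<in> fst (snd (t w))" using tw by blast+
    show "snd (snd (t w)) \<subseteq> fst (snd (t w))" "finite (snd (snd (t w)))"
     "\<forall>s\<in>snd (snd (t w)). a < s \<and> s + 2 \<le> e \<and> 4 dvd s - a" "card (snd (snd (t w))) = m a e" using tw by blast+
    show "12 * l < dist x0 (to_torus (X w i))" if "i \<le> e" for i
    proof -
     have "w \<in> Y" using w unfolding W_def ae(1) by simp
     then have "w \<notin> (g ^^ i) -` cball x0 (12 * l)" using that ae(2) unfolding Y_def V_def by auto
     then show ?thesis unfolding Xt[OF w] by simp
    qed
   next
    show "a < e" by (rule aen)
   next
    show "decoding_margin (\<delta> / 3) R" by (rule dec)
   next
    fix w w' assume ww: "w \<in> E'" "w' \<in> E'" "w \<noteq> w'"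
    then obtain i where i: "i < n - 2 * R'" "\<delta> / 3 < dist ((g ^^ (a + R' + i)) w) ((g ^^ (a + R' + i)) w')"
     using E'(3) by blast
    have "w \<in> W j" "w' \<in> W j" using ww E'(2) by auto
    then have "\<delta> / 3 \<le> dist (to_torus (X w' (a + R' + i))) (to_torus (X w (a + R' + i)))"
     using i(2) Xt by (simp add: dist_commute)
    moreover have "a + 2 * R < a + R' + i" "a + R' + i + 2 * R < e" using i(1) nR aen by (auto simp: R'_def)
    ultimately show "\<exists>i. a + 2 * R < i \<and> i + 2 * R < e \<and> \<delta> / 3 \<le> dist (to_torus (X w' i)) (to_torus (X w i))" by blast
   next
    fix Z assume Z: "finite Z" "bowen_separated g (e - a + 4 * c + 1) (l * \<mu> ^ R) Z"
    have "T1 \<le> e - a + 4 * c + 1" using n(2) T unfolding n_def by linarith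
    from T1[OF this Z] show "real (card Z) \<le> B" unfolding B_def n_def by simp
   qed
   then show "real (card E') \<le> K" unfolding K_def using mc0 by (simp add: pos_le_divide_eq)
  qed
  have eqT: "(a + R') + (n - 2 * R') + (T - (e - R')) = T" using nR ae aen by auto
  have leC: "(C * exp ((a + R') * h')) * K * (C * exp ((T - (e - R')) * h')) \<le> C2 * exp (T * (h - 7 * \<kappa>))"
  proof -
   have h'0: "h' > 0" using h0 \<kappa> by (simp add: h'_def)
   have eR: "real (T - (e - R')) = real T - real e + real R'" using nR ae aen by (simp add: of_nat_diff)
   have "K \<le> B / exp (c * (4 * h + 5))" unfolding K_def using ch mc0 by (intro divide_left_mono) (auto simp: B_def)
   also have "\<dots> = exp ((real n + 4 * c + 1) * h' - c * (4 * h + 5))" unfolding B_def by (simp add: exp_diff)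
   finally have "(C * exp ((a + R') * h')) * K * (C * exp ((T - (e - R')) * h')) \<le>
     (C * exp ((a + R') * h')) * exp ((real n + 4 * c + 1) * h' - c * (4 * h + 5)) * (C * exp ((T - (e - R')) * h'))"
    using C by (intro mult_right_mono mult_left_mono) auto
   also have "\<dots> = C\<^sup>2 * exp (((real a + R') * h') + ((real n + 4 * c + 1) * h' - c * (4 * h + 5)) + ((real T - real e + real R') * h'))"
    unfolding eR exp_add by (simp add: power2_eq_square)
   also have "\<dots> \<le> C\<^sup>2 * exp (c1 + T * (h - 7 * \<kappa>))"
   proof -
    have "((real a + R') * h') + ((real n + 4 * c + 1) * h' - c * (4 * h + 5)) + ((real T - real e + real R') * h')
      = (real T + 2 * real R' + 1) * h' + real c * (4 * \<kappa> - 5)"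
     unfolding n(1) h'_def by (simp add: algebra_simps)
    also have "real c * (4 * \<kappa> - 5) \<le> real c * (- 4)" using \<kappa> by (intro mult_left_mono) auto
    also have "real c * (- 4) \<le> - 2 * q * T + 4"
    proof -
     have "q * (T / 2) \<le> q * n" using n(2) q0 by (intro mult_left_mono) auto
     then show ?thesis using c(2) by simp
    qed
    also have "(real T + 2 * real R' + 1) * h' + (- 2 * q * T + 4) = c1 + T * (h - 7 * \<kappa>)"
     unfolding c1_def h'_def \<kappa>_def by (simp add: algebra_simps)
    finally show ?thesis using C by (intro mult_left_mono) auto
   qed
   also have "\<dots> = C2 * exp (T * (h - 7 * \<kappa>))" by (simp add: C2_def exp_add)
   finally show ?thesis .
  qed
  from cov1 obtain \<B> where B': "finite \<B>" "W j \<subseteq> \<Union>\<B>" "\<forall>B\<in>\<B>. bowen_small g T \<delta> B"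
   "real (card \<B>) \<le> (C * exp ((a + R') * h')) * K * (C * exp ((T - (e - R')) * h'))"
   unfolding eqT by blast
  show ?thesis using B'(1-3) order_trans[OF B'(4) leC] by blast
 qed
 define \<B> where "\<B> j = (SOME \<B>. finite \<B> \<and> W j \<subseteq> \<Union>\<B> \<and> (\<forall>B\<in>\<B>. bowen_small g T \<delta> B) \<and> real (card \<B>) \<le> C2 * exp (T * (h - 7 * \<kappa>)))" for j
 have \<B>: "finite (\<B> j) \<and> W j \<subseteq> \<Union>(\<B> j) \<and> (\<forall>B\<in>\<B> j. bowen_small g T \<delta> B) \<and> real (card (\<B> j)) \<le> C2 * exp (T * (h - 7 * \<kappa>))"
  if "j \<in> J" for j
  unfolding \<B>_def by (rule someI_ex[OF cover[OF that]])
 have "exp (T * (h - \<kappa>)) \<le> card (\<Union>j\<in>J. \<B> j)"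
 proof (rule low[rule_format, OF Ys Ym])
  show "finite (\<Union>j\<in>J. \<B> j)" using finJ \<B> by blast
  show "Y \<subseteq> \<Union>(\<Union>j\<in>J. \<B> j)"
  proof
   fix x assume "x \<in> Y"
   then obtain j where j: "j \<in> J" "x \<in> W j" using YW by blast
   then have "x \<in> \<Union>(\<B> j)" using \<B>[OF j(1)] by blast
   then show "x \<in> \<Union>(\<Union>j\<in>J. \<B> j)" using j(1) by blast
  qed
  show "bowen_small g T \<delta> A" if "A \<in> (\<Union>j\<in>J. \<B> j)" for A using that \<B> by blast
 qed
 also have "real (card (\<Union>j\<in>J. \<B> j)) \<le> (\<Sum>j\<in>J. real (card (\<B> j)))"
  using card_UN_le[OF finJ, of \<B>] by (simp only: of_nat_le_iff of_nat_sum[symmetric])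
 also have "\<dots> \<le> (\<Sum>j\<in>J. C2 * exp (T * (h - 7 * \<kappa>)))"
  using \<B> by (intro sum_mono) blast
 also have "\<dots> = real (card J) * (C2 * exp (T * (h - 7 * \<kappa>)))" by simp
 also have "\<dots> \<le> (real T)\<^sup>2 * (C2 * exp (T * (h - 7 * \<kappa>)))"
 proof (rule mult_right_mono)
  have "card J \<le> T * T" using card_mono[OF _ J] by (simp add: card_cartesian_product)
  then show "real (card J) \<le> (real T)\<^sup>2" by (simp add: power2_eq_square flip: of_nat_mult)
 qed (use C in \<open>simp add: C2_def\<close>)
 finally have "exp (6 * \<kappa> * T) * exp (T * (h - 7 * \<kappa>)) \<le> ((real T)\<^sup>2 * C2) * exp (T * (h - 7 * \<kappa>))"
  by (simp add: exp_add[symmetric] algebra_simps)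
 then have le: "exp (6 * \<kappa> * T) \<le> (real T)\<^sup>2 * C2" by simp
 have "2 * \<kappa> * T < exp (2 * \<kappa> * T)" using exp_ge_add_one_self[of "2 * \<kappa> * T"] by linarith
 then have "(2 * \<kappa> * T) ^ 3 < exp (2 * \<kappa> * T) ^ 3" using \<kappa> by (intro power_strict_mono) auto
 also have "exp (2 * \<kappa> * T) ^ 3 = exp (6 * \<kappa> * T)" by (simp add: exp_of_nat_mult[symmetric])
 finally have "(real T)\<^sup>2 * (8 * \<kappa> ^ 3 * T) < (real T)\<^sup>2 * C2"
  using le by (simp add: power_mult_distrib power2_eq_square power3_eq_cube mult_ac)
 then have "8 * \<kappa> ^ 3 * T < C2" by (simp add: mult_less_cancel_left)
 moreover have "C2 \<le> 8 * \<kappa> ^ 3 * T" using TC \<kappa>(1) by (simp add: pos_divide_le_eq mult.commute)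
 ultimately show False by linarith
qed

end

section \<open>Neighbourhoods of the standard map\<close>

lemma blinfun_apply_diff: "blinfun_apply (A - B) = (\<lambda>h. blinfun_apply A h - blinfun_apply B h)"
 by (rule ext) (rule blinfun.diff_left)

lemma int_lattice_valued_constant:
 fixes d :: "real \<times> real \<Rightarrow> real \<times> real"
 assumes cont: "continuous_on UNIV d" and lat: "\<And>p. d p \<in> int_lattice"
 obtains v where "\<And>p. d p = v"
proof -
 have c: "\<exists>c. \<forall>p. u p = c" if u: "continuous_on UNIV u" "\<And>p. u p \<in> \<int>" for u :: "real \<times> real \<Rightarrow> real"
 proof -
  have "u constant_on UNIV"
  proof (rule continuous_discrete_range_constant[OF connected_UNIV u(1)])
   fix p
   have "1 \<le> \<bar>u q - u p\<bar>" if "u q \<noteq> u p" for q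
    using u(2) that by (intro Ints_nonzero_abs_ge1 Ints_diff) auto
   then show "\<exists>e>0. \<forall>q. q \<in> UNIV \<and> u q \<noteq> u p \<longrightarrow> e \<le> norm (u q - u p)"
    by (intro exI[of _ 1]) auto
  qed
  then show ?thesis by (simp add: constant_on_def)
 qed
 have "fst (d p) \<in> \<int>" "snd (d p) \<in> \<int>" for p
  using lat[of p] by (simp_all add: int_lattice_def mem_Times_iff)
 then have "\<exists>c. \<forall>p. fst (d p) = c" and "\<exists>c. \<forall>p. snd (d p) = c"
  using c[OF continuous_on_fst[OF cont]] c[OF continuous_on_snd[OF cont]] by blast+
 then obtain a b where "\<And>p. fst (d p) = a" "\<And>p. snd (d p) = b" by blast
 then show thesis using that[of "(a, b)"] by (simp add: prod_eq_iff)
qed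

lemma C2_lift_unique:
 assumes f: "C2_lift f F F' F''" and h: "C2_lift f H H' H''"
 obtains v where "v \<in> int_lattice" "\<And>p. H p = F p + v" "H' = F'" "H'' = F''"
proof -
 have dF: "(F has_derivative blinfun_apply (F' p)) (at p)" "(F' has_derivative blinfun_apply (F'' p)) (at p)" for p
  using f unfolding C2_lift_def by blast+
 have dH: "(H has_derivative blinfun_apply (H' p)) (at p)" "(H' has_derivative blinfun_apply (H'' p)) (at p)" for p
  using h unfolding C2_lift_def by blast+
 have lat: "H p - F p \<in> int_lattice" for p
  using f h unfolding C2_lift_def by (metis to_torus_eq_iff)
 have cont: "continuous_on UNIV (\<lambda>p. H p - F p)"
  using dF(1) dH(1) by (intro continuous_on_diff) (auto intro!: continuous_at_imp_continuous_on has_derivative_continuous)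
 obtain v where v: "\<And>p. H p - F p = v"
  using int_lattice_valued_constant[OF cont lat] by metis
 have H: "H p = F p + v" for p using v[of p] by (metis add.commute diff_add_cancel)
 have "H' p = F' p" for p
 proof -
  have "(H has_derivative blinfun_apply (F' p)) (at p)"
   unfolding H[abs_def] using dF(1)[of p] by (auto intro!: derivative_eq_intros)
  then show ?thesis using dH(1)[of p] by (metis blinfun_apply_inject has_derivative_unique)
 qed
 then have H': "H' = F'" by blast
 have "H'' p = F'' p" for p
  using dH(2)[of p] dF(2)[of p] unfolding H' by (metis blinfun_apply_inject has_derivative_unique)
 then have "H'' = F''" by blast
 moreover have "v \<in> int_lattice" using lat[of 0] v by simp
 ultimately show thesis using that[of v] H H' by blast
qed

lemma C2_lift_shift:
 assumes "C2_lift f F F' F''" "v \<in> int_lattice"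
 shows "C2_lift f (\<lambda>p. F p - v) F' F''"
 using assms unfolding C2_lift_def
 by (auto simp: to_torus_diff_lattice intro!: derivative_eq_intros)

text \<open>The two balls may use different lifts of \<open>g\<close>. These differ by a constant
  lattice vector, by which the lift of \<open>h\<close> is translated before the triangle inequality
  is applied.\<close>

lemma C2_ball_trans:
 assumes g: "g \<in> C2_ball f r" and h: "h \<in> C2_ball g s"
 shows "h \<in> C2_ball f (r + s)"
proof -
 obtain F F' F'' G G' G'' where FG: "C2_lift f F F' F''" "C2_lift g G G' G''"
  "\<forall>p. norm (G p - F p) < r \<and> norm (G' p - F' p) < r \<and> norm (G'' p - F'' p) < r"
  using g unfolding C2_ball_def by auto
 obtain K K' K'' H H' H'' where KH: "C2_lift g K K' K''" "C2_lift h H H' H''" "h \<in> Diff2"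
  "\<forall>p. norm (H p - K p) < s \<and> norm (H' p - K' p) < s \<and> norm (H'' p - K'' p) < s"
  using h unfolding C2_ball_def by auto
 obtain v where v: "v \<in> int_lattice" "\<And>p. K p = G p + v" "K' = G'" "K'' = G''"
  by (rule C2_lift_unique[OF FG(2) KH(1)]) (rule that, assumption+)
 have tri: "norm (c - a) < r + s" if "norm (b - a) < r" "norm (c - b) < s" for a b c :: "'c::real_normed_vector"
  using norm_triangle_ineq[of "c - b" "b - a"] that by simp
 have "\<forall>p. norm ((H p - v) - F p) < r + s \<and> norm (H' p - F' p) < r + s \<and> norm (H'' p - F'' p) < r + s"
 proof
  fix p
  have le: "norm (G p - F p) < r" "norm (G' p - F' p) < r" "norm (G'' p - F'' p) < r"
   "norm (H' p - G' p) < s" "norm (H'' p - G'' p) < s"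
   using spec[OF FG(3), of p] spec[OF KH(4), of p] unfolding v(3,4) by blast+
  have "norm ((H p - v) - G p) < s" using spec[OF KH(4), of p] by (simp add: v(2) algebra_simps)
  then have "norm ((H p - v) - F p) < r + s" using le(1) by (rule tri[rotated])
  moreover have "norm (H' p - F' p) < r + s" using le(2) le(4) by (rule tri)
  moreover have "norm (H'' p - F'' p) < r + s" using le(3) le(5) by (rule tri)
  ultimately show "norm ((H p - v) - F p) < r + s \<and> norm (H' p - F' p) < r + s \<and> norm (H'' p - F'' p) < r + s" by blast
 qed
 then show ?thesis
  using FG(1) C2_lift_shift[OF KH(2) v(1)] KH(3) unfolding C2_ball_def by blast
qed

text \<open>The pointwise strict bounds in a ball are not visibly uniform, so openness is proved for
  the union of the balls of smaller radii, where \<open>C2_ball_trans\<close> leaves room.\<close>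

lemma C2_neighbourhood:
 fixes r :: real
 assumes "f \<in> Diff2" "r > 0"
 shows "openin C2_topology (\<Union>r'\<in>{0<..<r}. C2_ball f r')" "f \<in> (\<Union>r'\<in>{0<..<r}. C2_ball f r')"
proof -
 show "openin C2_topology (\<Union>r'\<in>{0<..<r}. C2_ball f r')"
  unfolding openin_C2_topology
 proof (intro conjI ballI)
  show "(\<Union>r'\<in>{0<..<r}. C2_ball f r') \<subseteq> Diff2" by (auto simp: C2_ball_def)
  fix g assume "g \<in> (\<Union>r'\<in>{0<..<r}. C2_ball f r')"
  then obtain r' where r': "0 < r'" "r' < r" "g \<in> C2_ball f r'" by auto
  have "C2_ball g ((r - r') / 2) \<subseteq> C2_ball f (r' + (r - r') / 2)"
   using C2_ball_trans[OF r'(3)] by blast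
  moreover have "r' + (r - r') / 2 \<in> {0<..<r}" using r' by (simp add: field_simps)
  ultimately show "\<exists>s>0. C2_ball g s \<subseteq> (\<Union>r'\<in>{0<..<r}. C2_ball f r')"
   using r' by (intro exI[of _ "(r - r') / 2"]) auto
 qed
 obtain F F' F'' where F: "C2_lift f F F' F''" using assms(1) unfolding Diff2_def C2_map_def by blast
 have "f \<in> C2_ball f (r / 2)"
  unfolding C2_ball_def using assms F by (auto intro!: exI[of _ F] exI[of _ F'] exI[of _ F''])
 then show "f \<in> (\<Union>r'\<in>{0<..<r}. C2_ball f r')" using assms(2) by (intro UN_I[of "r / 2"]) auto
qed

text \<open>The lift of the standard map supplied by the ball differs from
  \<open>standard_lift k\<close> by a constant lattice vector, which is subtracted from
  \<open>G\<close>. The bound on second derivatives becomes the Lipschitz bound on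
  \<open>E'\<close>.\<close>

lemma near_standard_C2_ball:
 assumes g: "g \<in> C2_ball (standard_map k) r" and k: "k \<ge> 1000" and r: "0 \<le> r" "r \<le> 1 / k ^ 4"
 obtains G E E' where "near_standard k r g G E E'"
proof -
 obtain F F' F'' G G' G'' where FG: "C2_lift (standard_map k) F F' F''" "C2_lift g G G' G''"
  and le: "\<And>p. norm (G p - F p) < r" "\<And>p. norm (G' p - F' p) < r" "\<And>p. norm (G'' p - F'' p) < r" and gD: "g \<in> Diff2"
  using g unfolding C2_ball_def by auto
 have dF: "(F has_derivative blinfun_apply (F' p)) (at p)" "(F' has_derivative blinfun_apply (F'' p)) (at p)" for p
  using FG(1) unfolding C2_lift_def by blast+
 have dG: "(G has_derivative blinfun_apply (G' p)) (at p)" "(G' has_derivative blinfun_apply (G'' p)) (at p)" for p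
  using FG(2) unfolding C2_lift_def by blast+
 have lat: "F p - standard_lift k p \<in> int_lattice" for p
  using FG(1) unfolding C2_lift_def by (metis to_torus_eq_iff standard_map_to_torus)
 have "continuous_on UNIV F"
  using dF(1) by (auto intro!: continuous_at_imp_continuous_on has_derivative_continuous)
 then have cont: "continuous_on UNIV (\<lambda>p. F p - standard_lift k p)"
  unfolding standard_lift_def case_prod_unfold by (intro continuous_intros)
 obtain v where v: "\<And>p. F p - standard_lift k p = v"
  using int_lattice_valued_constant[OF cont lat] by metis
 have vl: "v \<in> int_lattice" using lat[of 0] v by simp
 have "near_standard k r g (\<lambda>p. G p - v) (\<lambda>p. G p - F p) (\<lambda>p. G' p - F' p)"
 proof
  show "bij g" using gD by (simp add: Diff2_def)
  show "to_torus (G p - v) = g (to_torus p)" for p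
   
  proof -
   have "to_torus (G p) = g (to_torus p)" using FG(2) unfolding C2_lift_def by blast
   then show ?thesis by (simp only: to_torus_diff_lattice[OF vl])
  qed
  show "G p - v = standard_lift k p + (G p - F p)" for p using v[of p] by (simp add: algebra_simps)
  show "norm (G p - F p) \<le> r" "norm (G' p - F' p) \<le> r" for p using le(1)[of p] le(2)[of p] by linarith+
  show "((\<lambda>p. G p - F p) has_derivative blinfun_apply (G' p - F' p)) (at p)" for p
   unfolding blinfun_apply_diff by (rule has_derivative_diff[OF dG(1) dF(1)])
  show "norm (G' p - F' p - (G' q - F' q)) \<le> r * norm (p - q)" for p q
  proof (rule differentiable_bound[of UNIV "\<lambda>p. G' p - F' p" "\<lambda>p. blinfun_apply (G'' p - F'' p)"])
   show "((\<lambda>p. G' p - F' p) has_derivative blinfun_apply (G'' p - F'' p)) (at p within UNIV)" for p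
    using has_derivative_diff[OF dG(2)[of p] dF(2)[of p]] unfolding blinfun_apply_diff by simp
   show "onorm (blinfun_apply (G'' p - F'' p)) \<le> r" for p
    using le(3)[of p] by (simp add: norm_blinfun.rep_eq less_imp_le)
  qed auto
 qed (use k r in auto)
 then show thesis by (rule that)
qed

text \<open>With the exponent \<open>- 2 / 5\<close> one has
  \<open>k * l\<^sup>2 = k powr (1 / 5)\<close>, which tends to infinity, and
  \<open>l * root 3 k = k powr (- 1 / 15)\<close>, which tends to 0. The last inequality holds for
  large \<open>k\<close> because \<open>ln (7 * k) / ln k\<close> tends to 1.\<close>

lemma eventually_parameters:
 fixes \<tau> \<epsilon> :: real
 assumes \<epsilon>: "\<epsilon> > 0" and \<tau>: "\<tau> \<ge> 1"
 obtains k0 where "\<And>k l. k \<ge> k0 \<Longrightarrow> l = k powr (- (2 / 5)) \<Longrightarrow> 1000 \<le> k \<and> exp 400 \<le> k \<and> 0 < l \<and> 1000000 * \<tau> * l \<le> 1 \<and>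
  1000000 * \<tau>\<^sup>2 \<le> 7 * k \<and> 1000 \<le> k * l\<^sup>2 \<and> 10000000 * \<tau>\<^sup>2 * l \<le> 1 \<and> 12 * l \<le> 8 / root 3 k \<and> (2 - \<epsilon> / 2) * ln (7 * k) < 2 * ln k"
proof -
 have small: "\<forall>\<^sub>F k :: real in at_top. c * k powr (- a) < 1" if "a > 0" for a c :: real
 proof -
  have "((\<lambda>k :: real. k powr (- a)) \<longlongrightarrow> 0) at_top"
   using that by (intro tendsto_neg_powr filterlim_ident) auto
  then have "((\<lambda>k :: real. c * k powr (- a)) \<longlongrightarrow> 0) at_top" by (rule tendsto_mult_right_zero)
  then show ?thesis by (rule order_tendstoD) simp
 qed
 have "\<forall>\<^sub>F k :: real in at_top. 10 ^ 15 \<le> k \<and> exp 400 \<le> k \<and> 1000000 * \<tau>\<^sup>2 \<le> 7 * k \<and> exp (4 * ln 7 / \<epsilon>) < k \<and>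
   10000000 * \<tau>\<^sup>2 * k powr (- (2 / 5)) < 1 \<and> 3 / 2 * k powr (- (1 / 15)) < 1"
 proof (intro eventually_conj small)
  show "\<forall>\<^sub>F k :: real in at_top. 1000000 * \<tau>\<^sup>2 \<le> 7 * k"
   using eventually_ge_at_top[of "1000000 * \<tau>\<^sup>2 / 7"] by eventually_elim simp
 qed (auto intro: eventually_ge_at_top eventually_gt_at_top)
 then obtain k0 where k0: "\<And>k. k \<ge> k0 \<Longrightarrow> 10 ^ 15 \<le> k \<and> exp 400 \<le> k \<and> 1000000 * \<tau>\<^sup>2 \<le> 7 * k \<and> exp (4 * ln 7 / \<epsilon>) < k \<and>
   10000000 * \<tau>\<^sup>2 * k powr (- (2 / 5)) < 1 \<and> 3 / 2 * k powr (- (1 / 15)) < 1"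
  unfolding eventually_at_top_linorder by blast
 show thesis
 proof (rule that[of k0], intro conjI)
  fix k l :: real assume "k \<ge> k0" and l: "l = k powr (- (2 / 5))"
  note K = k0[OF \<open>k \<ge> k0\<close>]
  have kpos: "k > 0" using K by simp
  show "1000 \<le> k" "exp 400 \<le> k" "1000000 * \<tau>\<^sup>2 \<le> 7 * k" using K by auto
  show l0: "0 < l" using kpos by (simp add: l)
  show l1: "10000000 * \<tau>\<^sup>2 * l \<le> 1" using K by (simp add: l)
  have "\<tau> * l \<le> \<tau>\<^sup>2 * l" using \<tau> l0 by (intro mult_right_mono) (auto simp: power2_eq_square)
  moreover have "0 \<le> \<tau>\<^sup>2 * l" using l0 by simp
  ultimately show "1000000 * \<tau> * l \<le> 1" using l1 by linarith
  have "k * l\<^sup>2 = k powr 1 * (k powr (- (2 / 5))) powr 2" using kpos by (simp add: l powr_numeral)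
  also have "\<dots> = k powr (1 / 5)" unfolding powr_powr powr_add[symmetric] by simp
  finally have kl: "k * l\<^sup>2 = k powr (1 / 5)" .
  have "(1000 :: real) = (1000 ^ 5) powr (1 / 5)"
   using powr_powr[of 1000 5 "1 / 5"] by (simp add: powr_numeral)
  also have "\<dots> \<le> k powr (1 / 5)" using K by (intro powr_mono2) auto
  finally show "1000 \<le> k * l\<^sup>2" using kl by simp
  show "12 * l \<le> 8 / root 3 k"
  proof -
   have r: "root 3 k = k powr (1 / 3)" using kpos by (simp add: root_powr_inverse)
   have "k powr (- (2 / 5)) * k powr (1 / 3) = k powr (- (1 / 15))" unfolding powr_add[symmetric] by simp
   then have "12 * l * root 3 k = 12 * k powr (- (1 / 15))" by (simp add: r l)
   also have "\<dots> \<le> 8" using K by linarith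
   finally have "12 * l * root 3 k \<le> 8" .
   then show ?thesis using kpos by (simp add: pos_le_divide_eq)
  qed
  have "4 * ln 7 / \<epsilon> < ln k" using K kpos by (metis exp_less_cancel_iff exp_ln)
  then have "4 * ln 7 < \<epsilon> * ln k" using \<epsilon> by (simp add: field_simps)
  moreover have "0 < \<epsilon> / 2 * ln (7::real)" using \<epsilon> by simp
  moreover have "ln (7 * k) = ln 7 + ln k" using kpos by (simp add: ln_mult)
  ultimately show "(2 - \<epsilon> / 2) * ln (7 * k) < 2 * ln k" by (simp add: algebra_simps)
 qed
qed

context shadowing
begin

text \<open>A closed ball that misses the support is covered by open null sets, and by compactness
  by finitely many of them, hence null.\<close>

lemma r_dense_support:
 assumes mme: "maximal_entropy_measure g \<mu>'" and k400: "exp 400 \<le> k" and \<tau>8: "\<tau> = exp 80000"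
  and \<tau>l: "10000000 * \<tau>\<^sup>2 * l \<le> 1" and \<rho>: "12 * l \<le> \<rho>"
 shows "r_dense \<rho> (measure_support \<mu>')"
 unfolding r_dense_def
proof (rule allI, rule ccontr)
 fix x assume far: "\<not> (\<exists>a\<in>measure_support \<mu>'. dist x a \<le> \<rho>)"
 have sets: "sets \<mu>' = sets borel"
  using mme by (simp add: maximal_entropy_measure_def invariant_prob_def)
 define \<U> where "\<U> = {U. open U \<and> emeasure \<mu>' U = 0}"
 have comp: "compact (cball x (12 * l))"
  using compact_Int_closed[OF compact_UNIV_torus closed_cball[of x "12 * l"]] by simp
 have "cball x (12 * l) \<subseteq> \<Union>\<U>"
 proof
  fix y assume "y \<in> cball x (12 * l)"
  then have "y \<notin> measure_support \<mu>'" using far \<rho> by auto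
  then show "y \<in> \<Union>\<U>" unfolding measure_support_def \<U>_def by (auto simp: not_less)
 qed
 then obtain \<F> where F: "\<F> \<subseteq> \<U>" "finite \<F>" "cball x (12 * l) \<subseteq> \<Union>\<F>"
  using compactE[OF comp, of \<U>] unfolding \<U>_def by blast
 have "U \<in> null_sets \<mu>'" if "U \<in> \<F>" for U
  using F(1) that sets by (auto simp: \<U>_def null_sets_def)
 then have "\<Union>\<F> \<in> null_sets \<mu>'" using F(2) by (intro null_sets.finite_Union) auto
 then have "cball x (12 * l) \<in> null_sets \<mu>'"
  by (rule null_sets_subset[OF _ _ F(3)]) (simp add: sets)
 then have "measure \<mu>' (cball x (12 * l)) = 0" by (simp add: measure_eq_0_null_sets)
 then show False using cball_not_null[OF mme k400 \<tau>8 \<tau>l] by blast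
qed

end

theorem theorem3:
  fixes \<epsilon> :: real
  assumes "\<epsilon> > 0"
  shows "\<exists>k0::real. \<forall>k\<ge>k0. \<exists>\<U>.
           openin C2_topology \<U> \<and> standard_map k \<in> \<U> \<and>
           (\<forall>g\<in>\<U>. \<forall>\<mu>. maximal_entropy_measure g \<mu> \<longrightarrow>
              measure_hausdorff_dim \<mu> > ereal (2 - \<epsilon>) \<and>
              r_dense (8 / root 3 k) (measure_support \<mu>))"
proof -
  define \<tau> :: real where "\<tau> = exp 80000"
  have \<tau>: "\<tau> \<ge> 1" by (simp add: \<tau>_def)
  obtain k0 where k0: "\<And>k l. k \<ge> k0 \<Longrightarrow> l = k powr (- (2 / 5)) \<Longrightarrow> 1000 \<le> k \<and> exp 400 \<le> k \<and> 0 < l \<and> 1000000 * \<tau> * l \<le> 1 \<and>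
    1000000 * \<tau>\<^sup>2 \<le> 7 * k \<and> 1000 \<le> k * l\<^sup>2 \<and> 10000000 * \<tau>\<^sup>2 * l \<le> 1 \<and> 12 * l \<le> 8 / root 3 k \<and> (2 - \<epsilon> / 2) * ln (7 * k) < 2 * ln k"
    by (rule eventually_parameters[OF assms \<tau>]) (rule that, assumption+)
  show ?thesis
  proof (intro exI[of _ k0] allI impI)
    fix k assume "k \<ge> k0"
    define l where "l = k powr (- (2 / 5))"
    note K = k0[OF \<open>k \<ge> k0\<close> l_def]
    define r where "r = 1 / k ^ 4"
    have r0: "r > 0" using K by (simp add: r_def)
    define \<U> where "\<U> = (\<Union>r'\<in>{0<..<r}. C2_ball (standard_map k) r')"
    have "measure_hausdorff_dim \<mu> > ereal (2 - \<epsilon>) \<and> r_dense (8 / root 3 k) (measure_support \<mu>)"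
      if g: "g \<in> \<U>" and mme: "maximal_entropy_measure g \<mu>" for g \<mu>
    proof -
      obtain r' where r': "0 < r'" "r' < r" "g \<in> C2_ball (standard_map k) r'" using g by (auto simp: \<U>_def)
      obtain G E E' where ns: "near_standard k r' g G E E'"
        by (rule near_standard_C2_ball[OF r'(3)]) (use K r' in \<open>auto simp: r_def\<close>)
      interpret near_standard k r' g G E E' by (rule ns)
      interpret shadowing k r' g G E E' l \<tau>
        by standard (use K \<tau> in \<open>auto simp: L_def\<close>)
      \<comment> \<open>The entropy argument gives a weak inequality; the other half of
        \<open>\<epsilon>\<close> makes it strict.\<close>
      have "ereal (2 - \<epsilon> / 2) \<le> measure_hausdorff_dim \<mu>"
        by (rule measure_hausdorff_dim_ge[OF mme]) (use K in \<open>simp add: L_def\<close>)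
      moreover have "ereal (2 - \<epsilon>) < ereal (2 - \<epsilon> / 2)" using assms by simp
      ultimately have "measure_hausdorff_dim \<mu> > ereal (2 - \<epsilon>)" by (rule less_le_trans[rotated])
      moreover have "r_dense (8 / root 3 k) (measure_support \<mu>)"
        by (rule r_dense_support[OF mme _ \<tau>_def]) (use K in auto)
      ultimately show ?thesis by blast
    qed
    then show "\<exists>\<U>. openin C2_topology \<U> \<and> standard_map k \<in> \<U> \<and>
           (\<forall>g\<in>\<U>. \<forall>\<mu>. maximal_entropy_measure g \<mu> \<longrightarrow>
              measure_hausdorff_dim \<mu> > ereal (2 - \<epsilon>) \<and> r_dense (8 / root 3 k) (measure_support \<mu>))"
      using C2_neighbourhood[OF standard_map_in_Diff2 r0, of k] unfolding \<U>_def by blast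
  qed
qed

end
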